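(* Let $(X,d\mu)$ be a measure space, $H$ a Hilbert space, $\sigma>0$, and let $U(t):H\to L^2_X$, $t\in\mathbb{R}$, be a family of linear operators obeying the energy estimate $$\|U(t)h\|_{L^2_X}\lesssim \|h\|_H\qquad \forall t\in\mathbb{R},\ \forall h\in H,$$ and the dispersive inequality $$\|U(t)U^*(s)f\|_{L^\infty_X}\lesssim |t-s|^{-\sigma}\|f\|_{L^1_X}\qquad \forall t\neq s,\ \forall f\in L^1_X\cap L^2_X.$$ Let $I$ and $J$ be two time intervals of unit length $|I|=|J|=1$ separated by a distance of scale $1$, $\operatorname{dist}(I,J)\approx 1$. Then the estimate $$\|TT^*F\|_{L^q_t(J;L^r_X)}\lesssim\|F\|_{L^{\tilde q'}_t(I;L^{\tilde r'}_X)}\qquad\forall F\in L^{\tilde q'}_t(I;L^{\tilde r'}_X)$$ holds for all pairs $(q,r)$ and $(\tilde q,\tilde r)$ which verify $$1\le q,\tilde q\le\infty,\qquad 2\le r,\tilde r\le\infty,$$ $$\frac{\sigma-1}{r}\le\frac{\sigma}{\tilde r},\qquad \frac{\sigma-1}{\tilde r}\le\frac{\sigma}{r},$$ $$\frac1q\ge\sigma\left(\frac1{\tilde r}-\frac1r\right),\qquad \frac1{\tilde q}\ge\sigma\left(\frac1r-\frac1{\tilde r}\right),$$ and, if $\sigma=1$, also $r,\tilde r<\infty$.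
   Context: $L^p_X=L^p(X,d\mu)$. $p'$ denotes the conjugate exponent of $p$, $1/p+1/p'=1$, and $1/\infty=0$. $A\lesssim B$ means $A\le CB$ for a constant $C$ independent of the functions, vectors and times involved; $A\approx B$ means $A\lesssim B\lesssim A$. For an interval $I$, $L^q_t(I;L^r_X)$ is the mixed-norm space with norm $\big\|\,\|F(t)\|_{L^r_X}\big\|_{L^q(I,dt)}$; a function on $I$ is extended by zero outside $I$. $U^*(t):L^2_X\to H$ is the adjoint of $U(t)$; the family is implicitly assumed to depend measurably on $t$ so that the following operators make sense. $T:H\to L^\infty_t(\mathbb{R};L^2_X)$ is $Th(t)=U(t)h$; its formal adjoint is $T^*F=\int U^*(s)F(s)\,ds$, defined on $L^1_t(\mathbb{R};L^2_X)$, and $$TT^*F(t)=\int U(t)U^*(s)F(s)\,ds.$$ Estimates are understood as a priori estimates: the inequality is asserted for those $F$ in the space on the right-hand side for which the operator $TT^*$ is defined by the integral $\int U(t)U^*(s)F(s)\,ds$, i.e. $F$ also in $L^1_tL^2_X$. *)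

theory Defs
  imports "HOL-Analysis.Analysis" "HOL-Probability.Essential_Supremum"
begin

section \<open>Complex Hilbert spaces\<close>

text \<open>The library only has real inner products, hence this class. The inner product is linear in
  its first argument. Positivity of \<open>cinner x x\<close> follows from \<open>norm_eq_sqrt_cinner\<close> because
  Isabelle's \<open>sqrt\<close> is negative on negative reals.\<close>

class chilbert_space = banach +
  fixes scaleC :: "complex \<Rightarrow> 'a \<Rightarrow> 'a"  (infixr "*\<^sub>C" 75)
    and cinner :: "'a \<Rightarrow> 'a \<Rightarrow> complex"
  assumes scaleC_add_right: "a *\<^sub>C (x + y) = a *\<^sub>C x + a *\<^sub>C y"
    and scaleC_add_left: "(a + b) *\<^sub>C x = a *\<^sub>C x + b *\<^sub>C x"
    and scaleC_scaleC: "a *\<^sub>C (b *\<^sub>C x) = (a * b) *\<^sub>C x"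
    and scaleR_scaleC: "r *\<^sub>R x = complex_of_real r *\<^sub>C x"
    and cinner_commute: "cinner x y = cnj (cinner y x)"
    and cinner_add_left: "cinner (x + y) z = cinner x z + cinner y z"
    and cinner_scaleC_left: "cinner (a *\<^sub>C x) y = a * cinner x y"
    and norm_eq_sqrt_cinner: "norm x = sqrt (Re (cinner x x))"

instantiation complex :: chilbert_space
begin
definition scaleC_complex :: "complex \<Rightarrow> complex \<Rightarrow> complex" where "scaleC_complex a x = a * x"
definition cinner_complex :: "complex \<Rightarrow> complex \<Rightarrow> complex" where "cinner_complex x y = x * cnj y"
instance
  by standard (auto simp: scaleC_complex_def cinner_complex_def algebra_simps scaleR_conv_of_real
      cmod_def power2_eq_square)
end


section \<open>Lebesgue norms\<close>

text \<open>Exponents are extended reals, so \<open>1 / \<infinity> = 0\<close> and \<open>1 / 0 = \<infinity>\<close>.\<close>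

definition conj_exponent :: "ereal \<Rightarrow> ereal" where
  "conj_exponent p = 1 / (1 - 1 / p)"

lemma conj_exponent_sum: "1 \<le> p \<Longrightarrow> 1 / p + 1 / conj_exponent p = 1"
proof (cases p)
  case (real r)
  assume "1 \<le> p"
  with real have "1 \<le> r" by simp
  with real show ?thesis
    by (cases "r = 1") (auto simp: conj_exponent_def one_ereal_def divide_ereal_def field_simps)
qed (auto simp: conj_exponent_def one_ereal_def divide_ereal_def)

definition ennreal_powr :: "ennreal \<Rightarrow> real \<Rightarrow> ennreal" where
  "ennreal_powr x a = (if x = \<infinity> then \<infinity> else ennreal (enn2real x powr a))"

text \<open>As for the library's \<^const>\<open>esssup\<close>, the norm of a non-measurable function is \<open>\<infinity>\<close>; an upper
  bound on it therefore includes measurability. Only \<open>1 \<le> p \<le> \<infinity>\<close> is meaningful.\<close>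

definition L_norm :: "'a measure \<Rightarrow> ereal \<Rightarrow> ('a \<Rightarrow> ennreal) \<Rightarrow> ennreal" where
  "L_norm M p g =
    (if p = \<infinity> then esssup M g
     else if g \<in> borel_measurable M
       then ennreal_powr (\<integral>\<^sup>+ x. ennreal_powr (g x) (real_of_ereal p) \<partial>M) (1 / real_of_ereal p)
     else \<infinity>)"

definition Lp_norm :: "'x measure \<Rightarrow> ereal \<Rightarrow> ('x \<Rightarrow> complex) \<Rightarrow> ennreal" where
  "Lp_norm M p f = L_norm M p (\<lambda>x. ennreal (cmod (f x)))"

text \<open>Elements of \<open>L\<^sup>p\<close> are represented by functions; identities between them hold almost
  everywhere.\<close>

definition Lp_space :: "'x measure \<Rightarrow> ereal \<Rightarrow> ('x \<Rightarrow> complex) set" where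
  "Lp_space M p = {f \<in> borel_measurable M. Lp_norm M p f < \<infinity>}"

definition L2_inner :: "'x measure \<Rightarrow> ('x \<Rightarrow> complex) \<Rightarrow> ('x \<Rightarrow> complex) \<Rightarrow> complex" where
  "L2_inner M f g = (LINT x|M. f x * cnj (g x))"


section \<open>Mixed-norm spaces\<close>

text \<open>Strong (Bochner) measurability of \<open>F : I \<rightarrow> L\<^sup>r(M)\<close>: almost everywhere limit in norm of
  functions with finitely many values.\<close>

definition strongly_measurable ::
  "'x measure \<Rightarrow> real set \<Rightarrow> ereal \<Rightarrow> (real \<Rightarrow> 'x \<Rightarrow> complex) \<Rightarrow> bool" where
  "strongly_measurable M I r F \<longleftrightarrow>
    (AE t in lebesgue_on I. F t \<in> Lp_space M r) \<and>
    (\<exists>S :: nat \<Rightarrow> real \<Rightarrow> 'x \<Rightarrow> complex.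
      (\<forall>n. simple_function (lebesgue_on I) (S n) \<and> (\<forall>t\<in>I. S n t \<in> Lp_space M r)) \<and>
      (AE t in lebesgue_on I. (\<lambda>n. Lp_norm M r (\<lambda>x. F t x - S n t x)) \<longlonglongrightarrow> 0))"

definition mixed_norm ::
  "'x measure \<Rightarrow> real set \<Rightarrow> ereal \<Rightarrow> ereal \<Rightarrow> (real \<Rightarrow> 'x \<Rightarrow> complex) \<Rightarrow> ennreal" where
  "mixed_norm M I q r F = L_norm (lebesgue_on I) q (\<lambda>t. Lp_norm M r (F t))"

definition mixed_space ::
  "'x measure \<Rightarrow> real set \<Rightarrow> ereal \<Rightarrow> ereal \<Rightarrow> (real \<Rightarrow> 'x \<Rightarrow> complex) set" where
  "mixed_space M I q r = {F. strongly_measurable M I r F \<and> mixed_norm M I q r F < \<infinity>}"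

definition zero_extension :: "real set \<Rightarrow> (real \<Rightarrow> 'x \<Rightarrow> complex) \<Rightarrow> real \<Rightarrow> 'x \<Rightarrow> complex" where
  "zero_extension I F = (\<lambda>t. if t \<in> I then F t else (\<lambda>x. 0))"


section \<open>Operators into \<open>L\<^sup>2\<close> and the operator \<open>TT*\<close>\<close>

definition linear_into_L2 :: "'x measure \<Rightarrow> ('h::chilbert_space \<Rightarrow> 'x \<Rightarrow> complex) \<Rightarrow> bool" where
  "linear_into_L2 M A \<longleftrightarrow>
    (\<forall>h. A h \<in> Lp_space M 2) \<and>
    (\<forall>h k. AE x in M. A (h + k) x = A h x + A k x) \<and>
    (\<forall>c h. AE x in M. A (c *\<^sub>C h) x = c * A h x)"

definition L2_adjoint ::
  "'x measure \<Rightarrow> ('h::chilbert_space \<Rightarrow> 'x \<Rightarrow> complex) \<Rightarrow> ('x \<Rightarrow> complex) \<Rightarrow> 'h" where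
  "L2_adjoint M A f = (THE k. \<forall>h. cinner k h = L2_inner M f (A h))"

text \<open>The integral over \<open>\<real>\<close> of an \<open>L\<^sup>2\<close>-valued function, in the weak sense (the library's Bochner
  integral does not apply to functions modulo null sets or to non-separable spaces). It agrees with
  the Bochner integral whenever the latter exists, and is unique up to null sets.\<close>

definition L2_integral :: "'x measure \<Rightarrow> (real \<Rightarrow> 'x \<Rightarrow> complex) \<Rightarrow> 'x \<Rightarrow> complex" where
  "L2_integral M \<Phi> = (SOME G. G \<in> Lp_space M 2 \<and>
     (\<forall>g \<in> Lp_space M 2.
        has_bochner_integral lebesgue (\<lambda>s. L2_inner M (\<Phi> s) g) (L2_inner M G g)))"

definition TTstar ::
  "'x measure \<Rightarrow> (real \<Rightarrow> 'h::chilbert_space \<Rightarrow> 'x \<Rightarrow> complex) \<Rightarrow>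
    (real \<Rightarrow> 'x \<Rightarrow> complex) \<Rightarrow> real \<Rightarrow> 'x \<Rightarrow> complex" where
  "TTstar M U F = (\<lambda>t. L2_integral M (\<lambda>s. U t (L2_adjoint M (U s) (F s))))"

end

theory Submission
  imports Defs "HOL-Complex_Analysis.Conformal_Mappings"
begin

text \<open>Write \<open>x = 1/rt\<close>, \<open>y = 1/r\<close>. For \<open>s\<close> away from \<open>J\<close>, the form \<open>\<langle>U\<^sup>*(s) f, T\<^sup>*G\<rangle>\<close> is bounded
  by the dispersive inequality with \<open>f \<in> L\<^sup>1\<close> and \<open>G \<in> L\<^sup>1(J; L\<^sup>1)\<close>, and by the homogeneous
  Strichartz estimate with \<open>f \<in> L\<^sup>2\<close>. If \<open>y \<le> x\<close>, Riesz--Thorin interpolation between the two puts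
  \<open>f\<close> into the dual space of \<open>L\<^sup>1\<^sup>/\<^sup>x\<close>
  and \<open>G\<close> into that of \<open>L\<^sup>1\<^sup>/\<^sup>\<sigma>\<^sup>(\<^sup>x\<^sup>-\<^sup>y\<^sup>)(J; L\<^sup>1\<^sup>/\<^sup>y)\<close>; integrating in \<open>s\<close>, duality in
  \<open>G\<close> and Hoelder's inequality on the unit interval \<open>J\<close> give the theorem. The case \<open>x \<le> y\<close> is the same
  with the roles of the two intervals exchanged. The Strichartz estimate itself follows from the
  Hardy--Littlewood--Sobolev inequality, and at the endpoint from the argument of Keel and Tao: a Whitney
  decomposition of \<open>J \<times> J\<close> combined with a decomposition of \<open>G(t)\<close> into level sets. The level sets
  give bounds that decay geometrically away from one pair of levels on each dyadic scale.\<close>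

text \<open>The measure space need not be sigma-finite and \<open>H\<close> need not be separable,
  so vector-valued functions of time come without jointly measurable representatives to which Fubini
  would apply. Hence norms are tested against functions simple in time with simple values, norms as
  functions of time are recovered as suprema of truncated dual norms, and vector integrals are weak.
  Only one of the two time variables takes part in the interpolation; the other is frozen at a point
  \<open>s\<close>, and the bound is uniform in it because \<open>s\<close> stays at distance
  \<open>c1\<close> from the interval. This is why only the difference of \<open>x\<close> and
  \<open>y\<close> enters the time exponents. The condition
  \<open>(\<sigma> - 1) * x \<le> \<sigma> * y\<close> is
  \<open>\<sigma> * (1 - 2*\<beta>) \<le> 1\<close> for \<open>\<beta> = y/(2*x)\<close>, the range
  of the Strichartz estimate. Equality is allowed, which is where the endpoint is needed; for
  \<open>\<sigma> = 1\<close> it would be the forbidden endpoint \<open>\<beta> = 0\<close>, which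
  the finiteness of \<open>r\<close> and \<open>rt\<close> rules out.\<close>

section \<open>Lebesgue norms and duality\<close>

text \<open>Exponents are encoded by their reciprocals: \<open>Lp_bound M y g K\<close> says that the \<open>L\<^sup>1\<^sup>/\<^sup>y\<close> norm of \<open>g\<close> is
  at most \<open>K\<close>, and \<open>y = 0\<close> is the exponent \<open>\<infinity>\<close>.\<close>

definition Lp_bound :: "'a measure \<Rightarrow> real \<Rightarrow> ('a \<Rightarrow> real) \<Rightarrow> real \<Rightarrow> bool" where
  "Lp_bound M y g K \<longleftrightarrow> g \<in> borel_measurable M \<and> 0 \<le> K \<and>
    (if y = 0 then AE x in M. \<bar>g x\<bar> \<le> K
     else (\<integral>\<^sup>+x. ennreal (\<bar>g x\<bar> powr (1/y)) \<partial>M) \<le> ennreal (K powr (1/y)))"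

text \<open>Only integrable powers matter here: on the side of the test functions all exponents are duals of
  exponents in \<open>[2, \<infinity>]\<close> and thus lie in \<open>[1, 2]\<close>.\<close>

definition nrm :: "'a measure \<Rightarrow> real \<Rightarrow> ('a \<Rightarrow> complex) \<Rightarrow> real" where
  "nrm M e f = (LINT x|M. cmod (f x) powr e) powr (1/e)"

lemma ennreal_powr_ennreal: "0 \<le> a \<Longrightarrow> ennreal_powr (ennreal a) b = ennreal (a powr b)"
  by (simp add: ennreal_powr_def)

text \<open>The bridge between the norms of the theorem and the real bounds used in between. For
  non-measurable \<open>g\<close> both sides are false: \<open>L_norm\<close> is infinite by
  convention, and \<open>Lp_bound\<close> demands measurability.\<close>

lemma L_norm_le_iff:
  fixes g :: "'a \<Rightarrow> real"
  assumes g: "\<And>x. 0 \<le> g x" and p: "1 \<le> p" and K: "0 \<le> K"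
  shows "L_norm M p (\<lambda>x. ennreal (g x)) \<le> ennreal K \<longleftrightarrow> Lp_bound M (real_of_ereal (1/p)) g K"
proof (cases "g \<in> borel_measurable M")
  case False
  have "(\<lambda>x. ennreal (g x)) \<notin> borel_measurable M"
  proof
    assume "(\<lambda>x. ennreal (g x)) \<in> borel_measurable M"
    then have "(\<lambda>x. enn2real (ennreal (g x))) \<in> borel_measurable M" by measurable
    then show False using False g by simp
  qed
  then show ?thesis using False
    by (auto simp: L_norm_def Lp_bound_def esssup_non_measurable top_unique)
next
  case gm[measurable]: True
  show ?thesis
  proof (cases p)
    case PInf
    have "esssup M (\<lambda>x. ennreal (g x)) \<le> ennreal K \<longleftrightarrow> (AE x in M. ennreal (g x) \<le> ennreal K)"
      using esssup_AE[of "\<lambda>x. ennreal (g x)" M] by (auto intro!: esssup_I elim: order_trans)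
    then show ?thesis using PInf gm K g by (simp add: L_norm_def Lp_bound_def)
  next
    case (real p')
    then have p': "p' \<ge> 1" using p by simp
    have eq: "(\<integral>\<^sup>+ x. ennreal_powr (ennreal (g x)) p' \<partial>M) = (\<integral>\<^sup>+ x. ennreal (\<bar>g x\<bar> powr p') \<partial>M)"
      using g by (intro nn_integral_cong) (simp add: ennreal_powr_ennreal)
    have y: "real_of_ereal (1/p) = 1/p'" using real p' by (simp add: one_ereal_def)
    have "ennreal_powr T (1/p') \<le> ennreal K \<longleftrightarrow> T \<le> ennreal (K powr p')" for T
    proof (cases T)
      case (real t)
      have "t powr (1/p') \<le> K \<longleftrightarrow> t \<le> K powr p'"
      proof
        assume "t powr (1/p') \<le> K"
        then have "(t powr (1/p')) powr p' \<le> K powr p'" using p' by (intro powr_mono2) auto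
        then show "t \<le> K powr p'" using p' real by (simp add: powr_powr)
      next
        assume "t \<le> K powr p'"
        then have "t powr (1/p') \<le> (K powr p') powr (1/p')" using p' real by (intro powr_mono2) auto
        then show "t powr (1/p') \<le> K" using p' K by (simp add: powr_powr)
      qed
      then show ?thesis using real K by (simp add: ennreal_powr_ennreal)
    qed (simp add: ennreal_powr_def top_unique)
    then show ?thesis using real p' gm K eq y by (simp add: L_norm_def Lp_bound_def)
  qed (use p in auto)
qed

lemma Lp_bound_nonneg: "Lp_bound M y g K \<Longrightarrow> 0 \<le> K" by (simp add: Lp_bound_def)
lemma Lp_bound_measurable: "Lp_bound M y g K \<Longrightarrow> g \<in> borel_measurable M" by (simp add: Lp_bound_def)

lemma Lp_bound_zero:
  assumes "Lp_bound M y g 0" shows "AE x in M. g x = 0"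
proof (cases "y = 0")
  case False
  have [measurable]: "g \<in> borel_measurable M" using assms by (simp add: Lp_bound_def)
  have "(\<integral>\<^sup>+x. ennreal (\<bar>g x\<bar> powr (1/y)) \<partial>M) = 0" using assms False by (simp add: Lp_bound_def)
  then have "AE x in M. ennreal (\<bar>g x\<bar> powr (1/y)) = 0" by (subst (asm) nn_integral_0_iff_AE) auto
  then show ?thesis by (rule AE_mp) (auto intro!: AE_I2)
qed (use assms in \<open>auto simp: Lp_bound_def\<close>)

text \<open>Young's inequality for \<open>\<bar>f x\<bar>/A\<close> and
  \<open>\<bar>g x\<bar>/B\<close>, integrated, gives \<open>A * B * (1/p + 1/q)\<close>. A
  vanishing bound cannot be divided by, but it makes its function vanish almost everywhere.\<close>

lemma Lp_bound_Holder:
  assumes f: "Lp_bound M y f A" and g: "Lp_bound M (1-y) g B" and y: "0 \<le> y" "y \<le> 1"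
  shows "(\<integral>\<^sup>+x. ennreal (\<bar>f x\<bar> * \<bar>g x\<bar>) \<partial>M) \<le> ennreal (A*B)"
proof -
  note [measurable] = Lp_bound_measurable[OF f] Lp_bound_measurable[OF g]
  have A: "A \<ge> 0" and B: "B \<ge> 0" using f g by (auto simp: Lp_bound_def)
  \<comment> \<open>The exponent pair infinity and 1, for arbitrary functions, because
    \<open>y = 0\<close> and \<open>y = 1\<close> are both instances of it with the factors
    exchanged.\<close>
  have one: "(\<integral>\<^sup>+x. ennreal (\<bar>f x\<bar> * \<bar>g x\<bar>) \<partial>M) \<le> ennreal (A*B)"
    if "AE x in M. \<bar>f x\<bar> \<le> A" "(\<integral>\<^sup>+x. ennreal \<bar>g x\<bar> \<partial>M) \<le> ennreal B" 
       "A \<ge> 0" "B \<ge> 0" "f \<in> borel_measurable M" "g \<in> borel_measurable M" for f g :: "'a \<Rightarrow> real" and A B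
  proof -
    note [measurable] = that(5,6)
    have "(\<integral>\<^sup>+x. ennreal (\<bar>f x\<bar> * \<bar>g x\<bar>) \<partial>M) \<le> (\<integral>\<^sup>+x. ennreal A * ennreal \<bar>g x\<bar> \<partial>M)"
    proof (intro nn_integral_mono_AE)
      show "AE x in M. ennreal (\<bar>f x\<bar> * \<bar>g x\<bar>) \<le> ennreal A * ennreal \<bar>g x\<bar>"
        using that(1) by eventually_elim (use that in \<open>auto intro!: ennreal_leI mult_right_mono simp flip:
          ennreal_mult\<close>)
    qed
    also have "\<dots> = ennreal A * (\<integral>\<^sup>+x. ennreal \<bar>g x\<bar> \<partial>M)" by (rule nn_integral_cmult) simp
    also have "\<dots> \<le> ennreal A * ennreal B" using that by (intro mult_left_mono) auto
    finally show ?thesis using that by (simp add: ennreal_mult)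
  qed
  have "y = 0 \<or> y = 1 \<or> A = 0 \<or> B = 0 \<or> (0 < y \<and> y < 1 \<and> A > 0 \<and> B > 0)"
    using y A B by linarith
  then consider "y = 0" | "y = 1" | "A = 0" | "B = 0" | "0 < y" "y < 1" "A > 0" "B > 0" by blast
  then show ?thesis
  proof cases
    case 1 then show ?thesis using f g A B by (intro one) (auto simp: Lp_bound_def)
  next
    case 2
    have "(\<integral>\<^sup>+x. ennreal (\<bar>g x\<bar> * \<bar>f x\<bar>) \<partial>M) \<le> ennreal (B*A)"
      using f g A B 2 by (intro one) (auto simp: Lp_bound_def)
    then show ?thesis by (simp add: mult.commute)
  next
    case 3
    then have "AE x in M. f x = 0" using Lp_bound_zero f by blast
    then have "(\<integral>\<^sup>+x. ennreal (\<bar>f x\<bar> * \<bar>g x\<bar>) \<partial>M) = (\<integral>\<^sup>+x. 0 \<partial>M)" by (intro nn_integral_cong_AE) auto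
    then show ?thesis by simp
  next
    case 4
    then have "AE x in M. g x = 0" using Lp_bound_zero g by blast
    then have "(\<integral>\<^sup>+x. ennreal (\<bar>f x\<bar> * \<bar>g x\<bar>) \<partial>M) = (\<integral>\<^sup>+x. 0 \<partial>M)" by (intro nn_integral_cong_AE) auto
    then show ?thesis by simp
  next
    case 5
    define p where "p = 1/y"
    define q where "q = 1/(1-y)"
    have pq: "p > 1" "q > 1" "1/p + 1/q = 1" using 5 by (auto simp: p_def q_def)
    have fb: "(\<integral>\<^sup>+x. ennreal (\<bar>f x\<bar> powr p) \<partial>M) \<le> ennreal (A powr p)"
      using f 5 by (simp add: Lp_bound_def p_def)
    have gb: "(\<integral>\<^sup>+x. ennreal (\<bar>g x\<bar> powr q) \<partial>M) \<le> ennreal (B powr q)"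
      using g 5 by (simp add: Lp_bound_def q_def)
    \<comment> \<open>Young's coefficients \<open>1/p\<close> and \<open>1/q\<close>, multiplied by
      \<open>A * B\<close> and divided by the bounds of the two integrals, which undoes the
      normalisation.\<close>
    define a where "a = A*B / (p * A powr p)"
    define b where "b = A*B / (q * B powr q)"
    have ab: "a \<ge> 0" "b \<ge> 0" using A B pq by (auto simp: a_def b_def)
    have "\<bar>f x\<bar> * \<bar>g x\<bar> \<le> a * \<bar>f x\<bar> powr p + b * \<bar>g x\<bar> powr q" for x
    proof -
      have "\<bar>f x\<bar>/A * (\<bar>g x\<bar>/B) \<le> (\<bar>f x\<bar>/A) powr p / p + (\<bar>g x\<bar>/B) powr q / q"
        using 5 by (intro Youngs_inequality pq) auto
      then have "A*B*(\<bar>f x\<bar>/A * (\<bar>g x\<bar>/B)) \<le> A*B*((\<bar>f x\<bar>/A) powr p / p + (\<bar>g x\<bar>/B) powr q / q)"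
        using 5 by (intro mult_left_mono) auto
      moreover have "A*B*(\<bar>f x\<bar>/A * (\<bar>g x\<bar>/B)) = \<bar>f x\<bar> * \<bar>g x\<bar>" using 5 by simp
      moreover have "A*B*((\<bar>f x\<bar>/A) powr p / p + (\<bar>g x\<bar>/B) powr q / q) = a * \<bar>f x\<bar> powr p + b * \<bar>g x\<bar> powr q"
        using 5 by (simp add: a_def b_def powr_divide distrib_left mult.commute)
      ultimately show ?thesis by linarith
    qed
    then have "(\<integral>\<^sup>+x. ennreal (\<bar>f x\<bar> * \<bar>g x\<bar>) \<partial>M)
      \<le> (\<integral>\<^sup>+x. ennreal a * ennreal (\<bar>f x\<bar> powr p) + ennreal b * ennreal (\<bar>g x\<bar> powr q) \<partial>M)"
      using ab by (intro nn_integral_mono) (simp flip: ennreal_mult ennreal_plus)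
    also have "\<dots> = ennreal a * (\<integral>\<^sup>+x. ennreal (\<bar>f x\<bar> powr p) \<partial>M) + ennreal b
      * (\<integral>\<^sup>+x. ennreal (\<bar>g x\<bar> powr q) \<partial>M)"
      by (subst nn_integral_add) (auto simp: nn_integral_cmult)
    also have "\<dots> \<le> ennreal a * ennreal (A powr p) + ennreal b * ennreal (B powr q)"
      using fb gb by (intro add_mono mult_left_mono) auto
    also have "\<dots> = ennreal (a * A powr p + b * B powr q)" using ab by (simp add: ennreal_mult)
    also have "a * A powr p = A*B*(1/p)" using 5 by (simp add: a_def)
    also have "b * B powr q = A*B*(1/q)" using 5 by (simp add: b_def)
    also have "A*B*(1/p) + A*B*(1/q) = A*B" using pq(3) by (metis distrib_left mult.right_neutral)
    finally show ?thesis .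
  qed
qed

text \<open>Hoelder's inequality for \<open>\<bar>f x\<bar> powr (1/z)\<close> against the constant
  1, with reciprocal exponents \<open>y/z\<close> and \<open>1 - y/z\<close>; measure at most 1
  makes the constant disappear. This is how the unit length of the two intervals turns one time
  exponent into the whole range of \<open>q\<close> and \<open>qt\<close>.\<close>

lemma Lp_bound_mono_exponent:
  assumes M: "emeasure M (space M) \<le> 1" and f: "Lp_bound M y f K" and y: "0 \<le> y" "y \<le> z" "z \<le> 1"
  shows "Lp_bound M z f K"
proof -
  note [measurable] = Lp_bound_measurable[OF f]
  have K: "K \<ge> 0" using f by (simp add: Lp_bound_def)
  have "z = 0 \<or> (y = 0 \<and> z > 0) \<or> (y > 0 \<and> z > 0)" using y by linarith
  then consider "z = 0" | "y = 0" "z > 0" | "y > 0" "z > 0" by blast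
  then show ?thesis
  proof cases
    case 1 then show ?thesis using f y by simp
  next
    case 2
    have "(\<integral>\<^sup>+x. ennreal (\<bar>f x\<bar> powr (1/z)) \<partial>M) \<le> (\<integral>\<^sup>+x. ennreal (K powr (1/z)) \<partial>M)"
    proof (intro nn_integral_mono_AE)
      have "AE x in M. \<bar>f x\<bar> \<le> K" using f 2 by (simp add: Lp_bound_def)
      then show "AE x in M. ennreal (\<bar>f x\<bar> powr (1/z)) \<le> ennreal (K powr (1/z))"
        by eventually_elim (use 2 in \<open>auto intro!: ennreal_leI powr_mono2\<close>)
    qed
    also have "\<dots> \<le> ennreal (K powr (1/z)) * 1"
      using mult_left_mono[OF M, of "ennreal (K powr (1/z))"] by simp
    finally show ?thesis using f 2 by (auto simp: Lp_bound_def)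
  next
    case 3
    have g: "Lp_bound M (y/z) (\<lambda>x. \<bar>f x\<bar> powr (1/z)) (K powr (1/z))"
      using f 3 K by (auto simp: Lp_bound_def powr_powr)
    have o: "Lp_bound M (1 - y/z) (\<lambda>x. 1) 1" using M by (auto simp: Lp_bound_def)
    have "(\<integral>\<^sup>+x. ennreal (\<bar>\<bar>f x\<bar> powr (1/z)\<bar> * \<bar>1\<bar>) \<partial>M) \<le> ennreal (K powr (1/z) * 1)"
      using 3 y by (intro Lp_bound_Holder[OF g o]) auto
    then show ?thesis using f 3 by (auto simp: Lp_bound_def)
  qed
qed

text \<open>Finitely many values, nonzero on a set of finite measure only. Such functions can be
  measured with all the exponents of an interpolation argument at once, and their deformations in a
  complex parameter remain finite sums.\<close>

abbreviation test :: "'a measure \<Rightarrow> ('a \<Rightarrow> 'b::real_vector) \<Rightarrow> bool" where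
  "test M f \<equiv> Bochner_Integration.simple_bochner_integrable M f"

lemma test_compose: "test M f \<Longrightarrow> p 0 = 0 \<Longrightarrow> test M (\<lambda>x. p (f x))"
  using simple_bochner_integrable_compose2[of "\<lambda>a b. p a" M f f] by simp

lemma test_add: "test M f \<Longrightarrow> test M g \<Longrightarrow> test M (\<lambda>x. f x + g x)"
  by (rule simple_bochner_integrable_compose2) auto
lemma test_cmult: "test M (f :: _ \<Rightarrow> complex) \<Longrightarrow> test M (\<lambda>x. c * f x)"
  by (rule test_compose) auto
lemma test_zero: "test M (\<lambda>x. 0)"
  by (auto intro!: simple_bochner_integrable.intros)
lemma test_cnj: "test M f \<Longrightarrow> test M (\<lambda>x. cnj (f x))"
  by (rule test_compose) auto
lemma test_sum: "(\<And>i. i \<in> S \<Longrightarrow> test M (f i)) \<Longrightarrow> test M (\<lambda>x. \<Sum>i\<in>S. f i x)"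
  by (induction S rule: infinite_finite_induct) (auto intro: test_add test_zero)
lemma test_measurable: "test M (f :: _ \<Rightarrow> complex) \<Longrightarrow> f \<in> borel_measurable M"
  by (auto elim!: simple_bochner_integrable.cases intro: borel_measurable_simple_function)

lemma test_integrable_powr: "test M f \<Longrightarrow> integrable M (\<lambda>x. cmod (f x) powr e)"
  by (rule integrableI_simple_bochner_integrable, rule test_compose[where p="\<lambda>z. cmod z powr e"]) auto

lemma nrm_nonneg [simp]: "0 \<le> nrm M e f" by (simp add: nrm_def)

lemma nrm_powr: "e \<noteq> 0 \<Longrightarrow> nrm M e f powr e = (LINT x|M. cmod (f x) powr e)"
  by (simp add: nrm_def powr_powr)

lemma nrm_cmult: "e > 0 \<Longrightarrow> nrm M e (\<lambda>x. c * f x) = cmod c * nrm M e f"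
  by (simp add: nrm_def norm_mult powr_mult powr_powr)

lemma nrm_cnj [simp]: "nrm M e (\<lambda>x. cnj (f x)) = nrm M e f"
  by (simp add: nrm_def)

lemma test_nn_integral: "test M f \<Longrightarrow> e \<noteq> 0 \<Longrightarrow>
  (\<integral>\<^sup>+x. ennreal (cmod (f x) powr e) \<partial>M) = ennreal (nrm M e f powr e)"
  by (subst nn_integral_eq_integral) (auto simp: nrm_powr test_integrable_powr)

lemma test_Lp_bound: "test M f \<Longrightarrow> e > 0 \<Longrightarrow> Lp_bound M (1/e) (\<lambda>x. cmod (f x)) (nrm M e f)"
  using test_measurable[of M f] by (auto simp: Lp_bound_def test_nn_integral)

lemma nrm_eq_0_AE:
  assumes "test M f" "e > 0" "nrm M e f = 0" shows "AE x in M. f x = 0"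
  using Lp_bound_zero[of M "1/e" "\<lambda>x. cmod (f x)"] test_Lp_bound[OF assms(1,2)] assms(3) by simp

lemma nrm_AE_0: "AE x in M. f x = 0 \<Longrightarrow> nrm M e f = 0"
  unfolding nrm_def by (subst integral_eq_zero_AE) auto

text \<open>Moves the degenerate cases of interpolation, where nothing can be normalised, from the
  intermediate exponents to those at the ends.\<close>

lemma nrm_eq_0_iff: "test M f \<Longrightarrow> e > 0 \<Longrightarrow> e' > 0 \<Longrightarrow> nrm M e f = 0 \<longleftrightarrow> nrm M e' f = 0"
  using nrm_eq_0_AE nrm_AE_0 by metis

lemma mult_le_sum_squares:
  fixes a b :: real assumes "0 \<le> a" "0 \<le> b" shows "a * b \<le> a\<^sup>2 + b\<^sup>2"
proof -
  have "2 * (a * b) \<le> a\<^sup>2 + b\<^sup>2" using sum_squares_bound[of a b] by simp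
  moreover have "0 \<le> a * b" using assms by simp
  ultimately show ?thesis by linarith
qed

text \<open>Square integrability of \<open>v\<close> replaces sigma-finiteness in this converse of
  Hoelder's inequality: the sets where \<open>cmod (v x)\<close> is at least a positive constant
  have finite measure, so the extremal test functions can be supported there.\<close>

lemma Lp_bound_converse:
  fixes v :: "'a \<Rightarrow> complex"
  assumes v[measurable]: "v \<in> borel_measurable M" and v2: "integrable M (\<lambda>x. (cmod (v x))\<^sup>2)"
    and y: "0 \<le> y" "y < 1" and K: "0 \<le> K"
    and bound: "\<And>\<phi>. test M \<phi> \<Longrightarrow> cmod (LINT x|M. v x * \<phi> x) \<le> K * nrm M (1/(1-y)) \<phi>"
  shows "Lp_bound M y (\<lambda>x. cmod (v x)) K"
proof -
  define e where "e = 1/(1-y)"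
  have e: "e \<ge> 1" using y by (simp add: e_def field_simps)
  \<comment> \<open>The extremal functions below are bounded but not simple, so the hypothesis is
    first extended to them by dominated convergence; the simple approximants are dominated by
    \<open>2 * cmod (\<phi> x)\<close>.\<close>
  have ext: "cmod (LINT x|M. v x * \<phi> x) \<le> K * nrm M e \<phi>"
    if \<phi>m[measurable]: "\<phi> \<in> borel_measurable M" and B: "\<And>x. cmod (\<phi> x) \<le> B"
      and S: "emeasure M {x\<in>space M. \<phi> x \<noteq> 0} < \<infinity>" for \<phi> B
  proof -
    obtain F where F: "\<And>i. simple_function M (F i)" "\<And>x. x \<in> space M \<Longrightarrow> (\<lambda>i. F i x) \<longlonglongrightarrow> \<phi> x"
      "\<And>i x. x \<in> space M \<Longrightarrow> cmod (F i x) \<le> 2 * cmod (\<phi> x)"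
      using borel_measurable_implies_sequence_metric[OF \<phi>m, of 0] by simp metis
    have [measurable]: "\<And>i. F i \<in> borel_measurable M" using F(1) by (rule borel_measurable_simple_function)
    have tF: "test M (F i)" for i
    proof (rule simple_bochner_integrable.intros)
      show "simple_function M (F i)" by fact
      have "emeasure M {x\<in>space M. F i x \<noteq> 0} \<le> emeasure M {x\<in>space M. \<phi> x \<noteq> 0}"
        using F(3) by (intro emeasure_mono) force+
      then show "emeasure M {x\<in>space M. F i x \<noteq> 0} \<noteq> \<infinity>" using S by auto
    qed
    have ip: "integrable M (\<lambda>x. (2 * cmod (\<phi> x)) powr s)"
    if "s \<ge> 0" for s
      by (rule integrableI_bounded_set[where A="{x\<in>space M. \<phi> x \<noteq> 0}" and B="(2*B) powr s"])
        (use S B that in \<open>auto intro!: AE_I2 powr_mono2\<close>)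
    have l1: "(\<lambda>i. LINT x|M. v x * F i x) \<longlonglongrightarrow> (LINT x|M. v x * \<phi> x)"
    proof (rule integral_dominated_convergence[where w="\<lambda>x. (cmod (v x))\<^sup>2 + (2 * cmod (\<phi> x)) powr 2"])
      show "integrable M (\<lambda>x. (cmod (v x))\<^sup>2 + (2 * cmod (\<phi> x)) powr 2)"
        by (intro Bochner_Integration.integrable_add v2 ip) simp
      show "AE x in M. (\<lambda>i. v x * F i x) \<longlonglongrightarrow> v x * \<phi> x" using F(2) by (auto intro!: AE_I2 tendsto_intros)
      show "AE x in M. cmod (v x * F i x) \<le> (cmod (v x))\<^sup>2 + (2 * cmod (\<phi> x)) powr 2" for i
      proof (rule AE_I2)
        fix x assume x: "x \<in> space M"
        have "cmod (v x * F i x) \<le> cmod (v x) * (2 * cmod (\<phi> x))"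
          using F(3)[OF x] by (simp add: norm_mult mult_left_mono)
        also have "\<dots> \<le> (cmod (v x))\<^sup>2 + (2 * cmod (\<phi> x))\<^sup>2"
by (rule mult_le_sum_squares) auto
        finally show "cmod (v x * F i x) \<le> (cmod (v x))\<^sup>2 + (2 * cmod (\<phi> x)) powr 2" by simp
      qed
    qed auto
    have l2: "(\<lambda>i. LINT x|M. cmod (F i x) powr e) \<longlonglongrightarrow> (LINT x|M. cmod (\<phi> x) powr e)"
    proof (rule integral_dominated_convergence[where w="\<lambda>x. (2 * cmod (\<phi> x)) powr e"])
      show "AE x in M. (\<lambda>i. cmod (F i x) powr e) \<longlonglongrightarrow> cmod (\<phi> x) powr e"
      proof (rule AE_I2)
        fix x assume x: "x \<in> space M"
        have "(\<lambda>i. cmod (F i x)) \<longlonglongrightarrow> cmod (\<phi> x)" using F(2)[OF x] by (intro tendsto_intros)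
        then show "(\<lambda>i. cmod (F i x) powr e) \<longlonglongrightarrow> cmod (\<phi> x) powr e"
          using e by (intro tendsto_powr2 tendsto_const) auto
      qed
      show "AE x in M. norm (cmod (F i x) powr e) \<le> (2 * cmod (\<phi> x)) powr e" for i
        using F(3) e by (auto intro!: AE_I2 powr_mono2)
    qed (use ip[of e] e in auto)
    have l3: "(\<lambda>i. nrm M e (F i)) \<longlonglongrightarrow> nrm M e \<phi>"
      unfolding nrm_def using e by (intro tendsto_powr2[OF l2] tendsto_const) auto
    show ?thesis
    proof (rule LIMSEQ_le)
      show "(\<lambda>i. cmod (LINT x|M. v x * F i x)) \<longlonglongrightarrow> cmod (LINT x|M. v x * \<phi> x)" using l1 by (rule tendsto_norm)
      show "(\<lambda>i. K * nrm M e (F i)) \<longlonglongrightarrow> K * nrm M e \<phi>" using l3 by (intro tendsto_intros)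
      show "\<exists>N. \<forall>i\<ge>N. cmod (LINT x|M. v x * F i x) \<le> K * nrm M e (F i)"
        using bound[OF tF] by (auto simp: e_def)
    qed
  qed
  have cnjm[measurable]: "(\<lambda>x. cnj (v x)) \<in> borel_measurable M"
    by (intro measurable_compose[OF v] borel_measurable_continuous_onI continuous_intros)
  have fs: "emeasure M {x\<in>space M. c \<le> cmod (v x)} < \<infinity>" if "c > 0" for c
  proof -
    have "(\<integral>\<^sup>+x. ennreal ((cmod (v x))\<^sup>2) \<partial>M) < \<infinity>" using v2 by (simp add: integrable_iff_bounded)
    have "ennreal (c\<^sup>2) * emeasure M {x\<in>space M. c \<le> cmod (v x)}
      = (\<integral>\<^sup>+x. ennreal (c\<^sup>2) * indicator {x\<in>space M. c \<le> cmod (v x)} x \<partial>M)"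
      by (subst nn_integral_cmult_indicator) auto
    also have "\<dots> \<le> (\<integral>\<^sup>+x. ennreal ((cmod (v x))\<^sup>2) \<partial>M)"
      using that by (intro nn_integral_mono) (auto simp: indicator_def intro!: ennreal_leI power_mono)
    also have "\<dots> < \<infinity>" using v2 by (simp add: integrable_iff_bounded)
    finally show ?thesis using that by (auto simp: ennreal_mult_less_top)
  qed
  show ?thesis
  proof (cases "y = 0")
    case True
    have e1: "e = 1" using True by (simp add: e_def)
    have *: "AE x in M. cmod (v x) < K + 1/real (Suc n)" for n
    proof -
      \<comment> \<open>If \<open>cmod (v x) \<ge> c\<close> held on a set of positive measure,
        testing with the conjugate phase of \<open>v\<close> on it would give
        \<open>c * measure M E \<le> K * measure M E\<close>, although \<open>c > K\<close>.\<close>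
      define c where "c = K + 1/real (Suc n)"
      have c: "c > K" "c > 0" using K by (auto simp: c_def intro: add_nonneg_pos)
      define E where "E = {x\<in>space M. c \<le> cmod (v x)}"
      have [measurable]: "E \<in> sets M" by (simp add: E_def)
      define \<phi> where "\<phi> = (\<lambda>x. indicator E x * (cnj (v x) / of_real (cmod (v x))))"
      have [measurable]: "\<phi> \<in> borel_measurable M" unfolding \<phi>_def by measurable
      have fE: "emeasure M E < \<infinity>" using fs[OF c(2)] by (simp add: E_def)
      have \<phi>n: "cmod (\<phi> x) = indicator E x" if "x \<in> space M" for x
        using c that by (auto simp: \<phi>_def indicator_def norm_mult norm_divide E_def)
      have v\<phi>: "v x * \<phi> x = of_real (indicator E x * cmod (v x))" for x
      proof (cases "x \<in> E")
        case True
        have "v x * \<phi> x = (v x * cnj (v x)) / of_real (cmod (v x))" using True by (simp add: \<phi>_def)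
        then show ?thesis using True unfolding complex_norm_square[symmetric] by (simp add: power2_eq_square)
      qed (simp add: \<phi>_def)
      have "nrm M e \<phi> = measure M E"
      proof -
        have "(LINT x|M. cmod (\<phi> x) powr e) = (LINT x|M. indicator E x)"
          by (intro Bochner_Integration.integral_cong) (auto simp: \<phi>n indicator_def)
        then show ?thesis by (simp add: nrm_def e1 E_def measure_def Int_absorb2)
      qed
      moreover have "cmod (LINT x|M. v x * \<phi> x) \<le> K * nrm M e \<phi>"
      proof (rule ext[where B=1])
        show "cmod (\<phi> x) \<le> 1" for x by (auto simp: \<phi>_def indicator_def norm_divide norm_mult)
        have "emeasure M {x\<in>space M. \<phi> x \<noteq> 0} \<le> emeasure M E"
          by (intro emeasure_mono) (auto simp: \<phi>_def indicator_def split: if_splits)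
        then show "emeasure M {x\<in>space M. \<phi> x \<noteq> 0} < \<infinity>" using fE by auto
      qed simp
      moreover have "(LINT x|M. v x * \<phi> x) = of_real (LINT x|M. indicator E x * cmod (v x))"
        unfolding v\<phi> by (rule integral_complex_of_real)
      moreover have "c * measure M E \<le> (LINT x|M. indicator E x * cmod (v x))"
      proof -
        have "c * measure M E = (LINT x|M. c * indicator E x)" by (simp add: E_def Int_absorb2)
        also have "\<dots> \<le> (LINT x|M. indicator E x * cmod (v x))"
        proof (rule integral_mono)
          show "integrable M (\<lambda>x. c * indicator E x)" using fE by simp
          have "integrable M (\<lambda>x. (cmod (v x))\<^sup>2 / c)" using v2 by simp
          then show "integrable M (\<lambda>x. indicator E x * cmod (v x))"
          proof (rule Bochner_Integration.integrable_bound)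
            show "AE x in M. norm (indicator E x * cmod (v x)) \<le> norm ((cmod (v x))\<^sup>2 / c)"
              using c by (auto simp: indicator_def E_def field_simps power2_eq_square mult_right_mono)
          qed simp
        qed (auto simp: indicator_def E_def)
        finally show ?thesis .
      qed
      ultimately have "c * measure M E \<le> K * measure M E" by simp
      then have "measure M E = 0" using c measure_nonneg[of M E]
        by (metis dual_order.strict_iff_order less_le_trans linorder_not_le mult_right_le_imp_le
          order_antisym_conv)
      then have "emeasure M E = 0" using fE by (simp add: emeasure_eq_ennreal_measure)
      then have "E \<in> null_sets M" by auto
      then show ?thesis by (rule AE_I') (auto simp: E_def c_def)
    qed
    have "AE x in M. \<forall>n. cmod (v x) < K + 1/real (Suc n)" using * by (simp add: AE_all_countable)
    then have "AE x in M. cmod (v x) \<le> K"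
    proof eventually_elim
      case (elim x)
      show ?case
      proof (rule field_le_epsilon)
        fix \<epsilon> :: real assume "0 < \<epsilon>"
        then obtain n where "1/real (Suc n) < \<epsilon>" using nat_approx_posE by blast
        then show "cmod (v x) \<le> K + \<epsilon>" using elim[rule_format, of n] by simp
      qed
    qed
    then show ?thesis using True K by (simp add: Lp_bound_def)
  next
    case False
    then have y0: "y > 0" using y by simp
    define p where "p = 1/y"
    have p: "p > 1" using y y0 by (simp add: p_def)
    have pe: "(p-1)*e = p" using y0 y by (simp add: p_def e_def field_simps)
    \<comment> \<open>The lower cut makes the measure of \<open>E n\<close> finite and the upper one
      makes \<open>v\<close> bounded there. Hence the integral \<open>T\<close> below is finite and
      may be divided out of \<open>T \<le> K * T powr (1-y)\<close>; monotone convergence removes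
      the cuts.\<close>
    define E where "E n = {x\<in>space M. 1/real (Suc n) \<le> cmod (v x) \<and> cmod (v x) \<le> real (Suc n)}" for n
    have [measurable]: "\<And>n. E n \<in> sets M" by (simp add: E_def)
    have fE: "emeasure M (E n) < \<infinity>" for n
    proof -
      have "emeasure M (E n) \<le> emeasure M {x\<in>space M. 1/real (Suc n) \<le> cmod (v x)}"
        by (intro emeasure_mono) (auto simp: E_def)
      also have "\<dots> < \<infinity>" by (rule fs) simp
      finally show ?thesis .
    qed
    have In: "(\<integral>\<^sup>+x. ennreal (cmod (v x) powr p) * indicator (E n) x \<partial>M) \<le> ennreal (K powr p)" for n
    proof -
      \<comment> \<open>The equality case of Hoelder's inequality: on \<open>E n\<close> both
        \<open>v x * \<phi> x\<close> and \<open>cmod (\<phi> x) powr e\<close> are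
        \<open>cmod (v x) powr p\<close>, because \<open>(p-1)*e = p\<close>.\<close>
      define \<phi> where "\<phi> = (\<lambda>x. indicator (E n) x * (cnj (v x) * of_real (cmod (v x) powr (p-2))))"
      have [measurable]: "\<phi> \<in> borel_measurable M" by (simp add: \<phi>_def)
      have vn: "v x \<noteq> 0" if "x \<in> E n" for x
      proof
        assume "v x = 0"
        then have "1 / real (Suc n) \<le> 0" using that by (simp add: E_def)
        then show False by simp
      qed
      have \<phi>n: "cmod (\<phi> x) = indicator (E n) x * cmod (v x) powr (p-1)" for x
      proof (cases "x \<in> E n")
        case True
        have "cmod (v x) powr (p-1) = cmod (v x) powr 1 * cmod (v x) powr (p-2)" 
          by (subst powr_add[symmetric]) simp
        then show ?thesis using True by (simp add: \<phi>_def norm_mult)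
      qed (simp add: \<phi>_def)
      have v\<phi>: "v x * \<phi> x = of_real (indicator (E n) x * cmod (v x) powr p)" for x
      proof (cases "x \<in> E n")
        case True
        have "cmod (v x) powr p = cmod (v x) powr 2 * cmod (v x) powr (p-2)" 
          by (subst powr_add[symmetric]) simp
        moreover have "v x * \<phi> x = (v x * cnj (v x)) * of_real (cmod (v x) powr (p-2))"
          using True by (simp add: \<phi>_def)
        ultimately show ?thesis using True vn[OF True]
          unfolding complex_norm_square[symmetric] by simp
      qed (simp add: \<phi>_def)
      define T where "T = (LINT x|M. indicator (E n) x * cmod (v x) powr p)"
      have iT: "integrable M (\<lambda>x. indicator (E n) x * cmod (v x) powr p)"
      proof (rule integrableI_bounded_set[where A="E n" and B="real (Suc n) powr p"])
        show "AE x in M. x \<in> E n \<longrightarrow> norm (indicator (E n) x * cmod (v x) powr p) \<le> real (Suc n) powr p"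
          using p by (auto simp: E_def intro!: AE_I2 powr_mono2)
      qed (use fE in auto)
      have T0: "T \<ge> 0" unfolding T_def by (intro integral_nonneg_AE) auto
      have ne: "nrm M e \<phi> = T powr (1/e)"
      proof -
        have "cmod (\<phi> x) powr e = indicator (E n) x * cmod (v x) powr p" for x
          using e pe by (auto simp: \<phi>n indicator_def powr_powr)
        then show ?thesis by (simp add: nrm_def T_def)
      qed
      have "cmod (LINT x|M. v x * \<phi> x) \<le> K * nrm M e \<phi>"
      proof (rule ext[where B="real (Suc n) powr (p-1)"])
        show "cmod (\<phi> x) \<le> real (Suc n) powr (p-1)" for x
          using p by (auto simp: \<phi>n indicator_def E_def intro!: powr_mono2)
        have "emeasure M {x\<in>space M. \<phi> x \<noteq> 0} \<le> emeasure M (E n)"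
          by (intro emeasure_mono) (auto simp: \<phi>_def indicator_def split: if_splits)
        then show "emeasure M {x\<in>space M. \<phi> x \<noteq> 0} < \<infinity>" using fE[of n] by auto
      qed simp
      moreover have "(LINT x|M. v x * \<phi> x) = of_real T"
        unfolding v\<phi> T_def by (rule integral_complex_of_real)
      ultimately have TK: "T \<le> K * T powr (1-y)" using T0 ne by (simp add: e_def)
      have "T \<le> K powr p"
      proof (cases "T = 0")
        case False
        then have "T > 0" using T0 by simp
        have "T powr y * T powr (1-y) \<le> K * T powr (1-y)" using TK \<open>T > 0\<close> by (simp add: powr_add[symmetric])
        then have "T powr y \<le> K" using \<open>T > 0\<close> by simp
        then have "(T powr y) powr p \<le> K powr p" using p by (intro powr_mono2) auto
        then show ?thesis using \<open>T > 0\<close> y0 by (simp add: powr_powr p_def)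
      qed simp
      moreover have "(\<integral>\<^sup>+x. ennreal (cmod (v x) powr p) * indicator (E n) x \<partial>M) = ennreal T"
        unfolding T_def by (subst nn_integral_eq_integral[OF iT, symmetric])
          (auto intro!: nn_integral_cong simp: indicator_def)
      ultimately show ?thesis by (simp add: ennreal_leI)
    qed
    have "(\<integral>\<^sup>+x. ennreal (cmod (v x) powr p) \<partial>M)
      \<le> (\<integral>\<^sup>+x. (SUP n. ennreal (cmod (v x) powr p) * indicator (E n) x) \<partial>M)"
    proof (rule nn_integral_mono)
      fix x assume x: "x \<in> space M"
      show "ennreal (cmod (v x) powr p) \<le> (SUP n. ennreal (cmod (v x) powr p) * indicator (E n) x)"
      proof (cases "v x = 0")
        case False
        obtain n1 where n1: "1/real (Suc n1) < cmod (v x)"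
          using nat_approx_posE False by (metis zero_less_norm_iff)
        obtain n2 where n2: "cmod (v x) \<le> real n2" using real_arch_simple by blast
        define n where "n = max n1 n2"
        have "1/real (Suc n) \<le> 1/real (Suc n1)" by (auto simp: n_def frac_le)
        then have "x \<in> E n" using x n1 n2 by (auto simp: E_def n_def)
        then show ?thesis by (intro SUP_upper2[of n]) auto
      qed auto
    qed
    also have "\<dots> = (SUP n. \<integral>\<^sup>+x. ennreal (cmod (v x) powr p) * indicator (E n) x \<partial>M)"
    proof (rule nn_integral_monotone_convergence_SUP)
      have "E m \<subseteq> E n" if "m \<le> n" for m n
      proof -
        have "1/real (Suc n) \<le> 1/real (Suc m)" using that by (auto simp: frac_le)
        then show ?thesis using that by (auto simp: E_def)
      qed
      then show "incseq (\<lambda>n x. ennreal (cmod (v x) powr p) * indicator (E n) x)"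
        by (auto simp: incseq_def le_fun_def indicator_def)
    qed simp
    also have "\<dots> \<le> ennreal (K powr p)" using In by (intro SUP_least) auto
    finally show ?thesis using False K by (simp add: Lp_bound_def p_def)
  qed
qed

section \<open>The Hardy--Littlewood--Sobolev inequality\<close>

lemma sigma_finite_lebesgue: "sigma_finite_measure (lebesgue :: real measure)"
proof -
  obtain A :: "real set set" where A: "countable A" "A \<subseteq> sets lborel" "\<Union>A
    = space lborel" "\<forall>a\<in>A. emeasure lborel a \<noteq> \<infinity>"
    using lborel.sigma_finite_countable by blast
  show ?thesis
  proof (rule sigma_finite_measure.intro)
    show "\<exists>A. countable A \<and> A \<subseteq> sets lebesgue \<and> \<Union>A
      = space lebesgue \<and> (\<forall>a\<in>A. emeasure (lebesgue::real measure) a \<noteq> \<infinity>)"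
      using A by (intro exI[of _ A]) auto
  qed
qed

lemma id_measurable_lebesgue: "(\<lambda>x::real. x) \<in> borel_measurable lebesgue"
  by (rule measurable_completion) simp

text \<open>The line is cut at \<open>t\<close>; translation and reflection carry both halves to the
  positive axis, hence the factor 2.\<close>

lemma nn_integral_radial_le:
  fixes h :: "real \<Rightarrow> real" and t :: real
  assumes [measurable]: "h \<in> borel_measurable borel" and h0: "h 0 = 0" "\<And>u. 0 \<le> h u"
    and I: "(\<integral>\<^sup>+u. ennreal (h u) * indicator {0<..} u \<partial>lborel) \<le> ennreal c" and c: "0 \<le> c"
  shows "(\<integral>\<^sup>+s. ennreal (h \<bar>t - s\<bar>) \<partial>lebesgue) \<le> ennreal (2 * c)"
proof -
  define f where "f u = ennreal (h u) * indicator {0<..} u" for u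
  have [measurable]: "f \<in> borel_measurable borel" unfolding f_def by measurable
  have "ennreal (h \<bar>t - s\<bar>) \<le> f (- t + 1 * s) + f (t + (-1) * s)" for s
  proof -
    consider "s < t" | "s = t" | "s > t" by linarith
    then show ?thesis by cases (auto simp: f_def h0)
  qed
  then have "(\<integral>\<^sup>+s. ennreal (h \<bar>t - s\<bar>) \<partial>lebesgue) \<le> (\<integral>\<^sup>+s. f (- t + 1 * s) + f (t + (-1) * s) \<partial>lborel)"
    unfolding nn_integral_completion by (intro nn_integral_mono)
  also have "\<dots> = (\<integral>\<^sup>+s. f (- t + 1 * s) \<partial>lborel) + (\<integral>\<^sup>+s. f (t + (-1) * s) \<partial>lborel)"
    by (rule nn_integral_add) auto
  also have "(\<integral>\<^sup>+s. f (- t + 1 * s) \<partial>lborel) = (\<integral>\<^sup>+s. f s \<partial>lborel)"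
    using nn_integral_real_affine[of f 1 "- t"] by simp
  also have "(\<integral>\<^sup>+s. f (t + (-1) * s) \<partial>lborel) = (\<integral>\<^sup>+s. f s \<partial>lborel)"
    using nn_integral_real_affine[of f "-1" t] by simp
  also have "(\<integral>\<^sup>+s. f s \<partial>lborel) + (\<integral>\<^sup>+s. f s \<partial>lborel) \<le> ennreal c + ennreal c"
    using I unfolding f_def by (intro add_mono)
  also have "\<dots> = ennreal (2 * c)" using c by (simp flip: ennreal_plus)
  finally show ?thesis .
qed

lemma nn_integral_powr_near:
  fixes t :: real
  assumes "0 \<le> lam" "lam < 1" "0 < \<rho>"
  shows "(\<integral>\<^sup>+s. ennreal (if \<bar>t - s\<bar> \<le> \<rho> then \<bar>t - s\<bar> powr (-lam) else 0) \<partial>lebesgue)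
    \<le> ennreal (2 * (\<rho> powr (1-lam) / (1-lam)))"
proof (rule nn_integral_radial_le[where h="\<lambda>u.
  if u \<le> \<rho> \<and> u \<noteq> 0 then u powr (-lam) else 0", THEN order_trans[rotated]])
  have "((\<lambda>x. x powr (-lam)) has_integral (\<rho> powr (-lam+1) / (-lam+1))) {0..\<rho>}"
    using assms by (intro has_integral_powr_from_0) auto
  then have "(\<integral>\<^sup>+x. ennreal (x powr (-lam)) * indicator {0..\<rho>} x \<partial>lborel)
    = ennreal (\<rho> powr (-lam+1) / (-lam+1))"
    by (intro nn_integral_has_integral_lebesgue') auto
  then have *: "(\<integral>\<^sup>+x. ennreal (x powr (-lam)) * indicator {0..\<rho>} x \<partial>lborel)
    = ennreal (\<rho> powr (1-lam) / (1-lam))"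
    by (simp add: add.commute)
  show "(\<integral>\<^sup>+u. ennreal (if u \<le> \<rho> \<and> u \<noteq> 0 then u powr (-lam) else 0) * indicator {0<..} u \<partial>lborel)
    \<le> ennreal (\<rho> powr (1-lam) / (1-lam))"
    unfolding *[symmetric] by (intro nn_integral_mono) (auto simp: indicator_def)
  show "(\<integral>\<^sup>+s. ennreal (if \<bar>t - s\<bar> \<le> \<rho> then \<bar>t - s\<bar> powr (-lam) else 0) \<partial>lebesgue)
    \<le> (\<integral>\<^sup>+s. ennreal (if \<bar>t - s\<bar> \<le> \<rho> \<and> \<bar>t - s\<bar> \<noteq> 0 then \<bar>t - s\<bar> powr (-lam) else 0) \<partial>lebesgue)"
    by (intro nn_integral_mono) auto
qed (use assms in auto)

lemma nn_integral_powr_far: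
  fixes t :: real
  assumes "0 < \<rho>"
  shows "(\<integral>\<^sup>+s. ennreal (if \<rho> < \<bar>t - s\<bar> then \<bar>t - s\<bar> powr (-2) else 0) \<partial>lebesgue) \<le> ennreal (2 * (1/\<rho>))"
proof (rule nn_integral_radial_le[where h="\<lambda>u. if \<rho> < u then u powr (-2) else 0"])
  have "((\<lambda>x. x powr (-2)) has_integral - (\<rho> powr (-2 + 1)) / (-2 + 1)) {\<rho>..}"
    using assms by (intro has_integral_powr_to_inf) auto
  then have "(\<integral>\<^sup>+x. ennreal (x powr (-2)) * indicator {\<rho>..} x \<partial>lborel) = ennreal (- (\<rho> powr (-2+1)) / (-2+1))"
    by (intro nn_integral_has_integral_lebesgue') auto
  then have *: "(\<integral>\<^sup>+x. ennreal (x powr (-2)) * indicator {\<rho>..} x \<partial>lborel) = ennreal (1/\<rho>)"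
    using assms by (simp add: powr_minus_divide)
  show "(\<integral>\<^sup>+u. ennreal (if \<rho> < u then u powr (-2) else 0) * indicator {0<..} u \<partial>lborel) \<le> ennreal (1/\<rho>)"
    unfolding *[symmetric] by (intro nn_integral_mono) (auto simp: indicator_def)
qed (use assms in auto)

text \<open>The kernel is split at \<open>\<bar>t - s\<bar> = h powr (-p)\<close>; near the diagonal \<open>\<phi> \<le> h\<close> is used, away from it Young's
  inequality. With \<open>h = \<phi> t\<close> this bounds the part \<open>\<phi> s \<le> \<phi> t\<close> of the double integral, and symmetry takes
  care of the rest.\<close>

lemma HLS_inner:
  fixes \<phi> :: "real \<Rightarrow> real"
  assumes lam: "0 < lam" "lam < 1" and p: "p = 2/(2-lam)"
    and [measurable]: "\<phi> \<in> borel_measurable lebesgue" and nn: "\<And>s. 0 \<le> \<phi> s"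
    and N: "(\<integral>\<^sup>+s. ennreal (\<phi> s powr p) \<partial>lebesgue) \<le> 1" and h: "0 < h"
  shows "(\<integral>\<^sup>+s. ennreal (if \<phi> s \<le> h then \<phi> s * \<bar>t - s\<bar> powr (-lam) else 0) \<partial>lebesgue)
    \<le> ennreal ((2/(1-lam) + 3) * h powr (p-1))"
proof -
  have p1: "p > 1" "p - 1 = lam/(2-lam)" "1 - p*(1-lam) = p - 1" "p*lam/2 = p - 1" "1/p = 1 - lam/2"
    using lam by (simp_all add: p field_simps)
  \<comment> \<open>Young's inequality is used with the exponents \<open>p\<close> and
    \<open>2/lam\<close> after shifting a factor \<open>\<tau>\<close> between the two factors.
    These choices of \<open>\<rho>\<close> and \<open>\<tau>\<close> make all three resulting terms
    constants times \<open>h powr (p-1)\<close>.\<close>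
  define \<rho> where "\<rho> = h powr (-p)"
  define \<tau> where "\<tau> = \<rho> powr (- lam/(2*p))"
  have pos: "\<rho> > 0" "\<tau> > 0" using h by (auto simp: \<rho>_def \<tau>_def)
  have tau1: "\<tau> powr p = \<rho> powr (-lam/2)" using p1(1) by (simp add: \<tau>_def powr_powr)
  have tau2: "\<tau> powr (-2/lam) = \<rho> powr (1/p)" using lam p1(1) by (simp add: \<tau>_def powr_powr)
  have "- p * (- lam/2) = p - 1" using p1(4) by linarith
  then have rho1: "\<rho> powr (-lam/2) = h powr (p-1)" by (simp only: \<rho>_def powr_powr)
  have rho2: "h * \<rho> powr (1-lam) = h powr (p-1)"
  proof -
    have "h * \<rho> powr (1-lam) = h powr 1 * h powr (-(p*(1-lam)))" using h by (simp add: \<rho>_def powr_powr)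
    also have "\<dots> = h powr (1 + -(p*(1-lam)))" by (rule powr_add[symmetric])
    also have "1 + -(p*(1-lam)) = p - 1" using p1(3) by linarith
    finally show ?thesis .
  qed
  have rho3: "\<rho> powr (1/p) * (1/\<rho>) = h powr (p-1)"
  proof -
    have "\<rho> powr (1/p) * (1/\<rho>) = \<rho> powr (1/p) * \<rho> powr (-1)" using pos by (simp add: powr_minus_divide)
    also have "\<dots> = \<rho> powr (1/p + -1)" by (rule powr_add[symmetric])
    also have "1/p + -1 = -lam/2" using p1(5) by linarith
    finally show ?thesis using rho1 by simp
  qed
  have [measurable]: "(\<lambda>s. if \<bar>t - s\<bar> \<le> \<rho> then \<bar>t - s\<bar> powr (-lam) else 0) \<in> borel_measurable lebesgue"
    "(\<lambda>s. if \<rho> < \<bar>t - s\<bar> then \<bar>t - s\<bar> powr (-2) else 0) \<in> borel_measurable lebesgue"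
    by (intro measurable_completion; measurable)+
  have gen: "ennreal a * ennreal b + (ennreal c * 1 + ennreal d * ennreal e) = ennreal (a*b + (c + d*e))"
    if "0 \<le> a" "0 \<le> b" "0 \<le> c" "0 \<le> d" "0 \<le> e" for a b c d e :: real
    using that by (simp add: ennreal_mult ennreal_plus)
  have pt: "(if \<phi> s \<le> h then \<phi> s * \<bar>t - s\<bar> powr (-lam) else 0)
     \<le> h * (if \<bar>t - s\<bar> \<le> \<rho> then \<bar>t - s\<bar> powr (-lam) else 0) + (\<tau> powr p * \<phi> s powr p
        + \<tau> powr (-2/lam) * (if \<rho> < \<bar>t - s\<bar> then \<bar>t - s\<bar> powr (-2) else 0))" for s
  proof (cases "\<phi> s \<le> h")
    case True
    show ?thesis
    proof (cases "\<bar>t - s\<bar> \<le> \<rho>")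
      case near: True
      then show ?thesis using True pos nn[of s] by (auto intro!: mult_right_mono add_increasing2)
    next
      case far: False
      let ?u = "\<bar>t - s\<bar>"
      have u: "?u > 0" using far pos by linarith
      have "(\<phi> s * \<tau>) * (?u powr (-lam) / \<tau>) \<le> (\<phi> s * \<tau>) powr p / p
        + (?u powr (-lam) / \<tau>) powr (2/lam) / (2/lam)"
        using p1 lam pos nn[of s] by (intro Youngs_inequality) auto
      also have "\<dots> \<le> (\<phi> s * \<tau>) powr p + (?u powr (-lam) / \<tau>) powr (2/lam)"
      proof (rule add_mono)
        show "(\<phi> s * \<tau>) powr p / p \<le> (\<phi> s * \<tau>) powr p"
          using p1 by (simp add: divide_le_eq mult_left_le_one_le mult_le_cancel_left1)
        have "lam/2 * (?u powr (-lam) / \<tau>) powr (2/lam) \<le> 1 * (?u powr (-lam) / \<tau>) powr (2/lam)"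
          using lam by (intro mult_right_mono) auto
        then show "(?u powr (-lam) / \<tau>) powr (2/lam) / (2/lam) \<le> (?u powr (-lam) / \<tau>) powr (2/lam)"
          by (simp add: mult.commute)
      qed
      also have "(\<phi> s * \<tau>) powr p = \<tau> powr p * \<phi> s powr p"
        using pos nn[of s] by (simp add: powr_mult mult.commute)
      also have "(?u powr (-lam) / \<tau>) powr (2/lam) = \<tau> powr (-2/lam) * ?u powr (-2)"
      proof -
        have "(?u powr (-lam) / \<tau>) powr (2/lam) = (?u powr (-lam)) powr (2/lam) / \<tau> powr (2/lam)"
          by (rule powr_divide)
        also have "(?u powr (-lam)) powr (2/lam) = ?u powr (-2)" using lam by (simp add: powr_powr)
        also have "?u powr (-2) / \<tau> powr (2/lam) = \<tau> powr (-2/lam) * ?u powr (-2)"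
          using powr_minus_divide[of \<tau> "2/lam"] by simp
        finally show ?thesis .
      qed
      finally show ?thesis using True far pos u by simp
    qed
  qed (use pos h in auto)
  have "(\<integral>\<^sup>+s. ennreal (if \<phi> s \<le> h then \<phi> s * \<bar>t - s\<bar> powr (-lam) else 0) \<partial>lebesgue) \<le>
    (\<integral>\<^sup>+s. ennreal h * ennreal (if \<bar>t - s\<bar> \<le> \<rho> then \<bar>t - s\<bar> powr (-lam) else 0)
      + (ennreal (\<tau> powr p) * ennreal (\<phi> s powr p)
        + ennreal (\<tau> powr (-2/lam)) * ennreal (if \<rho> < \<bar>t - s\<bar> then \<bar>t - s\<bar> powr (-2) else 0)) \<partial>lebesgue)"
    using pt pos h by (intro nn_integral_mono) (auto simp flip: ennreal_mult ennreal_plus intro!: ennreal_leI)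
  also have "\<dots> = ennreal h * (\<integral>\<^sup>+s. ennreal (if \<bar>t - s\<bar> \<le> \<rho> then \<bar>t - s\<bar> powr (-lam) else 0) \<partial>lebesgue)
      + (ennreal (\<tau> powr p) * (\<integral>\<^sup>+s. ennreal (\<phi> s powr p) \<partial>lebesgue)
        + ennreal (\<tau> powr (-2/lam)) * (\<integral>\<^sup>+s. ennreal (if \<rho> < \<bar>t - s\<bar> then \<bar>t - s\<bar> powr (-2) else 0)
          \<partial>lebesgue))"
    by (simp add: nn_integral_add nn_integral_cmult)
  also have "\<dots> \<le> ennreal h * ennreal (2 * (\<rho> powr (1-lam) / (1-lam)))
      + (ennreal (\<tau> powr p) * 1 + ennreal (\<tau> powr (-2/lam)) * ennreal (2 * (1/\<rho>)))"
    using lam pos by (intro add_mono mult_left_mono nn_integral_powr_near nn_integral_powr_far N) auto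
  also have "\<dots> = ennreal (h * (2 * (\<rho> powr (1-lam) / (1-lam))) + (\<tau> powr p + \<tau> powr (-2/lam) * (2 * (1/\<rho>))))"
    by (rule gen) (use h pos lam in auto)
  also have "h * (2 * (\<rho> powr (1-lam) / (1-lam))) = 2/(1-lam) * (h * \<rho> powr (1-lam))" by simp
  also have "\<tau> powr (-2/lam) * (2 * (1/\<rho>)) = 2 * (\<rho> powr (1/p) * (1/\<rho>))" using tau2 by simp
  also have "2/(1-lam) * (h * \<rho> powr (1-lam)) + (\<tau> powr p + 2 * (\<rho> powr (1/p) * (1/\<rho>))) = (2/(1-lam) + 3)
    * h powr (p-1)"
    unfolding rho2 rho3 tau1 rho1 by (simp add: algebra_simps)
  finally show ?thesis .
qed

lemma HLS_normalised:
  fixes \<phi> :: "real \<Rightarrow> real"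
  assumes lam: "0 < lam" "lam < 1" and p: "p = 2/(2-lam)"
    and \<phi>m[measurable]: "\<phi> \<in> borel_measurable lebesgue" and nn: "\<And>s. 0 \<le> \<phi> s"
    and N: "(\<integral>\<^sup>+s. ennreal (\<phi> s powr p) \<partial>lebesgue) \<le> 1"
  shows "(\<integral>\<^sup>+t. \<integral>\<^sup>+s. ennreal (\<phi> s * \<phi> t * \<bar>t - s\<bar> powr (-lam)) \<partial>lebesgue \<partial>lebesgue)
    \<le> ennreal (2 * (2/(1-lam) + 3))"
proof -
  interpret L: sigma_finite_measure "lebesgue :: real measure" by (rule sigma_finite_lebesgue)
  interpret P: pair_sigma_finite "lebesgue :: real measure" "lebesgue :: real measure" ..
  define C where "C = 2/(1-lam) + 3"
  have C: "C > 0" using lam by (simp add: C_def add_nonneg_pos)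
  note [measurable] = id_measurable_lebesgue
  define k where "k t s = ennreal (if \<phi> s \<le> \<phi> t then \<phi> s * \<phi> t * \<bar>t - s\<bar> powr (-lam) else 0)" for t s
  have km: "(\<lambda>(t,s). k t s) \<in> borel_measurable (lebesgue \<Otimes>\<^sub>M lebesgue)" unfolding k_def by measurable
  have km'[measurable]: "(\<lambda>s. k t s) \<in> borel_measurable lebesgue" "(\<lambda>s. k s t) \<in> borel_measurable lebesgue"
    for t
    unfolding k_def by measurable
  have inner: "(\<integral>\<^sup>+s. k t s \<partial>lebesgue) \<le> ennreal (C * \<phi> t powr p)" for t
  proof (cases "\<phi> t = 0")
    case True
    then have "k t s = 0" for s by (simp add: k_def)
    then show ?thesis by simp
  next
    case False
    then have pos: "\<phi> t > 0" using nn[of t] by simp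
    have "(\<integral>\<^sup>+s. k t s \<partial>lebesgue) = (\<integral>\<^sup>+s. ennreal (\<phi> t)
      * ennreal (if \<phi> s \<le> \<phi> t then \<phi> s * \<bar>t - s\<bar> powr (-lam) else 0) \<partial>lebesgue)"
      using nn by (intro nn_integral_cong) (auto simp: k_def mult_ac simp flip: ennreal_mult)
    also have "\<dots> = ennreal (\<phi> t) * (\<integral>\<^sup>+s. ennreal (if \<phi> s \<le> \<phi> t then \<phi> s
      * \<bar>t - s\<bar> powr (-lam) else 0) \<partial>lebesgue)"
      by (rule nn_integral_cmult) measurable
    also have "\<dots> \<le> ennreal (\<phi> t) * ennreal (C * \<phi> t powr (p-1))"
      unfolding C_def by (intro mult_left_mono HLS_inner[OF lam p \<phi>m nn N pos]) auto
    also have "\<dots> = ennreal (C * (\<phi> t * \<phi> t powr (p-1)))" using pos C by (simp flip: ennreal_mult add: mult_ac)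
    also have "\<phi> t * \<phi> t powr (p-1) = \<phi> t powr p" using pos by (simp add: powr_mult_base)
    finally show ?thesis .
  qed
  have out: "(\<integral>\<^sup>+t. \<integral>\<^sup>+s. k t s \<partial>lebesgue \<partial>lebesgue) \<le> ennreal C"
  proof -
    have "(\<integral>\<^sup>+t. \<integral>\<^sup>+s. k t s \<partial>lebesgue \<partial>lebesgue) \<le> (\<integral>\<^sup>+t. ennreal C * ennreal (\<phi> t powr p) \<partial>lebesgue)"
      using inner C by (intro nn_integral_mono) (simp add: ennreal_mult)
    also have "\<dots> = ennreal C * (\<integral>\<^sup>+t. ennreal (\<phi> t powr p) \<partial>lebesgue)" by (rule nn_integral_cmult) measurable
    also have "\<dots> \<le> ennreal C * 1" by (intro mult_left_mono N) simp
    finally show ?thesis by simp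
  qed
  have "(\<integral>\<^sup>+t. \<integral>\<^sup>+s. ennreal (\<phi> s * \<phi> t * \<bar>t - s\<bar> powr (-lam)) \<partial>lebesgue \<partial>lebesgue)
     \<le> (\<integral>\<^sup>+t. \<integral>\<^sup>+s. k t s + k s t \<partial>lebesgue \<partial>lebesgue)"
  proof (intro nn_integral_mono)
    fix t s
    show "ennreal (\<phi> s * \<phi> t * \<bar>t - s\<bar> powr (-lam)) \<le> k t s + k s t"
      by (cases "\<phi> s \<le> \<phi> t") (auto simp: k_def mult_ac abs_minus_commute)
  qed
  also have "\<dots> = (\<integral>\<^sup>+t. ((\<integral>\<^sup>+s. k t s \<partial>lebesgue) + (\<integral>\<^sup>+s. k s t \<partial>lebesgue)) \<partial>lebesgue)"
    by (intro nn_integral_cong nn_integral_add) measurable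
  also have "\<dots> = (\<integral>\<^sup>+t. \<integral>\<^sup>+s. k t s \<partial>lebesgue \<partial>lebesgue) + (\<integral>\<^sup>+t. \<integral>\<^sup>+s. k s t \<partial>lebesgue \<partial>lebesgue)"
  proof (rule nn_integral_add)
    show "(\<lambda>t. \<integral>\<^sup>+s. k t s \<partial>lebesgue) \<in> borel_measurable lebesgue"
      using L.borel_measurable_nn_integral[of k lebesgue] km by simp
    have "(\<lambda>(t,s). k s t) \<in> borel_measurable (lebesgue \<Otimes>\<^sub>M lebesgue)" unfolding k_def by measurable
    then show "(\<lambda>t. \<integral>\<^sup>+s. k s t \<partial>lebesgue) \<in> borel_measurable lebesgue"
      using L.borel_measurable_nn_integral[of "\<lambda>t s. k s t" lebesgue] by simp
  qed
  also have "(\<integral>\<^sup>+t. \<integral>\<^sup>+s. k s t \<partial>lebesgue \<partial>lebesgue) = (\<integral>\<^sup>+s. \<integral>\<^sup>+t. k s t \<partial>lebesgue \<partial>lebesgue)"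
    using P.Fubini'[of "\<lambda>s t. k s t"] km by simp
  also have "(\<integral>\<^sup>+t. \<integral>\<^sup>+s. k t s \<partial>lebesgue \<partial>lebesgue) + (\<integral>\<^sup>+s. \<integral>\<^sup>+t. k s t \<partial>lebesgue \<partial>lebesgue) \<le> ennreal C
    + ennreal C"
    using out by (intro add_mono)
  finally show ?thesis using C by (simp add: C_def flip: ennreal_plus)
qed

text \<open>\<open>lam = 0\<close> must be included, since it is the member
  \<open>\<beta> = 1/2\<close> of the Strichartz family. There \<open>p = 1\<close>, Young's
  exponent \<open>2/lam\<close> would be infinite, and the double integral is bounded by a
  product.\<close>

lemma HLS:
  assumes lam: "0 \<le> lam" "lam < 1" and p: "p = 2/(2-lam)"
  obtains C where "C > 0" "\<And>\<phi> N. \<phi> \<in> borel_measurable lebesgue \<Longrightarrow> (\<And>s. 0 \<le> \<phi> s) \<Longrightarrow> 0 \<le> N \<Longrightarrow>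
     (\<integral>\<^sup>+s. ennreal (\<phi> s powr p) \<partial>lebesgue) \<le> ennreal (N powr p) \<Longrightarrow>
     (\<integral>\<^sup>+t. \<integral>\<^sup>+s. ennreal (\<phi> s * \<phi> t * \<bar>t - s\<bar> powr (-lam)) \<partial>lebesgue \<partial>lebesgue) \<le> ennreal (C * N\<^sup>2)"
proof (cases "lam = 0")
  case True
  show ?thesis
  proof (rule that[of 1])
    fix \<phi> :: "real \<Rightarrow> real" and N :: real
    assume \<phi>[measurable]: "\<phi> \<in> borel_measurable lebesgue" and nn: "\<And>s. 0 \<le> \<phi> s" and N: "0 \<le> N"
      and I: "(\<integral>\<^sup>+s. ennreal (\<phi> s powr p) \<partial>lebesgue) \<le> ennreal (N powr p)"
    have I': "(\<integral>\<^sup>+s. ennreal (\<phi> s) \<partial>lebesgue) \<le> ennreal N" using I nn N by (simp add: p True)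
    have "(\<integral>\<^sup>+t. \<integral>\<^sup>+s. ennreal (\<phi> s * \<phi> t * \<bar>t - s\<bar> powr (-lam)) \<partial>lebesgue \<partial>lebesgue) \<le> 
       (\<integral>\<^sup>+t. \<integral>\<^sup>+s. ennreal (\<phi> t) * ennreal (\<phi> s) \<partial>lebesgue \<partial>lebesgue)"
      using nn by (intro nn_integral_mono) (auto simp: True powr_def mult_ac simp flip: ennreal_mult)
    also have "\<dots> = (\<integral>\<^sup>+t. ennreal (\<phi> t) * (\<integral>\<^sup>+s. ennreal (\<phi> s) \<partial>lebesgue) \<partial>lebesgue)"
      by (intro nn_integral_cong nn_integral_cmult) measurable
    also have "\<dots> = (\<integral>\<^sup>+s. ennreal (\<phi> s) \<partial>lebesgue) * (\<integral>\<^sup>+s. ennreal (\<phi> s) \<partial>lebesgue)"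
      by (rule nn_integral_multc) measurable
    also have "\<dots> \<le> ennreal N * ennreal N" by (intro mult_mono I') auto
    finally show "(\<integral>\<^sup>+t. \<integral>\<^sup>+s. ennreal (\<phi> s * \<phi> t * \<bar>t - s\<bar> powr (-lam)) \<partial>lebesgue \<partial>lebesgue)
      \<le> ennreal (1 * N\<^sup>2)"
      using N by (simp add: power2_eq_square ennreal_mult)
  qed simp
next
  case False
  then have lam': "0 < lam" using lam by simp
  have p1: "p > 1" using lam' lam by (simp add: p field_simps)
  define C where "C = 2 * (2/(1-lam) + 3)"
  have C: "C > 0" using lam by (simp add: C_def add_nonneg_pos)
  show ?thesis
  proof (rule that[OF C])
    fix \<phi> :: "real \<Rightarrow> real" and N :: real
    assume \<phi>[measurable]: "\<phi> \<in> borel_measurable lebesgue" and nn: "\<And>s. 0 \<le> \<phi> s" and N: "0 \<le> N"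
      and I: "(\<integral>\<^sup>+s. ennreal (\<phi> s powr p) \<partial>lebesgue) \<le> ennreal (N powr p)"
    note [measurable] = id_measurable_lebesgue
    show "(\<integral>\<^sup>+t. \<integral>\<^sup>+s. ennreal (\<phi> s * \<phi> t * \<bar>t - s\<bar> powr (-lam)) \<partial>lebesgue \<partial>lebesgue) \<le> ennreal (C * N\<^sup>2)"
    proof (cases "N = 0")
      \<comment> \<open>\<open>N = 0\<close> cannot be scaled to 1, but it forces
        \<open>\<phi>\<close> to vanish almost everywhere.\<close>
      case True
      have "Lp_bound lebesgue (1/p) \<phi> 0" using I \<phi> nn p1 True by (simp add: Lp_bound_def)
      then have "AE s in lebesgue. \<phi> s = 0" by (rule Lp_bound_zero)
      then have "AE s in lebesgue. ennreal (\<phi> s * \<phi> t * \<bar>t - s\<bar> powr (-lam)) = 0" for t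
        by eventually_elim simp
      then have "(\<integral>\<^sup>+s. ennreal (\<phi> s * \<phi> t * \<bar>t - s\<bar> powr (-lam)) \<partial>lebesgue)
        = (\<integral>\<^sup>+s. 0 \<partial>(lebesgue :: real measure))" for t
        by (intro nn_integral_cong_AE)
      then show ?thesis by simp
    next
      case False
      then have N: "N > 0" using N by simp
      have I1: "(\<integral>\<^sup>+s. ennreal ((\<phi> s / N) powr p) \<partial>lebesgue) \<le> 1"
      proof -
        have "(\<integral>\<^sup>+s. ennreal ((\<phi> s / N) powr p) \<partial>lebesgue)
          = (\<integral>\<^sup>+s. ennreal (1 / N powr p) * ennreal (\<phi> s powr p) \<partial>lebesgue)"
          using N nn by (intro nn_integral_cong) (simp add: powr_divide flip: ennreal_mult)
        also have "\<dots> = ennreal (1 / N powr p) * (\<integral>\<^sup>+s. ennreal (\<phi> s powr p) \<partial>lebesgue)"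
          by (rule nn_integral_cmult) measurable
        also have "\<dots> \<le> ennreal (1 / N powr p) * ennreal (N powr p)" by (intro mult_left_mono I) auto
        also have "\<dots> = 1" using N by (simp flip: ennreal_mult)
        finally show ?thesis .
      qed
      have J: "(\<integral>\<^sup>+t. \<integral>\<^sup>+s. ennreal ((\<phi> s / N) * (\<phi> t / N) * \<bar>t - s\<bar> powr (-lam)) \<partial>lebesgue \<partial>lebesgue)
        \<le> ennreal C"
        unfolding C_def using nn N by (intro HLS_normalised[OF lam' lam(2) p _ _ I1]) auto
      have "(\<integral>\<^sup>+t. \<integral>\<^sup>+s. ennreal (\<phi> s * \<phi> t * \<bar>t - s\<bar> powr (-lam)) \<partial>lebesgue \<partial>lebesgue)
        = (\<integral>\<^sup>+t. \<integral>\<^sup>+s. ennreal (N\<^sup>2) * ennreal ((\<phi> s / N) * (\<phi> t / N)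
          * \<bar>t - s\<bar> powr (-lam)) \<partial>lebesgue \<partial>lebesgue)"
        using N nn by (intro nn_integral_cong) (simp add: power2_eq_square flip: ennreal_mult)
      also have "\<dots> = (\<integral>\<^sup>+t. ennreal (N\<^sup>2)
        * (\<integral>\<^sup>+s. ennreal ((\<phi> s / N) * (\<phi> t / N) * \<bar>t - s\<bar> powr (-lam)) \<partial>lebesgue) \<partial>lebesgue)"
        by (intro nn_integral_cong nn_integral_cmult) measurable
      also have "\<dots> = ennreal (N\<^sup>2) * (\<integral>\<^sup>+t. \<integral>\<^sup>+s. ennreal ((\<phi> s / N) * (\<phi> t / N)
        * \<bar>t - s\<bar> powr (-lam)) \<partial>lebesgue \<partial>lebesgue)"
      proof (rule nn_integral_cmult)
        interpret L: sigma_finite_measure "lebesgue :: real measure" by (rule sigma_finite_lebesgue)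
        show "(\<lambda>t. \<integral>\<^sup>+s. ennreal ((\<phi> s / N) * (\<phi> t / N) * \<bar>t - s\<bar> powr (-lam)) \<partial>lebesgue) \<in> borel_measurable
          lebesgue"
          by (rule L.borel_measurable_nn_integral) measurable
      qed
      also have "\<dots> \<le> ennreal (N\<^sup>2) * ennreal C" by (intro mult_left_mono J) auto
      finally show ?thesis using C by (simp add: mult.commute flip: ennreal_mult)
    qed
  qed
qed

section \<open>Riesz--Thorin interpolation\<close>

text \<open>Thorin's deformation of a single value: the phase is kept, so that \<open>w = 1\<close>
  gives back \<open>c\<close>, while the modulus depends on \<open>Re w\<close> alone.\<close>

definition phase_powr :: "complex \<Rightarrow> complex \<Rightarrow> complex" where
  "phase_powr c w = (if c = 0 then 0 else sgn c * exp (w * of_real (ln (cmod c))))"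

lemma phase_powr_0 [simp]: "phase_powr 0 w = 0" by (simp add: phase_powr_def)

lemma cmod_phase_powr: "cmod (phase_powr c w) = cmod c powr Re w"
  by (simp add: phase_powr_def norm_mult norm_sgn norm_exp_eq_Re powr_def)

lemma phase_powr_one [simp]: "phase_powr c 1 = c"
  by (simp add: phase_powr_def exp_of_real sgn_eq)

section \<open>The three lines theorem of Hadamard\<close>

definition strip_bounded :: "(complex \<Rightarrow> complex) \<Rightarrow> bool" where
  "strip_bounded F \<longleftrightarrow> F holomorphic_on UNIV \<and> (\<exists>B. \<forall>z. 0 \<le> Re z \<and> Re z \<le> 1 \<longrightarrow> cmod (F z) \<le> B)"

lemma strip_bounded_const: "strip_bounded (\<lambda>z. c)"
  by (auto simp: strip_bounded_def)

lemma strip_bounded_add: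
  assumes "strip_bounded F" "strip_bounded G" shows "strip_bounded (\<lambda>z. F z + G z)"
proof -
  obtain A B where A: "\<And>z. 0 \<le> Re z \<and> Re z \<le> 1 \<Longrightarrow> cmod (F z) \<le> A"
    and B: "\<And>z. 0 \<le> Re z \<and> Re z \<le> 1 \<Longrightarrow> cmod (G z) \<le> B"
    using assms by (auto simp: strip_bounded_def)
  have "cmod (F z + G z) \<le> A + B" if "0 \<le> Re z \<and> Re z \<le> 1" for z
    using norm_triangle_mono[OF A[OF that] B[OF that]] .
  then show ?thesis using assms by (auto simp: strip_bounded_def intro!: holomorphic_intros)
qed

lemma strip_bounded_mult:
  assumes "strip_bounded F" "strip_bounded G" shows "strip_bounded (\<lambda>z. F z * G z)"
proof -
  obtain A B where A: "\<And>z. 0 \<le> Re z \<and> Re z \<le> 1 \<Longrightarrow> cmod (F z) \<le> A"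
    and B: "\<And>z. 0 \<le> Re z \<and> Re z \<le> 1 \<Longrightarrow> cmod (G z) \<le> B"
    using assms by (auto simp: strip_bounded_def)
  have "cmod (F z * G z) \<le> A * B" if "0 \<le> Re z \<and> Re z \<le> 1" for z
  proof -
    have "0 \<le> A" using A[OF that] norm_ge_zero order_trans by blast
    then show ?thesis unfolding norm_mult using A[OF that] B[OF that] by (intro mult_mono) auto
  qed
  then show ?thesis using assms by (auto simp: strip_bounded_def intro!: holomorphic_intros)
qed

lemma strip_bounded_sum:
  "(\<And>i. i \<in> S \<Longrightarrow> strip_bounded (F i)) \<Longrightarrow> strip_bounded (\<lambda>z. \<Sum>i\<in>S. F i z)"
  by (induction S rule: infinite_finite_induct) (auto intro: strip_bounded_const strip_bounded_add)

lemma strip_bounded_phase_powr: "strip_bounded (\<lambda>z. phase_powr c (of_real a + of_real b * z))"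
proof (cases "c = 0")
  case False
  define l where "l = ln (cmod c)"
  have "cmod (phase_powr c (of_real a + of_real b * z)) \<le> exp ((\<bar>a\<bar> + \<bar>b\<bar>) * \<bar>l\<bar>)"
    if "0 \<le> Re z" "Re z \<le> 1" for z
  proof -
    have "\<bar>a + b * Re z\<bar> \<le> \<bar>a\<bar> + \<bar>b * Re z\<bar>" by (rule abs_triangle_ineq)
    also have "\<bar>b * Re z\<bar> \<le> \<bar>b\<bar>" using that by (simp add: abs_mult mult_left_le)
    finally have "\<bar>a + b * Re z\<bar> * \<bar>l\<bar> \<le> (\<bar>a\<bar> + \<bar>b\<bar>) * \<bar>l\<bar>" by (intro mult_right_mono) auto
    then have "(a + b * Re z) * l \<le> (\<bar>a\<bar> + \<bar>b\<bar>) * \<bar>l\<bar>"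
      using abs_ge_self[of "(a + b * Re z) * l"] by (simp add: abs_mult)
    then show ?thesis using False by (simp add: cmod_phase_powr powr_def l_def)
  qed
  moreover have "(\<lambda>z. phase_powr c (of_real a + of_real b * z)) holomorphic_on UNIV"
    using False by (auto simp: phase_powr_def intro!: holomorphic_intros)
  ultimately show ?thesis by (auto simp: strip_bounded_def)
qed (simp add: strip_bounded_const)

text \<open>Division by the exponential that interpolates \<open>K0\<close> and \<open>K1\<close>
  reduces to the bound 1 on both lines. The factor \<open>exp (\<epsilon> * (z\<^sup>2 - 1))\<close>
  has modulus at most 1 on the strip and decays far up and down, so the maximum principle on a
  finite rectangle suffices.\<close>

lemma three_lines:
  assumes F: "strip_bounded \<Phi>" and F0: "\<And>z. Re z = 0 \<Longrightarrow> cmod (\<Phi> z) \<le> K0"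
    and F1: "\<And>z. Re z = 1 \<Longrightarrow> cmod (\<Phi> z) \<le> K1"
    and K: "K0 > 0" "K1 > 0" and \<theta>: "0 \<le> \<theta>" "\<theta> \<le> 1"
  shows "cmod (\<Phi> (of_real \<theta>)) \<le> K0 powr (1-\<theta>) * K1 powr \<theta>"
proof -
  define \<Psi> where "\<Psi> z = \<Phi> z * exp (- ((1-z) * of_real (ln K0) + z * of_real (ln K1)))" for z
  obtain B where B: "\<And>z. 0 \<le> Re z \<Longrightarrow> Re z \<le> 1 \<Longrightarrow> cmod (\<Phi> z) \<le> B" and hol: "\<Phi> holomorphic_on UNIV"
    using F by (auto simp: strip_bounded_def)
  have "cmod (\<Phi> 0) \<le> B" using B[of 0] by simp
  then have B0: "B \<ge> 0" using norm_ge_zero[of "\<Phi> 0"] by linarith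
  have cP: "cmod (\<Psi> z) = cmod (\<Phi> z) * exp (- ((1 - Re z) * ln K0 + Re z * ln K1))" for z
    by (simp add: \<Psi>_def norm_mult norm_exp_eq_Re)
  define B' where "B' = B * exp (\<bar>ln K0\<bar> + \<bar>ln K1\<bar>) + 1"
  have B': "B' \<ge> 1" using B0 by (simp add: B'_def)
  have PB: "cmod (\<Psi> z) \<le> B'" if z: "0 \<le> Re z" "Re z \<le> 1" for z
  proof -
    have "- ((1 - Re z) * ln K0) \<le> \<bar>(1 - Re z) * ln K0\<bar>" by simp
    also have "\<dots> = (1 - Re z) * \<bar>ln K0\<bar>" using z by (simp add: abs_mult)
    also have "\<dots> \<le> \<bar>ln K0\<bar>" using z by (intro mult_left_le_one_le) auto
    finally have 1: "- ((1 - Re z) * ln K0) \<le> \<bar>ln K0\<bar>" .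
    have "- (Re z * ln K1) \<le> \<bar>Re z * ln K1\<bar>" by simp
    also have "\<dots> = Re z * \<bar>ln K1\<bar>" using z by (simp add: abs_mult)
    also have "\<dots> \<le> \<bar>ln K1\<bar>" using z by (intro mult_left_le_one_le) auto
    finally have "exp (- ((1 - Re z) * ln K0 + Re z * ln K1)) \<le> exp (\<bar>ln K0\<bar> + \<bar>ln K1\<bar>)" using 1 by simp
    then have "cmod (\<Psi> z) \<le> B * exp (\<bar>ln K0\<bar> + \<bar>ln K1\<bar>)" unfolding cP
      using B[OF z] B0 by (intro mult_mono) auto
    then show ?thesis by (simp add: B'_def)
  qed
  have claim: "cmod (\<Psi> (of_real \<theta>)) * exp (\<epsilon> * (\<theta>\<^sup>2 - 1)) \<le> 1" if \<epsilon>: "\<epsilon> > 0" for \<epsilon>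
  proof -
    \<comment> \<open>So large that on the horizontal sides the Gaussian factor beats the global
      bound: \<open>B' * exp (- \<epsilon> * R\<^sup>2) \<le> 1\<close>.\<close>
    define R where "R = sqrt (ln B' / \<epsilon>) + 1"
    have "ln B' / \<epsilon> \<ge> 0" using B' \<epsilon> by simp
    then have R: "R > 0" "ln B' / \<epsilon> \<le> R\<^sup>2" 
      by (auto simp: R_def power2_sum add_nonneg_pos intro: add_increasing2)
    then have RB: "ln B' \<le> \<epsilon> * R\<^sup>2" using \<epsilon> by (simp add: field_simps)
    define f where "f z = \<Psi> z * exp (of_real \<epsilon> * (z\<^sup>2 - 1))" for z
    have cf: "cmod (f z) = cmod (\<Psi> z) * exp (\<epsilon> * ((Re z)\<^sup>2 - (Im z)\<^sup>2 - 1))" for z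
      by (simp add: f_def norm_mult norm_exp_eq_Re power2_eq_square)
    have holf: "f holomorphic_on UNIV" unfolding f_def \<Psi>_def by (intro holomorphic_intros hol)
    have "cmod (f (of_real \<theta>)) \<le> 1"
    proof (rule maximum_modulus_frontier[where f=f and \<xi>="of_real \<theta>"
      and S="cbox (Complex 0 (-R)) (Complex 1 R)"])
      show "f holomorphic_on interior (cbox (Complex 0 (-R)) (Complex 1 R))"
        using holf holomorphic_on_subset by blast
      show "continuous_on (closure (cbox (Complex 0 (-R)) (Complex 1 R))) f"
        using holf holomorphic_on_imp_continuous_on continuous_on_subset by blast
      show "of_real \<theta> \<in> cbox (Complex 0 (-R)) (Complex 1 R)" using \<theta> R by (simp add: in_cbox_complex_iff)
      fix z assume "z \<in> frontier (cbox (Complex 0 (-R)) (Complex 1 R))"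
      then have z: "0 \<le> Re z" "Re z \<le> 1" "Re z = 0 \<or> Re z = 1 \<or> \<bar>Im z\<bar> = R"
        by (auto simp: frontier_cbox in_cbox_complex_iff in_box_complex_iff)
      have x2: "(Re z)\<^sup>2 \<le> 1" using z by (simp add: power_le_one)
      show "cmod (f z) \<le> 1"
      proof (cases "\<bar>Im z\<bar> = R")
        case True
        then have "(Im z)\<^sup>2 = R\<^sup>2" using power2_abs by metis
        then have "\<epsilon> * ((Re z)\<^sup>2 - (Im z)\<^sup>2 - 1) \<le> \<epsilon> * (- R\<^sup>2)" using x2 \<epsilon> by (intro mult_left_mono) auto
        then have "exp (\<epsilon> * ((Re z)\<^sup>2 - (Im z)\<^sup>2 - 1)) \<le> exp (- ln B')" using RB by simp
        then have "cmod (f z) \<le> B' * exp (- ln B')" unfolding cf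
          using PB[OF z(1,2)] B' by (intro mult_mono) auto
        then show ?thesis using B' by (simp add: exp_minus)
      next
        case False
        have e1: "exp (\<epsilon> * ((Re z)\<^sup>2 - (Im z)\<^sup>2 - 1)) \<le> 1"
        proof -
          have "(Re z)\<^sup>2 - (Im z)\<^sup>2 - 1 \<le> 0" using x2 zero_le_power2[of "Im z"] by linarith
          then show ?thesis using \<epsilon> by (simp add: mult_nonneg_nonpos)
        qed
        have "cmod (\<Psi> z) \<le> 1"
        proof (cases "Re z = 0")
          case True
          then show ?thesis unfolding cP using F0[OF True] K by (simp add: exp_minus field_simps)
        next
          case F: False
          then have "Re z = 1" using z False by auto
          then show ?thesis unfolding cP using F1[of z] K by (simp add: exp_minus field_simps)
        qed
        then show ?thesis unfolding cf using e1 by (intro mult_le_one) auto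
      qed
    qed auto
    then show ?thesis by (simp add: cf)
  qed
  have "cmod (\<Psi> (of_real \<theta>)) \<le> 1"
  proof (rule ccontr)
    define a where "a = cmod (\<Psi> (of_real \<theta>))"
    assume "\<not> cmod (\<Psi> (of_real \<theta>)) \<le> 1"
    then have a: "a > 1" by (simp add: a_def)
    then have la: "ln a > 0" by simp
    \<comment> \<open>This replaces the limit of small \<open>\<epsilon>\<close>: with
      \<open>\<epsilon> = ln a / 2\<close> the damping costs at most half of \<open>ln a\<close>, so
      the product still exceeds 1.\<close>
    have "a * exp (ln a / 2 * (\<theta>\<^sup>2 - 1)) \<le> 1" using claim[of "ln a / 2"] la by (simp add: a_def)
    then have "exp (ln a) * exp (ln a / 2 * (\<theta>\<^sup>2 - 1)) \<le> 1" using a by simp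
    then have "exp (ln a + ln a / 2 * (\<theta>\<^sup>2 - 1)) \<le> 1" by (simp add: exp_add)
    then have "ln a + ln a / 2 * (\<theta>\<^sup>2 - 1) \<le> 0" by simp
    moreover have "ln a + ln a / 2 * (\<theta>\<^sup>2 - 1) = ln a / 2 + ln a / 2 * \<theta>\<^sup>2" by (simp add: algebra_simps)
    moreover have "ln a / 2 * \<theta>\<^sup>2 \<ge> 0" using la by simp
    ultimately show False using la by linarith
  qed
  then have "cmod (\<Phi> (of_real \<theta>)) * exp (- ((1 - \<theta>) * ln K0 + \<theta> * ln K1)) \<le> 1" by (simp add: cP)
  moreover have "a \<le> exp s" if "a * exp (- s) \<le> 1" for a s :: real
    using that by (simp add: exp_minus field_simps)
  ultimately have "cmod (\<Phi> (of_real \<theta>)) \<le> exp ((1 - \<theta>) * ln K0 + \<theta> * ln K1)" by blast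
  also have "\<dots> = K0 powr (1-\<theta>) * K1 powr \<theta>" using K by (simp add: powr_def exp_add)
  finally show ?thesis .
qed

section \<open>Linear functionals on simple functions as finite sums\<close>

lemma test_linear_sum:
  fixes L :: "('x \<Rightarrow> complex) \<Rightarrow> complex"
  assumes add: "\<And>f f'. test M f \<Longrightarrow> test M f' \<Longrightarrow> L (\<lambda>x. f x + f' x) = L f + L f'"
    and sc: "\<And>c f. test M f \<Longrightarrow> L (\<lambda>x. c * f x) = c * L f"
    and C: "finite C" "\<And>c. c \<in> C \<Longrightarrow> test M (\<phi> c)"
  shows "L (\<lambda>x. \<Sum>c\<in>C. a c * \<phi> c x) = (\<Sum>c\<in>C. a c * L (\<phi> c))"
  using C
proof (induction C)
  case empty
  then show ?case using sc[OF test_zero, of 0] by simp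
next
  case (insert c C)
  have "L (\<lambda>x. a c * \<phi> c x + (\<Sum>c\<in>C. a c * \<phi> c x)) = L (\<lambda>x. a c * \<phi> c x) + L (\<lambda>x. \<Sum>c\<in>C. a c * \<phi> c x)"
    using insert by (intro add test_cmult test_sum) auto
  then show ?case using insert by (simp add: sc)
qed

text \<open>Separates the deformation from the functional: the coefficients of the scalars
  \<open>p c\<close> do not involve \<open>p\<close>. When \<open>p\<close> depends analytically on
  a parameter, the composite is thus a finite sum of the scalar functions treated above.\<close>

lemma test_expand:
  fixes L :: "('x \<Rightarrow> complex) \<Rightarrow> complex"
  assumes add: "\<And>f f'. test M f \<Longrightarrow> test M f' \<Longrightarrow> L (\<lambda>x. f x + f' x) = L f + L f'"
    and sc: "\<And>c f. test M f \<Longrightarrow> L (\<lambda>x. c * f x) = c * L f"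
    and cong: "\<And>f f'. test M f \<Longrightarrow> (\<And>x. x \<in> space M \<Longrightarrow> f x = f' x) \<Longrightarrow> L f = L f'"
    and f: "test M f" and p: "p 0 = 0"
  shows "L (\<lambda>x. p (f x)) = (\<Sum>c\<in>f ` space M - {0}. p c * L (\<lambda>x. if f x = c then 1 else 0))"
proof -
  have fin: "finite (f ` space M - {0})" 
    using f by (auto elim!: simple_bochner_integrable.cases dest: simple_functionD)
  have t: "test M (\<lambda>x. if f x = c then 1 else 0 :: complex)" if "c \<in> f ` space M - {0}" for c
    using that by (intro test_compose[OF f, of "\<lambda>z. if z = c then 1 else 0"]) auto
  have "L (\<lambda>x. p (f x)) = L (\<lambda>x. \<Sum>c\<in>f ` space M - {0}. p c * (if f x = c then 1 else 0))"
  proof (rule cong)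
    show "test M (\<lambda>x. p (f x))" using f p by (rule test_compose)
    fix x assume x: "x \<in> space M"
    show "p (f x) = (\<Sum>c\<in>f ` space M - {0}. p c * (if f x = c then 1 else 0))"
    proof (cases "f x = 0")
      case True
      then show ?thesis using p by (auto intro!: sum.neutral[symmetric])
    next
      case False
      have "(\<Sum>c\<in>f ` space M - {0}. p c * (if f x = c then 1 else 0))
        = (\<Sum>c\<in>{f x}. p c * (if f x = c then 1 else 0))"
        using x False fin by (intro sum.mono_neutral_right) auto
      then show ?thesis by simp
    qed
  qed
  also have "\<dots> = (\<Sum>c\<in>f ` space M - {0}. p c * L (\<lambda>x. if f x = c then 1 else 0))"
    by (rule test_linear_sum[OF add sc fin t])
  finally show ?thesis .
qed

lemma nrm_phase_powr:
  assumes "e > 0" "e' > 0" "Re w = e/e'"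
  shows "nrm M e' (\<lambda>x. phase_powr (f x) w) = nrm M e f powr (e/e')"
proof -
  have "(LINT x|M. cmod (phase_powr (f x) w) powr e') = (LINT x|M. cmod (f x) powr e)"
    using assms by (simp add: cmod_phase_powr powr_powr)
  then show ?thesis using assms by (simp add: nrm_def powr_powr)
qed


text \<open>The weights are the measures of the level sets of a simple function of time, so that \<open>mixed\<close> below is
  a mixed norm of \<open>t \<mapsto> \<gamma> (i t)\<close>.\<close>

locale bilinear_family =
  fixes M :: "'x measure" and S :: "'i set" and w :: "'i \<Rightarrow> real"
    and \<Lambda> :: "'i \<Rightarrow> ('x \<Rightarrow> complex) \<Rightarrow> ('x \<Rightarrow> complex) \<Rightarrow> complex"
  assumes finite_index: "finite S" and weight_nonneg: "\<And>i. i \<in> S \<Longrightarrow> 0 \<le> w i"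
    and congl: "\<And>i f f' g. i \<in> S \<Longrightarrow> test M f \<Longrightarrow> test M g \<Longrightarrow> (\<And>x. x \<in> space M \<Longrightarrow> f x = f' x) \<Longrightarrow> \<Lambda> i f g = \<Lambda> i f' g"
    and congr: "\<And>i f g g'. i \<in> S \<Longrightarrow> test M f \<Longrightarrow> test M g \<Longrightarrow> (\<And>x. x \<in> space M \<Longrightarrow> g x = g' x) \<Longrightarrow> \<Lambda> i f g = \<Lambda> i f g'"
    and addl: "\<And>i f f' g. i \<in> S \<Longrightarrow> test M f \<Longrightarrow> test M f' \<Longrightarrow> test M g \<Longrightarrow>
      \<Lambda> i (\<lambda>x. f x + f' x) g = \<Lambda> i f g + \<Lambda> i f' g"
    and addr: "\<And>i f g g'. i \<in> S \<Longrightarrow> test M f \<Longrightarrow> test M g \<Longrightarrow> test M g' \<Longrightarrow>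
      \<Lambda> i f (\<lambda>x. g x + g' x) = \<Lambda> i f g + \<Lambda> i f g'"
    and scl: "\<And>i c f g. i \<in> S \<Longrightarrow> test M f \<Longrightarrow> test M g \<Longrightarrow> \<Lambda> i (\<lambda>x. c * f x) g = c * \<Lambda> i f g"
    and scr: "\<And>i c f g. i \<in> S \<Longrightarrow> test M f \<Longrightarrow> test M g \<Longrightarrow> \<Lambda> i f (\<lambda>x. c * g x) = c * \<Lambda> i f g"
begin

definition mixed :: "real \<Rightarrow> real \<Rightarrow> ('i \<Rightarrow> 'x \<Rightarrow> complex) \<Rightarrow> real" where
  "mixed u v \<gamma> = (\<Sum>i\<in>S. w i * nrm M u (\<gamma> i) powr v) powr (1/v)"

definition bounded_form :: "real \<Rightarrow> real \<Rightarrow> real \<Rightarrow> real \<Rightarrow> bool" where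
  "bounded_form e u v K \<longleftrightarrow> (\<forall>f \<gamma>. test M f \<longrightarrow> (\<forall>i\<in>S. test M (\<gamma> i)) \<longrightarrow>
     cmod (\<Sum>i\<in>S. \<Lambda> i f (\<gamma> i)) \<le> K * nrm M e f * mixed u v \<gamma>)"

lemma form_zero_right: "i \<in> S \<Longrightarrow> test M f \<Longrightarrow> \<Lambda> i f (\<lambda>x. 0) = 0"
  using scr[of i f "\<lambda>x. 0" 0] test_zero[of M] by simp

text \<open>Testing with the family that is \<open>g\<close> at \<open>i\<close> and 0 elsewhere,
  whose mixed norm vanishes. It is needed because the deformation of \<open>\<gamma> i\<close> below
  is identically 0 when \<open>\<gamma> i\<close> is null, although \<open>\<gamma> i\<close> may be
  nonzero on a null set.\<close>

lemma form_null:
  assumes b: "bounded_form e u v K" and i: "i \<in> S" and f: "test M f" and g: "test M g" and n: "nrm M u g = 0"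
  shows "\<Lambda> i f g = 0"
proof -
  define \<gamma> where "\<gamma> j = (if j = i then g else (\<lambda>x. 0))" for j
  have n0: "nrm M u (\<gamma> j) = 0" for j using n by (auto simp: \<gamma>_def nrm_def)
  have "(\<Sum>j\<in>S. \<Lambda> j f (\<gamma> j)) = (\<Sum>j\<in>S. if j = i then \<Lambda> i f g else 0)"
    using f by (intro sum.cong) (auto simp: \<gamma>_def form_zero_right)
  also have "\<dots> = \<Lambda> i f g" using i finite_index by simp
  finally have "cmod (\<Lambda> i f g) \<le> K * nrm M e f * mixed u v \<gamma>"
    using b f g by (auto simp: bounded_form_def \<gamma>_def intro: test_zero dest!: spec[of _ f] spec[of _ \<gamma>])
  then show ?thesis using n0 by (simp add: mixed_def)
qed

text \<open>Thorin's argument: \<open>f\<close> and \<open>\<gamma>\<close> are deformed so that on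
  each boundary line the deformed functions have norm 1 for the exponents belonging to that line,
  while the parameter \<open>\<theta>\<close> gives the original pair back.\<close>

lemma riesz_thorin_normalised:
  assumes b0: "bounded_form e0 u0 v0 K0" and b1: "bounded_form e1 u1 v1 K1" and K: "0 < K0" "0 < K1"
    and pos: "0 < e0" "0 < u0" "0 < v0" "0 < e1" "0 < u1" "0 < v1" "0 < e" "0 < u" "0 < v"
    and \<theta>: "0 \<le> \<theta>" "\<theta> \<le> 1"
    and e: "1/e = (1-\<theta>)/e0 + \<theta>/e1" and u: "1/u = (1-\<theta>)/u0 + \<theta>/u1" and v: "1/v = (1-\<theta>)/v0 + \<theta>/v1"
    and f: "test M f" "nrm M e f = 1" and \<gamma>: "\<And>i. i \<in> S \<Longrightarrow> test M (\<gamma> i)"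
    and n1: "(\<Sum>i\<in>S. w i * nrm M u (\<gamma> i) powr v) = 1"
  shows "cmod (\<Sum>i\<in>S. \<Lambda> i f (\<gamma> i)) \<le> K0 powr (1-\<theta>) * K1 powr \<theta>"
proof -
  \<comment> \<open>The affine function whose real part is \<open>s/s0\<close> on the line
    \<open>Re z = 0\<close> and \<open>s/s1\<close> on \<open>Re z = 1\<close>; the interpolation
    relation for \<open>s\<close> says exactly that it is 1 at \<open>\<theta>\<close>.\<close>
  define ex :: "real \<Rightarrow> real \<Rightarrow> real \<Rightarrow> complex \<Rightarrow> complex" where
    "ex s s0 s1 z = of_real (s/s0) + of_real (s*(1/s1-1/s0)) * z" for s s0 s1 z
  have ex_\<theta>: "ex s s0 s1 (of_real \<theta>) = 1" if "1/s = (1-\<theta>)/s0 + \<theta>/s1" "s > 0" for s s0 s1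
  proof -
    have "s/s0 + s*(1/s1-1/s0) * \<theta> = s * ((1-\<theta>)/s0 + \<theta>/s1)" by (simp add: algebra_simps diff_divide_distrib)
    also have "\<dots> = 1" using that by (simp flip: that(1))
    finally have "complex_of_real (s/s0 + s*(1/s1-1/s0) * \<theta>) = 1" by simp
    then show ?thesis by (simp only: ex_def of_real_add of_real_mult)
  qed
  have ex_phase_powr: "strip_bounded (\<lambda>z. phase_powr c (ex s s0 s1 z))" for c s s0 s1
    unfolding ex_def by (rule strip_bounded_phase_powr)
  have ex_0: "Re (ex s s0 s1 z) = s/s0" if "Re z = 0" for s s0 s1 z using that by (simp add: ex_def)
  have ex_1: "Re (ex s s0 s1 z) = s/s1" if "Re z = 1" for s s0 s1 z
    using that by (simp add: ex_def algebra_simps)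
  define n where "n i = nrm M u (\<gamma> i)" for i
  define F where "F z x = phase_powr (f x) (ex e e0 e1 z)" for z x
  \<comment> \<open>A mixed norm needs two deformations: the size \<open>n i\<close> moves with the
    outer exponent \<open>v\<close>, the normalised profile \<open>d / n i\<close> with the inner
    exponent \<open>u\<close>. On a boundary line the spatial norm becomes
    \<open>n i powr (v/vs)\<close>, and the weighted sum of its powers \<open>vs\<close> is 1
    again.\<close>
  define P where "P i z d = phase_powr (of_real (n i)) (ex v v0 v1 z)
    * phase_powr (d / of_real (n i)) (ex u u0 u1 z)" for i z d
  define \<Phi> where "\<Phi> z = (\<Sum>i\<in>S. \<Lambda> i (F z) (\<lambda>x. P i z (\<gamma> i x)))" for z
  have tF: "test M (F z)" for z unfolding F_def by (rule test_compose[OF f(1)]) simp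
  have tG: "test M (\<lambda>x. P i z (\<gamma> i x))" if "i \<in> S" for i z 
    using \<gamma>[OF that] by (rule test_compose) (simp add: P_def)
  have bnd: "cmod (\<Phi> z) \<le> K" if b: "bounded_form es us vs K" and s: "0 < es" "0 < us" "0 < vs"
    and r: "Re (ex e e0 e1 z) = e/es" "Re (ex u u0 u1 z) = u/us" "Re (ex v v0 v1 z) = v/vs" for z es us vs K
  proof -
    have "nrm M es (F z) = 1" unfolding F_def by (simp add: nrm_phase_powr[OF pos(7) s(1) r(1)] f(2))
    moreover have *: "nrm M us (\<lambda>x. P i z (\<gamma> i x)) = n i powr (v/vs)" if "i \<in> S" for i
    proof (cases "n i = 0")
      case False
      then have ni: "n i > 0" by (simp add: n_def less_le)
      have "nrm M u (\<lambda>x. \<gamma> i x / of_real (n i)) = 1"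
        using nrm_cmult[of u M "1 / of_real (n i)" "\<gamma> i"] pos ni by (simp add: n_def norm_divide)
      then show ?thesis unfolding P_def using s ni pos
        by (simp add: nrm_cmult nrm_phase_powr[OF pos(8) s(2) r(2)] cmod_phase_powr r(3))
    qed (simp add: P_def nrm_def)
    have "mixed us vs (\<lambda>i x. P i z (\<gamma> i x)) = (\<Sum>i\<in>S. w i * n i powr v) powr (1/vs)"
    proof -
      have "(\<Sum>i\<in>S. w i * nrm M us (\<lambda>x. P i z (\<gamma> i x)) powr vs) = (\<Sum>i\<in>S. w i * n i powr v)"
        using s * by (intro sum.cong) (auto simp: powr_powr)
      then show ?thesis unfolding mixed_def by (rule arg_cong)
    qed
    then have "mixed us vs (\<lambda>i x. P i z (\<gamma> i x)) = 1" using n1 by (simp add: n_def)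
    moreover have "cmod (\<Phi> z) \<le> K * nrm M es (F z) * mixed us vs (\<lambda>i x. P i z (\<gamma> i x))"
      unfolding \<Phi>_def by (rule b[unfolded bounded_form_def, rule_format, OF tF]) (rule tG)
    ultimately show ?thesis by simp
  qed
  have "cmod (\<Phi> (of_real \<theta>)) \<le> K0 powr (1-\<theta>) * K1 powr \<theta>"
  proof (rule three_lines[OF _ _ _ K \<theta>])
    show "cmod (\<Phi> z) \<le> K0" if "Re z = 0" for z using bnd[OF b0] pos ex_0[OF that] by simp
    show "cmod (\<Phi> z) \<le> K1" if "Re z = 1" for z using bnd[OF b1] pos ex_1[OF that] by simp
    have "\<Lambda> i (F z) (\<lambda>x. P i z (\<gamma> i x)) = (\<Sum>c\<in>f ` space M - {0}. phase_powr c (ex e e0 e1 z) *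
        (\<Sum>d\<in>\<gamma> i ` space M - {0}. P i z d * \<Lambda> i (\<lambda>x. if f x = c then 1 else 0) (\<lambda>x.
          if \<gamma> i x = d then 1 else 0)))"
      if i: "i \<in> S" for i z
    proof -
      have t: "test M (\<lambda>x. if f x = c then 1 else 0 :: complex)" if "c \<in> f ` space M - {0}" for c
        using that by (intro test_compose[OF f(1), of "\<lambda>z. if z = c then 1 else 0"]) auto
      have "\<Lambda> i (F z) (\<lambda>x. P i z (\<gamma> i x)) = (\<Sum>c\<in>f ` space M - {0}. phase_powr c (ex e e0 e1 z) *
        \<Lambda> i (\<lambda>x. if f x = c then 1 else 0) (\<lambda>x. P i z (\<gamma> i x)))"
        unfolding F_def
        by (rule test_expand[of M "\<lambda>f. \<Lambda> i f (\<lambda>x. P i z (\<gamma> i x))" f "\<lambda>c. phase_powr c (ex e e0 e1 z)"])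
          (use i tG f in \<open>auto intro: addl scl congl\<close>)
      moreover have "\<Lambda> i (\<lambda>x. if f x = c then 1 else 0) (\<lambda>x. P i z (\<gamma> i x)) = 
        (\<Sum>d\<in>\<gamma> i ` space M - {0}. P i z d * \<Lambda> i (\<lambda>x. if f x = c then 1 else 0) (\<lambda>x.
          if \<gamma> i x = d then 1 else 0))"
        if c: "c \<in> f ` space M - {0}" for c
        by (rule test_expand[of M "\<Lambda> i (\<lambda>x. if f x = c then 1 else 0)" "\<gamma> i" "P i z"])
          (use i t[OF c] \<gamma> in \<open>auto intro: addr scr congr simp: P_def\<close>)
      ultimately show ?thesis by simp
    qed
    then have "\<Phi> = (\<lambda>z. \<Sum>i\<in>S. \<Sum>c\<in>f ` space M - {0}. phase_powr c (ex e e0 e1 z) *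
        (\<Sum>d\<in>\<gamma> i ` space M - {0}. P i z d * \<Lambda> i (\<lambda>x. if f x = c then 1 else 0) (\<lambda>x.
          if \<gamma> i x = d then 1 else 0)))"
      by (auto simp: \<Phi>_def fun_eq_iff)
    then show "strip_bounded \<Phi>"
      by (simp only: P_def) (intro strip_bounded_sum strip_bounded_mult ex_phase_powr strip_bounded_const)
  qed
  moreover have "\<Phi> (of_real \<theta>) = (\<Sum>i\<in>S. \<Lambda> i f (\<gamma> i))"
    unfolding \<Phi>_def
  proof (rule sum.cong[OF refl])
    fix i assume i: "i \<in> S"
    have F: "F (of_real \<theta>) = f"
    proof
      show "F (of_real \<theta>) x = f x" for x unfolding F_def ex_\<theta>[OF e pos(7)] by simp
    qed
    show "\<Lambda> i (F (of_real \<theta>)) (\<lambda>x. P i (of_real \<theta>) (\<gamma> i x)) = \<Lambda> i f (\<gamma> i)"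
    proof (cases "n i = 0")
      case True
      then have "nrm M u0 (\<gamma> i) = 0" using nrm_eq_0_iff[OF \<gamma>[OF i] pos(8) pos(2)] unfolding n_def by blast
      then have "\<Lambda> i f (\<gamma> i) = 0" using form_null[OF b0 i f(1) \<gamma>[OF i]] by simp
      then show ?thesis using True i f form_zero_right by (simp add: F P_def)
    next
      case False
      then have "(\<lambda>x. P i (of_real \<theta>) (\<gamma> i x)) = \<gamma> i"
        unfolding P_def ex_\<theta>[OF u pos(8)] ex_\<theta>[OF v pos(9)] by simp
      then show ?thesis by (simp add: F)
    qed
  qed
  ultimately show ?thesis by simp
qed

lemma riesz_thorin:
  assumes b0: "bounded_form e0 u0 v0 K0" and b1: "bounded_form e1 u1 v1 K1" and K: "0 < K0" "0 < K1"
    and pos: "0 < e0" "0 < u0" "0 < v0" "0 < e1" "0 < u1" "0 < v1" "0 < e" "0 < u" "0 < v"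
    and \<theta>: "0 \<le> \<theta>" "\<theta> \<le> 1"
    and e: "1/e = (1-\<theta>)/e0 + \<theta>/e1" and u: "1/u = (1-\<theta>)/u0 + \<theta>/u1" and v: "1/v = (1-\<theta>)/v0 + \<theta>/v1"
  shows "bounded_form e u v (K0 powr (1-\<theta>) * K1 powr \<theta>)"
  unfolding bounded_form_def
proof (intro allI impI)
  fix f :: "'x \<Rightarrow> complex" and \<gamma> :: "'i \<Rightarrow> 'x \<Rightarrow> complex"
  assume f: "test M f" and \<gamma>: "\<forall>i\<in>S. test M (\<gamma> i)"
  define a where "a = nrm M e f"
  define b where "b = mixed u v \<gamma>"
  have sb: "(\<Sum>i\<in>S. w i * nrm M u (\<gamma> i) powr v) = b powr v"
  proof -
    have "(\<Sum>i\<in>S. w i * nrm M u (\<gamma> i) powr v) \<ge> 0" by (intro sum_nonneg mult_nonneg_nonneg weight_nonneg) auto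
    then show ?thesis using pos by (simp add: b_def mixed_def powr_powr)
  qed
  have ab: "a \<ge> 0" "b \<ge> 0" by (auto simp: a_def b_def mixed_def)
  show "cmod (\<Sum>i\<in>S. \<Lambda> i f (\<gamma> i)) \<le> (K0 powr (1-\<theta>) * K1 powr \<theta>) * nrm M e f * mixed u v \<gamma>"
  proof (cases "a = 0 \<or> b = 0")
    case True
    \<comment> \<open>What is null for the intermediate exponents is null for those of
      \<open>b0\<close>, and \<open>b0\<close> alone then gives 0.\<close>
    have "nrm M e0 f * mixed u0 v0 \<gamma> = 0"
    proof (cases "a = 0")
      case True
      then have "nrm M e0 f = 0" using nrm_eq_0_iff[OF f pos(7) pos(1)] unfolding a_def by blast
      then show ?thesis by simp
    next
      case False
      then have "(\<Sum>i\<in>S. w i * nrm M u (\<gamma> i) powr v) = 0" using True sb pos by simp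
      then have "\<forall>i\<in>S. w i * nrm M u (\<gamma> i) powr v = 0"
        by (subst (asm) sum_nonneg_eq_0_iff[OF finite_index]) (auto intro!: mult_nonneg_nonneg weight_nonneg)
      moreover have "nrm M u (\<gamma> i) = 0 \<longleftrightarrow> nrm M u0 (\<gamma> i) = 0" if "i \<in> S" for i
        using nrm_eq_0_iff[of M "\<gamma> i" u u0] \<gamma> pos that by blast
      ultimately have "\<forall>i\<in>S. w i * nrm M u0 (\<gamma> i) powr v0 = 0" by simp
      then have "(\<Sum>i\<in>S. w i * nrm M u0 (\<gamma> i) powr v0) = 0" by (rule sum.neutral)
      then show ?thesis by (simp add: mixed_def)
    qed
    moreover have "cmod (\<Sum>i\<in>S. \<Lambda> i f (\<gamma> i)) \<le> K0 * nrm M e0 f * mixed u0 v0 \<gamma>"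
      using b0 f \<gamma> by (auto simp: bounded_form_def)
    ultimately have "cmod (\<Sum>i\<in>S. \<Lambda> i f (\<gamma> i)) \<le> 0" by (metis mult.assoc mult_zero_right)
    also have "0 \<le> (K0 powr (1-\<theta>) * K1 powr \<theta>) * nrm M e f * mixed u v \<gamma>" by (simp add: mixed_def)
    finally show ?thesis .
  next
    case False
    then have ab: "a > 0" "b > 0" using ab by auto
    define f' where "f' x = of_real (1/a) * f x" for x
    define \<gamma>' where "\<gamma>' i x = of_real (1/b) * \<gamma> i x" for i x
    have f': "test M f'" unfolding f'_def by (rule test_cmult[OF f])
    have \<gamma>': "test M (\<gamma>' i)" if "i \<in> S" for i unfolding \<gamma>'_def using \<gamma> that by (intro test_cmult) auto
    have nf': "nrm M e f' = 1" unfolding f'_def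
      using pos ab by (subst nrm_cmult) (auto simp: norm_divide simp flip: a_def)
    have n\<gamma>': "nrm M u (\<gamma>' i) = nrm M u (\<gamma> i) / b" for i unfolding \<gamma>'_def
      using pos ab by (subst nrm_cmult) (auto simp: norm_divide)
    have "(\<Sum>i\<in>S. w i * nrm M u (\<gamma>' i) powr v) = (\<Sum>i\<in>S. w i * nrm M u (\<gamma> i) powr v) / b powr v"
      by (simp add: n\<gamma>' powr_divide sum_divide_distrib)
    then have n1: "(\<Sum>i\<in>S. w i * nrm M u (\<gamma>' i) powr v) = 1" using sb ab by simp
    have "cmod (\<Sum>i\<in>S. \<Lambda> i f' (\<gamma>' i)) \<le> K0 powr (1-\<theta>) * K1 powr \<theta>"
      by (rule riesz_thorin_normalised[OF b0 b1 K pos \<theta> e u v f' nf' \<gamma>' n1])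
    moreover have "(\<Sum>i\<in>S. \<Lambda> i f' (\<gamma>' i)) = of_real (1/a) * of_real (1/b) * (\<Sum>i\<in>S. \<Lambda> i f (\<gamma> i))"
      unfolding sum_distrib_left
    proof (rule sum.cong[OF refl])
      fix i assume i: "i \<in> S"
      have "\<Lambda> i f' (\<gamma>' i) = of_real (1/a) * \<Lambda> i f (\<gamma>' i)" unfolding f'_def using i f \<gamma>' by (intro scl) auto
      also have "\<Lambda> i f (\<gamma>' i) = of_real (1/b) * \<Lambda> i f (\<gamma> i)" unfolding \<gamma>'_def using i f \<gamma> by (intro scr) auto
      finally show "\<Lambda> i f' (\<gamma>' i) = of_real (1/a) * of_real (1/b) * \<Lambda> i f (\<gamma> i)" by simp
    qed
    ultimately have "cmod (\<Sum>i\<in>S. \<Lambda> i f (\<gamma> i)) / (a*b) \<le> K0 powr (1-\<theta>) * K1 powr \<theta>"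
      using ab by (simp add: norm_mult norm_divide)
    then have "cmod (\<Sum>i\<in>S. \<Lambda> i f (\<gamma> i)) \<le> (K0 powr (1-\<theta>) * K1 powr \<theta>) * (a*b)"
      using ab by (simp add: divide_le_eq)
    then show ?thesis by (simp add: a_def b_def mult.assoc)
  qed
qed

end

section \<open>Complex Hilbert spaces\<close>

lemma cinner_add_right: "cinner (x::'h::chilbert_space) (y + z) = cinner x y + cinner x z"
  using cinner_add_left[of y z x] cinner_commute[of x "y+z"] cinner_commute[of x y] cinner_commute[of x z]
    by simp

lemma cinner_scaleC_right: "cinner (x::'h::chilbert_space) (a *\<^sub>C y) = cnj a * cinner x y"
  using cinner_scaleC_left[of a y x] cinner_commute[of x "a *\<^sub>C y"] cinner_commute[of x y] by simp

lemma cinner_scaleR_left: "cinner (a *\<^sub>R (x::'h::chilbert_space)) y = of_real a * cinner x y"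
  by (simp add: scaleR_scaleC cinner_scaleC_left)

lemma cinner_scaleR_right: "cinner (x::'h::chilbert_space) (a *\<^sub>R y) = of_real a * cinner x y"
  by (simp add: scaleR_scaleC cinner_scaleC_right)

lemma cinner_zero_left [simp]: "cinner (0::'h::chilbert_space) y = 0"
  using cinner_scaleR_left[of 0 0 y] by simp

lemma cinner_zero_right [simp]: "cinner (y::'h::chilbert_space) 0 = 0"
  using cinner_scaleR_right[of y 0 0] by simp

lemma cinner_minus_left: "cinner (- (x::'h::chilbert_space)) y = - cinner x y"
  using cinner_scaleR_left[of "-1" x y] by simp

lemma cinner_minus_right: "cinner (x::'h::chilbert_space) (- y) = - cinner x y"
  using cinner_scaleR_right[of x "-1" y] by simp

lemma cinner_diff_left: "cinner ((x::'h::chilbert_space) - y) z = cinner x z - cinner y z"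
  using cinner_add_left[of x "- y" z] by (simp add: cinner_minus_left)

lemma cinner_diff_right: "cinner (x::'h::chilbert_space) (y - z) = cinner x y - cinner x z"
  using cinner_add_right[of x y "- z"] by (simp add: cinner_minus_right)

lemma cinner_sum_left: "cinner (\<Sum>i\<in>S. f i :: 'h::chilbert_space) y = (\<Sum>i\<in>S. cinner (f i) y)"
  by (induction S rule: infinite_finite_induct) (auto simp: cinner_add_left)

lemma cinner_sum_right: "cinner (y :: 'h::chilbert_space) (\<Sum>i\<in>S. f i) = (\<Sum>i\<in>S. cinner y (f i))"
  by (induction S rule: infinite_finite_induct) (auto simp: cinner_add_right)

lemma Re_cinner_self: "Re (cinner (x::'h::chilbert_space) x) = (norm x)\<^sup>2"
proof -
  have "sqrt (Re (cinner x x)) \<ge> 0" using norm_ge_zero[of x] by (simp add: norm_eq_sqrt_cinner)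
  then have "Re (cinner x x) \<ge> 0" by simp
  then show ?thesis by (simp add: norm_eq_sqrt_cinner)
qed

lemma cinner_self: "cinner (x::'h::chilbert_space) x = of_real ((norm x)\<^sup>2)"
proof (rule complex_eqI)
  have "Im (cinner x x) = - Im (cinner x x)" using cinner_commute[of x x] by (metis cnj.simps(2))
  then show "Im (cinner x x) = Im (of_real ((norm x)\<^sup>2))" by simp
qed (simp add: Re_cinner_self)

lemma norm_cinner_commute: "cmod (cinner (x::'h::chilbert_space) y) = cmod (cinner y x)"
  by (subst cinner_commute) simp

lemma norm_diff_sq: "(norm ((x::'h::chilbert_space) - y))\<^sup>2 = (norm x)\<^sup>2 - 2 * Re (cinner x y) + (norm y)\<^sup>2"
proof -
  have "Re (cinner y x) = Re (cinner x y)" by (subst cinner_commute) simp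
  then show ?thesis by (simp flip: Re_cinner_self add: cinner_diff_left cinner_diff_right)
qed

lemma norm_add_sq: "(norm ((x::'h::chilbert_space) + y))\<^sup>2 = (norm x)\<^sup>2 + 2 * Re (cinner x y) + (norm y)\<^sup>2"
proof -
  have "Re (cinner y x) = Re (cinner x y)" by (subst cinner_commute) simp
  then show ?thesis by (simp flip: Re_cinner_self add: cinner_add_left cinner_add_right)
qed

lemma cinner_Cauchy_Schwarz: "cmod (cinner (x::'h::chilbert_space) y) \<le> norm x * norm y"
proof (cases "y = 0")
  case False
  define n where "n = (norm y)\<^sup>2"
  have n: "n > 0" using False by (simp add: n_def)
  define a where "a = cinner x y / of_real n"
  have cc: "z * cnj z = of_real ((cmod z)\<^sup>2)" for z by (rule complex_norm_square[symmetric])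
  have "0 \<le> (norm (x - a *\<^sub>C y))\<^sup>2" by simp
  also have "\<dots> = (norm x)\<^sup>2 - 2 * Re (cinner x (a *\<^sub>C y)) + (norm (a *\<^sub>C y))\<^sup>2" by (rule norm_diff_sq)
  also have "cinner x (a *\<^sub>C y) = of_real ((cmod (cinner x y))\<^sup>2 / n)"
  proof -
    have "cinner x (a *\<^sub>C y) = (cinner x y * cnj (cinner x y)) / of_real n"
      by (simp add: cinner_scaleC_right a_def)
    then show ?thesis unfolding cc by simp
  qed
  also have "(norm (a *\<^sub>C y))\<^sup>2 = (cmod (cinner x y))\<^sup>2 / n"
  proof -
    have "cinner (a *\<^sub>C y) (a *\<^sub>C y) = (a * cnj a) * cinner y y"
      by (simp add: cinner_scaleC_left cinner_scaleC_right)
    then have "cinner (a *\<^sub>C y) (a *\<^sub>C y) = (a * cnj a) * of_real n" by (simp only: cinner_self[of y] n_def)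
    then have "cinner (a *\<^sub>C y) (a *\<^sub>C y) = of_real ((cmod a)\<^sup>2 * n)" by (simp only: cc of_real_mult)
    then have "(norm (a *\<^sub>C y))\<^sup>2 = (cmod a)\<^sup>2 * n" using Re_cinner_self[of "a *\<^sub>C y"] by simp
    also have "cmod a = cmod (cinner x y) / n" using n by (simp add: a_def norm_divide)
    finally show ?thesis using n by (simp add: power_divide power2_eq_square)
  qed
  finally have "(cmod (cinner x y))\<^sup>2 / n \<le> (norm x)\<^sup>2" by simp
  then have "(cmod (cinner x y))\<^sup>2 \<le> (norm x * norm y)\<^sup>2"
    using n by (simp add: divide_le_eq power_mult_distrib n_def)
  then show ?thesis by (rule power2_le_imp_le) simp
qed simp

lemma cinner_ext: "(\<And>h. cinner (k::'h::chilbert_space) h = cinner k' h) \<Longrightarrow> k = k'"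
  using cinner_self[of "k - k'"] by (simp add: cinner_diff_left)

text \<open>If \<open>k\<close> represents \<open>l\<close>, then
  \<open>J x = (norm (x - k))\<^sup>2 - (norm k)\<^sup>2\<close>, so \<open>k\<close> is sought as
  the minimiser of \<open>J\<close>. The parallelogram identity makes minimising sequences Cauchy.
  The functional is conjugate linear because \<open>k\<close> stands in the linear argument.\<close>

lemma riesz_representation:
  fixes l :: "'h::chilbert_space \<Rightarrow> complex"
  assumes add: "\<And>x y. l (x + y) = l x + l y" and sc: "\<And>a x. l (a *\<^sub>C x) = cnj a * l x"
    and b: "\<And>x. cmod (l x) \<le> K * norm x" and K: "0 \<le> K"
  shows "\<exists>k. (\<forall>h. cinner k h = l h) \<and> norm k \<le> K"
proof -
  have scR: "l (a *\<^sub>R x) = of_real a * l x" for a x by (simp add: scaleR_scaleC sc)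
  have diff: "l (x - y) = l x - l y" for x y using add[of x "- 1 *\<^sub>R y"] scR[of "-1" y] by simp
  define J where "J x = (norm x)\<^sup>2 - 2 * Re (l x)" for x
  have Jlow: "J x \<ge> - K\<^sup>2" for x
  proof -
    have "Re (l x) \<le> K * norm x" using b[of x] complex_Re_le_cmod order_trans by blast
    moreover have "2 * (K * norm x) \<le> K\<^sup>2 + (norm x)\<^sup>2" using sum_squares_bound[of K "norm x"] by simp
    ultimately show ?thesis by (simp add: J_def)
  qed
  define m where "m = Inf (range J)"
  have bdd: "bdd_below (range J)" using Jlow by (intro bdd_belowI2[of _ "- K\<^sup>2"]) auto
  have mle: "m \<le> J x" for x unfolding m_def by (rule cInf_lower[OF _ bdd]) simp
  have "\<exists>x. J x < m + 1/real (Suc n)" for n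
    using cInf_lessD[of "range J" "m + 1/real (Suc n)"] by (auto simp: m_def)
  then obtain X where X: "\<And>n. J (X n) < m + 1/real (Suc n)" by metis
  have par: "(norm (x - y))\<^sup>2 \<le> 2 * (J x + J y) - 4 * m" for x y
  proof -
    have "m \<le> J ((1/2) *\<^sub>R (x + y))" by (rule mle)
    also have "\<dots> = (norm (x + y))\<^sup>2 / 4 - Re (l x) - Re (l y)"
      by (simp add: J_def scR add power_divide add_divide_distrib)
    finally show ?thesis by (simp add: J_def norm_diff_sq norm_add_sq field_simps)
  qed
  have "Cauchy X"
  proof (rule metric_CauchyI)
    fix e :: real assume e: "e > 0"
    obtain N where N: "1/real (Suc N) < e\<^sup>2/4" using nat_approx_posE[of "e\<^sup>2/4"] e by auto
    have "dist (X i) (X j) < e" if "i \<ge> N" "j \<ge> N" for i j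
    proof -
      have s: "1/real (Suc i) \<le> 1/real (Suc N)" "1/real (Suc j) \<le> 1/real (Suc N)"
        using that by (auto simp: frac_le)
      have "(norm (X i - X j))\<^sup>2 \<le> 2 * (J (X i) + J (X j)) - 4 * m" by (rule par)
      also have "\<dots> < 2 * (1/real (Suc i) + 1/real (Suc j))" using X[of i] X[of j] by simp
      also have "\<dots> < e\<^sup>2" using s N by simp
      finally show ?thesis using e by (simp add: dist_norm power_less_imp_less_base)
    qed
    then show "\<exists>M. \<forall>m\<ge>M. \<forall>n\<ge>M. dist (X m) (X n) < e" by blast
  qed
  then obtain k where k: "X \<longlonglongrightarrow> k" using Cauchy_convergent convergent_def by blast
  have lk: "(\<lambda>n. l (X n)) \<longlonglongrightarrow> l k"
  proof -
    have "(\<lambda>n. l (X n) - l k) \<longlonglongrightarrow> 0"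
    proof (rule Lim_null_comparison)
      show "\<forall>\<^sub>F n in sequentially. norm (l (X n) - l k) \<le> K * norm (X n - k)"
        using b by (simp flip: diff)
      have "(\<lambda>n. K * norm (X n - k)) \<longlonglongrightarrow> K * norm (k - k)" by (intro tendsto_intros k)
      then show "(\<lambda>n. K * norm (X n - k)) \<longlonglongrightarrow> 0" by simp
    qed
    then show ?thesis by (simp add: LIM_zero_iff)
  qed
  have "J k \<le> m"
  proof (rule LIMSEQ_le)
    show "(\<lambda>n. J (X n)) \<longlonglongrightarrow> J k" unfolding J_def by (intro tendsto_intros k lk)
    have "(\<lambda>n. m + 1/real (Suc n)) \<longlonglongrightarrow> m + 0" by (intro tendsto_intros LIMSEQ_Suc[OF lim_1_over_n])
    then show "(\<lambda>n. m + 1/real (Suc n)) \<longlonglongrightarrow> m" by simp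
    show "\<exists>N. \<forall>n\<ge>N. J (X n) \<le> m + 1/real (Suc n)" using X less_imp_le by blast
  qed
  have re: "Re (cinner k h) = Re (l h)" for h
  proof -
    define c where "c = Re (cinner k h) - Re (l h)"
    have q: "0 \<le> t\<^sup>2 * (norm h)\<^sup>2 + 2 * t * c" for t
    proof -
      have "J k \<le> J (k + t *\<^sub>R h)" using \<open>J k \<le> m\<close> mle[of "k + t *\<^sub>R h"] by linarith
      then show ?thesis by (simp add: J_def norm_add_sq add scR cinner_scaleR_right c_def power_mult_distrib
        algebra_simps)
    qed
    have "c = 0"
    proof (rule ccontr)
      assume "c \<noteq> 0"
      \<comment> \<open>Close to the minimum of the quadratic in \<open>q\<close>; the added 1 also
        covers \<open>h = 0\<close>.\<close>
      define t where "t = - c / ((norm h)\<^sup>2 + 1)"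
      have d: "(norm h)\<^sup>2 + 1 > 0" by (simp add: add_nonneg_pos)
      have "t\<^sup>2 * (norm h)\<^sup>2 + 2 * t * c \<le> t\<^sup>2 * ((norm h)\<^sup>2 + 1) + 2 * t * c" by (simp add: algebra_simps)
      also have "\<dots> = t * (t * ((norm h)\<^sup>2 + 1)) + 2 * t * c" by (simp add: power2_eq_square)
      also have "t * ((norm h)\<^sup>2 + 1) = - c" using d by (simp add: t_def)
      also have "t * - c + 2 * t * c = - (c\<^sup>2 / ((norm h)\<^sup>2 + 1))" by (simp add: t_def power2_eq_square)
      also have "\<dots> < 0" using \<open>c \<noteq> 0\<close> d by simp
      finally show False using q[of t] by simp
    qed
    then show ?thesis by (simp add: c_def)
  qed
  have eq: "cinner k h = l h" for h
  proof (rule complex_eqI)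
    \<comment> \<open>Both sides are conjugate linear in \<open>h\<close>, so their real parts at
      \<open>\<i> *\<^sub>C h\<close> are their imaginary parts at \<open>h\<close>.\<close>
    show "Im (cinner k h) = Im (l h)" using re[of "\<i> *\<^sub>C h"] by (simp add: cinner_scaleC_right sc)
  qed (rule re)
  have "norm k \<le> K"
  proof (cases "k = 0")
    case True
    then show ?thesis using K by simp
  next
    case False
    have "(norm k)\<^sup>2 = cmod (l k)" using eq[of k] cinner_self[of k] by (metis abs_power2 norm_of_real)
    also have "\<dots> \<le> K * norm k" by (rule b)
    finally show ?thesis using False by (simp add: power2_eq_square)
  qed
  then show ?thesis using eq by blast
qed


section \<open>The space of square integrable functions\<close>

lemma Lp_norm_le_iff:
  "1 \<le> p \<Longrightarrow> 0 \<le> K \<Longrightarrow> Lp_norm M p f \<le> ennreal K \<longleftrightarrow> Lp_bound M (real_of_ereal (1/p)) (\<lambda>x. cmod (f x)) K"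
  unfolding Lp_norm_def by (rule L_norm_le_iff) auto

lemma ereal_two_ge_one: "(1::ereal) \<le> 2" by simp

lemma Lp_space_2_iff: "f \<in> Lp_space M 2 \<longleftrightarrow> f \<in> borel_measurable M \<and> integrable M (\<lambda>x. (cmod (f x))\<^sup>2)"
proof (cases "f \<in> borel_measurable M")
  case [measurable]: True
  have "Lp_norm M 2 f < \<infinity> \<longleftrightarrow> (\<exists>K\<ge>0. Lp_norm M 2 f \<le> ennreal K)"
    by (metis ennreal_enn2real enn2real_nonneg ennreal_less_top infinity_ennreal_def le_less_trans order_refl)
  also have "\<dots> \<longleftrightarrow> (\<exists>K\<ge>0. Lp_bound M (1/2) (\<lambda>x. cmod (f x)) K)"
    using Lp_norm_le_iff[of 2 _ M f] by (auto simp: one_ereal_def)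
  also have "\<dots> \<longleftrightarrow> (\<integral>\<^sup>+x. ennreal ((cmod (f x))\<^sup>2) \<partial>M) < \<infinity>"
  proof
    assume "\<exists>K\<ge>0. Lp_bound M (1/2) (\<lambda>x. cmod (f x)) K"
    then show "(\<integral>\<^sup>+x. ennreal ((cmod (f x))\<^sup>2) \<partial>M) < \<infinity>" by (auto simp: Lp_bound_def intro: le_less_trans)
  next
    assume a: "(\<integral>\<^sup>+x. ennreal ((cmod (f x))\<^sup>2) \<partial>M) < \<infinity>"
    have "Lp_bound M (1/2) (\<lambda>x. cmod (f x)) (sqrt (enn2real (\<integral>\<^sup>+x. ennreal ((cmod (f x))\<^sup>2) \<partial>M)))"
      using a by (simp add: Lp_bound_def ennreal_enn2real)
    then show "\<exists>K\<ge>0. Lp_bound M (1/2) (\<lambda>x. cmod (f x)) K" using Lp_bound_nonneg by blast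
  qed
  also have "\<dots> \<longleftrightarrow> integrable M (\<lambda>x. (cmod (f x))\<^sup>2)" by (simp add: integrable_iff_bounded)
  finally show ?thesis by (simp add: Lp_space_def)
qed (simp add: Lp_space_def)

definition L2 :: "'x measure \<Rightarrow> ('x \<Rightarrow> complex) set" where "L2 M = Lp_space M 2"

lemma L2_iff: "f \<in> L2 M \<longleftrightarrow> f \<in> borel_measurable M \<and> integrable M (\<lambda>x. (cmod (f x))\<^sup>2)"
  unfolding L2_def by (rule Lp_space_2_iff)

lemma L2_measurable: "f \<in> L2 M \<Longrightarrow> f \<in> borel_measurable M" by (simp add: L2_iff)

lemma nrm_2_sq: "(nrm M 2 f)\<^sup>2 = (LINT x|M. (cmod (f x))\<^sup>2)"
  using nrm_powr[of 2 M f] by simp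

lemma L2_Lp_bound: "f \<in> L2 M \<Longrightarrow> Lp_bound M (1/2) (\<lambda>x. cmod (f x)) (nrm M 2 f)"
  by (auto simp: L2_iff Lp_bound_def nrm_2_sq nn_integral_eq_integral)

lemma Lp_bound_nrm_2: "f \<in> L2 M \<Longrightarrow> Lp_bound M (1/2) (\<lambda>x. cmod (f x)) K \<Longrightarrow> nrm M 2 f \<le> K"
proof -
  assume f: "f \<in> L2 M" and b: "Lp_bound M (1/2) (\<lambda>x. cmod (f x)) K"
  have "ennreal (LINT x|M. (cmod (f x))\<^sup>2) = (\<integral>\<^sup>+x. ennreal ((cmod (f x))\<^sup>2) \<partial>M)"
    using f by (intro nn_integral_eq_integral[symmetric]) (auto simp: L2_iff)
  also have "\<dots> \<le> ennreal (K\<^sup>2)" using b by (auto simp: Lp_bound_def)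
  finally have "(nrm M 2 f)\<^sup>2 \<le> K\<^sup>2" unfolding nrm_2_sq by simp
  then show ?thesis by (rule power2_le_imp_le) (use b in \<open>simp add: Lp_bound_def\<close>)
qed

lemma Lp_norm_2: "f \<in> L2 M \<Longrightarrow> Lp_norm M 2 f = ennreal (nrm M 2 f)"
proof (rule antisym)
  assume f: "f \<in> L2 M"
  show "Lp_norm M 2 f \<le> ennreal (nrm M 2 f)"
    using L2_Lp_bound[OF f] Lp_norm_le_iff[of 2 "nrm M 2 f" M f] by (simp add: one_ereal_def)
  have "Lp_norm M 2 f < \<infinity>" using f by (simp add: L2_def Lp_space_def del: numeral_eq_ereal)
  then obtain K where K: "K \<ge> 0" "Lp_norm M 2 f = ennreal K" by (cases "Lp_norm M 2 f") auto
  then have "Lp_bound M (1/2) (\<lambda>x. cmod (f x)) K"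
    using Lp_norm_le_iff[of 2 K M f] by (simp add: one_ereal_def)
  then show "ennreal (nrm M 2 f) \<le> Lp_norm M 2 f" using Lp_bound_nrm_2[OF f] K by simp
qed

lemma test_L2: "test M f \<Longrightarrow> f \<in> L2 M"
  using test_measurable[of M f] test_integrable_powr[of M f 2] by (simp add: L2_iff)

lemma L2_cmult: "f \<in> L2 M \<Longrightarrow> (\<lambda>x. c * f x) \<in> L2 M"
  by (auto simp: L2_iff norm_mult power_mult_distrib)

lemma cnj_measurable: "f \<in> borel_measurable M \<Longrightarrow> (\<lambda>x. cnj (f x)) \<in> borel_measurable M"
  by (erule measurable_compose) (intro borel_measurable_continuous_onI continuous_intros)

lemma L2_inner_integrable:
  assumes "f \<in> L2 M" "g \<in> L2 M" shows "integrable M (\<lambda>x. f x * cnj (g x))"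
proof (rule Bochner_Integration.integrable_bound)
  show "integrable M (\<lambda>x. (cmod (f x))\<^sup>2 + (cmod (g x))\<^sup>2)" using assms by (simp add: L2_iff)
  show "(\<lambda>x. f x * cnj (g x)) \<in> borel_measurable M"
    using assms by (intro borel_measurable_times cnj_measurable L2_measurable)
  show "AE x in M. norm (f x * cnj (g x)) \<le> norm ((cmod (f x))\<^sup>2 + (cmod (g x))\<^sup>2)"
    using mult_le_sum_squares by (intro AE_I2) (simp add: norm_mult)
qed

lemma L2_add: "f \<in> L2 M \<Longrightarrow> g \<in> L2 M \<Longrightarrow> (\<lambda>x. f x + g x) \<in> L2 M"
proof -
  assume a: "f \<in> L2 M" "g \<in> L2 M"
  have [measurable]: "f \<in> borel_measurable M" "g \<in> borel_measurable M" using a by (auto simp: L2_measurable)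
  have "integrable M (\<lambda>x. (cmod (f x + g x))\<^sup>2)"
  proof (rule Bochner_Integration.integrable_bound)
    show "integrable M (\<lambda>x. 2 * (cmod (f x))\<^sup>2 + 2 * (cmod (g x))\<^sup>2)" using a by (simp add: L2_iff)
    have "(cmod (f x + g x))\<^sup>2 \<le> 2 * (cmod (f x))\<^sup>2 + 2 * (cmod (g x))\<^sup>2" for x
    proof -
      have "(cmod (f x + g x))\<^sup>2 \<le> (cmod (f x) + cmod (g x))\<^sup>2" by (intro power_mono norm_triangle_ineq) auto
      also have "\<dots> = (cmod (f x))\<^sup>2 + (cmod (g x))\<^sup>2 + 2 * cmod (f x) * cmod (g x)" by (rule power2_sum)
      also have "\<dots> \<le> 2 * (cmod (f x))\<^sup>2 + 2 * (cmod (g x))\<^sup>2"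
        using sum_squares_bound[of "cmod (f x)" "cmod (g x)"] by simp
      finally show ?thesis .
    qed
    then show "AE x in M. norm ((cmod (f x + g x))\<^sup>2) \<le> norm (2 * (cmod (f x))\<^sup>2 + 2 * (cmod (g x))\<^sup>2)"
      by (intro AE_I2) simp
  qed simp
  then show ?thesis by (simp add: L2_iff)
qed

lemma L2_diff: "f \<in> L2 M \<Longrightarrow> g \<in> L2 M \<Longrightarrow> (\<lambda>x. f x - g x) \<in> L2 M"
  using L2_add[of f M "\<lambda>x. -1 * g x"] L2_cmult[of g M "-1"] by simp

lemma L2_sum: "(\<And>i. i \<in> S \<Longrightarrow> f i \<in> L2 M) \<Longrightarrow> (\<lambda>x. \<Sum>i\<in>S. f i x) \<in> L2 M"
  by (induction S rule: infinite_finite_induct) (auto intro: L2_add test_L2[OF test_zero])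

lemma L2_inner_cnj: "L2_inner M f g = cnj (L2_inner M g f)"
  using Bochner_Integration.integral_cnj[of M "\<lambda>x. g x * cnj (f x)"]
    by (simp add: L2_inner_def mult.commute del: Bochner_Integration.integral_cnj)

lemma L2_inner_add_left: "f \<in> L2 M \<Longrightarrow> f' \<in> L2 M \<Longrightarrow> g \<in> L2 M \<Longrightarrow>
  L2_inner M (\<lambda>x. f x + f' x) g = L2_inner M f g + L2_inner M f' g"
  using L2_inner_integrable[of f M g] L2_inner_integrable[of f' M g] by (simp add: L2_inner_def distrib_right)

lemma L2_inner_add_right: "f \<in> L2 M \<Longrightarrow> f' \<in> L2 M \<Longrightarrow> g \<in> L2 M \<Longrightarrow>
  L2_inner M g (\<lambda>x. f x + f' x) = L2_inner M g f + L2_inner M g f'"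
  using L2_inner_integrable[of g M f] L2_inner_integrable[of g M f'] by (simp add: L2_inner_def distrib_left)

lemma L2_inner_diff_left: "f \<in> L2 M \<Longrightarrow> f' \<in> L2 M \<Longrightarrow> g \<in> L2 M \<Longrightarrow>
  L2_inner M (\<lambda>x. f x - f' x) g = L2_inner M f g - L2_inner M f' g"
  using L2_inner_integrable[of f M g] L2_inner_integrable[of f' M g]
    by (simp add: L2_inner_def left_diff_distrib)

lemma L2_inner_diff_right: "f \<in> L2 M \<Longrightarrow> f' \<in> L2 M \<Longrightarrow> g \<in> L2 M \<Longrightarrow>
  L2_inner M g (\<lambda>x. f x - f' x) = L2_inner M g f - L2_inner M g f'"
  using L2_inner_integrable[of g M f] L2_inner_integrable[of g M f']
    by (simp add: L2_inner_def right_diff_distrib)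

lemma L2_inner_cmult_left: "L2_inner M (\<lambda>x. c * f x) g = c * L2_inner M f g"
  by (simp add: L2_inner_def mult.assoc)

lemma L2_inner_cmult_right: "L2_inner M f (\<lambda>x. c * g x) = cnj c * L2_inner M f g"
proof -
  have "L2_inner M f (\<lambda>x. c * g x) = (LINT x|M. cnj c * (f x * cnj (g x)))"
    unfolding L2_inner_def by (intro Bochner_Integration.integral_cong) auto
  then show ?thesis by (simp add: L2_inner_def)
qed

lemma L2_inner_zero_left [simp]: "L2_inner M (\<lambda>x. 0) g = 0"
  by (simp add: L2_inner_def)

lemma L2_inner_sum_left: "(\<And>i. i \<in> S \<Longrightarrow> f i \<in> L2 M) \<Longrightarrow> g \<in> L2 M \<Longrightarrow>
  L2_inner M (\<lambda>x. \<Sum>i\<in>S. f i x) g = (\<Sum>i\<in>S. L2_inner M (f i) g)"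
  by (induction S rule: infinite_finite_induct) (auto simp: L2_inner_add_left L2_sum)

lemma L2_inner_self: "L2_inner M f f = of_real ((nrm M 2 f)\<^sup>2)"
  unfolding L2_inner_def nrm_2_sq complex_norm_square[symmetric] by (rule integral_complex_of_real)

lemma L2_inner_cong_AE:
  "f \<in> L2 M \<Longrightarrow> f' \<in> L2 M \<Longrightarrow> g \<in> L2 M \<Longrightarrow> g' \<in> L2 M \<Longrightarrow> AE x in M. f x = f' x \<Longrightarrow> AE x in M. g x = g' x \<Longrightarrow>
    L2_inner M f g = L2_inner M f' g'"
  unfolding L2_inner_def
proof (rule integral_cong_AE)
  assume "f \<in> L2 M" "f' \<in> L2 M" "g \<in> L2 M" "g' \<in> L2 M"
  then show "(\<lambda>x. f x * cnj (g x)) \<in> borel_measurable M" "(\<lambda>x. f' x * cnj (g' x)) \<in> borel_measurable M"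
    by (intro borel_measurable_times cnj_measurable L2_measurable; simp)+
  assume "AE x in M. f x = f' x" "AE x in M. g x = g' x"
  then show "AE x in M. f x * cnj (g x) = f' x * cnj (g' x)" by eventually_elim simp
qed

lemma L2_inner_Holder:
  assumes f: "f \<in> L2 M" "Lp_bound M y (\<lambda>x. cmod (f x)) A"
    and g: "g \<in> L2 M" "Lp_bound M (1-y) (\<lambda>x. cmod (g x)) B"
    and y: "0 \<le> y" "y \<le> 1"
  shows "cmod (L2_inner M f g) \<le> A * B"
proof -
  have AB: "0 \<le> A * B" using Lp_bound_nonneg[OF f(2)] Lp_bound_nonneg[OF g(2)] by simp
  have "ennreal (cmod (L2_inner M f g)) \<le> (\<integral>\<^sup>+x. ennreal (cmod (f x * cnj (g x))) \<partial>M)"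
    unfolding L2_inner_def by (rule integral_norm_bound_ennreal[OF L2_inner_integrable[OF f(1) g(1)]])
  also have "\<dots> = (\<integral>\<^sup>+x. ennreal (\<bar>cmod (f x)\<bar> * \<bar>cmod (g x)\<bar>) \<partial>M)" by (simp add: norm_mult)
  also have "\<dots> \<le> ennreal (A * B)" by (rule Lp_bound_Holder[OF f(2) g(2) y])
  finally show ?thesis using AB by simp
qed

lemma L2_Cauchy_Schwarz: "f \<in> L2 M \<Longrightarrow> g \<in> L2 M \<Longrightarrow> cmod (L2_inner M f g) \<le> nrm M 2 f * nrm M 2 g"
  by (rule L2_inner_Holder[of f M "1/2"]) (auto intro: L2_Lp_bound)

lemma nrm_2_triangle:
  assumes "f \<in> L2 M" "g \<in> L2 M" shows "nrm M 2 (\<lambda>x. f x + g x) \<le> nrm M 2 f + nrm M 2 g"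
proof (rule power2_le_imp_le)
  have fg: "(\<lambda>x. f x + g x) \<in> L2 M" using assms by (rule L2_add)
  have "(nrm M 2 (\<lambda>x. f x + g x))\<^sup>2 = Re (L2_inner M (\<lambda>x. f x + g x) (\<lambda>x. f x + g x))"
    by (simp add: L2_inner_self)
  also have "\<dots> = (nrm M 2 f)\<^sup>2 + Re (L2_inner M f g) + (Re (L2_inner M g f) + (nrm M 2 g)\<^sup>2)"
    unfolding L2_inner_add_left[OF assms fg] L2_inner_add_right[OF assms assms(1)]
      L2_inner_add_right[OF assms assms(2)]
    by (simp add: L2_inner_self)
  also have "\<dots> \<le> (nrm M 2 f)\<^sup>2 + nrm M 2 f * nrm M 2 g + (nrm M 2 g * nrm M 2 f + (nrm M 2 g)\<^sup>2)"
    using L2_Cauchy_Schwarz[OF assms] L2_Cauchy_Schwarz[OF assms(2,1)] complex_Re_le_cmod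
    by (intro add_mono order_refl) (auto intro: order_trans)
  also have "\<dots> = (nrm M 2 f + nrm M 2 g)\<^sup>2" by (simp add: power2_eq_square algebra_simps)
  finally show "(nrm M 2 (\<lambda>x. f x + g x))\<^sup>2 \<le> (nrm M 2 f + nrm M 2 g)\<^sup>2" .
qed simp

section \<open>Measurability of almost everywhere limits\<close>

lemma complete_lebesgue_on: "I \<in> sets lebesgue \<Longrightarrow> complete_measure (lebesgue_on I)"
proof
  fix A B assume I: "I \<in> sets lebesgue" and "B \<subseteq> A" "A \<in> null_sets (lebesgue_on I)"
  then have "A \<subseteq> I" "A \<in> null_sets lebesgue" by (auto simp: null_sets_restrict_space)
  then have "B \<in> null_sets lebesgue" using \<open>B \<subseteq> A\<close> completion.complete2 by blast
  then have "B \<in> null_sets (lebesgue_on I)" using \<open>B \<subseteq> A\<close> \<open>A \<subseteq> I\<close> I by (auto simp: null_sets_restrict_space)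
  then show "B \<in> sets (lebesgue_on I)" by auto
qed

text \<open>Strong measurability provides limits almost everywhere only. On the complete measure
  \<open>lebesgue_on I\<close> this yields measurability of the limit itself and not merely of a
  modification.\<close>

lemma (in complete_measure) borel_measurable_AE:
  fixes f g :: "'a \<Rightarrow> 'b::topological_space"
  assumes f: "f \<in> borel_measurable M" and ae: "AE x in M. f x = g x"
  shows "g \<in> borel_measurable M"
proof (rule measurableI)
  fix A :: "'b set" assume "A \<in> sets borel"
  then have "f -` A \<inter> space M \<in> sets M" using f by (rule measurable_sets[rotated])
  moreover have "AE x in M. x \<in> f -` A \<inter> space M \<longleftrightarrow> x \<in> g -` A \<inter> space M" using ae by eventually_elim auto
  ultimately show "g -` A \<inter> space M \<in> sets M" using in_sets_AE by blast
qed auto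

lemma (in complete_measure) borel_measurable_AE_LIMSEQ:
  fixes g :: "'a \<Rightarrow> 'b::{banach, second_countable_topology}"
  assumes f: "\<And>n. f n \<in> borel_measurable M" and ae: "AE x in M. (\<lambda>n. f n x) \<longlonglongrightarrow> g x"
  shows "g \<in> borel_measurable M"
proof (rule borel_measurable_AE)
  show "(\<lambda>x. lim (\<lambda>n. f n x)) \<in> borel_measurable M" by (rule borel_measurable_lim_metric[OF f])
  show "AE x in M. lim (\<lambda>n. f n x) = g x" using ae by eventually_elim (rule limI)
qed

section \<open>Duality in mixed-norm spaces\<close>

text \<open>The case \<open>r = 2\<close> of \<open>strongly_measurable\<close> in terms of the
  real-valued \<open>nrm\<close>. Membership in \<open>L2\<close> stands next to the convergence
  because \<open>nrm M 2\<close> is 0, not infinite, for functions that are not square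
  integrable.\<close>

definition strong_meas :: "'x measure \<Rightarrow> real set \<Rightarrow> (real \<Rightarrow> 'x \<Rightarrow> complex) \<Rightarrow> bool" where
  "strong_meas M I \<Phi> \<longleftrightarrow> (\<exists>S :: nat \<Rightarrow> real \<Rightarrow> 'x \<Rightarrow> complex.
      (\<forall>n. simple_function (lebesgue_on I) (S n) \<and> (\<forall>t\<in>I. S n t \<in> L2 M)) \<and>
      (AE t in lebesgue_on I. \<Phi> t \<in> L2 M \<and> (\<lambda>n. nrm M 2 (\<lambda>x. \<Phi> t x - S n t x)) \<longlonglongrightarrow> 0))"

lemma strong_measE:
  assumes "strong_meas M I \<Phi>"
  obtains S where "\<And>n. simple_function (lebesgue_on I) (S n)" "\<And>n t. t \<in> I \<Longrightarrow> S n t \<in> L2 M"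
    "AE t in lebesgue_on I. t \<in> I \<and> \<Phi> t \<in> L2 M \<and> (\<lambda>n. nrm M 2 (\<lambda>x. \<Phi> t x - S n t x)) \<longlonglongrightarrow> 0"
proof -
  obtain S where S: "\<And>n. simple_function (lebesgue_on I) (S n)" "\<And>n t. t \<in> I \<Longrightarrow> S n t \<in> L2 M"
    "AE t in lebesgue_on I. \<Phi> t \<in> L2 M \<and> (\<lambda>n. nrm M 2 (\<lambda>x. \<Phi> t x - S n t x)) \<longlonglongrightarrow> 0"
    using assms unfolding strong_meas_def by blast
  have "AE t in lebesgue_on I. t \<in> I" by (rule AE_I2) (simp add: space_restrict_space)
  with S(3) have "AE t in lebesgue_on I. t \<in> I \<and> \<Phi> t \<in> L2 M \<and> (\<lambda>n. nrm M 2 (\<lambda>x. \<Phi> t x - S n t x)) \<longlonglongrightarrow> 0"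
    by eventually_elim simp
  then show ?thesis using that S by blast
qed

lemma strongly_measurable_strong_meas:
  assumes "strongly_measurable M I 2 \<Phi>" shows "strong_meas M I \<Phi>"
proof -
  obtain S where S: "\<And>n. simple_function (lebesgue_on I) (S n)" "\<And>n t. t \<in> I \<Longrightarrow> S n t \<in> L2 M"
      "AE t in lebesgue_on I. (\<lambda>n. Lp_norm M 2 (\<lambda>x. \<Phi> t x - S n t x)) \<longlonglongrightarrow> 0"
    using assms unfolding strongly_measurable_def L2_def by blast
  have "AE t in lebesgue_on I. \<Phi> t \<in> L2 M" using assms unfolding strongly_measurable_def L2_def by blast
  moreover have "AE t in lebesgue_on I. t \<in> I" by (rule AE_I2) (simp add: space_restrict_space)
  ultimately have "AE t in lebesgue_on I. \<Phi> t \<in> L2 M \<and> (\<lambda>n. nrm M 2 (\<lambda>x. \<Phi> t x - S n t x)) \<longlonglongrightarrow> 0"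
    using S(3)
  proof eventually_elim
    case (elim t)
    then have "Lp_norm M 2 (\<lambda>x. \<Phi> t x - S n t x) = ennreal (nrm M 2 (\<lambda>x. \<Phi> t x - S n t x))" for n
      by (intro Lp_norm_2 L2_diff S(2))
    with elim(3) have "(\<lambda>n. ennreal (nrm M 2 (\<lambda>x. \<Phi> t x - S n t x))) \<longlonglongrightarrow> 0" by (simp only:)
    then show ?case using elim by (simp add: ennreal_tendsto_0_iff)
  qed
  then show ?thesis using S unfolding strong_meas_def by blast
qed

lemma strong_meas_restrict:
  assumes "strong_meas M J \<Phi>" "I \<subseteq> J" "I \<in> sets lebesgue" "J \<in> sets lebesgue" shows "strong_meas M I \<Phi>"
proof -
  obtain S where S: "\<And>n. simple_function (lebesgue_on J) (S n)" "\<And>n t. t \<in> J \<Longrightarrow> S n t \<in> L2 M"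
    "AE t in lebesgue_on J. t \<in> J \<and> \<Phi> t \<in> L2 M \<and> (\<lambda>n. nrm M 2 (\<lambda>x. \<Phi> t x - S n t x)) \<longlonglongrightarrow> 0"
    by (rule strong_measE[OF assms(1)]) blast
  have "simple_function (lebesgue_on I) (S n)" for n
    unfolding simple_function_def
  proof
    have "finite (S n ` J)" using simple_functionD(1)[OF S(1)] by (simp add: space_restrict_space)
    then show "finite (S n ` space (lebesgue_on I))"
      using finite_subset[OF image_mono[OF assms(2)]] by (simp add: space_restrict_space)
    show "\<forall>x\<in>S n ` space (lebesgue_on I). S n -` {x} \<inter> space (lebesgue_on I) \<in> sets (lebesgue_on I)"
    proof
      fix x
      have "S n -` {x} \<inter> J \<in> sets (lebesgue_on J)"
        using simple_functionD(2)[OF S(1), of n "{x}"] by (simp add: space_restrict_space)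
      then have "S n -` {x} \<inter> J \<in> sets lebesgue" using assms(4) by (simp add: sets_restrict_space_iff)
      then have "(S n -` {x} \<inter> J) \<inter> I \<in> sets lebesgue" using assms(3) by (rule sets.Int)
      moreover have "S n -` {x} \<inter> J \<inter> I = S n -` {x} \<inter> I" using assms(2) by blast
      ultimately have "S n -` {x} \<inter> I \<in> sets lebesgue" by simp
      then show "S n -` {x} \<inter> space (lebesgue_on I) \<in> sets (lebesgue_on I)" 
        using assms(3) by (simp add: sets_restrict_space_iff space_restrict_space)
    qed
  qed
  moreover have "AE t in lebesgue_on I. \<Phi> t \<in> L2 M \<and> (\<lambda>n. nrm M 2 (\<lambda>x. \<Phi> t x - S n t x)) \<longlonglongrightarrow> 0"
  proof -
    have "AE t in lebesgue. t \<in> J \<longrightarrow> t \<in> J \<and> \<Phi> t \<in> L2 M \<and> (\<lambda>n. nrm M 2 (\<lambda>x. \<Phi> t x - S n t x)) \<longlonglongrightarrow> 0"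
      using S(3) assms(4) by (subst (asm) AE_restrict_space_iff) auto
    then have "AE t in lebesgue. t \<in> I \<longrightarrow> \<Phi> t \<in> L2 M \<and> (\<lambda>n. nrm M 2 (\<lambda>x. \<Phi> t x - S n t x)) \<longlonglongrightarrow> 0"
      by eventually_elim (use assms(2) in auto)
    then show ?thesis using assms(3) by (subst AE_restrict_space_iff) auto
  qed
  ultimately show ?thesis using S(2) assms(2) unfolding strong_meas_def by blast
qed

text \<open>The Strichartz and off-diagonal estimates are proved for these functions. A general
  \<open>F\<close> is not approximated by them in a mixed norm but reached by duality.\<close>

definition time_simple :: "'x measure \<Rightarrow> real set \<Rightarrow> (real \<Rightarrow> 'x \<Rightarrow> complex) \<Rightarrow> bool" where
  "time_simple M J G \<longleftrightarrow> simple_function (lebesgue_on J) G \<and> (\<forall>t\<in>J. test M (G t))"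

lemma time_simple_strong_meas: "time_simple M J G \<Longrightarrow> strong_meas M J G"
  unfolding strong_meas_def time_simple_def
  by (intro exI[of _ "\<lambda>n. G"]) (auto intro!: AE_I2 test_L2 simp: space_restrict_space nrm_def)

lemma time_simple_compose:
  assumes "time_simple M J G" "\<And>t. t \<in> J \<Longrightarrow> test M (h (G t))" shows "time_simple M J (\<lambda>t. h (G t))"
  using assms unfolding time_simple_def using simple_function_compose1[of "lebesgue_on J" G h] by blast

text \<open>The pairing of two simple functions is simple, and Cauchy--Schwarz carries the almost
  everywhere convergence of the approximants over to their pairings.\<close>

lemma strong_meas_inner:
  assumes I: "I \<in> sets lebesgue" and \<Phi>: "strong_meas M I \<Phi>" and \<Psi>: "strong_meas M I \<Psi>"
  shows "(\<lambda>t. L2_inner M (\<Phi> t) (\<Psi> t)) \<in> borel_measurable (lebesgue_on I)"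
proof -
  interpret complete_measure "lebesgue_on I" by (rule complete_lebesgue_on[OF I])
  obtain S where S: "\<And>n. simple_function (lebesgue_on I) (S n)" "\<And>n t. t \<in> I \<Longrightarrow> S n t \<in> L2 M"
    "AE t in lebesgue_on I. t \<in> I \<and> \<Phi> t \<in> L2 M \<and> (\<lambda>n. nrm M 2 (\<lambda>x. \<Phi> t x - S n t x)) \<longlonglongrightarrow> 0"
    by (rule strong_measE[OF \<Phi>]) blast
  obtain R where R: "\<And>n. simple_function (lebesgue_on I) (R n)" "\<And>n t. t \<in> I \<Longrightarrow> R n t \<in> L2 M"
    "AE t in lebesgue_on I. t \<in> I \<and> \<Psi> t \<in> L2 M \<and> (\<lambda>n. nrm M 2 (\<lambda>x. \<Psi> t x - R n t x)) \<longlonglongrightarrow> 0"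
    by (rule strong_measE[OF \<Psi>]) blast
  show ?thesis
  proof (rule borel_measurable_AE_LIMSEQ)
    show "(\<lambda>t. L2_inner M (S n t) (R n t)) \<in> borel_measurable (lebesgue_on I)" for n
      by (rule borel_measurable_simple_function, rule simple_function_compose2[where h="L2_inner M"])
        (rule S R)+
    show "AE t in lebesgue_on I. (\<lambda>n. L2_inner M (S n t) (R n t)) \<longlonglongrightarrow> L2_inner M (\<Phi> t) (\<Psi> t)"
      using S(3) R(3)
    proof eventually_elim
      case (elim t)
      have L: "\<Phi> t \<in> L2 M" "\<Psi> t \<in> L2 M" "\<And>n. S n t \<in> L2 M" "\<And>n. R n t \<in> L2 M" using elim S R by auto
      define a where "a n = nrm M 2 (\<lambda>x. \<Phi> t x - S n t x)" for n
      define b where "b n = nrm M 2 (\<lambda>x. \<Psi> t x - R n t x)" for n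
      have ab: "a \<longlonglongrightarrow> 0" "b \<longlonglongrightarrow> 0" using elim unfolding a_def b_def by blast+
      have bd: "cmod (L2_inner M (S n t) (R n t) - L2_inner M (\<Phi> t) (\<Psi> t)) \<le> a n * nrm M 2 (\<Psi> t)
        + (nrm M 2 (\<Phi> t) + a n) * b n" for n
      proof -
        have Sn: "nrm M 2 (S n t) \<le> nrm M 2 (\<Phi> t) + a n"
        proof -
          have "nrm M 2 (S n t) = nrm M 2 (\<lambda>x. \<Phi> t x + -1 * (\<Phi> t x - S n t x))" by simp
          also have "\<dots> \<le> nrm M 2 (\<Phi> t) + nrm M 2 (\<lambda>x. -1 * (\<Phi> t x - S n t x))"
            using L by (intro nrm_2_triangle L2_cmult L2_diff) auto
          also have "nrm M 2 (\<lambda>x. -1 * (\<Phi> t x - S n t x)) = a n" unfolding a_def by (subst nrm_cmult) auto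
          finally show ?thesis .
        qed
        have "L2_inner M (\<Phi> t) (\<Psi> t) - L2_inner M (S n t) (R n t) =
          L2_inner M (\<lambda>x. \<Phi> t x - S n t x) (\<Psi> t) + L2_inner M (S n t) (\<lambda>x. \<Psi> t x - R n t x)"
          using L by (simp add: L2_inner_diff_left L2_inner_diff_right)
        then have "cmod (L2_inner M (S n t) (R n t) - L2_inner M (\<Phi> t) (\<Psi> t)) =
          cmod (L2_inner M (\<lambda>x. \<Phi> t x - S n t x) (\<Psi> t) + L2_inner M (S n t) (\<lambda>x. \<Psi> t x - R n t x))"
          by (metis norm_minus_commute)
        also have "\<dots> \<le> cmod (L2_inner M (\<lambda>x. \<Phi> t x - S n t x) (\<Psi> t))
          + cmod (L2_inner M (S n t) (\<lambda>x. \<Psi> t x - R n t x))"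
          by (rule norm_triangle_ineq)
        also have "\<dots> \<le> a n * nrm M 2 (\<Psi> t) + nrm M 2 (S n t) * b n"
          unfolding a_def b_def using L by (intro add_mono L2_Cauchy_Schwarz L2_diff)
        also have "\<dots> \<le> a n * nrm M 2 (\<Psi> t) + (nrm M 2 (\<Phi> t) + a n) * b n"
          using Sn by (intro add_left_mono mult_right_mono) (auto simp: b_def)
        finally show ?thesis .
      qed
      have lim: "(\<lambda>n. a n * nrm M 2 (\<Psi> t) + (nrm M 2 (\<Phi> t) + a n) * b n) \<longlonglongrightarrow> 0 * nrm M 2 (\<Psi> t)
        + (nrm M 2 (\<Phi> t) + 0) * 0"
        by (intro tendsto_intros ab)
      have "(\<lambda>n. L2_inner M (S n t) (R n t) - L2_inner M (\<Phi> t) (\<Psi> t)) \<longlonglongrightarrow> 0"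
        by (rule Lim_null_comparison[OF always_eventually[OF allI[OF bd]]]) (use lim in simp)
      then show ?case by (simp add: LIM_zero_iff)
    qed
  qed
qed

lemma nrm_2_eq: "nrm M 2 f = sqrt (Re (L2_inner M f f))"
  by (simp add: L2_inner_self)

lemma strong_meas_nrm: "I \<in> sets lebesgue \<Longrightarrow> strong_meas M I \<Phi> \<Longrightarrow>
  (\<lambda>t. nrm M 2 (\<Phi> t)) \<in> borel_measurable (lebesgue_on I)"
  unfolding nrm_2_eq using strong_meas_inner[of I M \<Phi> \<Phi>] by measurable

text \<open>The constraint \<open>nrm M 2 \<phi> \<le> k\<close> makes the supremum finite and Lipschitz continuous on \<open>L\<^sup>2\<close>, hence
  measurable along \<open>strong_meas\<close> functions, even if \<open>v\<close> is not in \<open>L\<^sup>1\<^sup>/\<^sup>y\<close>. The norm is recovered as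
  \<open>k \<rightarrow> \<infinity>\<close>.\<close>

definition dual_norm :: "'x measure \<Rightarrow> real \<Rightarrow> real \<Rightarrow> ('x \<Rightarrow> complex) \<Rightarrow> real" where
  "dual_norm M y k v = (SUP \<phi>\<in>{\<phi>. test M \<phi> \<and> nrm M (1/(1-y)) \<phi> \<le> 1 \<and> nrm M 2 \<phi> \<le> k}. cmod (L2_inner M v \<phi>))"

context
  fixes M :: "'x measure" and y :: real
  assumes y: "0 \<le> y" "y < 1"
begin

abbreviation (input) "D k \<equiv> {\<phi>. test M \<phi> \<and> nrm M (1/(1-y)) \<phi> \<le> 1 \<and> nrm M 2 \<phi> \<le> k}"

lemma dual_norm_set_zero: "0 \<le> k \<Longrightarrow> (\<lambda>x. 0) \<in> D k"
  using test_zero by (auto simp: nrm_def)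

lemma dual_norm_bdd: "v \<in> L2 M \<Longrightarrow> \<phi> \<in> D k \<Longrightarrow> cmod (L2_inner M v \<phi>) \<le> k * nrm M 2 v"
proof -
  assume v: "v \<in> L2 M" and \<phi>: "\<phi> \<in> D k"
  have "cmod (L2_inner M v \<phi>) \<le> nrm M 2 v * nrm M 2 \<phi>" using \<phi> by (intro L2_Cauchy_Schwarz[OF v] test_L2) auto
  also have "\<dots> \<le> nrm M 2 v * k" using \<phi> by (intro mult_left_mono) auto
  finally show ?thesis by (simp add: mult.commute)
qed

lemma dual_norm_bdd_above: "v \<in> L2 M \<Longrightarrow> bdd_above ((\<lambda>\<phi>. cmod (L2_inner M v \<phi>)) ` D k)"
  using dual_norm_bdd by (intro bdd_aboveI2[of _ _ "k * nrm M 2 v"]) blast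

lemma dual_norm_upper: "v \<in> L2 M \<Longrightarrow> \<phi> \<in> D k \<Longrightarrow> cmod (L2_inner M v \<phi>) \<le> dual_norm M y k v"
  unfolding dual_norm_def by (rule cSUP_upper[OF _ dual_norm_bdd_above])

lemma dual_norm_least: "0 \<le> k \<Longrightarrow> (\<And>\<phi>. \<phi> \<in> D k \<Longrightarrow> cmod (L2_inner M v \<phi>) \<le> K) \<Longrightarrow> dual_norm M y k v \<le> K"
  unfolding dual_norm_def using dual_norm_set_zero by (intro cSUP_least) auto

lemma dual_norm_nonneg: "v \<in> L2 M \<Longrightarrow> 0 \<le> k \<Longrightarrow> 0 \<le> dual_norm M y k v"
  using dual_norm_upper[OF _ dual_norm_set_zero, of v k] norm_ge_zero order_trans by blast

lemma dual_norm_le_nrm: "v \<in> L2 M \<Longrightarrow> 0 \<le> k \<Longrightarrow> dual_norm M y k v \<le> k * nrm M 2 v"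
  by (rule dual_norm_least) (auto intro: dual_norm_bdd)

lemma dual_norm_mono: "v \<in> L2 M \<Longrightarrow> 0 \<le> k \<Longrightarrow> k \<le> k' \<Longrightarrow> dual_norm M y k v \<le> dual_norm M y k' v"
  by (rule dual_norm_least) (auto intro: dual_norm_upper)

lemma dual_norm_lipschitz:
  assumes "v \<in> L2 M" "w \<in> L2 M" "0 \<le> k"
  shows "dual_norm M y k v \<le> dual_norm M y k w + k * nrm M 2 (\<lambda>x. v x - w x)"
proof (rule dual_norm_least[OF assms(3)])
  fix \<phi> assume \<phi>: "\<phi> \<in> D k"
  have "\<phi> \<in> L2 M" using \<phi> by (auto intro: test_L2)
  then have "L2_inner M v \<phi> = L2_inner M w \<phi> + L2_inner M (\<lambda>x. v x - w x) \<phi>"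
    using L2_inner_diff_left[OF assms(1,2)] by simp
  then have "cmod (L2_inner M v \<phi>) \<le> cmod (L2_inner M w \<phi>) + cmod (L2_inner M (\<lambda>x. v x - w x) \<phi>)"
    by (simp add: norm_triangle_ineq)
  also have "\<dots> \<le> dual_norm M y k w + k * nrm M 2 (\<lambda>x. v x - w x)"
    using assms \<phi> by (intro add_mono dual_norm_upper dual_norm_bdd L2_diff)
  finally show "cmod (L2_inner M v \<phi>) \<le> dual_norm M y k w + k * nrm M 2 (\<lambda>x. v x - w x)" .
qed

lemma L2_converse:
  assumes v: "v \<in> L2 M" and K: "0 \<le> K"
    and b: "\<And>\<phi>. test M \<phi> \<Longrightarrow> cmod (L2_inner M v \<phi>) \<le> K * nrm M (1/(1-y)) \<phi>"
  shows "Lp_bound M y (\<lambda>x. cmod (v x)) K"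
proof (rule Lp_bound_converse[OF _ _ y K])
  fix \<phi> :: "'x \<Rightarrow> complex" assume \<phi>: "test M \<phi>"
  have "(LINT x|M. v x * \<phi> x) = L2_inner M v (\<lambda>x. cnj (\<phi> x))" by (simp add: L2_inner_def)
  then show "cmod (LINT x|M. v x * \<phi> x) \<le> K * nrm M (1/(1-y)) \<phi>" using b[OF test_cnj[OF \<phi>]] by simp
qed (use v in \<open>auto simp: L2_iff\<close>)

lemma dual_norm_le_iff:
  assumes v: "v \<in> L2 M" and K: "0 \<le> K"
  shows "(\<forall>k::nat. dual_norm M y (real k) v \<le> K) \<longleftrightarrow> Lp_bound M y (\<lambda>x. cmod (v x)) K"
proof
  define u where "u = 1/(1-y)"
  have u: "u > 0" "1/u = 1-y" using y by (auto simp: u_def)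
  assume a: "\<forall>k::nat. dual_norm M y (real k) v \<le> K"
  show "Lp_bound M y (\<lambda>x. cmod (v x)) K"
  proof (rule L2_converse[OF v K])
    fix \<phi> :: "'x \<Rightarrow> complex" assume \<phi>: "test M \<phi>"
    define c where "c = nrm M u \<phi>"
    show "cmod (L2_inner M v \<phi>) \<le> K * nrm M (1/(1-y)) \<phi>"
    \<comment> \<open>A null test function cannot be scaled, but its pairing with \<open>v\<close>
      is 0.\<close>
    proof (cases "c = 0")
      case True
      then have "AE x in M. \<phi> x = 0" using nrm_eq_0_AE[OF \<phi> u(1)] by (simp add: c_def)
      then have "L2_inner M v \<phi> = L2_inner M v (\<lambda>x. 0)"
        by (intro L2_inner_cong_AE v test_L2 \<phi> test_zero) auto
      then have "L2_inner M v \<phi> = 0" by (simp add: L2_inner_def)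
      then show ?thesis using K by simp
    next
      case False
      then have c: "c > 0" by (simp add: c_def less_le)
      define \<psi> where "\<psi> x = of_real (1/c) * \<phi> x" for x
      have t: "test M \<psi>" unfolding \<psi>_def by (rule test_cmult[OF \<phi>])
      have "nrm M u \<psi> = 1" unfolding \<psi>_def using u c by (subst nrm_cmult) (auto simp: norm_divide c_def)
      moreover obtain k :: nat where "nrm M 2 \<psi> \<le> real k" using real_arch_simple by blast
      ultimately have "\<psi> \<in> D (real k)" using t by (simp add: u_def)
      then have "cmod (L2_inner M v \<psi>) \<le> K" using dual_norm_upper[OF v] a order_trans by blast
      moreover have "L2_inner M v \<psi> = of_real (1/c) * L2_inner M v \<phi>" 
        unfolding \<psi>_def L2_inner_cmult_right by simp
      ultimately have "cmod (L2_inner M v \<phi>) / c \<le> K" using c by (simp add: norm_divide)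
      then show ?thesis using c by (simp add: divide_le_eq c_def u_def)
    qed
  qed
next
  define u where "u = 1/(1-y)"
  have u: "u > 0" "1/u = 1-y" using y by (auto simp: u_def)
  assume b: "Lp_bound M y (\<lambda>x. cmod (v x)) K"
  show "\<forall>k::nat. dual_norm M y (real k) v \<le> K"
  proof
    fix k :: nat show "dual_norm M y (real k) v \<le> K"
    proof (rule dual_norm_least)
      fix \<phi> assume \<phi>: "\<phi> \<in> D (real k)"
      have "Lp_bound M (1-y) (\<lambda>x. cmod (\<phi> x)) (nrm M u \<phi>)" using test_Lp_bound[of M \<phi> u] \<phi> u by simp
      then have "cmod (L2_inner M v \<phi>) \<le> K * nrm M u \<phi>"
        using \<phi> y by (intro L2_inner_Holder[OF v b]) (auto intro: test_L2)
      also have "\<dots> \<le> K * 1" using \<phi> K by (intro mult_left_mono) (auto simp: u_def)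
      finally show "cmod (L2_inner M v \<phi>) \<le> K" by simp
    qed simp
  qed
qed

lemma strong_meas_dual_norm:
  assumes I: "I \<in> sets lebesgue" and V: "strong_meas M I V" and k: "0 \<le> k"
  shows "(\<lambda>t. dual_norm M y k (V t)) \<in> borel_measurable (lebesgue_on I)"
proof -
  interpret complete_measure "lebesgue_on I" by (rule complete_lebesgue_on[OF I])
  obtain S where S: "\<And>n. simple_function (lebesgue_on I) (S n)" "\<And>n t. t \<in> I \<Longrightarrow> S n t \<in> L2 M"
    "AE t in lebesgue_on I. t \<in> I \<and> V t \<in> L2 M \<and> (\<lambda>n. nrm M 2 (\<lambda>x. V t x - S n t x)) \<longlonglongrightarrow> 0"
    by (rule strong_measE[OF V]) blast
  show ?thesis
  proof (rule borel_measurable_AE_LIMSEQ)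
    show "(\<lambda>t. dual_norm M y k (S n t)) \<in> borel_measurable (lebesgue_on I)" for n
      by (rule borel_measurable_simple_function, rule simple_function_compose1[where g="dual_norm M y k"])
        (rule S)
    show "AE t in lebesgue_on I. (\<lambda>n. dual_norm M y k (S n t)) \<longlonglongrightarrow> dual_norm M y k (V t)"
      using S(3)
    proof eventually_elim
      case (elim t)
      have L: "V t \<in> L2 M" "\<And>n. S n t \<in> L2 M" using elim S by auto
      have bd: "norm (dual_norm M y k (S n t) - dual_norm M y k (V t)) \<le> k
        * nrm M 2 (\<lambda>x. V t x - S n t x)" for n
      proof -
        have "nrm M 2 (\<lambda>x. S n t x - V t x) = nrm M 2 (\<lambda>x. -1 * (V t x - S n t x))" by simp
        also have "\<dots> = nrm M 2 (\<lambda>x. V t x - S n t x)" by (subst nrm_cmult) auto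
        finally show ?thesis using dual_norm_lipschitz[OF L(1) L(2)[of n] k]
          dual_norm_lipschitz[OF L(2)[of n] L(1) k]
          by (simp add: abs_le_iff)
      qed
      have lim: "(\<lambda>n. k * nrm M 2 (\<lambda>x. V t x - S n t x)) \<longlonglongrightarrow> k * 0" using elim by (intro tendsto_intros) auto
      have "(\<lambda>n. dual_norm M y k (S n t) - dual_norm M y k (V t)) \<longlonglongrightarrow> 0"
        by (rule Lim_null_comparison[OF always_eventually[OF allI[OF bd]]]) (use lim in simp)
      then show ?case by (simp add: LIM_zero_iff)
    qed
  qed
qed

end

lemma strong_meas_diff:
  assumes \<Phi>: "strong_meas M I \<Phi>" and \<Psi>: "strong_meas M I \<Psi>" shows "strong_meas M I (\<lambda>t x. \<Phi> t x - \<Psi> t x)"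
proof -
  obtain S where S: "\<And>n. simple_function (lebesgue_on I) (S n)" "\<And>n t. t \<in> I \<Longrightarrow> S n t \<in> L2 M"
    "AE t in lebesgue_on I. t \<in> I \<and> \<Phi> t \<in> L2 M \<and> (\<lambda>n. nrm M 2 (\<lambda>x. \<Phi> t x - S n t x)) \<longlonglongrightarrow> 0"
    by (rule strong_measE[OF \<Phi>]) blast
  obtain R where R: "\<And>n. simple_function (lebesgue_on I) (R n)" "\<And>n t. t \<in> I \<Longrightarrow> R n t \<in> L2 M"
    "AE t in lebesgue_on I. t \<in> I \<and> \<Psi> t \<in> L2 M \<and> (\<lambda>n. nrm M 2 (\<lambda>x. \<Psi> t x - R n t x)) \<longlonglongrightarrow> 0"
    by (rule strong_measE[OF \<Psi>]) blast
  have "simple_function (lebesgue_on I) (\<lambda>t x. S n t x - R n t x)" for n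
    by (rule simple_function_compose2[where h="\<lambda>f g x. f x - g x"]) (rule S R)+
  moreover have "AE t in lebesgue_on I. (\<lambda>x. \<Phi> t x - \<Psi> t x) \<in> L2 M \<and>
      (\<lambda>n. nrm M 2 (\<lambda>x. (\<Phi> t x - \<Psi> t x) - (S n t x - R n t x))) \<longlonglongrightarrow> 0"
    using S(3) R(3)
  proof eventually_elim
    case (elim t)
    have L: "\<Phi> t \<in> L2 M" "\<Psi> t \<in> L2 M" "\<And>n. S n t \<in> L2 M" "\<And>n. R n t \<in> L2 M" using elim S R by auto
    have "nrm M 2 (\<lambda>x. (\<Phi> t x - \<Psi> t x) - (S n t x - R n t x)) \<le> nrm M 2 (\<lambda>x. \<Phi> t x - S n t x)
      + nrm M 2 (\<lambda>x. \<Psi> t x - R n t x)" for n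
    proof -
      have "nrm M 2 (\<lambda>x. (\<Phi> t x - \<Psi> t x) - (S n t x - R n t x))
        = nrm M 2 (\<lambda>x. (\<Phi> t x - S n t x) + -1 * (\<Psi> t x - R n t x))"
        by (rule arg_cong[where f="nrm M 2"]) (simp add: algebra_simps)
      also have "\<dots> \<le> nrm M 2 (\<lambda>x. \<Phi> t x - S n t x) + nrm M 2 (\<lambda>x. -1 * (\<Psi> t x - R n t x))"
        using L by (intro nrm_2_triangle L2_cmult L2_diff)
      also have "nrm M 2 (\<lambda>x. -1 * (\<Psi> t x - R n t x)) = nrm M 2 (\<lambda>x. \<Psi> t x - R n t x)"
        by (subst nrm_cmult) auto
      finally show ?thesis .
    qed
    then have bd: "norm (nrm M 2 (\<lambda>x. (\<Phi> t x - \<Psi> t x) - (S n t x - R n t x))) \<le> nrm M 2 (\<lambda>x. \<Phi> t x - S n t x)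
      + nrm M 2 (\<lambda>x. \<Psi> t x - R n t x)" for n
      by simp
    have lim: "(\<lambda>n. nrm M 2 (\<lambda>x. \<Phi> t x - S n t x) + nrm M 2 (\<lambda>x. \<Psi> t x - R n t x)) \<longlonglongrightarrow> 0 + 0"
      using elim by (intro tendsto_add) blast+
    have "(\<lambda>n. nrm M 2 (\<lambda>x. (\<Phi> t x - \<Psi> t x) - (S n t x - R n t x))) \<longlonglongrightarrow> 0"
      by (rule Lim_null_comparison[OF always_eventually[OF allI[OF bd]]]) (use lim in simp)
    then show ?case using L L2_diff by blast
  qed
  ultimately show ?thesis unfolding strong_meas_def using S(2) R(2) L2_diff
    by (intro exI[of _ "\<lambda>n t x. S n t x - R n t x"]) blast
qed

lemma Lp_bound_abs: "f \<in> borel_measurable M \<Longrightarrow> Lp_bound M y (\<lambda>x. \<bar>f x\<bar>) K \<longleftrightarrow> Lp_bound M y f K"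
  unfolding Lp_bound_def abs_idempotent by simp

lemma simple_lebesgue_test:
  "I \<in> lmeasurable \<Longrightarrow> simple_function (lebesgue_on I) (g :: real \<Rightarrow> 'b::real_normed_vector) \<Longrightarrow>
    test (lebesgue_on I) g"
proof (rule simple_bochner_integrable.intros)
  assume I: "I \<in> lmeasurable" and g: "simple_function (lebesgue_on I) g"
  interpret finite_measure "lebesgue_on I" by (rule finite_measure_lebesgue_on[OF I])
  show "emeasure (lebesgue_on I) {y \<in> space (lebesgue_on I). g y \<noteq> 0} \<noteq> \<infinity>" by simp
qed

lemma simple_lebesgue_integrable:
  "I \<in> lmeasurable \<Longrightarrow> simple_function (lebesgue_on I) (g :: real \<Rightarrow> 'b::{banach, second_countable_topology}) \<Longrightarrow>
    integrable (lebesgue_on I) g"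
  by (intro integrableI_simple_bochner_integrable simple_lebesgue_test)

lemma time_simple_nrm_integrable:
  assumes "I \<in> lmeasurable" "time_simple M I G"
  shows "integrable (lebesgue_on I) (\<lambda>t. nrm M u (G t) powr v)"
  using assms simple_function_compose1[of "lebesgue_on I" G "\<lambda>g. nrm M u g powr v"]
  by (intro simple_lebesgue_integrable) (auto simp: time_simple_def)

text \<open>A near maximiser multiplied by the phase of its pairing, so that the real part carries
  the whole modulus. The lower bound can then be integrated in time without absolute values under
  the integral.\<close>

lemma dual_norm_attained:
  assumes y: "0 \<le> y" "y < 1" and d: "d \<in> L2 M" and k: "0 \<le> k" and \<epsilon>: "0 < \<epsilon>"
  shows "\<exists>\<phi>. test M \<phi> \<and> nrm M (1/(1-y)) \<phi> \<le> 1 \<and> nrm M 2 \<phi> \<le> k \<and> dual_norm M y k d - \<epsilon> \<le> Re (L2_inner M d \<phi>)"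
proof -
  let ?D = "{\<phi>. test M \<phi> \<and> nrm M (1/(1-y)) \<phi> \<le> 1 \<and> nrm M 2 \<phi> \<le> k}"
  have ne: "?D \<noteq> {}" using dual_norm_set_zero[OF y k] by blast
  have "dual_norm M y k d - \<epsilon> < (SUP \<phi>\<in>?D. cmod (L2_inner M d \<phi>))" using \<epsilon> by (simp add: dual_norm_def)
  then obtain \<phi> where \<phi>: "\<phi> \<in> ?D" "dual_norm M y k d - \<epsilon> < cmod (L2_inner M d \<phi>)"
    using less_cSUP_iff[OF ne dual_norm_bdd_above[OF y d]] by auto
  define z where "z = L2_inner M d \<phi>"
  define c where "c = (if z = 0 then 1 else z / of_real (cmod z))"
  have c1: "cmod c = 1" by (simp add: c_def norm_divide)
  have c2: "cnj c * z = of_real (cmod z)"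
  proof (cases "z = 0")
    case False
    then have "cnj c * z = (z * cnj z) / of_real (cmod z)" by (simp add: c_def)
    also have "\<dots> = of_real (cmod z)" using False unfolding complex_norm_square[symmetric]
      by (simp add: power2_eq_square)
    finally show ?thesis .
  qed simp
  note c = c1 c2
  have "test M (\<lambda>x. c * \<phi> x)" "nrm M (1/(1-y)) (\<lambda>x. c * \<phi> x) \<le> 1" "nrm M 2 (\<lambda>x. c * \<phi> x) \<le> k"
    using \<phi> c y by (auto simp: nrm_cmult intro: test_cmult)
  moreover have "Re (L2_inner M d (\<lambda>x. c * \<phi> x)) = cmod z"
    using c unfolding L2_inner_cmult_right z_def[symmetric] by simp
  ultimately show ?thesis using \<phi>(2) unfolding z_def by (intro exI[of _ "\<lambda>x. c * \<phi> x"]) auto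
qed

text \<open>The difficulty in this converse of the mixed Hoelder inequality is to choose nearly
  optimal test functions measurably in \<open>t\<close>. They are chosen for a simple approximation
  of \<open>V\<close>, where only finitely many choices occur, and the Lipschitz bound of the dual
  norm pays for the replacement.\<close>

lemma mixed_converse:
  fixes v K :: real
  assumes I: "I \<in> lmeasurable" and V: "strong_meas M I V" and y: "0 \<le> y" "y < 1" and v: "1 \<le> v" and K: "0 \<le> K"
    and k: "0 \<le> k"
    and bd: "AE t in lebesgue_on I. nrm M 2 (V t) \<le> B" and B: "0 \<le> B"
    and H: "\<And>G. time_simple M I G \<Longrightarrow> cmod (LINT t|lebesgue_on I. L2_inner M (V t) (G t))
        \<le> K * (LINT t|lebesgue_on I. nrm M (1/(1-y)) (G t) powr v) powr (1/v)"
  shows "Lp_bound (lebesgue_on I) (1 - 1/v) (\<lambda>t. dual_norm M y k (V t)) K"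
proof -
  let ?L = "lebesgue_on I"
  interpret finite_measure ?L by (rule finite_measure_lebesgue_on[OF I])
  have Is: "I \<in> sets lebesgue" using I by (rule fmeasurableD)
  define u where "u = 1/(1-y)"
  have u: "u > 0" using y by (simp add: u_def)
  define n where "n t = dual_norm M y k (V t)" for t
  have nm[measurable]: "n \<in> borel_measurable ?L" unfolding n_def by (rule strong_meas_dual_norm[OF y Is V k])
  obtain S where S: "\<And>m. simple_function ?L (S m)" "\<And>m t. t \<in> I \<Longrightarrow> S m t \<in> L2 M"
    "AE t in ?L. t \<in> I \<and> V t \<in> L2 M \<and> (\<lambda>m. nrm M 2 (\<lambda>x. V t x - S m t x)) \<longlonglongrightarrow> 0"
    by (rule strong_measE[OF V]) blast
  have nb: "AE t in ?L. 0 \<le> n t \<and> n t \<le> k * B" using S(3) bd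
  proof eventually_elim
    case (elim t)
    then have "n t \<le> k * nrm M 2 (V t)" unfolding n_def by (intro dual_norm_le_nrm[OF y] k) auto
    also have "\<dots> \<le> k * B" using elim k by (intro mult_left_mono) auto
    finally show ?case using elim dual_norm_nonneg[OF y _ k] by (auto simp: n_def)
  qed
  \<comment> \<open>The cut provides an integrable majorant of the errors. It is inactive as soon as
    \<open>S m t\<close> is within 1 of \<open>V t\<close>, hence for all large
    \<open>m\<close>.\<close>
  define S' where "S' m t = (if nrm M 2 (S m t) \<le> B + 1 then S m t else (\<lambda>x. 0))" for m t
  have S's: "simple_function ?L (S' m)" for m
    unfolding S'_def using simple_function_compose1[OF S(1), of "\<lambda>f.
      if nrm M 2 f \<le> B + 1 then f else (\<lambda>x. 0)" m] .
  have S'L: "S' m t \<in> L2 M" if "t \<in> I" for m t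
    using S(2)[OF that] by (auto simp: S'_def intro: test_L2 test_zero)
  have S'B: "nrm M 2 (S' m t) \<le> B + 1" for m t using B by (auto simp: S'_def nrm_def)
  have S'sm: "strong_meas M I (S' m)" for m
    unfolding strong_meas_def using S's S'L
      by (intro exI[of _ "\<lambda>_. S' m"]) (auto intro!: AE_I2 simp: space_restrict_space nrm_def)
  define e where "e m t = nrm M 2 (\<lambda>x. V t x - S' m t x)" for m t
  have em[measurable]: "e m \<in> borel_measurable ?L" for m
    unfolding e_def by (rule strong_meas_nrm[OF Is strong_meas_diff[OF V S'sm]])
  have e0: "0 \<le> e m t" for m t by (simp add: e_def)
  have eb: "AE t in ?L. (\<forall>m. e m t \<le> 2 * B + 1) \<and> (\<lambda>m. e m t) \<longlonglongrightarrow> 0"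
    using S(3) bd
  proof eventually_elim
    case (elim t)
    have L: "V t \<in> L2 M" "\<And>m. S m t \<in> L2 M" "\<And>m. S' m t \<in> L2 M" using elim S S'L by auto
    have tri: "nrm M 2 (\<lambda>x. f x - g x) \<le> nrm M 2 f + nrm M 2 g" if "f \<in> L2 M" "g \<in> L2 M" for f g
    proof -
      have "nrm M 2 (\<lambda>x. f x - g x) = nrm M 2 (\<lambda>x. f x + -1 * g x)" by simp
      also have "\<dots> \<le> nrm M 2 f + nrm M 2 (\<lambda>x. -1 * g x)" using that by (intro nrm_2_triangle L2_cmult)
      also have "nrm M 2 (\<lambda>x. -1 * g x) = nrm M 2 g" by (subst nrm_cmult) auto
      finally show ?thesis .
    qed
    have "e m t \<le> 2 * B + 1" for m
      using tri[OF L(1) L(3)[of m]] S'B[of m t] elim by (simp add: e_def)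
    moreover have "(\<lambda>m. e m t) \<longlonglongrightarrow> 0"
    proof (rule Lim_transform_eventually)
      show "(\<lambda>m. nrm M 2 (\<lambda>x. V t x - S m t x)) \<longlonglongrightarrow> 0" using elim by blast
      then have "\<forall>\<^sub>F m in sequentially. nrm M 2 (\<lambda>x. V t x - S m t x) < 1" by (rule order_tendstoD) simp
      then show "\<forall>\<^sub>F m in sequentially. nrm M 2 (\<lambda>x. V t x - S m t x) = e m t"
      proof eventually_elim
        case (elim m)
        have "nrm M 2 (S m t) = nrm M 2 (\<lambda>x. V t x - (V t x - S m t x))" by simp
        also have "\<dots> \<le> nrm M 2 (V t) + nrm M 2 (\<lambda>x. V t x - S m t x)" by (intro tri L2_diff L)
        also have "\<dots> \<le> B + 1" using \<open>nrm M 2 (V t) \<le> B\<close> elim by simp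
        finally show ?case by (simp add: e_def S'_def)
      qed
    qed
    ultimately show ?case by blast
  qed
  \<comment> \<open>The choice depends on \<open>m\<close> and on the value \<open>d\<close> alone,
    so composed with the simple function \<open>S' m\<close> it is again simple in time.\<close>
  have "\<forall>m d. \<exists>\<phi>. d \<in> L2 M \<longrightarrow> test M \<phi> \<and> nrm M u \<phi> \<le> 1 \<and> nrm M 2 \<phi> \<le> k \<and> dual_norm M y k d - 1/real (Suc m)
    \<le> Re (L2_inner M d \<phi>)"
  proof (intro allI)
    fix m :: nat and d
    have "0 < 1/real (Suc m)" by simp
    then show "\<exists>\<phi>. d \<in> L2 M \<longrightarrow> test M \<phi> \<and> nrm M u \<phi> \<le> 1 \<and> nrm M 2 \<phi> \<le> k \<and> dual_norm M y k d - 1/real (Suc m)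
      \<le> Re (L2_inner M d \<phi>)"
      using dual_norm_attained[OF y _ k, of d M "1/real (Suc m)"] unfolding u_def by blast
  qed
  then obtain ch where ch: "\<And>m d. d \<in> L2 M \<Longrightarrow> test M (ch m d)" "\<And>m d. d \<in> L2 M \<Longrightarrow> nrm M u (ch m d) \<le> 1"
    "\<And>m d. d \<in> L2 M \<Longrightarrow> nrm M 2 (ch m d) \<le> k" "\<And>m d. d \<in> L2 M \<Longrightarrow>
      dual_norm M y k d - 1/real (Suc m) \<le> Re (L2_inner M d (ch m d))"
    by metis
  \<comment> \<open>With the scalar weight \<open>cmod (a t)\<close> the hypothesis on vector-valued
    \<open>G\<close> becomes one on the scalar function \<open>n\<close>, to which
    \<open>Lp_bound_converse\<close> applies in the time variable.\<close>
  have key: "cmod (LINT t|?L. of_real (n t) * a t) \<le> K * nrm ?L v a"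
    if a: "test ?L a" for a :: "real \<Rightarrow> complex"
  proof -
    have as: "simple_function ?L a" using a by (rule simple_bochner_integrable.cases)
    have am[measurable]: "a \<in> borel_measurable ?L" using as by (rule borel_measurable_simple_function)
    have cam: "simple_function ?L (\<lambda>t. cmod (a t))" using as by (rule simple_function_compose1)
    have ai: "integrable ?L (\<lambda>t. cmod (a t))" by (rule simple_lebesgue_integrable[OF I cam])
    define G where "G m t x = of_real (cmod (a t)) * ch m (S' m t) x" for m t x
    have Gs: "time_simple M I (G m)" for m
      unfolding time_simple_def
    proof
      show "simple_function ?L (G m)"
        using simple_function_compose2[OF as S's[of m], of "\<lambda>z d x. of_real (cmod z) * ch m d x"]
          by (simp add: G_def[abs_def])
      show "\<forall>t\<in>I. test M (G m t)" unfolding G_def by (intro ballI test_cmult ch S'L)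
    qed
    \<comment> \<open>The total error: \<open>1/real (Suc m)\<close> for the near maximiser, and
      \<open>k * e m t\<close> twice, once for replacing \<open>V\<close> by \<open>S' m\<close> in
      the dual norm and once for returning to \<open>V\<close> in the pairing.\<close>
    define \<delta> where "\<delta> m = (LINT t|?L. cmod (a t) * (1/real (Suc m) + 2 * k * e m t))" for m
    have di: "integrable ?L (\<lambda>t. cmod (a t) * (1/real (Suc m) + 2 * k * e m t))" for m
    proof (rule Bochner_Integration.integrable_bound)
      show "integrable ?L (\<lambda>t. cmod (a t) * (1 + 2 * k * (2 * B + 1)))" using ai by simp
      show "AE t in ?L. norm (cmod (a t) * (1/real (Suc m) + 2 * k * e m t))
        \<le> norm (cmod (a t) * (1 + 2 * k * (2 * B + 1)))"
        using eb
      proof eventually_elim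
        case (elim t)
        have "1/real (Suc m) + 2 * k * e m t \<le> 1 + 2 * k * (2 * B + 1)"
          using elim k by (intro add_mono mult_left_mono) auto
        then show ?case using k B e0[of m t] unfolding norm_mult by (intro mult_left_mono) auto
      qed
    qed simp
    have "\<delta> \<longlonglongrightarrow> (LINT t|?L. cmod (a t) * (0 + 2 * k * 0))"
      unfolding \<delta>_def
    proof (rule integral_dominated_convergence)
      show "integrable ?L (\<lambda>t. cmod (a t) * (1 + 2 * k * (2 * B + 1)))" using ai by simp
      show "AE t in ?L. norm (cmod (a t) * (1/real (Suc m) + 2 * k * e m t)) \<le> cmod (a t)
        * (1 + 2 * k * (2 * B + 1))" for m
        using eb
      proof eventually_elim
        case (elim t)
        have "1/real (Suc m) + 2 * k * e m t \<le> 1 + 2 * k * (2 * B + 1)"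
          using elim k by (intro add_mono mult_left_mono) auto
        then show ?case using k B e0[of m t] by (simp add: abs_mult mult_left_mono)
      qed
      show "AE t in ?L. (\<lambda>m. cmod (a t) * (1/real (Suc m) + 2 * k * e m t)) \<longlonglongrightarrow> cmod (a t) * (0 + 2 * k * 0)"
        using eb by eventually_elim (intro tendsto_intros LIMSEQ_Suc[OF lim_1_over_n]; blast)
    qed simp_all
    then have \<delta>0: "\<delta> \<longlonglongrightarrow> 0" by simp
    have main: "(LINT t|?L. cmod (a t) * n t) \<le> K * nrm ?L v a + \<delta> m" for m
    proof -
      have VG: "(\<lambda>t. L2_inner M (V t) (G m t)) \<in> borel_measurable ?L"
        by (rule strong_meas_inner[OF Is V time_simple_strong_meas[OF Gs]])
      have Gb: "AE t in ?L. cmod (L2_inner M (V t) (G m t)) \<le> cmod (a t) * (k * B) \<and>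
          cmod (a t) * n t \<le> Re (L2_inner M (V t) (G m t)) + cmod (a t) * (1/real (Suc m) + 2 * k * e m t)"
        using S(3) bd
      proof eventually_elim
        case (elim t)
        have L: "V t \<in> L2 M" "S' m t \<in> L2 M" "t \<in> I" using elim S'L by auto
        let ?\<phi> = "ch m (S' m t)"
        have \<phi>: "?\<phi> \<in> L2 M" "nrm M 2 ?\<phi> \<le> k" using ch[OF L(2)] test_L2 by blast+
        have G: "L2_inner M (V t) (G m t) = of_real (cmod (a t)) * L2_inner M (V t) ?\<phi>"
          unfolding G_def L2_inner_cmult_right by simp
        have "cmod (L2_inner M (V t) ?\<phi>) \<le> nrm M 2 (V t) * nrm M 2 ?\<phi>"
          by (rule L2_Cauchy_Schwarz[OF L(1) \<phi>(1)])
        also have "\<dots> \<le> B * k" using elim \<phi> B by (intro mult_mono) auto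
        finally have "cmod (a t) * cmod (L2_inner M (V t) ?\<phi>) \<le> cmod (a t) * (B * k)"
          by (rule mult_left_mono) simp
        then have 1: "cmod (L2_inner M (V t) (G m t)) \<le> cmod (a t) * (k * B)"
          unfolding G norm_mult by (simp add: mult.commute[of B k])
        have "n t \<le> dual_norm M y k (S' m t) + k * e m t"
          unfolding n_def e_def by (rule dual_norm_lipschitz[OF y L(1,2) k])
        also have "dual_norm M y k (S' m t) \<le> Re (L2_inner M (S' m t) ?\<phi>) + 1/real (Suc m)"
          using ch(4)[OF L(2), of m] by simp
        also have "L2_inner M (S' m t) ?\<phi> = L2_inner M (V t) ?\<phi> - L2_inner M (\<lambda>x. V t x - S' m t x) ?\<phi>"
          using L2_inner_diff_left[OF L(1,2) \<phi>(1)] by simp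
        also have "Re (L2_inner M (V t) ?\<phi> - L2_inner M (\<lambda>x. V t x - S' m t x) ?\<phi>) \<le> Re (L2_inner M (V t) ?\<phi>)
          + k * e m t"
        proof -
          have "- Re (L2_inner M (\<lambda>x. V t x - S' m t x) ?\<phi>) \<le> cmod (L2_inner M (\<lambda>x. V t x - S' m t x) ?\<phi>)"
            using abs_Re_le_cmod[of "L2_inner M (\<lambda>x. V t x - S' m t x) ?\<phi>"] by linarith
          also have "\<dots> \<le> e m t * nrm M 2 ?\<phi>" unfolding e_def by (intro L2_Cauchy_Schwarz L2_diff L \<phi>)
          also have "\<dots> \<le> e m t * k" using \<phi> e0 by (intro mult_left_mono) auto
          finally show ?thesis by (simp add: mult.commute)
        qed
        finally have "n t \<le> Re (L2_inner M (V t) ?\<phi>) + (1/real (Suc m) + 2 * k * e m t)" by simp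
        then have "cmod (a t) * n t \<le> cmod (a t)
          * (Re (L2_inner M (V t) ?\<phi>) + (1/real (Suc m) + 2 * k * e m t))"
          by (intro mult_left_mono) auto
        then show ?case using 1 by (simp add: G distrib_left)
      qed
      have VGi: "integrable ?L (\<lambda>t. L2_inner M (V t) (G m t))"
      proof (rule Bochner_Integration.integrable_bound)
        show "integrable ?L (\<lambda>t. cmod (a t) * (k * B))" using ai by simp
        show "AE t in ?L. norm (L2_inner M (V t) (G m t)) \<le> norm (cmod (a t) * (k * B))"
          using Gb by eventually_elim (use k B in auto)
      qed fact
      have "(LINT t|?L. cmod (a t) * n t)
        \<le> (LINT t|?L. Re (L2_inner M (V t) (G m t)) + cmod (a t) * (1/real (Suc m) + 2 * k * e m t))"
      proof (rule integral_mono_AE)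
        show "integrable ?L (\<lambda>t. cmod (a t) * n t)"
        proof (rule Bochner_Integration.integrable_bound)
          show "integrable ?L (\<lambda>t. cmod (a t) * (k * B))" using ai by simp
          show "AE t in ?L. norm (cmod (a t) * n t) \<le> norm (cmod (a t) * (k * B))"
            using nb by eventually_elim (use k B in \<open>auto simp: abs_mult intro!: mult_left_mono\<close>)
        qed simp
        show "integrable ?L (\<lambda>t. Re (L2_inner M (V t) (G m t)) + cmod (a t)
          * (1/real (Suc m) + 2 * k * e m t))"
          by (intro Bochner_Integration.integrable_add di integrable_Re VGi)
        show "AE t in ?L. cmod (a t) * n t \<le> Re (L2_inner M (V t) (G m t)) + cmod (a t)
          * (1/real (Suc m) + 2 * k * e m t)"
          using Gb by eventually_elim blast
      qed
      also have "\<dots> = Re (LINT t|?L. L2_inner M (V t) (G m t)) + \<delta> m"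
        unfolding \<delta>_def using VGi di by (subst Bochner_Integration.integral_add) (auto intro: integrable_Re)
      also have "Re (LINT t|?L. L2_inner M (V t) (G m t)) \<le> cmod (LINT t|?L. L2_inner M (V t) (G m t))"
        by (rule complex_Re_le_cmod)
      also have "\<dots> \<le> K * (LINT t|?L. nrm M u (G m t) powr v) powr (1/v)" using H[OF Gs] by (simp add: u_def)
      also have "\<dots> \<le> K * nrm ?L v a"
      proof -
        have "(LINT t|?L. nrm M u (G m t) powr v) \<le> (LINT t|?L. cmod (a t) powr v)"
        proof (rule integral_mono)
          show "integrable ?L (\<lambda>t. nrm M u (G m t) powr v)" by (rule time_simple_nrm_integrable[OF I Gs])
          show "integrable ?L (\<lambda>t. cmod (a t) powr v)" by (rule test_integrable_powr[OF a])
          fix t assume "t \<in> space ?L"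
          then have "t \<in> I" by (simp add: space_restrict_space)
          have "nrm M u (G m t) = cmod (a t) * nrm M u (ch m (S' m t))" unfolding G_def
            using u by (subst nrm_cmult) auto
          also have "\<dots> \<le> cmod (a t) * 1" using ch(2)[OF S'L[OF \<open>t \<in> I\<close>]] by (intro mult_left_mono) auto
          finally show "nrm M u (G m t) powr v \<le> cmod (a t) powr v" using v by (intro powr_mono2) auto
        qed
        moreover have "0 \<le> (LINT t|?L. nrm M u (G m t) powr v)" by (intro integral_nonneg_AE) auto
        ultimately have "(LINT t|?L. nrm M u (G m t) powr v) powr (1/v) \<le> nrm ?L v a"
          unfolding nrm_def[of ?L] using v by (intro powr_mono2) auto
        then show ?thesis using K by (intro mult_left_mono)
      qed
      finally show ?thesis by simp
    qed
    have "cmod (LINT t|?L. of_real (n t) * a t) \<le> (LINT t|?L. cmod (of_real (n t) * a t))"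
      by (rule integral_norm_bound)
    also have "\<dots> = (LINT t|?L. cmod (a t) * n t)"
      using nb by (intro integral_cong_AE) (auto elim!: eventually_mono simp: norm_mult)
    also have "\<dots> \<le> K * nrm ?L v a"
    proof (rule LIMSEQ_le)
      show "(\<lambda>m. LINT t|?L. cmod (a t) * n t) \<longlonglongrightarrow> (LINT t|?L. cmod (a t) * n t)" by simp
      have "(\<lambda>m. K * nrm ?L v a + \<delta> m) \<longlonglongrightarrow> K * nrm ?L v a + 0" by (intro tendsto_intros \<delta>0)
      then show "(\<lambda>m. K * nrm ?L v a + \<delta> m) \<longlonglongrightarrow> K * nrm ?L v a" by simp
      show "\<exists>N. \<forall>m\<ge>N. (LINT t|?L. cmod (a t) * n t) \<le> K * nrm ?L v a + \<delta> m" using main by blast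
    qed
    finally show ?thesis .
  qed
  have "Lp_bound ?L (1 - 1/v) (\<lambda>t. cmod (complex_of_real (n t))) K"
  proof (rule Lp_bound_converse)
    show "integrable ?L (\<lambda>t. (cmod (complex_of_real (n t)))\<^sup>2)"
    proof (rule integrable_const_bound[of _ "(k * B)\<^sup>2"])
      show "AE t in ?L. norm ((cmod (complex_of_real (n t)))\<^sup>2) \<le> (k * B)\<^sup>2"
        using nb by eventually_elim (auto intro!: power_mono)
    qed simp
    show "0 \<le> 1 - 1/v" "1 - 1/v < 1" using v by auto
    show "cmod (LINT t|?L. complex_of_real (n t) * \<phi> t) \<le> K * nrm ?L (1 / (1 - (1 - 1/v))) \<phi>"
      if "test ?L \<phi>" for \<phi>
      using key[OF that] by simp
  qed (use K in auto)
  then show ?thesis unfolding norm_of_real Lp_bound_abs[OF nm] by (simp add: n_def[abs_def])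
qed

text \<open>Both inequalities are run over all finite bounds \<open>K\<close>, so that infinite
  norms are covered. Along a strongly measurable function the norm thereby becomes a countable
  supremum of measurable functions of time.\<close>

lemma Lp_norm_eq_SUP_dual_norm:
  assumes p: "2 \<le> p" and y: "y = real_of_ereal (1/p)" and v: "v \<in> L2 M"
  shows "Lp_norm M p v = (SUP k::nat. ennreal (dual_norm M y (real k) v))"
proof -
  have p1: "1 \<le> p" using p by (metis ereal_two_ge_one order_trans)
  have y01: "0 \<le> y" "y < 1"
    using p unfolding y by (cases p; simp add: one_ereal_def)+
  show ?thesis
  proof (rule antisym)
    show "Lp_norm M p v \<le> (SUP k::nat. ennreal (dual_norm M y (real k) v))"
    proof (cases "(SUP k::nat. ennreal (dual_norm M y (real k) v))")
      case (real K)
      have "dual_norm M y (real k) v \<le> K" for k :: nat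
      proof -
        have "ennreal (dual_norm M y (real k) v) \<le> ennreal K" unfolding real(2)[symmetric]
          by (rule SUP_upper) simp
        then show ?thesis using real(1) by simp
      qed
      then have "Lp_bound M y (\<lambda>x. cmod (v x)) K" using dual_norm_le_iff[OF y01 v real(1)] by blast
      then show ?thesis unfolding real(2) using Lp_norm_le_iff[OF p1 real(1), of M v] y by simp
    next
      case top
      show ?thesis unfolding top by (rule top_greatest)
    qed
    show "(SUP k::nat. ennreal (dual_norm M y (real k) v)) \<le> Lp_norm M p v"
    proof (cases "Lp_norm M p v")
      case (real K)
      then have "Lp_bound M y (\<lambda>x. cmod (v x)) K" using Lp_norm_le_iff[OF p1 real(1), of M v] y by simp
      then have "\<forall>k::nat. dual_norm M y (real k) v \<le> K" using dual_norm_le_iff[OF y01 v real(1)] by blast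
      then show ?thesis unfolding real(2) by (intro SUP_least ennreal_leI) blast
    next
      case top
      show ?thesis unfolding top by (rule top_greatest)
    qed
  qed
qed

text \<open>Monotone convergence, with measurability of \<open>g\<close> inherited from the
  supremum; an upper bound on \<open>L_norm\<close> has to deliver that measurability as
  well.\<close>

lemma L_norm_SUP_le:
  fixes n :: "nat \<Rightarrow> 'a \<Rightarrow> real"
  assumes q: "1 \<le> q" and K: "0 \<le> K" and nn: "\<And>k t. t \<in> space N \<Longrightarrow> 0 \<le> n k t"
    and inc: "\<And>k t. t \<in> space N \<Longrightarrow> n k t \<le> n (Suc k) t"
    and b: "\<And>k. Lp_bound N (real_of_ereal (1/q)) (n k) K"
      and eq: "\<And>t. t \<in> space N \<Longrightarrow> g t = (SUP k. ennreal (n k t))"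
  shows "L_norm N q g \<le> ennreal K"
proof -
  have [measurable]: "n k \<in> borel_measurable N" for k using b by (rule Lp_bound_measurable)
  have "(\<lambda>t. SUP k. ennreal (n k t)) \<in> borel_measurable N" by measurable
  then have gm[measurable]: "g \<in> borel_measurable N" using measurable_cong[of N g, OF eq] by blast
  show ?thesis
  proof (cases q)
    case PInf
    have "AE t in N. \<bar>n k t\<bar> \<le> K" for k using b[of k] PInf by (simp add: Lp_bound_def)
    then have "AE t in N. \<forall>k. \<bar>n k t\<bar> \<le> K" by (simp add: AE_all_countable)
    then have "AE t in N. t \<in> space N \<and> (\<forall>k. \<bar>n k t\<bar> \<le> K)" using AE_space by eventually_elim simp
    then have "AE t in N. g t \<le> ennreal K"
      by eventually_elim (auto simp: eq abs_le_iff intro!: SUP_least ennreal_leI)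
    then show ?thesis using PInf gm by (auto simp: L_norm_def intro!: esssup_I)
  next
    case (real p)
    then have p: "p \<ge> 1" using q by simp
    have y: "real_of_ereal (1/q) = 1/p" using real p by (simp add: one_ereal_def)
    have mono: "ennreal_powr x r \<le> ennreal (a powr r)" if "x \<le> ennreal a" "0 \<le> a" "0 \<le> r" for x a r
    proof (cases x)
      case (real z)
      then show ?thesis using that by (auto simp: ennreal_powr_ennreal intro!: ennreal_leI powr_mono2)
    qed (use that in \<open>simp add: top_unique\<close>)
    have pt: "ennreal_powr (g t) p \<le> (SUP k. ennreal (n k t powr p))" if t: "t \<in> space N" for t
    proof (cases "(SUP k. ennreal (n k t powr p))")
      case (real \<tau>)
      have "n k t \<le> \<tau> powr (1/p)" for k
      proof -
        have "ennreal (n k t powr p) \<le> ennreal \<tau>" unfolding real(2)[symmetric] by (rule SUP_upper) simp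
        then have "n k t powr p \<le> \<tau>" using real by simp
        then have "(n k t powr p) powr (1/p) \<le> \<tau> powr (1/p)" using p by (intro powr_mono2) auto
        then show ?thesis using p nn[OF t] by (simp add: powr_powr)
      qed
      then have "g t \<le> ennreal (\<tau> powr (1/p))" unfolding eq[OF t] by (intro SUP_least ennreal_leI)
      then have "ennreal_powr (g t) p \<le> ennreal ((\<tau> powr (1/p)) powr p)" using p by (intro mono) auto
      then show ?thesis using p real by (simp add: powr_powr)
    next
      case top
      show ?thesis unfolding top by (rule top_greatest)
    qed
    have "(\<integral>\<^sup>+t. ennreal_powr (g t) p \<partial>N) \<le> (\<integral>\<^sup>+t. (SUP k. ennreal (n k t powr p)) \<partial>N)"
      by (intro nn_integral_mono pt)
    also have "\<dots> = (SUP k. \<integral>\<^sup>+t. ennreal (n k t powr p) \<partial>N)"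
    proof (rule nn_integral_monotone_convergence_SUP_AE)
      show "AE t in N. ennreal (n k t powr p) \<le> ennreal (n (Suc k) t powr p)" for k
        using p inc nn by (intro AE_I2 ennreal_leI powr_mono2) auto
    qed simp
    also have "\<dots> \<le> ennreal (K powr p)"
    proof (rule SUP_least)
      fix k
      have "(\<integral>\<^sup>+t. ennreal (n k t powr p) \<partial>N) = (\<integral>\<^sup>+t. ennreal (\<bar>n k t\<bar> powr p) \<partial>N)"
        using nn by (intro nn_integral_cong) simp
      also have "\<dots> \<le> ennreal (K powr p)" using b[of k] p by (simp add: y Lp_bound_def)
      finally show "(\<integral>\<^sup>+t. ennreal (n k t powr p) \<partial>N) \<le> ennreal (K powr p)" .
    qed
    finally have "ennreal_powr (\<integral>\<^sup>+t. ennreal_powr (g t) p \<partial>N) (1/p) \<le> ennreal ((K powr p) powr (1/p))"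
      using p by (intro mono) auto
    then show ?thesis using real gm K p by (simp add: L_norm_def powr_powr)
  qed (use q in auto)
qed

section \<open>Dispersive families\<close>

text \<open>The hypotheses of the theorem with named constants, enlarged to at least 1 because
  interpolation asks for positive bounds, and with the dispersive inequality kept for test
  functions.\<close>

locale dispersive =
  fixes M :: "'x measure" and U :: "real \<Rightarrow> 'h::chilbert_space \<Rightarrow> 'x \<Rightarrow> complex" and \<sigma> A B :: real
  assumes sigma_pos: "0 < \<sigma>"
    and U_linear: "\<And>t. linear_into_L2 M (U t)"
    and U_strong_meas: "\<And>h. strong_meas M UNIV (\<lambda>t. U t h)"
    and A1: "1 \<le> A" and energy: "\<And>t h. nrm M 2 (U t h) \<le> A * norm h"
    and B1: "1 \<le> B" and dispersion: "\<And>t s f. t \<noteq> s \<Longrightarrow> test M f \<Longrightarrow>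
      Lp_bound M 0 (\<lambda>x. cmod (U t (L2_adjoint M (U s) f) x)) (B * \<bar>t - s\<bar> powr (-\<sigma>) * nrm M 1 f)"
begin

abbreviation adj :: "real \<Rightarrow> ('x \<Rightarrow> complex) \<Rightarrow> 'h" where "adj s \<equiv> L2_adjoint M (U s)"

lemma U_L2: "U t h \<in> L2 M"
  using U_linear unfolding linear_into_L2_def L2_def by blast

lemma L2_inner_U_add: "f \<in> L2 M \<Longrightarrow> L2_inner M f (U t (h + k)) = L2_inner M f (U t h) + L2_inner M f (U t k)"
proof -
  assume f: "f \<in> L2 M"
  have "AE x in M. U t (h + k) x = U t h x + U t k x" using U_linear unfolding linear_into_L2_def by blast
  then have "L2_inner M f (U t (h + k)) = L2_inner M f (\<lambda>x. U t h x + U t k x)"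
    by (intro L2_inner_cong_AE f U_L2 L2_add) auto
  then show ?thesis using L2_inner_add_right[OF U_L2 U_L2 f] by simp
qed

lemma L2_inner_U_scale: "f \<in> L2 M \<Longrightarrow> L2_inner M f (U t (c *\<^sub>C h)) = cnj c * L2_inner M f (U t h)"
proof -
  assume f: "f \<in> L2 M"
  have "AE x in M. U t (c *\<^sub>C h) x = c * U t h x" using U_linear unfolding linear_into_L2_def by blast
  then have "L2_inner M f (U t (c *\<^sub>C h)) = L2_inner M f (\<lambda>x. c * U t h x)"
    by (intro L2_inner_cong_AE f U_L2 L2_cmult) auto
  then show ?thesis by (simp add: L2_inner_cmult_right)
qed

lemma adj_exists: "f \<in> L2 M \<Longrightarrow> \<exists>k. (\<forall>h. cinner k h = L2_inner M f (U s h)) \<and> norm k \<le> A * nrm M 2 f"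
proof (rule riesz_representation)
  assume f: "f \<in> L2 M"
  show "cmod (L2_inner M f (U s x)) \<le> A * nrm M 2 f * norm x" for x
  proof -
    have "cmod (L2_inner M f (U s x)) \<le> nrm M 2 f * nrm M 2 (U s x)" by (rule L2_Cauchy_Schwarz[OF f U_L2])
    also have "\<dots> \<le> nrm M 2 f * (A * norm x)" by (intro mult_left_mono energy) simp
    finally show ?thesis by (simp add: mult_ac)
  qed
  show "0 \<le> A * nrm M 2 f" using A1 by simp
qed (auto simp: L2_inner_U_add L2_inner_U_scale)

lemma adj_eqI: "(\<And>h. cinner k h = L2_inner M f (U s h)) \<Longrightarrow> adj s f = k"
  unfolding L2_adjoint_def by (rule the_equality) (auto intro: cinner_ext)

lemma cinner_adj: "f \<in> L2 M \<Longrightarrow> cinner (adj s f) h = L2_inner M f (U s h)"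
  using adj_exists[of f s] adj_eqI[of _ f s] by metis

lemma norm_adj: "f \<in> L2 M \<Longrightarrow> norm (adj s f) \<le> A * nrm M 2 f"
  using adj_exists[of f s] adj_eqI[of _ f s] by metis

lemma adj_cong: "(\<And>x. x \<in> space M \<Longrightarrow> f x = g x) \<Longrightarrow> adj s f = adj s g"
proof -
  assume a: "\<And>x. x \<in> space M \<Longrightarrow> f x = g x"
  have "L2_inner M f h = L2_inner M g h" for h
    unfolding L2_inner_def using a by (intro Bochner_Integration.integral_cong) auto
  then show ?thesis unfolding L2_adjoint_def by simp
qed

lemma adj_add: "f \<in> L2 M \<Longrightarrow> g \<in> L2 M \<Longrightarrow> adj s (\<lambda>x. f x + g x) = adj s f + adj s g"
  by (rule adj_eqI) (simp add: cinner_add_left cinner_adj L2_inner_add_left U_L2)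

lemma adj_scale: "f \<in> L2 M \<Longrightarrow> adj s (\<lambda>x. c * f x) = c *\<^sub>C adj s f"
  by (rule adj_eqI) (simp add: cinner_scaleC_left cinner_adj L2_inner_cmult_left)

lemma adj_pair: "f \<in> L2 M \<Longrightarrow> g \<in> L2 M \<Longrightarrow> cinner (adj s f) (adj t g) = L2_inner M (U t (adj s f)) g"
  by (subst cinner_commute) (simp add: cinner_adj L2_inner_cnj[symmetric])

lemma pair_dispersive:
  assumes f: "test M f" and g: "test M g" and st: "s \<noteq> t"
  shows "cmod (cinner (adj s f) (adj t g)) \<le> B * \<bar>t - s\<bar> powr (-\<sigma>) * nrm M 1 f * nrm M 1 g"
proof -
  have "cinner (adj s f) (adj t g) = L2_inner M (U t (adj s f)) g" using f g test_L2 by (intro adj_pair) auto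
  moreover have "Lp_bound M (1 - 0) (\<lambda>x. cmod (g x)) (nrm M 1 g)" using test_Lp_bound[OF g, of 1] by simp
  ultimately show ?thesis
    using L2_inner_Holder[OF U_L2 dispersion[OF st[symmetric] f] test_L2[OF g]] by simp
qed

section \<open>The adjoint of T as a weak integral over a set of times\<close>

definition admissible :: "real set \<Rightarrow> (real \<Rightarrow> 'x \<Rightarrow> complex) \<Rightarrow> bool" where
  "admissible I \<Phi> \<longleftrightarrow> I \<in> sets lebesgue \<and> strong_meas M I \<Phi> \<and> integrable (lebesgue_on I) (\<lambda>t. nrm M 2 (\<Phi> t))"

text \<open>\<open>T\<^sup>*\<close> applied to the restriction of \<open>\<Phi>\<close> to \<open>I\<close>. The integral is taken weakly because \<open>H\<close> need not be
  separable; for the same reason only iterated integrals are available for \<open>\<parallel>T\<^sup>*\<Phi>\<parallel>\<^sup>2\<close>.\<close>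

definition Tstar :: "real set \<Rightarrow> (real \<Rightarrow> 'x \<Rightarrow> complex) \<Rightarrow> 'h" where
  "Tstar I \<Phi> = (THE k. \<forall>h. cinner k h = (LINT t|lebesgue_on I. L2_inner M (\<Phi> t) (U t h)))"

lemma strong_meas_AE_L2: "strong_meas M I \<Phi> \<Longrightarrow> AE t in lebesgue_on I. \<Phi> t \<in> L2 M"
  unfolding strong_meas_def by (auto elim: eventually_mono)

lemma U_strong_meas_on: "I \<in> sets lebesgue \<Longrightarrow> strong_meas M I (\<lambda>t. U t h)"
  by (rule strong_meas_restrict[OF U_strong_meas]) auto

lemma inner_U_measurable: "I \<in> sets lebesgue \<Longrightarrow> strong_meas M I \<Phi> \<Longrightarrow>
  (\<lambda>t. L2_inner M (\<Phi> t) (U t h)) \<in> borel_measurable (lebesgue_on I)"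
  by (intro strong_meas_inner U_strong_meas_on)

lemma admissible_integrable:
  assumes "admissible I \<Phi>" shows "integrable (lebesgue_on I) (\<lambda>t. L2_inner M (\<Phi> t) (U t h))"
proof (rule Bochner_Integration.integrable_bound)
  show "integrable (lebesgue_on I) (\<lambda>t. nrm M 2 (\<Phi> t) * (A * norm h))"
    using assms by (simp add: admissible_def)
  show "(\<lambda>t. L2_inner M (\<Phi> t) (U t h)) \<in> borel_measurable (lebesgue_on I)"
    using assms by (intro inner_U_measurable) (auto simp: admissible_def)
  have "AE t in lebesgue_on I. \<Phi> t \<in> L2 M" using assms by (auto simp: admissible_def intro: strong_meas_AE_L2)
  then show "AE t in lebesgue_on I. norm (L2_inner M (\<Phi> t) (U t h)) \<le> norm (nrm M 2 (\<Phi> t) * (A * norm h))"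
  proof eventually_elim
    case (elim t)
    have "cmod (L2_inner M (\<Phi> t) (U t h)) \<le> nrm M 2 (\<Phi> t) * nrm M 2 (U t h)"
      by (rule L2_Cauchy_Schwarz[OF elim U_L2])
    also have "\<dots> \<le> nrm M 2 (\<Phi> t) * (A * norm h)" by (intro mult_left_mono energy) simp
    finally show ?case using A1 by simp
  qed
qed

lemma Tstar_exists:
  assumes \<Phi>: "admissible I \<Phi>"
  shows "\<exists>k. (\<forall>h. cinner k h = (LINT t|lebesgue_on I. L2_inner M (\<Phi> t) (U t h))) \<and> norm k \<le> A
    * (LINT t|lebesgue_on I. nrm M 2 (\<Phi> t))"
proof (rule riesz_representation)
  let ?L = "lebesgue_on I"
  have ae: "AE t in ?L. \<Phi> t \<in> L2 M" using \<Phi> by (auto simp: admissible_def intro: strong_meas_AE_L2)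
  note [measurable] = borel_measurable_integrable[OF admissible_integrable[OF \<Phi>]]
  show "(LINT t|?L. L2_inner M (\<Phi> t) (U t (h + k))) = (LINT t|?L. L2_inner M (\<Phi> t) (U t h))
    + (LINT t|?L. L2_inner M (\<Phi> t) (U t k))" for h k
  proof -
    have "(LINT t|?L. L2_inner M (\<Phi> t) (U t (h + k)))
      = (LINT t|?L. L2_inner M (\<Phi> t) (U t h) + L2_inner M (\<Phi> t) (U t k))"
    proof (rule integral_cong_AE)
      show "AE t in ?L. L2_inner M (\<Phi> t) (U t (h + k)) = L2_inner M (\<Phi> t) (U t h) + L2_inner M (\<Phi> t) (U t k)"
        using ae by eventually_elim (rule L2_inner_U_add)
    qed measurable
    then show ?thesis using admissible_integrable[OF \<Phi>] by simp
  qed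
  show "(LINT t|?L. L2_inner M (\<Phi> t) (U t (c *\<^sub>C h))) = cnj c * (LINT t|?L. L2_inner M (\<Phi> t) (U t h))" for c h
  proof -
    have "(LINT t|?L. L2_inner M (\<Phi> t) (U t (c *\<^sub>C h))) = (LINT t|?L. cnj c * L2_inner M (\<Phi> t) (U t h))"
    proof (rule integral_cong_AE)
      show "AE t in ?L. L2_inner M (\<Phi> t) (U t (c *\<^sub>C h)) = cnj c * L2_inner M (\<Phi> t) (U t h)"
        using ae by eventually_elim (rule L2_inner_U_scale)
    qed measurable
    then show ?thesis by simp
  qed
  show "cmod (LINT t|?L. L2_inner M (\<Phi> t) (U t h)) \<le> A * (LINT t|?L. nrm M 2 (\<Phi> t)) * norm h" for h
  proof -
    have "cmod (LINT t|?L. L2_inner M (\<Phi> t) (U t h)) \<le> (LINT t|?L. nrm M 2 (\<Phi> t) * (A * norm h))"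
    proof (rule order_trans[OF integral_norm_bound integral_mono_AE])
      show "integrable ?L (\<lambda>t. cmod (L2_inner M (\<Phi> t) (U t h)))"
        by (intro integrable_norm admissible_integrable[OF \<Phi>])
      show "integrable ?L (\<lambda>t. nrm M 2 (\<Phi> t) * (A * norm h))" using \<Phi> by (simp add: admissible_def)
      show "AE t in ?L. cmod (L2_inner M (\<Phi> t) (U t h)) \<le> nrm M 2 (\<Phi> t) * (A * norm h)"
        using ae
      proof eventually_elim
        case (elim t)
        have "cmod (L2_inner M (\<Phi> t) (U t h)) \<le> nrm M 2 (\<Phi> t) * nrm M 2 (U t h)"
          by (rule L2_Cauchy_Schwarz[OF elim U_L2])
        also have "\<dots> \<le> nrm M 2 (\<Phi> t) * (A * norm h)" by (intro mult_left_mono energy) simp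
        finally show ?case .
      qed
    qed
    then show ?thesis by (simp add: mult_ac)
  qed
  show "0 \<le> A * (LINT t|?L. nrm M 2 (\<Phi> t))" using A1 by (simp add: integral_nonneg_AE)
qed

lemma Tstar_eqI: "(\<And>h. cinner k h = (LINT t|lebesgue_on I. L2_inner M (\<Phi> t) (U t h))) \<Longrightarrow> Tstar I \<Phi> = k"
  unfolding Tstar_def by (rule the_equality) (auto intro: cinner_ext)

lemma cinner_Tstar: "admissible I \<Phi> \<Longrightarrow> cinner (Tstar I \<Phi>) h = (LINT t|lebesgue_on I. L2_inner M (\<Phi> t) (U t h))"
  using Tstar_exists[of I \<Phi>] Tstar_eqI[of _ I \<Phi>] by metis

lemma norm_Tstar: "admissible I \<Phi> \<Longrightarrow> norm (Tstar I \<Phi>) \<le> A * (LINT t|lebesgue_on I. nrm M 2 (\<Phi> t))"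
  using Tstar_exists[of I \<Phi>] Tstar_eqI[of _ I \<Phi>] by metis

lemma time_simple_admissible: "I \<in> lmeasurable \<Longrightarrow> time_simple M I G \<Longrightarrow> admissible I G"
  unfolding admissible_def using time_simple_nrm_integrable[of I M G 2 1]
  by (auto intro: time_simple_strong_meas)

lemma time_simple_subset:
  assumes G: "time_simple M J G" and IJ: "I \<subseteq> J" "I \<in> sets lebesgue" "J \<in> sets lebesgue"
  shows "time_simple M I G"
proof -
  have sJ: "simple_function (lebesgue_on J) G" and t: "\<forall>t\<in>J. test M (G t)"
    using G by (auto simp: time_simple_def)
  have "simple_function (lebesgue_on I) G"
    unfolding simple_function_def
  proof
    have "finite (G ` J)" using simple_functionD(1)[OF sJ] by (simp add: space_restrict_space)
    then show "finite (G ` space (lebesgue_on I))"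
      using finite_subset[OF image_mono[OF IJ(1), of G]] by (simp add: space_restrict_space)
    show "\<forall>x\<in>G ` space (lebesgue_on I). G -` {x} \<inter> space (lebesgue_on I) \<in> sets (lebesgue_on I)"
    proof
      fix x
      have "G -` {x} \<inter> J \<in> sets (lebesgue_on J)"
        using simple_functionD(2)[OF sJ, of "{x}"] by (simp add: space_restrict_space)
      then have "G -` {x} \<inter> J \<in> sets lebesgue" using IJ(3) by (simp add: sets_restrict_space_iff)
      then have "(G -` {x} \<inter> J) \<inter> I \<in> sets lebesgue" using IJ(2) by (rule sets.Int)
      moreover have "(G -` {x} \<inter> J) \<inter> I = G -` {x} \<inter> I" using IJ(1) by blast
      ultimately have "G -` {x} \<inter> I \<in> sets lebesgue" by simp
      then show "G -` {x} \<inter> space (lebesgue_on I) \<in> sets (lebesgue_on I)"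
        using IJ(2) by (simp add: sets_restrict_space_iff space_restrict_space)
    qed
  qed
  then show ?thesis using t IJ(1) by (auto simp: time_simple_def)
qed

text \<open>Used for the decomposition of \<open>G\<close> into levels and, in the interpolation,
  for the decomposition into the values that \<open>G\<close> takes.\<close>

lemma Tstar_sum:
  assumes J: "J \<in> lmeasurable" and K: "finite K" and G: "time_simple M J G"
    and Gk: "\<And>k. k \<in> K \<Longrightarrow> time_simple M J (H k)"
    and eq: "\<And>t x. t \<in> J \<Longrightarrow> x \<in> space M \<Longrightarrow> G t x = (\<Sum>k\<in>K. H k t x)"
  shows "Tstar J G = (\<Sum>k\<in>K. Tstar J (H k))"
proof (rule Tstar_eqI)
  fix h
  have "cinner (\<Sum>k\<in>K. Tstar J (H k)) h = (\<Sum>k\<in>K. LINT t|lebesgue_on J. L2_inner M (H k t) (U t h))"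
    unfolding cinner_sum_left by (intro sum.cong refl cinner_Tstar time_simple_admissible J Gk)
  also have "\<dots> = (LINT t|lebesgue_on J. (\<Sum>k\<in>K. L2_inner M (H k t) (U t h)))"
    by (intro Bochner_Integration.integral_sum[symmetric] admissible_integrable time_simple_admissible J Gk)
  also have "\<dots> = (LINT t|lebesgue_on J. L2_inner M (G t) (U t h))"
  proof (rule Bochner_Integration.integral_cong[OF refl])
    fix t assume "t \<in> space (lebesgue_on J)"
    then have t: "t \<in> J" by (simp add: space_restrict_space)
    have "L2_inner M (G t) (U t h) = L2_inner M (\<lambda>x. \<Sum>k\<in>K. H k t x) (U t h)"
      unfolding L2_inner_def using eq[OF t] by (intro Bochner_Integration.integral_cong) auto
    also have "\<dots> = (\<Sum>k\<in>K. L2_inner M (H k t) (U t h))"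
      using Gk t by (intro L2_inner_sum_left U_L2 test_L2) (auto simp: time_simple_def)
    finally show "(\<Sum>k\<in>K. L2_inner M (H k t) (U t h)) = L2_inner M (G t) (U t h)" by simp
  qed
  finally show "cinner (\<Sum>k\<in>K. Tstar J (H k)) h = (LINT t|lebesgue_on J. L2_inner M (G t) (U t h))" .
qed

lemma Tstar_scale:
  assumes J: "J \<in> lmeasurable" and G: "time_simple M J G"
  shows "Tstar J (\<lambda>t x. c * G t x) = c *\<^sub>C Tstar J G"
  by (rule Tstar_eqI) (simp add: cinner_scaleC_left cinner_Tstar[OF time_simple_admissible[OF J G]]
    L2_inner_cmult_left)

lemma Tstar_disjoint_Un:
  assumes E: "E1 \<in> lmeasurable" "E2 \<in> lmeasurable" "E1 \<inter> E2 = {}" and G: "time_simple M (E1 \<union> E2) G"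
  shows "Tstar (E1 \<union> E2) G = Tstar E1 G + Tstar E2 G"
proof (rule Tstar_eqI)
  fix h
  have s: "E1 \<in> sets lebesgue" "E2 \<in> sets lebesgue" using E by auto
  have G12: "time_simple M E1 G" "time_simple M E2 G" by (rule time_simple_subset[OF G]; use s in auto)+
  let ?f = "\<lambda>t. L2_inner M (G t) (U t h)"
  have i: "integrable lebesgue (\<lambda>t. indicator E1 t *\<^sub>R ?f t)" "integrable lebesgue
    (\<lambda>t. indicator E2 t *\<^sub>R ?f t)"
    using admissible_integrable[OF time_simple_admissible[OF E(1) G12(1)]]
      admissible_integrable[OF time_simple_admissible[OF E(2) G12(2)]] s
    by (simp_all add: integrable_restrict_space)
  have "cinner (Tstar E1 G + Tstar E2 G) h = (LINT t|lebesgue_on E1. ?f t) + (LINT t|lebesgue_on E2. ?f t)"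
    by (simp add: cinner_add_left cinner_Tstar[OF time_simple_admissible[OF E(1) G12(1)]]
      cinner_Tstar[OF time_simple_admissible[OF E(2) G12(2)]])
  also have "\<dots> = (LINT t|lebesgue. indicator E1 t *\<^sub>R ?f t) + (LINT t|lebesgue. indicator E2 t *\<^sub>R ?f t)"
    using s by (simp add: integral_restrict_space)
  also have "\<dots> = (LINT t|lebesgue. indicator E1 t *\<^sub>R ?f t + indicator E2 t *\<^sub>R ?f t)"
    using i by simp
  also have "\<dots> = (LINT t|lebesgue. indicator (E1 \<union> E2) t *\<^sub>R ?f t)"
    using E(3) by (intro Bochner_Integration.integral_cong) (auto simp: indicator_def)
  also have "\<dots> = (LINT t|lebesgue_on (E1 \<union> E2). ?f t)" using s by (simp add: integral_restrict_space)
  finally show "cinner (Tstar E1 G + Tstar E2 G) h = (LINT t|lebesgue_on (E1 \<union> E2). ?f t)" .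
qed

text \<open>The integral for \<open>Tstar E G\<close> is unfolded in \<open>s\<close> against
  \<open>h = Tstar E' G'\<close>, then the pairing of \<open>h\<close> with
  \<open>adj s (G s)\<close> is unfolded in \<open>t\<close>. The bound \<open>\<kappa>\<close> may
  fail on the diagonal, which is null in \<open>t\<close> for every \<open>s\<close>; this admits
  singular kernels.\<close>

lemma Tstar_double_bound:
  assumes E: "E \<in> lmeasurable" "E' \<in> lmeasurable" and G: "time_simple M E G" and G': "time_simple M E' G'"
    and \<kappa>: "\<And>s t. s \<in> E \<Longrightarrow> t \<in> E' \<Longrightarrow> s \<noteq> t \<Longrightarrow> cmod (cinner (adj s (G s)) (adj t (G' t))) \<le> \<kappa> s t"
  shows "ennreal (cmod (cinner (Tstar E G) (Tstar E' G')))
    \<le> (\<integral>\<^sup>+s. \<integral>\<^sup>+t. ennreal (\<kappa> s t) \<partial>lebesgue_on E' \<partial>lebesgue_on E)"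
proof -
  define h where "h = Tstar E' G'"
  have "ennreal (cmod (cinner (Tstar E G) h))
    \<le> (\<integral>\<^sup>+s. ennreal (cmod (L2_inner M (G s) (U s h))) \<partial>lebesgue_on E)"
    unfolding cinner_Tstar[OF time_simple_admissible[OF E(1) G]]
    by (rule integral_norm_bound_ennreal[OF admissible_integrable[OF time_simple_admissible[OF E(1) G]]])
  also have "\<dots> \<le> (\<integral>\<^sup>+s. \<integral>\<^sup>+t. ennreal (\<kappa> s t) \<partial>lebesgue_on E' \<partial>lebesgue_on E)"
  proof (rule nn_integral_mono)
    fix s assume "s \<in> space (lebesgue_on E)"
    then have s: "s \<in> E" by (simp add: space_restrict_space)
    then have Gs: "G s \<in> L2 M" using G by (auto simp: time_simple_def intro: test_L2)
    have "cmod (L2_inner M (G s) (U s h)) = cmod (cinner h (adj s (G s)))"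
      by (subst norm_cinner_commute) (simp add: cinner_adj[OF Gs])
    then have "ennreal (cmod (L2_inner M (G s) (U s h)))
      \<le> (\<integral>\<^sup>+t. ennreal (cmod (L2_inner M (G' t) (U t (adj s (G s))))) \<partial>lebesgue_on E')"
      unfolding h_def cinner_Tstar[OF time_simple_admissible[OF E(2) G']]
      using integral_norm_bound_ennreal[OF
        admissible_integrable[OF time_simple_admissible[OF E(2) G'], of "adj s (G s)"]] by simp
    also have "\<dots> \<le> (\<integral>\<^sup>+t. ennreal (\<kappa> s t) \<partial>lebesgue_on E')"
    proof (rule nn_integral_mono_AE)
      have "AE t in lebesgue. t \<in> E' \<longrightarrow> t \<noteq> s"
        by (rule AE_I'[of "{s}"]) auto
      then have "AE t in lebesgue_on E'. t \<noteq> s" using E(2) by (subst AE_restrict_space_iff) auto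
      moreover have "AE t in lebesgue_on E'. t \<in> E'" by (rule AE_I2) (simp add: space_restrict_space)
      ultimately show "AE t in lebesgue_on E'. ennreal (cmod (L2_inner M (G' t) (U t (adj s (G s)))))
        \<le> ennreal (\<kappa> s t)"
      proof eventually_elim
        case (elim t)
        have G't: "G' t \<in> L2 M" using G' elim by (auto simp: time_simple_def intro: test_L2)
        have "cmod (L2_inner M (G' t) (U t (adj s (G s)))) = cmod (cinner (adj s (G s)) (adj t (G' t)))"
          by (subst norm_cinner_commute) (simp add: cinner_adj[OF G't])
        also have "\<dots> \<le> \<kappa> s t" using s elim by (intro \<kappa>) auto
        finally show ?case by (rule ennreal_leI)
      qed
    qed
    finally show "ennreal (cmod (L2_inner M (G s) (U s h))) \<le> (\<integral>\<^sup>+t. ennreal (\<kappa> s t) \<partial>lebesgue_on E')" .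
  qed
  finally show ?thesis by (simp add: h_def)
qed

text \<open>Interpolation with parameter \<open>2*\<beta>\<close> between the dispersive inequality
  and the energy estimate applied to both factors. The index set is one point of weight 1, so the
  mixed norm is the norm in space, and conjugating the second function makes the pairing
  bilinear.\<close>

lemma pair_decay:
  assumes st: "s \<noteq> t" and \<beta>: "0 \<le> \<beta>" "\<beta> \<le> 1/2" and f: "test M f" and g: "test M g"
  shows "cmod (cinner (adj s f) (adj t g)) \<le> (B * \<bar>t - s\<bar> powr (-\<sigma>)) powr (1 - 2*\<beta>) * (A\<^sup>2) powr (2*\<beta>)
     * nrm M (1/(1-\<beta>)) f * nrm M (1/(1-\<beta>)) g"
proof -
  define \<Lambda> where "\<Lambda> i f g = cinner (adj s f) (adj t (\<lambda>x. cnj (g x)))" for i :: unit and f g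
  interpret bilinear_family M "{()}" "\<lambda>_. 1" \<Lambda>
  proof
    fix i :: unit and c and f f' g g' :: "'x \<Rightarrow> complex"
    show "\<Lambda> i f g = \<Lambda> i f' g" if "\<And>x. x \<in> space M \<Longrightarrow> f x = f' x"
      unfolding \<Lambda>_def using adj_cong[OF that] by simp
    show "\<Lambda> i f g = \<Lambda> i f g'" if "\<And>x. x \<in> space M \<Longrightarrow> g x = g' x"
      unfolding \<Lambda>_def using adj_cong[of "\<lambda>x. cnj (g x)" "\<lambda>x. cnj (g' x)" t] that by simp
    assume f: "test M f" and g: "test M g"
    note L = test_L2[OF f] test_L2[OF test_cnj[OF g]]
    show "\<Lambda> i (\<lambda>x. f x + f' x) g = \<Lambda> i f g + \<Lambda> i f' g" if "test M f'"
      unfolding \<Lambda>_def using adj_add[OF L(1) test_L2[OF that]] by (simp add: cinner_add_left)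
    show "\<Lambda> i f (\<lambda>x. g x + g' x) = \<Lambda> i f g + \<Lambda> i f g'" if "test M g'"
      unfolding \<Lambda>_def using adj_add[OF L(2) test_L2[OF test_cnj[OF that]]] by (simp add: cinner_add_right)
    show "\<Lambda> i (\<lambda>x. c * f x) g = c * \<Lambda> i f g"
      unfolding \<Lambda>_def using adj_scale[OF L(1)] by (simp add: cinner_scaleC_left)
    show "\<Lambda> i f (\<lambda>x. c * g x) = c * \<Lambda> i f g"
      unfolding \<Lambda>_def using adj_scale[OF L(2), of t "cnj c"] by (simp add: cinner_scaleC_right)
  qed auto
  have mx: "mixed u 1 \<gamma> = nrm M u (\<gamma> ())" for u \<gamma> by (simp add: mixed_def)
  have b0: "bounded_form 1 1 1 (B * \<bar>t - s\<bar> powr (-\<sigma>))"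
    unfolding bounded_form_def
  proof (intro allI impI)
    fix f :: "'x \<Rightarrow> complex" and \<gamma> :: "unit \<Rightarrow> 'x \<Rightarrow> complex"
    assume "test M f" "\<forall>i\<in>{()}. test M (\<gamma> i)"
    then show "cmod (\<Sum>i\<in>{()}. \<Lambda> i f (\<gamma> i)) \<le> B * \<bar>t - s\<bar> powr (-\<sigma>) * nrm M 1 f * mixed 1 1 \<gamma>"
      using pair_dispersive[of f "\<lambda>x. cnj (\<gamma> () x)" s t] st by (simp add: \<Lambda>_def mx test_cnj)
  qed
  have b1: "bounded_form 2 2 1 (A\<^sup>2)"
    unfolding bounded_form_def
  proof (intro allI impI)
    fix f :: "'x \<Rightarrow> complex" and \<gamma> :: "unit \<Rightarrow> 'x \<Rightarrow> complex"
    assume f: "test M f" "\<forall>i\<in>{()}. test M (\<gamma> i)"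
    let ?g = "\<lambda>x. cnj (\<gamma> () x)"
    have "cmod (\<Lambda> () f (\<gamma> ())) \<le> norm (adj s f) * norm (adj t ?g)" unfolding \<Lambda>_def
      by (rule cinner_Cauchy_Schwarz)
    also have "\<dots> \<le> (A * nrm M 2 f) * (A * nrm M 2 ?g)"
      using f A1 by (intro mult_mono norm_adj test_L2 test_cnj) auto
    finally show "cmod (\<Sum>i\<in>{()}. \<Lambda> i f (\<gamma> i)) \<le> A\<^sup>2 * nrm M 2 f * mixed 2 1 \<gamma>"
      by (simp add: mx power2_eq_square mult_ac)
  qed
  have pos: "0 < B * \<bar>t - s\<bar> powr (-\<sigma>)" "0 < A\<^sup>2" using B1 A1 st by auto
  have r: "1/(1/(1-\<beta>)) = (1 - 2*\<beta>)/1 + 2*\<beta>/2" using \<beta> by simp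
  have "bounded_form (1/(1-\<beta>)) (1/(1-\<beta>)) 1 ((B * \<bar>t - s\<bar> powr (-\<sigma>)) powr (1 - 2*\<beta>) * (A\<^sup>2) powr (2*\<beta>))"
    by (rule riesz_thorin[OF b0 b1 pos _ _ _ _ _ _ _ _ _ _ _ r r]) (use \<beta> in auto)
  from this[unfolded bounded_form_def, rule_format, of f "\<lambda>_ x. cnj (g x)"]
  show ?thesis using f test_cnj[OF g] by (simp add: \<Lambda>_def mx)
qed

end

section \<open>The Strichartz estimate\<close>

text \<open>The square of \<open>norm (Tstar E G)\<close> is a double integral in time whose
  integrand \<open>pair_decay\<close> bounds by the spatial norms times
  \<open>\<bar>t - s\<bar> powr (-lam)\<close>. The value of \<open>p\<close> is the one for which
  this kernel is bounded; the endpoint is \<open>lam = 1\<close>, where the kernel is no longer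
  locally integrable.\<close>

lemma (in dispersive) strichartz_nonendpoint:
  assumes \<beta>: "0 \<le> \<beta>" "\<beta> \<le> 1/2" and lam: "lam = \<sigma> * (1 - 2*\<beta>)" "lam < 1" and p: "p = 2/(2-lam)"
  obtains C where "C > 0" "\<And>E G. E \<in> lmeasurable \<Longrightarrow> time_simple M E G \<Longrightarrow>
     norm (Tstar E G) \<le> C * (LINT t|lebesgue_on E. nrm M (1/(1-\<beta>)) (G t) powr p) powr (1/p)"
proof -
  have lam0: "0 \<le> lam" using lam sigma_pos \<beta> by simp
  have p1: "p \<ge> 1" using lam0 lam(2) by (simp add: p field_simps)
  obtain C0 where C0: "C0 > 0" and HLS: "\<And>\<phi> N. \<phi> \<in> borel_measurable lebesgue \<Longrightarrow> (\<And>s. 0 \<le> \<phi> s) \<Longrightarrow> 0 \<le> N \<Longrightarrow>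
     (\<integral>\<^sup>+s. ennreal (\<phi> s powr p) \<partial>lebesgue) \<le> ennreal (N powr p) \<Longrightarrow>
     (\<integral>\<^sup>+t. \<integral>\<^sup>+s. ennreal (\<phi> s * \<phi> t * \<bar>t - s\<bar> powr (-lam)) \<partial>lebesgue \<partial>lebesgue) \<le> ennreal (C0 * N\<^sup>2)"
    by (rule HLS[OF lam0 lam(2) p]) blast
  define D where "D = B powr (1 - 2*\<beta>) * (A\<^sup>2) powr (2*\<beta>)"
  have D: "D > 0" using A1 B1 by (simp add: D_def)
  show ?thesis
  proof (rule that[of "sqrt (D * C0)"])
    show "sqrt (D * C0) > 0" using D C0 by simp
    fix E G assume E: "E \<in> lmeasurable" and G: "time_simple M E G"
    have Es: "E \<in> sets lebesgue" using E by auto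
    let ?u = "1/(1-\<beta>)"
    define N where "N = (LINT t|lebesgue_on E. nrm M ?u (G t) powr p) powr (1/p)"
    define \<phi> where "\<phi> t = indicator E t *\<^sub>R nrm M ?u (G t)" for t :: real
    have ii: "integrable (lebesgue_on E) (\<lambda>t. nrm M ?u (G t) powr p)"
      by (rule time_simple_nrm_integrable[OF E G])
    have "(\<lambda>t. nrm M ?u (G t) powr 1) \<in> borel_measurable (lebesgue_on E)"
      using time_simple_nrm_integrable[OF E G] by (rule borel_measurable_integrable)
    then have \<phi>m: "\<phi> \<in> borel_measurable lebesgue"
      unfolding \<phi>_def using Es by (simp add: borel_measurable_restrict_space_iff)
    have \<phi>0: "0 \<le> \<phi> s" for s by (simp add: \<phi>_def)
    have N0: "0 \<le> N" by (simp add: N_def)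
    have NI: "(\<integral>\<^sup>+s. ennreal (\<phi> s powr p) \<partial>lebesgue) \<le> ennreal (N powr p)"
    proof -
      have "(\<integral>\<^sup>+s. ennreal (\<phi> s powr p) \<partial>lebesgue)
        = (\<integral>\<^sup>+s. ennreal (nrm M ?u (G s) powr p) * indicator E s \<partial>lebesgue)"
        using p1 by (intro nn_integral_cong) (auto simp: \<phi>_def indicator_def)
      also have "\<dots> = (\<integral>\<^sup>+s. ennreal (nrm M ?u (G s) powr p) \<partial>lebesgue_on E)"
        using Es by (simp add: nn_integral_restrict_space)
      also have "\<dots> = ennreal (LINT s|lebesgue_on E. nrm M ?u (G s) powr p)"
        by (rule nn_integral_eq_integral[OF ii]) simp
      also have "(LINT s|lebesgue_on E. nrm M ?u (G s) powr p) = N powr p"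
        using p1 by (simp add: N_def powr_powr integral_nonneg_AE)
      finally show ?thesis by simp
    qed
    have \<kappa>: "cmod (cinner (adj s (G s)) (adj t (G t))) \<le> D * (\<phi> t * \<phi> s * \<bar>s - t\<bar> powr (-lam))"
      if st: "s \<in> E" "t \<in> E" "s \<noteq> t" for s t
    proof -
      have "(B * \<bar>t - s\<bar> powr (-\<sigma>)) powr (1 - 2*\<beta>) = B powr (1 - 2*\<beta>) * \<bar>s - t\<bar> powr (-lam)"
        using B1 by (simp add: powr_mult powr_powr lam abs_minus_commute)
      moreover have "test M (G s)" "test M (G t)" using G st by (auto simp: time_simple_def)
      ultimately show ?thesis using pair_decay[OF st(3) \<beta>, of "G s" "G t"] st
        by (simp add: D_def \<phi>_def mult_ac)
    qed
    have "ennreal ((norm (Tstar E G))\<^sup>2) = ennreal (cmod (cinner (Tstar E G) (Tstar E G)))"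
      by (simp add: cinner_self norm_power)
    also have "\<dots> \<le> (\<integral>\<^sup>+s. \<integral>\<^sup>+t. ennreal (D
      * (\<phi> t * \<phi> s * \<bar>s - t\<bar> powr (-lam))) \<partial>lebesgue_on E \<partial>lebesgue_on E)"
      by (rule Tstar_double_bound[OF E E G G \<kappa>])
    also have "\<dots> \<le> (\<integral>\<^sup>+s. \<integral>\<^sup>+t. ennreal (D * (\<phi> t * \<phi> s * \<bar>s - t\<bar> powr (-lam))) \<partial>lebesgue \<partial>lebesgue)"
      using Es by (auto simp: nn_integral_restrict_space indicator_def intro!: nn_integral_mono)
    also have "\<dots> = ennreal D * (\<integral>\<^sup>+s. \<integral>\<^sup>+t. ennreal (\<phi> t * \<phi> s * \<bar>s - t\<bar> powr (-lam)) \<partial>lebesgue \<partial>lebesgue)"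
    proof -
      interpret L: sigma_finite_measure "lebesgue :: real measure" by (rule sigma_finite_lebesgue)
      note [measurable] = id_measurable_lebesgue \<phi>m
      have m: "(\<lambda>s. \<integral>\<^sup>+t. ennreal (\<phi> t * \<phi> s * \<bar>s - t\<bar> powr (-lam)) \<partial>lebesgue) \<in> borel_measurable lebesgue"
        by (rule L.borel_measurable_nn_integral) measurable
      have "(\<integral>\<^sup>+s. \<integral>\<^sup>+t. ennreal (D * (\<phi> t * \<phi> s * \<bar>s - t\<bar> powr (-lam))) \<partial>lebesgue \<partial>lebesgue) =
        (\<integral>\<^sup>+s. \<integral>\<^sup>+t. ennreal D * ennreal (\<phi> t * \<phi> s * \<bar>s - t\<bar> powr (-lam)) \<partial>lebesgue \<partial>lebesgue)"
        using D \<phi>0 by (simp add: ennreal_mult')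
      also have "\<dots> = (\<integral>\<^sup>+s. ennreal D * (\<integral>\<^sup>+t. ennreal (\<phi> t * \<phi> s * \<bar>s - t\<bar> powr (-lam)) \<partial>lebesgue)
        \<partial>lebesgue)"
        by (intro nn_integral_cong nn_integral_cmult) measurable
      also have "\<dots> = ennreal D * (\<integral>\<^sup>+s. \<integral>\<^sup>+t. ennreal (\<phi> t * \<phi> s * \<bar>s - t\<bar> powr (-lam)) \<partial>lebesgue \<partial>lebesgue)"
        by (rule nn_integral_cmult[OF m])
      finally show ?thesis .
    qed
    also have "\<dots> \<le> ennreal D * ennreal (C0 * N\<^sup>2)" by (intro mult_left_mono HLS[OF \<phi>m \<phi>0 N0 NI]) simp
    also have "\<dots> = ennreal (D * C0 * N\<^sup>2)" using D C0 by (simp flip: ennreal_mult add: mult.assoc)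
    finally have "(norm (Tstar E G))\<^sup>2 \<le> D * C0 * N\<^sup>2" using D C0 by (subst (asm) ennreal_le_iff) auto
    also have "\<dots> = (sqrt (D * C0) * N)\<^sup>2" using D C0 by (simp add: power_mult_distrib)
    finally show "norm (Tstar E G) \<le> sqrt (D * C0) * (LINT t|lebesgue_on E. nrm M ?u (G t) powr p) powr (1/p)"
      unfolding N_def[symmetric] by (rule power2_le_imp_le) (use D C0 N0 in auto)
  qed
qed

text \<open>Uniformity in \<open>\<tau>\<close> is the point: the sum is taken over the levels at a
  fixed scale and over the scales at a fixed level, and the fixed parameter only shifts the
  peak.\<close>

lemma sum_geometric_int_bound:
  fixes \<epsilon> \<gamma> :: real
  assumes "0 < \<epsilon>" "0 < \<gamma>"
  obtains C where "C > 0" "\<And>K \<tau>. finite K \<Longrightarrow> (\<Sum>n\<in>K. 2 powr (- \<epsilon> * \<bar>\<gamma> * real_of_int n - \<tau>\<bar>)) \<le> C"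
proof -
  define q where "q = 2 powr (- \<epsilon> * \<gamma>)"
  have q: "0 < q" "q < 1" using assms by (auto simp: q_def powr_less_one)
  define C where "C = 2 powr (\<epsilon> * \<gamma>) * (2 / (1 - q))"
  show ?thesis
  proof (rule that[of C])
    show "C > 0" using q by (simp add: C_def)
    fix K :: "int set" and \<tau> :: real assume K: "finite K"
    \<comment> \<open>Moving the peak to an integer costs the factor
      \<open>2 powr (\<epsilon> * \<gamma>)\<close>. Each distance to \<open>n0\<close> then occurs
      at most once on either side, which gives two geometric series.\<close>
    define n0 where "n0 = \<lfloor>\<tau> / \<gamma>\<rfloor>"
    have n0: "\<bar>\<gamma> * real_of_int n0 - \<tau>\<bar> \<le> \<gamma>"
    proof -
      have "real_of_int n0 \<le> \<tau> / \<gamma>" "\<tau> / \<gamma> < real_of_int n0 + 1" unfolding n0_def by linarith+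
      then have "\<gamma> * real_of_int n0 \<le> \<tau>" "\<tau> < \<gamma> * real_of_int n0 + \<gamma>" using assms by (auto simp: field_simps)
      then show ?thesis by linarith
    qed
    have trm: "2 powr (- \<epsilon> * \<bar>\<gamma> * real_of_int n - \<tau>\<bar>) \<le> 2 powr (\<epsilon> * \<gamma>) * q ^ nat \<bar>n - n0\<bar>" for n
    proof -
      have "\<gamma> * \<bar>real_of_int (n - n0)\<bar> = \<bar>\<gamma> * real_of_int n - \<gamma> * real_of_int n0\<bar>"
        using assms by (simp add: abs_mult right_diff_distrib[symmetric])
      then have "\<gamma> * \<bar>real_of_int (n - n0)\<bar> - \<gamma> \<le> \<bar>\<gamma> * real_of_int n - \<tau>\<bar>" using n0 by linarith
      then have "- \<epsilon> * \<bar>\<gamma> * real_of_int n - \<tau>\<bar> \<le> - \<epsilon> * (\<gamma> * \<bar>real_of_int (n - n0)\<bar> - \<gamma>)"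
        using assms by (intro mult_left_mono_neg) auto
      then have "2 powr (- \<epsilon> * \<bar>\<gamma> * real_of_int n - \<tau>\<bar>) \<le> 2 powr (\<epsilon> * \<gamma> + (- \<epsilon> * \<gamma>) * real (nat \<bar>n - n0\<bar>))"
        by (simp add: algebra_simps)
      also have "\<dots> = 2 powr (\<epsilon> * \<gamma>) * q ^ nat \<bar>n - n0\<bar>"
        unfolding powr_realpow[OF q(1), symmetric] by (simp only: powr_add q_def powr_powr)
      finally show ?thesis .
    qed
    have half: "(\<Sum>n\<in>K'. q ^ nat \<bar>n - n0\<bar>) \<le> 1 / (1 - q)" if "finite K'" "inj_on (\<lambda>n. nat \<bar>n - n0\<bar>) K'" for K'
    proof -
      have "(\<Sum>n\<in>K'. q ^ nat \<bar>n - n0\<bar>) = (\<Sum>i\<in>(\<lambda>n. nat \<bar>n - n0\<bar>) ` K'. q ^ i)"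
        using that by (simp add: sum.reindex)
      also have "\<dots> \<le> (\<Sum>i. q ^ i)" using that q by (intro sum_le_suminf summable_geometric) auto
      also have "\<dots> = 1 / (1 - q)" using q by (intro suminf_geometric) auto
      finally show ?thesis .
    qed
    have "(\<Sum>n\<in>K. q ^ nat \<bar>n - n0\<bar>) = (\<Sum>n\<in>{n\<in>K. n0 \<le> n}. q ^ nat \<bar>n - n0\<bar>)
      + (\<Sum>n\<in>{n\<in>K. \<not> n0 \<le> n}. q ^ nat \<bar>n - n0\<bar>)"
      using K by (subst sum.union_disjoint[symmetric]) (auto intro!: sum.cong)
    also have "\<dots> \<le> 1/(1-q) + 1/(1-q)" using K by (intro add_mono half) (auto simp: inj_on_def)
    finally have s: "(\<Sum>n\<in>K. q ^ nat \<bar>n - n0\<bar>) \<le> 2/(1-q)" by simp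
    have "(\<Sum>n\<in>K. 2 powr (- \<epsilon> * \<bar>\<gamma> * real_of_int n - \<tau>\<bar>)) \<le> (\<Sum>n\<in>K. 2 powr (\<epsilon> * \<gamma>) * q ^ nat \<bar>n - n0\<bar>)"
      by (intro sum_mono trm)
    also have "\<dots> = 2 powr (\<epsilon> * \<gamma>) * (\<Sum>n\<in>K. q ^ nat \<bar>n - n0\<bar>)" by (simp add: sum_distrib_left)
    also have "\<dots> \<le> C" unfolding C_def using s by (intro mult_left_mono) auto
    finally show "(\<Sum>n\<in>K. 2 powr (- \<epsilon> * \<bar>\<gamma> * real_of_int n - \<tau>\<bar>)) \<le> C" .
  qed
qed

text \<open>The nonnegative power of \<open>\<delta>\<close> is the gain on short intervals. It
  comes from Hoelder's inequality for \<open>g t powr s\<close> with exponent \<open>2/s\<close>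
  against the constant 1.\<close>

lemma time_Holder:
  fixes E :: "real set"
  assumes E: "E \<in> lmeasurable" "measure lebesgue E \<le> \<delta>"
    and g: "simple_function (lebesgue_on E) g" "\<And>t. 0 \<le> g t"
    and s: "1 \<le> s" "s \<le> 2" and \<delta>: "0 < \<delta>"
  shows "(LINT t|lebesgue_on E. g t powr s) powr (1/s) \<le> \<delta> powr (1/s - 1/2)
    * sqrt (LINT t|lebesgue_on E. (g t)\<^sup>2)"
proof -
  let ?L = "lebesgue_on E"
  have Es: "E \<in> sets lebesgue" using E by auto
  define N where "N = (LINT t|?L. (g t)\<^sup>2)"
  have N0: "N \<ge> 0" by (simp add: N_def integral_nonneg_AE)
  have i2: "integrable ?L (\<lambda>t. (g t)\<^sup>2)"
    using simple_function_compose1[OF g(1), of "\<lambda>x. x\<^sup>2"] by (rule simple_lebesgue_integrable[OF E(1)])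
  have isb: "integrable ?L (\<lambda>t. g t powr s)"
    using simple_function_compose1[OF g(1), of "\<lambda>x. x powr s"] by (rule simple_lebesgue_integrable[OF E(1)])
  have f: "Lp_bound ?L (s/2) (\<lambda>t. g t powr s) (N powr (s/2))"
  proof -
    have "(\<integral>\<^sup>+t. ennreal (\<bar>g t powr s\<bar> powr (1/(s/2))) \<partial>?L) = (\<integral>\<^sup>+t. ennreal ((g t)\<^sup>2) \<partial>?L)"
      using s g(2) by (intro nn_integral_cong) (simp add: powr_powr)
    also have "\<dots> = ennreal N" unfolding N_def by (rule nn_integral_eq_integral[OF i2]) simp
    finally show ?thesis using s N0 isb by (simp add: Lp_bound_def powr_powr borel_measurable_integrable)
  qed
  have o: "Lp_bound ?L (1 - s/2) (\<lambda>t. 1) (\<delta> powr (1 - s/2))"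
  proof (cases "s = 2")
    case False
    have "emeasure ?L (space ?L) = ennreal (measure lebesgue E)"
      using E Es by (simp add: space_restrict_space emeasure_restrict_space emeasure_eq_measure2)
    then show ?thesis using False s \<delta> E by (simp add: Lp_bound_def powr_powr ennreal_leI)
  qed (use \<delta> in \<open>simp add: Lp_bound_def\<close>)
  have "ennreal (LINT t|?L. g t powr s) = (\<integral>\<^sup>+t. ennreal (g t powr s) \<partial>?L)"
    by (rule nn_integral_eq_integral[OF isb, symmetric]) simp
  also have "\<dots> = (\<integral>\<^sup>+t. ennreal (\<bar>g t powr s\<bar> * \<bar>1\<bar>) \<partial>?L)" by simp
  also have "\<dots> \<le> ennreal (N powr (s/2) * \<delta> powr (1 - s/2))" using s by (intro Lp_bound_Holder[OF f o]) auto
  finally have "(LINT t|?L. g t powr s) \<le> N powr (s/2) * \<delta> powr (1 - s/2)"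
    by (subst (asm) ennreal_le_iff) auto
  then have "(LINT t|?L. g t powr s) powr (1/s) \<le> (N powr (s/2) * \<delta> powr (1 - s/2)) powr (1/s)"
    using s by (intro powr_mono2) (auto simp: integral_nonneg_AE)
  also have "\<dots> = N powr (1/2) * \<delta> powr ((1 - s/2) * (1/s))" using s by (simp add: powr_mult powr_powr)
  also have "(1 - s/2) * (1/s) = 1/s - 1/2" using s by (simp add: field_simps)
  finally show ?thesis using N0 by (simp add: N_def powr_half_sqrt mult.commute)
qed

section \<open>Whitney decomposition on the level of dyadic indices\<close>

lemma sum_lessThan_double: "(\<Sum>m<2*K. h m)
  = (\<Sum>m<K. h (2*m) + h (Suc (2*m)))" for h :: "nat \<Rightarrow> 'a::comm_monoid_add"
  by (induction K) (auto simp: add.assoc)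

definition adjacent :: "nat \<Rightarrow> nat \<Rightarrow> bool" where "adjacent m n \<longleftrightarrow> m \<le> Suc n \<and> n \<le> Suc m"

lemma adjacent_div2: "adjacent m n \<Longrightarrow> adjacent (m div 2) (n div 2)"
  unfolding adjacent_def by linarith

text \<open>A telescoping form of the Whitney decomposition: the pairs that become separated at scale \<open>j + 1\<close>
  are collected, and the adjacent pairs on the finest scale remain.\<close>

lemma whitney_sum:
  fixes v w :: "nat \<Rightarrow> nat \<Rightarrow> 'h::chilbert_space"
  assumes v: "\<And>j m. v j m = v (Suc j) (2*m) + v (Suc j) (Suc (2*m))"
    and w: "\<And>j m. w j m = w (Suc j) (2*m) + w (Suc j) (Suc (2*m))"
  shows "cinner (v 0 0) (w 0 0) =
    (\<Sum>j<N. \<Sum>m<2^Suc j. \<Sum>n<2^Suc j. if adjacent (m div 2) (n div 2) \<and> \<not> adjacent m n then cinner (v (Suc j) m)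
      (w (Suc j) n) else 0)
    + (\<Sum>m<2^N. \<Sum>n<2^N. if adjacent m n then cinner (v N m) (w N n) else 0)"
proof (induction N)
  case 0
  then show ?case by (simp add: adjacent_def)
next
  case (Suc N)
  let ?c = "\<lambda>j m n. cinner (v j m) (w j n)"
  have "(\<Sum>m<2^N. \<Sum>n<2^N. if adjacent m n then ?c N m n else 0) =
    (\<Sum>m<2^Suc N. \<Sum>n<2^Suc N. if adjacent (m div 2) (n div 2) then ?c (Suc N) m n else 0)"
    unfolding power_Suc sum_lessThan_double
    by (intro sum.cong refl)
      (auto simp: sum.distrib[symmetric] v[of N] w[of N] cinner_add_left cinner_add_right add_ac intro!:
        sum.cong)
  \<comment> \<open>Adjacent children have adjacent parents, so the second summand is the remainder
    of the next stage without further condition, and the first is what this stage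
    contributes.\<close>
  also have "\<dots> = (\<Sum>m<2^Suc N. \<Sum>n<2^Suc N.
    (if adjacent (m div 2) (n div 2) \<and> \<not> adjacent m n then ?c (Suc N) m n else 0)
      + (if adjacent m n then ?c (Suc N) m n else 0))"
    using adjacent_div2 by (intro sum.cong refl) auto
  finally show ?case using Suc by (simp add: sum.distrib)
qed

section \<open>Level sets of a function relative to its norm\<close>

definition level_scale :: "'x measure \<Rightarrow> real \<Rightarrow> ('x \<Rightarrow> complex) \<Rightarrow> real" where
  "level_scale M p f = (if nrm M p f = 0 then 1 else nrm M p f)"

text \<open>The thresholds are multiples of the norm of \<open>f\<close> itself, which makes the
  pieces homogeneous: the same index \<open>k\<close> can be used for all \<open>G t\<close>,
  whatever their sizes.\<close>

definition level :: "'x measure \<Rightarrow> real \<Rightarrow> int \<Rightarrow> ('x \<Rightarrow> complex) \<Rightarrow> 'x \<Rightarrow> complex" where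
  "level M p k f = (\<lambda>x. if 2 powr k * level_scale M p f \<le> cmod (f x) \<and> cmod (f x) < 2 powr (k + 1)
    * level_scale M p f then f x else 0)"

lemma level_scale_pos: "0 < level_scale M p f"
  by (simp add: level_scale_def less_le)

lemma test_level: "test M f \<Longrightarrow> test M (level M p k f)"
  unfolding level_def using test_compose[of M f "\<lambda>z.
    if 2 powr k * level_scale M p f \<le> cmod z \<and> cmod z < 2 powr (k + 1) * level_scale M p f then z else 0"]
    by simp

lemma level_index: "z \<noteq> 0 \<Longrightarrow> 0 < s \<Longrightarrow>
  (2 powr real_of_int k * s \<le> cmod z \<and> cmod z < 2 powr (real_of_int k + 1) * s) \<longleftrightarrow> k = \<lfloor>log 2 (cmod z / s)\<rfloor>"
proof -
  assume z: "z \<noteq> 0" "0 < s"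
  then have q: "cmod z / s > 0" by simp
  have "2 powr real_of_int k * s \<le> cmod z \<longleftrightarrow> 2 powr real_of_int k \<le> cmod z / s"
    using z by (simp add: field_simps)
  also have "\<dots> \<longleftrightarrow> real_of_int k \<le> log 2 (cmod z / s)" using q by (subst le_log_iff) auto
  finally have 1: "2 powr real_of_int k * s \<le> cmod z \<longleftrightarrow> real_of_int k \<le> log 2 (cmod z / s)" .
  have "cmod z < 2 powr (real_of_int k + 1) * s \<longleftrightarrow> cmod z / s < 2 powr (real_of_int k + 1)"
    using z by (simp add: field_simps)
  also have "\<dots> \<longleftrightarrow> log 2 (cmod z / s) < real_of_int k + 1" using q by (subst log_less_iff) auto
  finally have 2: "cmod z < 2 powr (real_of_int k + 1) * s \<longleftrightarrow> log 2 (cmod z / s) < real_of_int k + 1" .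
  show ?thesis unfolding 1 2 eq_commute[of k] floor_eq_iff ..
qed

lemma level_eq: "level M p k f x = (if f x \<noteq> 0 \<and> k
  = \<lfloor>log 2 (cmod (f x) / level_scale M p f)\<rfloor> then f x else 0)"
  using level_index[of "f x" "level_scale M p f" k] level_scale_pos[of M p f]
    by (cases "f x = 0") (auto simp: level_def)

text \<open>The ratio under the root is at most \<open>1\<close>, so the exponent \<open>1/2\<close> may replace \<open>1/e\<close> for every
  \<open>e \<in> [1, 2]\<close> in \<open>nrm_level_le\<close>, and it makes the squares of the parts summable over \<open>k\<close>.\<close>

definition level_part :: "'x measure \<Rightarrow> real \<Rightarrow> int \<Rightarrow> ('x \<Rightarrow> complex) \<Rightarrow> real" where
  "level_part M p k f = nrm M p f * sqrt
    ((LINT x|M. cmod (level M p k f x) powr p) / level_scale M p f powr p)"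

lemma level_part_nonneg: "0 \<le> level_part M p k f"
  by (simp add: level_part_def integral_nonneg_AE)

lemma level_sum: 
  assumes "finite K" "f x \<noteq> 0 \<Longrightarrow> \<lfloor>log 2 (cmod (f x) / level_scale M p f)\<rfloor> \<in> K"
  shows "f x = (\<Sum>k\<in>K. level M p k f x)"
proof (cases "f x = 0")
  case False
  then have "(\<Sum>k\<in>K. level M p k f x) = (\<Sum>k\<in>K.
    if k = \<lfloor>log 2 (cmod (f x) / level_scale M p f)\<rfloor> then f x else 0)"
    by (simp add: level_eq)
  also have "\<dots> = f x" using assms False by simp
  finally show ?thesis by simp
qed (simp add: level_eq)

text \<open>Distinct levels have disjoint supports, so the integrals of their powers
  \<open>p\<close> add up to at most that of \<open>f\<close>; the square root in
  \<open>level_part\<close> turns this into a bound for squares.\<close>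

lemma sum_level_part:
  assumes f: "test M f" and p: "0 < p" and K: "finite K"
  shows "(\<Sum>k\<in>K. (level_part M p k f)\<^sup>2) \<le> (nrm M p f)\<^sup>2"
proof (cases "nrm M p f = 0")
  case False
  then have c: "level_scale M p f = nrm M p f" "nrm M p f > 0" by (auto simp: level_scale_def less_le)
  have "(\<Sum>k\<in>K. LINT x|M. cmod (level M p k f x) powr p) = (LINT x|M. (\<Sum>k\<in>K. cmod (level M p k f x) powr p))"
    by (intro Bochner_Integration.integral_sum[symmetric] test_integrable_powr test_level f)
  also have "\<dots> \<le> (LINT x|M. cmod (f x) powr p)"
  proof (rule integral_mono)
    show "integrable M (\<lambda>x. \<Sum>k\<in>K. cmod (level M p k f x) powr p)"
      by (intro Bochner_Integration.integrable_sum test_integrable_powr test_level f)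
    show "integrable M (\<lambda>x. cmod (f x) powr p)" by (rule test_integrable_powr[OF f])
    fix x
    have "(\<Sum>k\<in>K. cmod (level M p k f x) powr p)
      = (\<Sum>k\<in>K. if k = \<lfloor>log 2 (cmod (f x) / level_scale M p f)\<rfloor> then cmod (f x) powr p else 0)"
      by (intro sum.cong) (auto simp: level_eq)
    also have "\<dots> \<le> cmod (f x) powr p" using K by simp
    finally show "(\<Sum>k\<in>K. cmod (level M p k f x) powr p) \<le> cmod (f x) powr p" .
  qed
  also have "\<dots> = nrm M p f powr p" using p by (simp add: nrm_powr)
  finally have s: "(\<Sum>k\<in>K. LINT x|M. cmod (level M p k f x) powr p) \<le> nrm M p f powr p" .
  have "(\<Sum>k\<in>K. (level_part M p k f)\<^sup>2)
    = (\<Sum>k\<in>K. (nrm M p f)\<^sup>2 * ((LINT x|M. cmod (level M p k f x) powr p) / nrm M p f powr p))"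
    by (simp add: level_part_def power_mult_distrib c integral_nonneg_AE)
  also have "\<dots> = (nrm M p f)\<^sup>2 * ((\<Sum>k\<in>K. LINT x|M. cmod (level M p k f x) powr p) / nrm M p f powr p)"
    by (simp add: sum_distrib_left sum_divide_distrib)
  also have "\<dots> \<le> (nrm M p f)\<^sup>2 * 1" using s c by (intro mult_left_mono) (auto simp: divide_le_eq)
  finally show ?thesis by simp
qed (simp add: level_part_def)

text \<open>On the level the modulus lies between the threshold \<open>h\<close> and
  \<open>2*h\<close>. Trading the exponent \<open>p\<close> for \<open>e\<close> thus costs
  \<open>h powr (e-p)\<close> and, both exponents being in \<open>[1, 2]\<close>, a factor at most
  2. The power of 2 depending on \<open>k\<close> that results is the source of all decay in the
  level index.\<close>

lemma nrm_level_le: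
  assumes f: "test M f" and p: "1 \<le> p" "p \<le> 2" and e: "1 \<le> e" "e \<le> 2"
  shows "nrm M e (level M p k f) \<le> 2 * 2 powr (k * (1 - p/e)) * level_part M p k f"
proof (cases "nrm M p f = 0")
  case True
  then have "AE x in M. f x = 0" using nrm_eq_0_AE[OF f _ True] p by simp
  then have "AE x in M. level M p k f x = 0" by eventually_elim (simp add: level_eq)
  then have "nrm M e (level M p k f) = 0" by (rule nrm_AE_0)
  then show ?thesis using level_part_nonneg[of M p k f] by simp
next
  case False
  define \<nu> where "\<nu> = nrm M p f"
  have \<nu>: "level_scale M p f = \<nu>" "\<nu> > 0" using False by (auto simp: level_scale_def less_le \<nu>_def)
  define g where "g = level M p k f"
  define h where "h = 2 powr real_of_int k * \<nu>"
  have h: "h > 0" using \<nu> by (simp add: h_def)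
  define X where "X = (LINT x|M. cmod (g x) powr p) / \<nu> powr p"
  have gt: "test M g" unfolding g_def by (rule test_level[OF f])
  have X0: "X \<ge> 0" by (simp add: X_def integral_nonneg_AE)
  have X1: "X \<le> 1"
  proof -
    have "(LINT x|M. cmod (g x) powr p) \<le> (LINT x|M. cmod (f x) powr p)"
      using p by (intro integral_mono test_integrable_powr gt f) (auto simp: g_def level_def)
    also have "\<dots> = \<nu> powr p" using p by (simp add: nrm_powr \<nu>_def)
    finally show ?thesis using \<nu> by (simp add: X_def divide_le_eq)
  qed
  have pt: "cmod (g x) powr e \<le> 2 * h powr (e-p) * cmod (g x) powr p" for x
  proof (cases "g x = 0")
    case False
    have gx: "h \<le> cmod (g x)" "cmod (g x) \<le> 2 * h"
      using False unfolding g_def level_def \<nu> h_def by (auto simp: powr_add split: if_splits)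
    have "cmod (g x) powr (e-p) \<le> 2 * h powr (e-p)"
    proof (cases "e \<ge> p")
      case True
      then have "cmod (g x) powr (e-p) \<le> (2 * h) powr (e-p)" using gx by (intro powr_mono2) auto
      also have "\<dots> = 2 powr (e-p) * h powr (e-p)" using h by (simp add: powr_mult)
      also have "\<dots> \<le> 2 powr 1 * h powr (e-p)" using e p by (intro mult_right_mono powr_mono) auto
      finally show ?thesis by simp
    next
      case False
      then have "cmod (g x) powr (e-p) \<le> h powr (e-p)" using gx h by (intro powr_mono2') auto
      also have "\<dots> \<le> 2 * h powr (e-p)" by simp
      finally show ?thesis .
    qed
    then have "cmod (g x) powr (e-p) * cmod (g x) powr p \<le> 2 * h powr (e-p) * cmod (g x) powr p"
      by (intro mult_right_mono) auto
    then show ?thesis by (simp add: powr_add[symmetric])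
  qed simp
  have "(LINT x|M. cmod (g x) powr e) \<le> (LINT x|M. 2 * h powr (e-p) * cmod (g x) powr p)"
    using pt by (intro integral_mono integrable_mult_right test_integrable_powr gt)
  also have "\<dots> = 2 * h powr (e-p) * (\<nu> powr p * X)" using \<nu> by (simp add: X_def)
  finally have "nrm M e g \<le> (2 * h powr (e-p) * (\<nu> powr p * X)) powr (1/e)"
    unfolding nrm_def using e by (intro powr_mono2) (auto simp: integral_nonneg_AE)
  also have "\<dots> = 2 powr (1/e) * (h powr ((e-p)*(1/e)) * (\<nu> powr (p*(1/e)) * X powr (1/e)))"
    using X0 by (simp add: powr_mult powr_powr)
  also have "h powr ((e-p)*(1/e)) = 2 powr (k * (1 - p/e)) * \<nu> powr (1 - p/e)"
  proof -
    have "(e-p)*(1/e) = 1 - p/e" using e by (simp add: field_simps)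
    then show ?thesis using \<nu> by (simp add: h_def powr_mult powr_powr)
  qed
  also have "2 powr (1/e) * (2 powr (k * (1 - p/e)) * \<nu> powr (1 - p/e) * (\<nu> powr (p*(1/e)) * X powr (1/e)))
     = 2 powr (1/e) * (2 powr (k * (1 - p/e)) * (\<nu> powr (1 - p/e) * \<nu> powr (p*(1/e))) * X powr (1/e))"
       by (simp add: mult_ac)
  also have "\<nu> powr (1 - p/e) * \<nu> powr (p*(1/e)) = \<nu>" using \<nu> by (simp add: powr_add[symmetric])
  also have "2 powr (1/e) * (2 powr (k * (1 - p/e)) * \<nu> * X powr (1/e)) \<le> 2
    * (2 powr (k * (1 - p/e)) * \<nu> * sqrt X)"
  proof (rule mult_mono)
    have "2 powr (1/e) \<le> 2 powr (1::real)" using e by (intro powr_mono) auto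
    then show "2 powr (1/e) \<le> (2::real)" by simp
    have "X powr (1/e) \<le> X powr (1/2)" using X0 X1 e by (intro powr_mono') (auto simp: field_simps)
    then show "2 powr (k * (1 - p/e)) * \<nu> * X powr (1/e) \<le> 2 powr (k * (1 - p/e)) * \<nu> * sqrt X"
      using \<nu> X0 by (intro mult_left_mono) (auto simp: powr_half_sqrt)
  qed (use \<nu> X0 in auto)
  finally show ?thesis by (simp add: g_def level_part_def X_def \<nu>(1) mult_ac flip: \<nu>_def)
qed

text \<open>The left-hand sides are the exponents of the bounds for a pair of level pieces that come from the
  dispersive inequality and, in the two others, from Cauchy--Schwarz with the energy estimate for one
  piece and a non-endpoint Strichartz estimate for the other.\<close>

lemma three_exponents:
  fixes \<alpha> \<eta> a c :: real
  assumes \<alpha>: "0 < \<alpha>" and \<eta>: "0 < \<eta>"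
  defines "\<epsilon> \<equiv> min (\<alpha>/3) (\<eta>/6)"
  shows "- \<alpha> * (a + c) \<le> - \<epsilon> * (\<bar>a\<bar> + \<bar>c\<bar>) \<or> \<eta> * a + \<eta>/4 * c \<le> - \<epsilon> * (\<bar>a\<bar> + \<bar>c\<bar>) \<or> \<eta>/4 * a + \<eta> * c \<le> - \<epsilon>
    * (\<bar>a\<bar> + \<bar>c\<bar>)"
proof -
  define S where "S = \<bar>a\<bar> + \<bar>c\<bar>"
  have S: "0 \<le> S" by (simp add: S_def)
  have e1: "\<epsilon> * S \<le> \<alpha> * (S/3)" and e2: "\<epsilon> * S \<le> \<eta> * (S/6)"
    using S mult_right_mono[of \<epsilon> "\<alpha>/3" S] mult_right_mono[of \<epsilon> "\<eta>/6" S] by (auto simp: \<epsilon>_def)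
  have first: "- \<alpha> * (a + c) \<le> - \<epsilon> * S" if "S/3 \<le> a + c"
  proof -
    have "\<alpha> * (S/3) \<le> \<alpha> * (a + c)" using that \<alpha> by (intro mult_left_mono) auto
    then show ?thesis using e1 by linarith
  qed
  have second: "\<eta> * a + \<eta>/4 * c \<le> - \<epsilon> * S" if "a + c/4 \<le> - S/6"
    using mult_left_mono[OF that, of \<eta>] \<eta> e2 by (simp add: algebra_simps)
  have third: "\<eta>/4 * a + \<eta> * c \<le> - \<epsilon> * S" if "a/4 + c \<le> - S/6"
    using mult_left_mono[OF that, of \<eta>] \<eta> e2 by (simp add: algebra_simps)
  \<comment> \<open>The thresholds match when the signs differ: for \<open>c < 0 \<le> a\<close> the
    first and the third alternative meet at \<open>a = -2 * c\<close>, where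
    \<open>S = -3 * c\<close>.\<close>
  have "S/3 \<le> a + c \<or> a + c/4 \<le> - S/6 \<or> a/4 + c \<le> - S/6"
    unfolding S_def by (auto simp: abs_if)
  then show ?thesis using first second third unfolding S_def by blast
qed

section \<open>Bounds for a pair of level pieces on separated time sets\<close>

context dispersive
begin

lemma time_simple_level: "time_simple M E G \<Longrightarrow> time_simple M E (\<lambda>t. level M p k (G t))"
  by (rule time_simple_compose) (auto intro: test_level simp: time_simple_def)

lemma level_part_simple: "time_simple M E G \<Longrightarrow> simple_function (lebesgue_on E) (\<lambda>t. level_part M p k (G t))"
  unfolding time_simple_def using simple_function_compose1[of "lebesgue_on E" G "level_part M p k"] by blast

text \<open>A single quantity, the square mean in time of \<open>level_part\<close>, controls the
  piece in every mixed norm with exponents in \<open>[1, 2]\<close>; the exponents survive only in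
  powers of 2 and \<open>\<delta>\<close>. This makes the different estimates for one pair of pieces
  comparable.\<close>

lemma level_time_bound:
  assumes E: "E \<in> lmeasurable" "measure lebesgue E \<le> \<delta>" "0 < \<delta>" and G: "time_simple M E G"
    and p: "1 \<le> p" "p \<le> 2" and e: "1 \<le> e" "e \<le> 2" and s: "1 \<le> s" "s \<le> 2"
  shows "(LINT t|lebesgue_on E. nrm M e (level M p k (G t)) powr s) powr (1/s)
     \<le> 2 * 2 powr (k * (1 - p/e)) * \<delta> powr (1/s - 1/2)
       * sqrt (LINT t|lebesgue_on E. (level_part M p k (G t))\<^sup>2)"
proof -
  let ?L = "lebesgue_on E"
  define c where "c = 2 * 2 powr (k * (1 - p/e))"
  have c: "c > 0" by (simp add: c_def)
  have i1: "integrable ?L (\<lambda>t. nrm M e (level M p k (G t)) powr s)"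
    by (rule time_simple_nrm_integrable[OF E(1) time_simple_level[OF G]])
  have i2: "integrable ?L (\<lambda>t. level_part M p k (G t) powr s)"
    using simple_function_compose1[OF level_part_simple[OF G], of "\<lambda>x. x powr s"]
      by (rule simple_lebesgue_integrable[OF E(1)])
  have "(LINT t|?L. nrm M e (level M p k (G t)) powr s)
    \<le> (LINT t|?L. c powr s * level_part M p k (G t) powr s)"
  proof (rule integral_mono[OF i1])
    show "integrable ?L (\<lambda>t. c powr s * level_part M p k (G t) powr s)" using i2 by simp
    fix t assume "t \<in> space ?L"
    then have "test M (G t)" using G by (simp add: time_simple_def space_restrict_space)
    then have "nrm M e (level M p k (G t)) \<le> c * level_part M p k (G t)" unfolding c_def
      by (rule nrm_level_le[OF _ p e])
    then have "nrm M e (level M p k (G t)) powr s \<le> (c * level_part M p k (G t)) powr s"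
      using s by (intro powr_mono2) auto
    also have "\<dots> = c powr s * level_part M p k (G t) powr s" by (rule powr_mult)
    finally show "nrm M e (level M p k (G t)) powr s \<le> c powr s * level_part M p k (G t) powr s" .
  qed
  then have "(LINT t|?L. nrm M e (level M p k (G t)) powr s) powr (1/s)
    \<le> (c powr s * (LINT t|?L. level_part M p k (G t) powr s)) powr (1/s)"
    using s by (intro powr_mono2) (auto simp: integral_nonneg_AE)
  also have "\<dots> = c * (LINT t|?L. level_part M p k (G t) powr s) powr (1/s)"
    using s c by (simp add: powr_mult powr_powr)
  also have "\<dots> \<le> c * (\<delta> powr (1/s - 1/2) * sqrt (LINT t|?L. (level_part M p k (G t))\<^sup>2))"
    using c by (intro mult_left_mono time_Holder E s level_part_simple G level_part_nonneg) auto
  finally show ?thesis by (simp add: c_def mult_ac)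
qed

text \<open>All available bounds are one and the same product times powers of 2 that are linear in
  \<open>a = p*k - \<sigma>*j\<close> and \<open>c = p*l - \<sigma>*j\<close>. The critical level on
  scale \<open>j\<close> is where these vanish, and \<open>three_exponents\<close> selects for each
  pair of levels a bound that decays away from it.\<close>

lemma endpoint_pair:
  assumes \<sigma>1: "1 < \<sigma>" and \<alpha>: "\<alpha> = (\<sigma>-1)/(2*\<sigma>)" and p: "p = 1/(1-\<alpha>)"
  obtains C \<epsilon> where "C > 0" "\<epsilon> > 0"
    "\<And>E E' G j k l. E \<in> lmeasurable \<Longrightarrow> E' \<in> lmeasurable \<Longrightarrow> measure lebesgue E \<le> 2 powr (1 - real j) \<Longrightarrow>
      measure lebesgue E' \<le> 2 powr (1 - real j) \<Longrightarrow> (\<And>s t. s \<in> E \<Longrightarrow> t \<in> E' \<Longrightarrow> 2 powr (1 - real j) \<le> \<bar>t - s\<bar>) \<Longrightarrow>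
      time_simple M E G \<Longrightarrow> time_simple M E' G \<Longrightarrow>
      cmod (cinner (Tstar E (\<lambda>t. level M p k (G t))) (Tstar E' (\<lambda>t. level M p l (G t))))
      \<le> C * 2 powr (- \<epsilon> * (\<bar>p * real_of_int k - \<sigma> * real j\<bar> + \<bar>p * real_of_int l - \<sigma> * real j\<bar>))
          * (sqrt (LINT t|lebesgue_on E. (level_part M p k (G t))\<^sup>2)
            * sqrt (LINT t|lebesgue_on E'. (level_part M p l (G t))\<^sup>2))"
proof -
  \<comment> \<open>\<open>\<eta>\<close> is the distance from \<open>\<alpha>\<close> to the energy
    value \<open>1/2\<close>. The intermediate \<open>\<rho>\<close> lies a quarter of the way up,
    where the kernel exponent is \<open>3/4\<close> instead of the critical 1 and the time exponent
    is \<open>8/5\<close>. With \<open>\<rho> = \<alpha>\<close> the argument would be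
    circular.\<close>
  define \<eta> where "\<eta> = 1/(2*\<sigma>)"
  define \<rho> where "\<rho> = \<alpha> + \<eta>/4"
  define r where "r = 1/(1-\<rho>)"
  have par: "0 < \<alpha>" "0 < \<eta>" "\<alpha> + \<eta> = 1/2" "\<eta> * \<sigma> = 1/2" "2 * \<alpha> * \<sigma> = \<sigma> - 1"
    using \<sigma>1 by (simp_all add: \<alpha> \<eta>_def field_simps)
  have pp: "p * (1 - \<alpha>) = 1" "1 < p" "p \<le> 2"
    using par by (simp_all add: p field_simps)
  have \<rho>: "0 < \<rho>" "\<rho> < 1/2" using par by (auto simp: \<rho>_def)
  have r: "1 \<le> r" "r \<le> 2" using \<rho> by (simp_all add: r_def field_simps)
  have lam: "3/4 = \<sigma> * (1 - 2*\<rho>)"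
  proof -
    have "1 - 2*\<rho> = 3/2 * \<eta>" using par(3) by (simp add: \<rho>_def)
    then have "\<sigma> * (1 - 2*\<rho>) = 3/2 * (\<eta> * \<sigma>)" by (simp only:) simp
    then show ?thesis using par(4) by simp
  qed
  have s85: "8/5 = 2/(2 - 3/4 :: real)" by simp
  obtain C1 where C1: "C1 > 0" and S1: "\<And>E G. E \<in> lmeasurable \<Longrightarrow> time_simple M E G \<Longrightarrow>
     norm (Tstar E G) \<le> C1 * (LINT t|lebesgue_on E. nrm M r (G t) powr (8/5)) powr (1/(8/5))"
    unfolding r_def by (rule strichartz_nonendpoint[OF _ _ lam _ s85]) (use \<rho> in auto)
  define \<epsilon> where "\<epsilon> = min (\<alpha>/3) (\<eta>/6)"
  define C where "C = 4 * B + 8 * (A * C1)"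
  have C: "C > 0" "4 * B \<le> C" "8 * (A * C1) \<le> C" using A1 B1 C1 by (auto simp: C_def add_pos_pos)
  show ?thesis
  proof (rule that[of C \<epsilon>])
    show "C > 0" by fact
    show "\<epsilon> > 0" using par by (simp add: \<epsilon>_def)
    fix E E' :: "real set" and G :: "real \<Rightarrow> 'x \<Rightarrow> complex" and j :: nat and k l :: int
    assume E: "E \<in> lmeasurable" and E': "E' \<in> lmeasurable" and mE: "measure lebesgue E \<le> 2 powr (1 - real j)"
      and mE': "measure lebesgue E' \<le> 2 powr (1 - real j)"
        and sep: "\<And>s t. s \<in> E \<Longrightarrow> t \<in> E' \<Longrightarrow> 2 powr (1 - real j) \<le> \<bar>t - s\<bar>"
      and G: "time_simple M E G" and G': "time_simple M E' G"
    define \<delta> where "\<delta> = 2 powr (1 - real j)"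
    have \<delta>: "\<delta> > 0" by (simp add: \<delta>_def)
    define Gk where "Gk t = level M p k (G t)" for t
    define Gl where "Gl t = level M p l (G t)" for t
    have Gk: "time_simple M E Gk" "time_simple M E' Gk" unfolding Gk_def
      by (rule time_simple_level[OF G] time_simple_level[OF G'])+
    have Gl: "time_simple M E Gl" "time_simple M E' Gl" unfolding Gl_def
      by (rule time_simple_level[OF G] time_simple_level[OF G'])+
    define X where "X = sqrt (LINT t|lebesgue_on E. (level_part M p k (G t))\<^sup>2)"
    define Y where "Y = sqrt (LINT t|lebesgue_on E'. (level_part M p l (G t))\<^sup>2)"
    have XY: "0 \<le> X" "0 \<le> Y" by (auto simp: X_def Y_def integral_nonneg_AE)
    have bk: "(LINT t|lebesgue_on E. nrm M e (Gk t) powr s) powr (1/s) \<le> 2 * 2 powr (k * (1 - p/e))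
      * \<delta> powr (1/s - 1/2) * X"
      if "1 \<le> e" "e \<le> 2" "1 \<le> s" "s \<le> 2" for e s
      unfolding Gk_def X_def by (rule level_time_bound[OF E _ \<delta> G]) (use mE pp that in \<open>auto simp: \<delta>_def\<close>)
    have bl: "(LINT t|lebesgue_on E'. nrm M e (Gl t) powr s) powr (1/s) \<le> 2 * 2 powr (l * (1 - p/e))
      * \<delta> powr (1/s - 1/2) * Y"
      if "1 \<le> e" "e \<le> 2" "1 \<le> s" "s \<le> 2" for e s
      unfolding Gl_def Y_def by (rule level_time_bound[OF E' _ \<delta> G']) (use mE' pp that in \<open>auto simp: \<delta>_def\<close>)
    have int1: "(LINT t|lebesgue_on D. nrm M e (H t)) \<le> K"
      if "(LINT t|lebesgue_on D. nrm M e (H t) powr 1) powr (1/1) \<le> K" for D e H K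
      using that by (simp add: integral_nonneg_AE)
    define a where "a = p * real_of_int k - \<sigma> * real j"
    define c where "c = p * real_of_int l - \<sigma> * real j"
    define Z where "Z = cmod (cinner (Tstar E Gk) (Tstar E' Gl))"
    \<comment> \<open>The separation contributes \<open>\<delta> powr (-\<sigma>)\<close>, and
      passing from square means to integrals over the two time sets contributes
      \<open>\<delta> powr (1/2)\<close> twice.\<close>
    have b0: "Z \<le> C * 2 powr (- \<alpha> * (a + c)) * (X * Y)"
    proof -
      let ?I = "LINT s|lebesgue_on E. nrm M 1 (Gk s)" and ?I' = "LINT t|lebesgue_on E'. nrm M 1 (Gl t)"
      have ik: "integrable (lebesgue_on E) (\<lambda>s. nrm M 1 (Gk s))" "integrable (lebesgue_on E')
        (\<lambda>s. nrm M 1 (Gl s))"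
        using time_simple_nrm_integrable[OF E Gk(1), of 1 1] time_simple_nrm_integrable[OF E' Gl(2), of 1 1]
          by simp_all
      have "ennreal Z \<le> (\<integral>\<^sup>+s. \<integral>\<^sup>+t. ennreal (B * \<delta> powr (-\<sigma>) * nrm M 1 (Gk s)
        * nrm M 1 (Gl t)) \<partial>lebesgue_on E' \<partial>lebesgue_on E)"
        unfolding Z_def
      proof (rule Tstar_double_bound[OF E E' Gk(1) Gl(2)])
        fix s t assume st: "s \<in> E" "t \<in> E'" "s \<noteq> t"
        have "test M (Gk s)" "test M (Gl t)" using Gk Gl st by (auto simp: time_simple_def)
        then have "cmod (cinner (adj s (Gk s)) (adj t (Gl t))) \<le> B * \<bar>t - s\<bar> powr (-\<sigma>) * nrm M 1 (Gk s)
          * nrm M 1 (Gl t)"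
          by (rule pair_dispersive[OF _ _ st(3)])
        also have "\<dots> \<le> B * \<delta> powr (-\<sigma>) * nrm M 1 (Gk s) * nrm M 1 (Gl t)"
        proof -
          have "\<bar>t - s\<bar> powr (-\<sigma>) \<le> \<delta> powr (-\<sigma>)"
            using sep[OF st(1,2)] \<delta> sigma_pos by (intro powr_mono2') (auto simp: \<delta>_def)
          then show ?thesis using B1 by (intro mult_right_mono mult_left_mono) auto
        qed
        finally show "cmod (cinner (adj s (Gk s)) (adj t (Gl t))) \<le> B * \<delta> powr (-\<sigma>) * nrm M 1 (Gk s)
          * nrm M 1 (Gl t)" .
      qed
      also have "\<dots> = (\<integral>\<^sup>+s. ennreal (B * \<delta> powr (-\<sigma>) * nrm M 1 (Gk s) * ?I') \<partial>lebesgue_on E)"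
        using ik B1 by (intro nn_integral_cong) (subst nn_integral_eq_integral; simp)
      also have "\<dots> = ennreal (LINT s|lebesgue_on E. B * \<delta> powr (-\<sigma>) * nrm M 1 (Gk s) * ?I')"
        using ik B1 by (intro nn_integral_eq_integral)
          (auto intro!: AE_I2 mult_nonneg_nonneg simp: integral_nonneg_AE)
      also have "(LINT s|lebesgue_on E. B * \<delta> powr (-\<sigma>) * nrm M 1 (Gk s) * ?I') = B * \<delta> powr (-\<sigma>) * ?I * ?I'"
        by simp
      finally have "Z \<le> B * \<delta> powr (-\<sigma>) * ?I * ?I'"
        using B1 by (subst (asm) ennreal_le_iff) (auto intro!: mult_nonneg_nonneg simp: integral_nonneg_AE)
      also have "\<dots> \<le> B * \<delta> powr (-\<sigma>) * (2 * 2 powr (k * (1 - p/1)) * \<delta> powr (1/1 - 1/2) * X)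
        * (2 * 2 powr (l * (1 - p/1)) * \<delta> powr (1/1 - 1/2) * Y)"
        using B1 XY by (intro mult_mono mult_left_mono int1 bk bl)
          (auto simp: integral_nonneg_AE intro!: mult_nonneg_nonneg)
      also have "\<dots> = 4 * B * (2 powr (k * (1 - p)) * 2 powr (l * (1 - p))
        * (\<delta> powr (-\<sigma>) * \<delta> powr (1/2) * \<delta> powr (1/2))) * (X * Y)"
        by simp
      also have "\<delta> powr (-\<sigma>) * \<delta> powr (1/2) * \<delta> powr (1/2) = 2 powr ((1 - real j) * (1 - \<sigma>))"
        unfolding powr_add[symmetric] by (simp add: \<delta>_def powr_powr)
      also have "2 powr (k * (1 - p)) * 2 powr (l * (1 - p)) * 2 powr ((1 - real j) * (1 - \<sigma>))
         = 2 powr (k * (1 - p) + l * (1 - p) + (1 - real j) * (1 - \<sigma>))" by (simp only: powr_add)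
      also have "k * (1 - p) + l * (1 - p) + (1 - real j) * (1 - \<sigma>) = - \<alpha> * (a + c) + (1 - \<sigma>)"
      proof -
        have ap: "\<alpha> * p = p - 1" using pp(1) by (simp add: algebra_simps)
        have "- \<alpha> * (a + c) = - (\<alpha> * p) * k - (\<alpha> * p) * l + (2 * \<alpha> * \<sigma>) * real j"
          by (simp add: a_def c_def algebra_simps)
        also have "\<dots> = - (p - 1) * k - (p - 1) * l + (\<sigma> - 1) * real j" by (simp only: ap par(5))
        finally show ?thesis by (simp add: algebra_simps)
      qed
      \<comment> \<open>The leftover \<open>1 - \<sigma>\<close> stems from \<open>\<delta>\<close>
        being \<open>2 powr (1 - real j)\<close> rather than \<open>2 powr (- real j)\<close>; it is
        negative because \<open>\<sigma> > 1\<close>.\<close>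
      also have "4 * B * 2 powr (- \<alpha> * (a + c) + (1 - \<sigma>)) * (X * Y) \<le> C * 2 powr (- \<alpha> * (a + c)) * (X * Y)"
        using C \<sigma>1 XY B1 by (intro mult_right_mono mult_mono powr_mono) auto
      finally show ?thesis .
    qed
    have pe: "1 - p/2 = p * \<eta>" "1 - p/r = p * (\<eta>/4)"
    proof -
      have "p/2 = p * (1/2)" by simp
      also have "\<dots> = p * \<alpha> + p * \<eta>" by (simp only: par(3)[symmetric] distrib_left)
      also have "p * \<alpha> = p - 1" using pp(1) by (simp add: algebra_simps)
      finally have p2: "p/2 = p - 1 + p * \<eta>" .
      have "p * \<alpha> = p - 1" using pp(1) by (simp add: algebra_simps)
      moreover have "p/r = p - p * \<alpha> - p * (\<eta>/4)" using \<rho> by (simp add: r_def \<rho>_def algebra_simps)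
      ultimately show "1 - p/r = p * (\<eta>/4)" by simp
      have "1 - p/2 = 1 - p + p/2" by simp
      then show "1 - p/2 = p * \<eta>" using p2 by simp
    qed
    \<comment> \<open>The time exponents 1 and \<open>8/5\<close> contribute \<open>1/2\<close> and
      \<open>1/8\<close>; the factor 2 absorbs \<open>2 powr (5/8)\<close>.\<close>
    have \<delta>58: "\<delta> powr (1/1 - 1/2) * \<delta> powr (1/(8/5) - 1/2) \<le> 2 * 2 powr (- (5/8) * real j)"
    proof -
      have "\<delta> powr (1/1 - 1/2) * \<delta> powr (1/(8/5) - 1/2) = 2 powr ((1 - real j) * (5/8))"
        unfolding powr_add[symmetric] by (simp add: \<delta>_def powr_powr)
      also have "(1 - real j) * (5/8) = 5/8 + (- (5/8) * real j)" by (simp add: left_diff_distrib)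
      also have "2 powr (5/8 + (- (5/8) * real j)) = 2 powr (5/8) * 2 powr (- (5/8) * real j)"
        by (rule powr_add)
      also have "\<dots> \<le> 2 powr 1 * 2 powr (- (5/8) * real j)" by (intro mult_right_mono powr_mono) auto
      finally show ?thesis by simp
    qed
    \<comment> \<open>\<open>5/8 = 1/2 + 1/8\<close> and \<open>\<eta> * \<sigma> = 1/2\<close>: the
      power of 2 in \<open>j\<close> is exactly what completes \<open>p * k\<close> and
      \<open>p * l\<close> to \<open>a\<close> and \<open>c\<close>.\<close>
    have js: "5/8 * real j = \<eta> * (\<sigma> * real j) + \<eta>/4 * (\<sigma> * real j)"
      using par(4) by (simp add: mult.assoc[symmetric])
    have b1: "Z \<le> C * 2 powr (\<eta> * a + \<eta>/4 * c) * (X * Y)"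
    proof -
      have "Z \<le> norm (Tstar E Gk) * norm (Tstar E' Gl)" unfolding Z_def by (rule cinner_Cauchy_Schwarz)
      also have "\<dots> \<le> (A * (2 * 2 powr (k * (1 - p/2)) * \<delta> powr (1/1 - 1/2) * X))
        * (C1 * (2 * 2 powr (l * (1 - p/r)) * \<delta> powr (1/(8/5) - 1/2) * Y))"
      proof (rule mult_mono)
        show "norm (Tstar E Gk) \<le> A * (2 * 2 powr (k * (1 - p/2)) * \<delta> powr (1/1 - 1/2) * X)"
          by (rule order_trans[OF norm_Tstar[OF time_simple_admissible[OF E Gk(1)]]])
            (use A1 in \<open>intro mult_left_mono int1 bk; simp\<close>)
        show "norm (Tstar E' Gl) \<le> C1 * (2 * 2 powr (l * (1 - p/r)) * \<delta> powr (1/(8/5) - 1/2) * Y)"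
          by (rule order_trans[OF S1[OF E' Gl(2)]]) (use C1 r in \<open>intro mult_left_mono bl; simp\<close>)
      qed (use A1 XY in auto)
      also have "\<dots> = 4 * (A * C1) * (2 powr (k * (p * \<eta>)) * 2 powr (l * (p * (\<eta>/4))))
        * (\<delta> powr (1/1 - 1/2) * \<delta> powr (1/(8/5) - 1/2)) * (X * Y)"
        unfolding pe by (simp only: mult_ac)
      also have "\<dots> \<le> 4 * (A * C1) * (2 powr (k * (p * \<eta>)) * 2 powr (l * (p * (\<eta>/4))))
        * (2 * 2 powr (- (5/8) * real j)) * (X * Y)"
        using A1 C1 XY by (intro mult_right_mono mult_left_mono \<delta>58) auto
      also have "\<dots> = 8 * (A * C1) * (2 powr (k * (p * \<eta>)) * 2 powr (l * (p * (\<eta>/4)))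
        * 2 powr (- (5/8) * real j)) * (X * Y)" by simp
      also have "2 powr (k * (p * \<eta>)) * 2 powr (l * (p * (\<eta>/4))) * 2 powr (- (5/8) * real j)
        = 2 powr (\<eta> * a + \<eta>/4 * c)"
        unfolding powr_add[symmetric] a_def c_def
          using js by (intro arg_cong[where f="\<lambda>x. 2 powr x"]) (simp add: algebra_simps)
      also have "8 * (A * C1) * 2 powr (\<eta> * a + \<eta>/4 * c) * (X * Y) \<le> C * 2 powr (\<eta> * a + \<eta>/4 * c) * (X * Y)"
        using C XY by (intro mult_right_mono) auto
      finally show ?thesis .
    qed
    have b2: "Z \<le> C * 2 powr (\<eta>/4 * a + \<eta> * c) * (X * Y)"
    proof -
      have "Z \<le> norm (Tstar E Gk) * norm (Tstar E' Gl)" unfolding Z_def by (rule cinner_Cauchy_Schwarz)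
      also have "\<dots> \<le> (C1 * (2 * 2 powr (k * (1 - p/r)) * \<delta> powr (1/(8/5) - 1/2) * X))
        * (A * (2 * 2 powr (l * (1 - p/2)) * \<delta> powr (1/1 - 1/2) * Y))"
      proof (rule mult_mono)
        show "norm (Tstar E' Gl) \<le> A * (2 * 2 powr (l * (1 - p/2)) * \<delta> powr (1/1 - 1/2) * Y)"
          by (rule order_trans[OF norm_Tstar[OF time_simple_admissible[OF E' Gl(2)]]])
            (use A1 in \<open>intro mult_left_mono int1 bl; simp\<close>)
        show "norm (Tstar E Gk) \<le> C1 * (2 * 2 powr (k * (1 - p/r)) * \<delta> powr (1/(8/5) - 1/2) * X)"
          by (rule order_trans[OF S1[OF E Gk(1)]]) (use C1 r in \<open>intro mult_left_mono bk; simp\<close>)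
      qed (use C1 XY in auto)
      also have "\<dots> = 4 * (A * C1) * (2 powr (k * (p * (\<eta>/4))) * 2 powr (l * (p * \<eta>)))
        * (\<delta> powr (1/1 - 1/2) * \<delta> powr (1/(8/5) - 1/2)) * (X * Y)"
        unfolding pe by (simp only: mult_ac)
      also have "\<dots> \<le> 4 * (A * C1) * (2 powr (k * (p * (\<eta>/4))) * 2 powr (l * (p * \<eta>)))
        * (2 * 2 powr (- (5/8) * real j)) * (X * Y)"
        using A1 C1 XY by (intro mult_right_mono mult_left_mono \<delta>58) auto
      also have "\<dots> = 8 * (A * C1) * (2 powr (k * (p * (\<eta>/4))) * 2 powr (l * (p * \<eta>))
        * 2 powr (- (5/8) * real j)) * (X * Y)" by simp
      also have "2 powr (k * (p * (\<eta>/4))) * 2 powr (l * (p * \<eta>)) * 2 powr (- (5/8) * real j)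
        = 2 powr (\<eta>/4 * a + \<eta> * c)"
        unfolding powr_add[symmetric] a_def c_def
          using js by (intro arg_cong[where f="\<lambda>x. 2 powr x"]) (simp add: algebra_simps)
      also have "8 * (A * C1) * 2 powr (\<eta>/4 * a + \<eta> * c) * (X * Y) \<le> C * 2 powr (\<eta>/4 * a + \<eta> * c) * (X * Y)"
        using C XY by (intro mult_right_mono) auto
      finally show ?thesis .
    qed
    have le: "C * 2 powr m * (X * Y) \<le> C * 2 powr (- \<epsilon> * (\<bar>a\<bar> + \<bar>c\<bar>)) * (X * Y)"
      if "m \<le> - \<epsilon> * (\<bar>a\<bar> + \<bar>c\<bar>)" for m
      using C XY that by (intro mult_right_mono mult_left_mono powr_mono) auto
    have "Z \<le> C * 2 powr (- \<epsilon> * (\<bar>a\<bar> + \<bar>c\<bar>)) * (X * Y)"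
      using three_exponents[OF par(1,2), of a c] b0 b1 b2 le unfolding \<epsilon>_def[symmetric] by (meson order_trans)
    then show "cmod (cinner (Tstar E (\<lambda>t. level M p k (G t))) (Tstar E' (\<lambda>t. level M p l (G t))))
      \<le> C * 2 powr (- \<epsilon> * (\<bar>p * real_of_int k - \<sigma> * real j\<bar> + \<bar>p * real_of_int l - \<sigma> * real j\<bar>))
          * (sqrt (LINT t|lebesgue_on E. (level_part M p k (G t))\<^sup>2)
            * sqrt (LINT t|lebesgue_on E'. (level_part M p l (G t))\<^sup>2))"
      by (simp add: Z_def X_def Y_def a_def c_def Gk_def[abs_def] Gl_def[abs_def])
  qed
qed

end

section \<open>Dyadic intervals of total length 2 and their neighbours\<close>

definition dyadic_box :: "real \<Rightarrow> nat \<Rightarrow> nat \<Rightarrow> real set" where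
  "dyadic_box c j m = {c + 2 * real m / 2^j ..< c + 2 * (real m + 1) / 2^j}"

lemma dyadic_box_split: "dyadic_box c j m = dyadic_box c (Suc j) (2*m) \<union> dyadic_box c (Suc j) (Suc (2*m))"
  "dyadic_box c (Suc j) (2*m) \<inter> dyadic_box c (Suc j) (Suc (2*m)) = {}"
proof -
  have 1: "2 * real m / 2^j = 2 * real (2*m) / 2^Suc j" by simp
  have 2: "2 * (real m + 1) / 2^j = 2 * (real (Suc (2*m)) + 1) / 2^Suc j" by (simp add: field_simps)
  have 3: "2 * (real (2*m) + 1) / 2^Suc j = 2 * real (Suc (2*m)) / 2^Suc j" by simp
  have 4: "2 * real (2*m) / 2^Suc j \<le> 2 * (real (2*m) + 1) / 2^Suc j" by (intro divide_right_mono) auto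
  have 5: "2 * real (Suc (2*m)) / 2^Suc j \<le> 2 * (real (Suc (2*m)) + 1) / 2^Suc j"
    by (intro divide_right_mono) auto
  have "c + 2 * real (2*m) / 2^Suc j \<le> c + 2 * real (Suc (2*m)) / 2^Suc j"
       "c + 2 * real (Suc (2*m)) / 2^Suc j \<le> c + 2 * (real (Suc (2*m)) + 1) / 2^Suc j"
         using 3 4 5 by linarith+
  then show "dyadic_box c j m = dyadic_box c (Suc j) (2*m) \<union> dyadic_box c (Suc j) (Suc (2*m))"
    unfolding dyadic_box_def 1 2 3 by (rule ivl_disj_un_two(3)[symmetric])
  show "dyadic_box c (Suc j) (2*m) \<inter> dyadic_box c (Suc j) (Suc (2*m)) = {}"
    unfolding dyadic_box_def 3 by auto
qed

lemma two_powr_box: "2 powr (1 - real j) = 2 / 2^j"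
  by (simp add: powr_diff powr_realpow)

lemma measure_dyadic_box: "dyadic_box c j m \<in> lmeasurable" "measure lebesgue (dyadic_box c j m)
  = 2 powr (1 - real j)"
proof -
  show "dyadic_box c j m \<in> lmeasurable" unfolding dyadic_box_def by (rule bounded_set_imp_lmeasurable) auto
  have "c + 2 * real m / 2^j \<le> c + 2 * (real m + 1) / 2^j" by (auto intro!: divide_right_mono)
  then have "measure lebesgue (dyadic_box c j m) = 2 * (real m + 1) / 2^j - 2 * real m / 2^j"
    unfolding dyadic_box_def by (simp add: measure_completion)
  also have "\<dots> = 2 powr (1 - real j)" unfolding two_powr_box by (simp add: field_simps)
  finally show "measure lebesgue (dyadic_box c j m) = 2 powr (1 - real j)" .
qed

lemma dyadic_box_separated:
  assumes "\<not> adjacent m n" "s \<in> dyadic_box c j m" "t \<in> dyadic_box c j n"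
  shows "2 powr (1 - real j) \<le> \<bar>t - s\<bar>"
proof -
  have *: "2 / 2^j \<le> y - x" if "Suc m < n" "x \<in> dyadic_box c j m" "y \<in> dyadic_box c j n" for m n x y
  proof -
    have "2 * (real m + 2) / 2^j \<le> 2 * real n / 2^j" using that(1) by (intro divide_right_mono) auto
    moreover have "2 * (real m + 2) / 2^j = 2 * (real m + 1) / 2^j + 2 / 2^j" by (simp add: field_simps)
    ultimately show ?thesis using that(2,3) by (simp add: dyadic_box_def)
  qed
  have "Suc n < m \<or> Suc m < n" using assms(1) by (auto simp: adjacent_def)
  then show ?thesis using *[of n m t s] *[of m n s t] assms(2,3) unfolding two_powr_box by (auto simp: abs_if)
qed

text \<open>Children of parents at distance at most 1 have indices that differ by at most 3.\<close>

lemma far_card: "card {n. n < N \<and> adjacent (m div 2) (n div 2) \<and> \<not> adjacent m n} \<le> 7"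
proof -
  have "{n. n < N \<and> adjacent (m div 2) (n div 2) \<and> \<not> adjacent m n} \<subseteq> {m - 3..m + 3}"
    by (auto simp: adjacent_def)
  then have "card {n. n < N \<and> adjacent (m div 2) (n div 2) \<and> \<not> adjacent m n} \<le> card {m - 3..m + 3}"
    by (intro card_mono) auto
  also have "\<dots> \<le> 7" by simp
  finally show ?thesis .
qed

lemma adjacent_card: "card {n. n < N \<and> adjacent m n} \<le> 3"
proof -
  have "{n. n < N \<and> adjacent m n} \<subseteq> {m - 1..m + 1}" by (auto simp: adjacent_def)
  then have "card {n. n < N \<and> adjacent m n} \<le> card {m - 1..m + 1}" by (intro card_mono) auto
  also have "\<dots> \<le> 3" by simp
  finally show ?thesis .
qed

lemma adjacent_sym: "adjacent m n \<longleftrightarrow> adjacent n m"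
  by (auto simp: adjacent_def)

lemma sum_far_left:
  fixes x :: "nat \<Rightarrow> real" assumes "\<And>m. 0 \<le> x m"
  shows "(\<Sum>m<N. \<Sum>n<N. if adjacent (m div 2) (n div 2) \<and> \<not> adjacent m n then x m else 0) \<le> 7 * (\<Sum>m<N. x m)"
proof -
  have "(\<Sum>n<N. if adjacent (m div 2) (n div 2) \<and> \<not> adjacent m n then x m else 0) \<le> 7 * x m" for m
  proof -
    have "(\<Sum>n<N. if adjacent (m div 2) (n div 2) \<and> \<not> adjacent m n then x m else 0)
      = (\<Sum>n\<in>{n. n < N \<and> adjacent (m div 2) (n div 2) \<and> \<not> adjacent m n}. x m)"
      by (rule sum.mono_neutral_cong_right) auto
    also have "\<dots> = real (card {n. n < N \<and> adjacent (m div 2) (n div 2) \<and> \<not> adjacent m n}) * x m" by simp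
    also have "\<dots> \<le> 7 * x m" using far_card[of N m] assms by (intro mult_right_mono) auto
    finally show ?thesis .
  qed
  then show ?thesis by (simp add: sum_distrib_left sum_mono)
qed

lemma sum_far_right:
  fixes x :: "nat \<Rightarrow> real" assumes "\<And>m. 0 \<le> x m"
  shows "(\<Sum>m<N. \<Sum>n<N. if adjacent (m div 2) (n div 2) \<and> \<not> adjacent m n then x n else 0) \<le> 7 * (\<Sum>m<N. x m)"
proof -
  have "(\<Sum>m<N. \<Sum>n<N. if adjacent (m div 2) (n div 2) \<and> \<not> adjacent m n then x n else 0)
    = (\<Sum>n<N. \<Sum>m<N. if adjacent (m div 2) (n div 2) \<and> \<not> adjacent m n then x n else 0)" by (rule sum.swap)
  also have "\<dots> = (\<Sum>n<N. \<Sum>m<N. if adjacent (n div 2) (m div 2) \<and> \<not> adjacent n m then x n else 0)"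
  proof (intro sum.cong refl)
    fix n m
    have "adjacent (m div 2) (n div 2) = adjacent (n div 2) (m div 2)" "adjacent m n = adjacent n m"
      by (rule adjacent_sym)+
    then show "(if adjacent (m div 2) (n div 2) \<and> \<not> adjacent m n then x n else 0)
      = (if adjacent (n div 2) (m div 2) \<and> \<not> adjacent n m then x n else 0)" by simp
  qed
  also have "\<dots> \<le> 7 * (\<Sum>m<N. x m)" by (rule sum_far_left[OF assms])
  finally show ?thesis .
qed

section \<open>Summation over scales and levels at the endpoint\<close>

context dispersive
begin

text \<open>\<open>G\<close> has finitely many values on \<open>J\<close>, and each of them has
  finitely many values in space, so finitely many levels occur over all times together.\<close>

lemma level_cover:
  assumes "time_simple M J G"
  obtains K where "finite K" "\<And>t x. t \<in> J \<Longrightarrow> x \<in> space M \<Longrightarrow> G t x = (\<Sum>k\<in>K. level M p k (G t) x)"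
proof -
  define K where "K = (\<Union>g\<in>G ` J. (\<lambda>v. \<lfloor>log 2 (cmod v / level_scale M p g)\<rfloor>) ` (g ` space M))"
  have f1: "finite (G ` J)" using assms simple_functionD(1)[of "lebesgue_on J" G]
    by (simp add: time_simple_def space_restrict_space)
  have f2: "finite (g ` space M)" if "g \<in> G ` J" for g
  proof -
    have "test M g" using that assms by (auto simp: time_simple_def)
    then show ?thesis by (auto elim!: simple_bochner_integrable.cases dest: simple_functionD)
  qed
  have K: "finite K" unfolding K_def by (rule finite_UN_I[OF f1 finite_imageI[OF f2]])
  show ?thesis
  proof (rule that[OF K])
    fix t x assume "t \<in> J" "x \<in> space M"
    then have "\<lfloor>log 2 (cmod (G t x) / level_scale M p (G t))\<rfloor> \<in> K" unfolding K_def by blast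
    then show "G t x = (\<Sum>k\<in>K. level M p k (G t) x)" by (rule level_sum[OF K])
  qed
qed

text \<open>The square of the norm is reduced to a sum of \<open>e k j * e l j * (X k + X l)\<close>
  over two levels and a scale. For the part with \<open>X k\<close> one sums over \<open>l\<close>
  at fixed \<open>j\<close>, then over \<open>j\<close> at fixed \<open>k\<close>; both sums are
  bounded uniformly, and the sum of \<open>X k\<close> is at most the squared norm of
  \<open>G\<close>.\<close>

lemma strichartz_endpoint:
  assumes \<sigma>1: "1 < \<sigma>" and \<alpha>: "\<alpha> = (\<sigma>-1)/(2*\<sigma>)"
  obtains C where "C > 0" "\<And>c J G. J \<in> lmeasurable \<Longrightarrow> J \<subseteq> {c..<c+2} \<Longrightarrow> time_simple M J G \<Longrightarrow>
     norm (Tstar J G) \<le> C * sqrt (LINT t|lebesgue_on J. (nrm M (1/(1-\<alpha>)) (G t))\<^sup>2)"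
proof -
  define p where "p = 1/(1-\<alpha>)"
  have \<alpha>01: "0 < \<alpha>" "\<alpha> < 1/2" using \<sigma>1 by (simp_all add: \<alpha> field_simps)
  have p0: "p > 0" using \<alpha>01 by (simp add: p_def)
  obtain C0 \<epsilon> where C0: "C0 > 0" and \<epsilon>: "\<epsilon> > 0" and pair:
    "\<And>E E' G j k l. E \<in> lmeasurable \<Longrightarrow> E' \<in> lmeasurable \<Longrightarrow> measure lebesgue E \<le> 2 powr (1 - real j) \<Longrightarrow>
      measure lebesgue E' \<le> 2 powr (1 - real j) \<Longrightarrow> (\<And>s t. s \<in> E \<Longrightarrow> t \<in> E' \<Longrightarrow> 2 powr (1 - real j) \<le> \<bar>t - s\<bar>) \<Longrightarrow>
      time_simple M E G \<Longrightarrow> time_simple M E' G \<Longrightarrow>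
      cmod (cinner (Tstar E (\<lambda>t. level M p k (G t))) (Tstar E' (\<lambda>t. level M p l (G t))))
      \<le> C0 * 2 powr (- \<epsilon> * (\<bar>p * real_of_int k - \<sigma> * real j\<bar> + \<bar>p * real_of_int l - \<sigma> * real j\<bar>))
          * (sqrt (LINT t|lebesgue_on E. (level_part M p k (G t))\<^sup>2)
            * sqrt (LINT t|lebesgue_on E'. (level_part M p l (G t))\<^sup>2))"
    by (rule endpoint_pair[OF \<sigma>1 \<alpha> p_def]) blast
  obtain C2 where C2: "C2 > 0" "\<And>K \<tau>. finite K \<Longrightarrow> (\<Sum>n\<in>K. 2 powr (- \<epsilon> * \<bar>p * real_of_int n - \<tau>\<bar>)) \<le> C2"
    using sum_geometric_int_bound[OF \<epsilon> p0] by blast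
  obtain C3 where C3: "C3 > 0" "\<And>K \<tau>. finite K \<Longrightarrow> (\<Sum>n\<in>K. 2 powr (- \<epsilon> * \<bar>\<sigma> * real_of_int n - \<tau>\<bar>)) \<le> C3"
    using sum_geometric_int_bound[OF \<epsilon> sigma_pos] by blast
  show ?thesis
  \<comment> \<open>\<open>14 = 2 * 7\<close>: an interval has at most seven far partners, and the
    sums with \<open>X k\<close> and with \<open>X l\<close> are equal by symmetry.\<close>
  proof (rule that[of "sqrt (14 * C0 * C2 * C3)"])
    show "sqrt (14 * C0 * C2 * C3) > 0" using C0 C2 C3 by simp
    fix c J G assume J: "J \<in> lmeasurable" and Jc: "J \<subseteq> {c..<c+2}" and G: "time_simple M J G"
    have Js: "J \<in> sets lebesgue" using J by auto
    obtain K where K: "finite K" and GK: "\<And>t x. t \<in> J \<Longrightarrow> x \<in> space M \<Longrightarrow> G t x = (\<Sum>k\<in>K. level M p k (G t) x)"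
      using level_cover[OF G] by blast
    define Gk where "Gk k t = level M p k (G t)" for k t
    have Gk: "time_simple M J (Gk k)" for k unfolding Gk_def by (rule time_simple_level[OF G])
    define E where "E j m = J \<inter> dyadic_box c j m" for j m
    have Em: "E j m \<in> lmeasurable" for j m unfolding E_def by (intro fmeasurable.Int J measure_dyadic_box)
    have Es: "E j m \<in> sets lebesgue" for j m using Em by blast
    have EJ: "E j m \<subseteq> J" for j m by (auto simp: E_def)
    have mE: "measure lebesgue (E j m) \<le> 2 powr (1 - real j)" for j m
      unfolding measure_dyadic_box(2)[of c j m, symmetric] E_def
      by (intro measure_mono_fmeasurable measure_dyadic_box) (use Js measure_dyadic_box(1)[of c j m] in auto)
    have GE: "time_simple M (E j m) G" for j m by (rule time_simple_subset[OF G EJ Es Js])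
    have GkE: "time_simple M (E j m) (Gk k)" for j m k by (rule time_simple_subset[OF Gk EJ Es Js])
    have E0: "E 0 0 = J" using Jc by (auto simp: E_def dyadic_box_def)
    have Esplit: "E j m = E (Suc j) (2*m) \<union> E (Suc j) (Suc (2*m))" "E (Suc j) (2*m) \<inter> E (Suc j) (Suc (2*m))
      = {}" for j m
      using dyadic_box_split[of c j m] unfolding E_def by blast+
    define v where "v k j m = Tstar (E j m) (Gk k)" for k j m
    have vsplit: "v k j m = v k (Suc j) (2*m) + v k (Suc j) (Suc (2*m))" for k j m
      unfolding v_def Esplit(1)[of j m]
      by (rule Tstar_disjoint_Un[OF Em Em Esplit(2)]) (use GkE[of j m k] Esplit(1)[of j m] in simp)
    define x where "x k j m = (LINT t|lebesgue_on (E j m). (level_part M p k (G t))\<^sup>2)" for k j m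
    have x0: "0 \<le> x k j m" for k j m by (simp add: x_def integral_nonneg_AE)
    have xint: "integrable lebesgue (\<lambda>t. indicator (E j m) t *\<^sub>R (level_part M p k (G t))\<^sup>2)" for k j m
    proof -
      have "integrable (lebesgue_on (E j m)) (\<lambda>t. (level_part M p k (G t))\<^sup>2)"
        using simple_function_compose1[OF level_part_simple[OF GE[of j m], of p k], where g="\<lambda>z. z\<^sup>2"]
          by (rule simple_lebesgue_integrable[OF Em])
      then show ?thesis using Es by (simp add: integrable_restrict_space)
    qed
    have xsplit: "x k j m = x k (Suc j) (2*m) + x k (Suc j) (Suc (2*m))" for k j m
    proof -
      have "x k (Suc j) (2*m) + x k (Suc j) (Suc (2*m))
        = (LINT t|lebesgue. indicator (E (Suc j) (2*m)) t *\<^sub>R (level_part M p k (G t))\<^sup>2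
         + indicator (E (Suc j) (Suc (2*m))) t *\<^sub>R (level_part M p k (G t))\<^sup>2)"
        unfolding x_def using Es xint[of "Suc j" "2*m" k] xint[of "Suc j" "Suc (2*m)" k]
        by (simp only: integral_restrict_space Int_UNIV_right space_completion sets.Int
          Bochner_Integration.integral_add space_lborel)
           (simp add: integral_restrict_space)
      also have "\<dots> = (LINT t|lebesgue. indicator (E j m) t *\<^sub>R (level_part M p k (G t))\<^sup>2)"
        using Esplit[of j m] by (intro Bochner_Integration.integral_cong) (auto simp: indicator_def)
      also have "\<dots> = x k j m" unfolding x_def using Es by (simp add: integral_restrict_space)
      finally show ?thesis by simp
    qed
    define X where "X k = (LINT t|lebesgue_on J. (level_part M p k (G t))\<^sup>2)" for k
    have X0: "0 \<le> X k" for k by (simp add: X_def integral_nonneg_AE)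
    have xsum: "(\<Sum>m<2^j. x k j m) = X k" for k j
    proof (induction j)
      case 0 then show ?case by (simp add: x_def X_def E0)
    next
      case (Suc j)
      have "(\<Sum>m<2^Suc j. x k (Suc j) m) = (\<Sum>m<2^j. x k j m)"
        unfolding power_Suc sum_lessThan_double by (simp only: xsplit[of k j, symmetric])
      then show ?case using Suc by simp
    qed
    define e where "e k j = 2 powr (- \<epsilon> * \<bar>p * real_of_int k - \<sigma> * real (Suc j)\<bar>)" for k j
    have e0: "0 \<le> e k j" for k j by (simp add: e_def)
    have far: "cmod (\<Sum>m<2^Suc j. \<Sum>n<2^Suc j.
      if adjacent (m div 2) (n div 2) \<and> \<not> adjacent m n then cinner (v k (Suc j) m) (v l (Suc j) n) else 0)
       \<le> 7 * C0 * (e k j * e l j) * (X k + X l)" for k l j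
    proof -
      let ?P = "\<lambda>m n. adjacent (m div 2) (n div 2) \<and> \<not> adjacent m n"
      have el: "cmod (if ?P m n then cinner (v k (Suc j) m) (v l (Suc j) n) else 0)
         \<le> C0 * (e k j * e l j) * ((if ?P m n then x k (Suc j) m else 0)
           + (if ?P m n then x l (Suc j) n else 0))" for m n
      proof (cases "?P m n")
        case True
        have "cmod (cinner (v k (Suc j) m) (v l (Suc j) n)) \<le> C0
          * 2 powr (- \<epsilon> * (\<bar>p * real_of_int k - \<sigma> * real (Suc j)\<bar> + \<bar>p * real_of_int l - \<sigma> * real (Suc j)\<bar>))
          * (sqrt (x k (Suc j) m) * sqrt (x l (Suc j) n))"
          unfolding v_def Gk_def x_def
          by (rule pair[OF Em Em mE mE _ GE GE])
            (use True dyadic_box_separated[of m n _ c "Suc j"] in \<open>auto simp: E_def\<close>)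
        also have "2 powr (- \<epsilon> * (\<bar>p * real_of_int k - \<sigma> * real (Suc j)\<bar> + \<bar>p * real_of_int l - \<sigma>
          * real (Suc j)\<bar>)) = e k j * e l j"
          unfolding e_def powr_add[symmetric] by (simp add: algebra_simps)
        also have "C0 * (e k j * e l j) * (sqrt (x k (Suc j) m) * sqrt (x l (Suc j) n)) \<le> C0 * (e k j * e l j)
          * (x k (Suc j) m + x l (Suc j) n)"
        proof (rule mult_left_mono)
          \<comment> \<open>This splits the double sum over intervals into two single sums. Little
            is lost, since every interval has boundedly many partners.\<close>
          show "sqrt (x k (Suc j) m) * sqrt (x l (Suc j) n) \<le> x k (Suc j) m + x l (Suc j) n"
            using mult_le_sum_squares[of "sqrt (x k (Suc j) m)" "sqrt (x l (Suc j) n)"] x0 by simp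
        qed (use C0 e0 in auto)
        finally show ?thesis using True by simp
      next
        case False
        then show ?thesis by (simp only: if_False) simp
      qed
      have "cmod (\<Sum>m<2^Suc j. \<Sum>n<2^Suc j. if ?P m n then cinner (v k (Suc j) m) (v l (Suc j) n) else 0)
        \<le> (\<Sum>m<2^Suc j. \<Sum>n<2^Suc j. C0 * (e k j * e l j)
          * ((if ?P m n then x k (Suc j) m else 0) + (if ?P m n then x l (Suc j) n else 0)))"
        by (intro sum_norm_le el)
      also have "\<dots> = C0 * (e k j * e l j) * ((\<Sum>m<2^Suc j. \<Sum>n<2^Suc j. if ?P m n then x k (Suc j) m else 0)
          + (\<Sum>m<2^Suc j. \<Sum>n<2^Suc j. if ?P m n then x l (Suc j) n else 0))"
        by (simp only: sum.distrib sum_distrib_left distrib_left)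
      also have "\<dots> \<le> C0 * (e k j * e l j) * (7 * X k + 7 * X l)"
        using sum_far_left[of "x k (Suc j)" "2^Suc j"] sum_far_right[of "x l (Suc j)" "2^Suc j"] x0 C0 e0
        unfolding xsum by (intro mult_left_mono add_mono) auto
      finally show ?thesis by (simp add: algebra_simps)
    qed
    \<comment> \<open>A crude bound for all level pieces of all values of \<open>G\<close>. Its
      dependence on \<open>G\<close> is harmless: it controls the adjacent pairs on the finest
      scale, whose contribution tends to 0.\<close>
    define Y where "Y = (\<Sum>k\<in>K. \<Sum>g\<in>G ` J. nrm M 2 (level M p k g))"
    have fGJ: "finite (G ` J)" using G simple_functionD(1)[of "lebesgue_on J" G]
      by (simp add: time_simple_def space_restrict_space)
    have Y: "nrm M 2 (Gk k t) \<le> Y" if "k \<in> K" "t \<in> J" for k t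
    proof -
      have "nrm M 2 (level M p k (G t)) \<le> (\<Sum>g\<in>G ` J. nrm M 2 (level M p k g))"
        using that fGJ by (intro member_le_sum) auto
      also have "\<dots> \<le> Y" unfolding Y_def using that K by (intro member_le_sum) (auto intro: sum_nonneg)
      finally show ?thesis by (simp add: Gk_def)
    qed
    have Y0: "0 \<le> Y" by (auto simp: Y_def intro!: sum_nonneg)
    have vN: "norm (v k N m) \<le> A * Y * (2/2^N)" if "k \<in> K" for k N m
    proof -
      have "norm (v k N m) \<le> A * (LINT t|lebesgue_on (E N m). nrm M 2 (Gk k t))"
        unfolding v_def by (rule norm_Tstar[OF time_simple_admissible[OF Em GkE]])
      also have "(LINT t|lebesgue_on (E N m). nrm M 2 (Gk k t)) \<le> (LINT t|lebesgue_on (E N m). Y)"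
      proof (rule integral_mono)
        show "integrable (lebesgue_on (E N m)) (\<lambda>t. nrm M 2 (Gk k t))"
          using time_simple_nrm_integrable[OF Em[of N m] GkE[of N m k], where u=2 and v=1] by simp
        show "integrable (lebesgue_on (E N m)) (\<lambda>t. Y)"
          by (rule simple_lebesgue_integrable[OF Em simple_function_const])
        show "nrm M 2 (Gk k t) \<le> Y" if "t \<in> space (lebesgue_on (E N m))" for t
          using that \<open>k \<in> K\<close> EJ by (intro Y) (auto simp: space_restrict_space)
      qed
      also have "(LINT t|lebesgue_on (E N m). Y) = measure lebesgue (E N m) * Y"
        using Es by (simp add: space_restrict_space measure_restrict_space)
      also have "\<dots> \<le> (2/2^N) * Y" using mE[of N m] Y0 unfolding two_powr_box by (intro mult_right_mono)
      finally show ?thesis using A1 by (simp add: mult_ac)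
    qed
    \<comment> \<open>There are \<open>2^N\<close> intervals with at most three neighbours each, and
      a pair contributes at most the square of \<open>A * Y * 2 / 2^N\<close>; this gives
      \<open>12\<close> and leaves one factor \<open>1 / 2^N\<close>.\<close>
    define W where "W = 12 * (A * Y)\<^sup>2"
    have near: "cmod (\<Sum>m<2^N. \<Sum>n<2^N. if adjacent m n then cinner (v k N m) (v l N n) else 0) \<le> W / 2^N"
      if "k \<in> K" "l \<in> K" for k l N
    proof -
      let ?b = "(A * Y * (2/2^N))\<^sup>2"
      have "cmod (\<Sum>m<2^N. \<Sum>n<2^N. if adjacent m n then cinner (v k N m) (v l N n) else 0)
        \<le> (\<Sum>m<(2::nat)^N. \<Sum>n<(2::nat)^N. if adjacent m n then ?b else 0)"
      proof (intro sum_norm_le)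
        fix m n
        have "cmod (cinner (v k N m) (v l N n)) \<le> norm (v k N m) * norm (v l N n)"
          by (rule cinner_Cauchy_Schwarz)
        also have "\<dots> \<le> (A * Y * (2/2^N)) * (A * Y * (2/2^N))" using vN that A1 Y0 by (intro mult_mono) auto
        finally show "norm (if adjacent m n then cinner (v k N m) (v l N n) else 0)
          \<le> (if adjacent m n then ?b else 0)"
          by (simp add: power2_eq_square)
      qed
      also have "\<dots> \<le> (\<Sum>m<(2::nat)^N. 3 * ?b)"
      proof (rule sum_mono)
        fix m
        have "(\<Sum>n<(2::nat)^N. if adjacent m n then ?b else 0) = (\<Sum>n\<in>{n. n < 2^N \<and> adjacent m n}. ?b)"
          by (rule sum.mono_neutral_cong_right) auto
        also have "\<dots> = real (card {n. n < 2^N \<and> adjacent m n}) * ?b" by simp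
        also have "\<dots> \<le> 3 * ?b" using adjacent_card[of "2^N" m] by (intro mult_right_mono) auto
        finally show "(\<Sum>n<(2::nat)^N. if adjacent m n then ?b else 0) \<le> 3 * ?b" .
      qed
      also have "\<dots> = W / 2^N" by (simp add: W_def power2_eq_square field_simps)
      finally show ?thesis .
    qed
    define S where "S = (\<Sum>k\<in>K. X k)"
    have Gsum: "Tstar J G = (\<Sum>k\<in>K. v k 0 0)"
      unfolding v_def E0 Gk_def by (rule Tstar_sum[OF J K G]) (use GK time_simple_level[OF G] in auto)
    have bound: "(norm (Tstar J G))\<^sup>2 \<le> 14 * C0 * C2 * C3 * S + (real (card K))\<^sup>2 * (W / 2^N)" for N
    proof -
      have "(norm (Tstar J G))\<^sup>2 = cmod (cinner (Tstar J G) (Tstar J G))"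
        by (simp add: cinner_self norm_power)
      also have "\<dots> = cmod (\<Sum>k\<in>K. \<Sum>l\<in>K. cinner (v k 0 0) (v l 0 0))"
        unfolding Gsum cinner_sum_left cinner_sum_right by (subst sum.swap) simp
      also have "\<dots> \<le> (\<Sum>k\<in>K. \<Sum>l\<in>K. (\<Sum>j<N. 7 * C0 * (e k j * e l j) * (X k + X l)) + W / 2^N)"
      proof (intro sum_norm_le)
        fix k l assume kl: "k \<in> K" "l \<in> K"
        have "cmod (cinner (v k 0 0) (v l 0 0)) \<le>
          cmod (\<Sum>j<N. \<Sum>m<2^Suc j. \<Sum>n<2^Suc j.
            if adjacent (m div 2) (n div 2) \<and> \<not> adjacent m n then cinner (v k (Suc j) m) (v l (Suc j) n) else
            0)
          + cmod (\<Sum>m<2^N. \<Sum>n<2^N. if adjacent m n then cinner (v k N m) (v l N n) else 0)"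
          by (subst whitney_sum[where v="v k" and w="v l" and N=N, OF vsplit vsplit])
            (rule norm_triangle_ineq)
        also have "\<dots> \<le> (\<Sum>j<N. 7 * C0 * (e k j * e l j) * (X k + X l)) + W / 2^N"
          by (intro add_mono sum_norm_le far near kl)
        finally show "cmod (cinner (v k 0 0) (v l 0 0)) \<le> (\<Sum>j<N. 7 * C0 * (e k j * e l j) * (X k + X l))
          + W / 2^N" .
      qed
      also have "\<dots> = 7 * C0 * ((\<Sum>k\<in>K. \<Sum>l\<in>K. \<Sum>j<N. e k j * e l j * X k)
        + (\<Sum>k\<in>K. \<Sum>l\<in>K. \<Sum>j<N. e k j * e l j * X l))
           + (real (card K))\<^sup>2 * (W / 2^N)"
        by (simp add: sum.distrib sum_distrib_left distrib_left power2_eq_square mult_ac)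
      also have "(\<Sum>k\<in>K. \<Sum>l\<in>K. \<Sum>j<N. e k j * e l j * X l) = (\<Sum>k\<in>K. \<Sum>l\<in>K. \<Sum>j<N. e k j * e l j * X k)"
        by (subst sum.swap) (simp add: mult_ac)
      also have "(\<Sum>k\<in>K. \<Sum>l\<in>K. \<Sum>j<N. e k j * e l j * X k) \<le> C2 * C3 * S"
      proof -
        have "(\<Sum>k\<in>K. \<Sum>l\<in>K. \<Sum>j<N. e k j * e l j * X k) = (\<Sum>k\<in>K. X k * (\<Sum>j<N. e k j * (\<Sum>l\<in>K. e l j)))"
        proof (rule sum.cong[OF refl])
          fix k
          have "(\<Sum>l\<in>K. \<Sum>j<N. e k j * e l j * X k) = (\<Sum>j<N. \<Sum>l\<in>K. e k j * e l j * X k)" by (rule sum.swap)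
          also have "\<dots> = X k * (\<Sum>j<N. e k j * (\<Sum>l\<in>K. e l j))" by (simp add: sum_distrib_left mult_ac)
          finally show "(\<Sum>l\<in>K. \<Sum>j<N. e k j * e l j * X k) = X k * (\<Sum>j<N. e k j * (\<Sum>l\<in>K. e l j))" .
        qed
        also have "\<dots> \<le> (\<Sum>k\<in>K. X k * (C3 * C2))"
        proof (intro sum_mono mult_left_mono X0)
          fix k
          have "(\<Sum>j<N. e k j * (\<Sum>l\<in>K. e l j)) \<le> (\<Sum>j<N. e k j * C2)"
            using C2(2)[OF K] by (intro sum_mono mult_left_mono e0) (simp add: e_def)
          also have "\<dots> = (\<Sum>j<N. e k j) * C2" by (simp add: sum_distrib_right)
          also have "(\<Sum>j<N. e k j) \<le> C3"
          proof -
            have "(\<Sum>j<N. e k j) = (\<Sum>n\<in>(\<lambda>j. int (Suc j)) ` {..<N}. 2 powr (- \<epsilon> * \<bar>\<sigma> * real_of_int n - p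
              * real_of_int k\<bar>))"
              by (subst sum.reindex) (auto simp: inj_on_def e_def abs_minus_commute)
            also have "\<dots> \<le> C3" by (rule C3(2)) simp
            finally show ?thesis .
          qed
          finally show "(\<Sum>j<N. e k j * (\<Sum>l\<in>K. e l j)) \<le> C3 * C2" using C2(1) by simp
        qed
        also have "\<dots> = C2 * C3 * S" by (simp add: S_def sum_distrib_left mult_ac)
        finally show ?thesis .
      qed
      finally show ?thesis using C0 by (simp add: mult_ac)
    qed
    have "(norm (Tstar J G))\<^sup>2 \<le> 14 * C0 * C2 * C3 * S"
    proof (rule LIMSEQ_le)
      show "(\<lambda>N. (norm (Tstar J G))\<^sup>2) \<longlonglongrightarrow> (norm (Tstar J G))\<^sup>2" by simp
      have eqW: "W / 2^N = W * (1/2)^N" for N by (simp add: power_one_over)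
      have h: "(\<lambda>N. (1/2::real)^N) \<longlonglongrightarrow> 0" by (rule LIMSEQ_power_zero) simp
      have "(\<lambda>N. 14 * C0 * C2 * C3 * S + (real (card K))\<^sup>2 * (W * (1/2)^N)) \<longlonglongrightarrow> 14 * C0 * C2 * C3 * S
        + (real (card K))\<^sup>2 * (W * 0)"
        by (rule tendsto_add[OF tendsto_const
          tendsto_mult[OF tendsto_const tendsto_mult[OF tendsto_const h]]])
      then show "(\<lambda>N. 14 * C0 * C2 * C3 * S + (real (card K))\<^sup>2 * (W / 2^N)) \<longlonglongrightarrow> 14 * C0 * C2 * C3 * S"
        by (simp only: eqW mult_zero_right add_0_right)
      show "\<exists>N0. \<forall>N\<ge>N0. (norm (Tstar J G))\<^sup>2 \<le> 14 * C0 * C2 * C3 * S + (real (card K))\<^sup>2 * (W / 2^N)"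
        using bound by blast
    qed
    also have "S \<le> (LINT t|lebesgue_on J. (nrm M p (G t))\<^sup>2)"
    proof -
      have li: "integrable (lebesgue_on J) (\<lambda>t. (level_part M p k (G t))\<^sup>2)" for k
        using simple_function_compose1[OF level_part_simple[OF G, of p k], where g="\<lambda>z. z\<^sup>2"]
          by (rule simple_lebesgue_integrable[OF J])
      have "S = (LINT t|lebesgue_on J. (\<Sum>k\<in>K. (level_part M p k (G t))\<^sup>2))"
        unfolding S_def X_def using li by simp
      also have "\<dots> \<le> (LINT t|lebesgue_on J. (nrm M p (G t))\<^sup>2)"
      proof (rule integral_mono)
        show "integrable (lebesgue_on J) (\<lambda>t. \<Sum>k\<in>K. (level_part M p k (G t))\<^sup>2)" using li by simp
        show "integrable (lebesgue_on J) (\<lambda>t. (nrm M p (G t))\<^sup>2)"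
          using time_simple_nrm_integrable[OF J G, of p 2] by simp
        fix t assume "t \<in> space (lebesgue_on J)"
        then have "test M (G t)" using G by (simp add: time_simple_def space_restrict_space)
        then show "(\<Sum>k\<in>K. (level_part M p k (G t))\<^sup>2) \<le> (nrm M p (G t))\<^sup>2" by (rule sum_level_part[OF _ p0 K])
      qed
      finally show ?thesis .
    qed
    finally have "(norm (Tstar J G))\<^sup>2 \<le> 14 * C0 * C2 * C3 * (LINT t|lebesgue_on J. (nrm M p (G t))\<^sup>2)"
      using C0 C2 C3 by (simp add: mult_left_mono)
    then have "sqrt ((norm (Tstar J G))\<^sup>2)
      \<le> sqrt (14 * C0 * C2 * C3 * (LINT t|lebesgue_on J. (nrm M p (G t))\<^sup>2))" by (rule real_sqrt_le_mono)
    then show "norm (Tstar J G) \<le> sqrt (14 * C0 * C2 * C3)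
      * sqrt (LINT t|lebesgue_on J. (nrm M (1/(1-\<alpha>)) (G t))\<^sup>2)"
      by (simp add: real_sqrt_mult p_def)
  qed
qed

end

section \<open>The estimate for separated intervals\<close>

lemma conj_exponent_recip:
  assumes "1 \<le> p"
  shows "1 \<le> conj_exponent p" "real_of_ereal (1 / conj_exponent p) = 1 - real_of_ereal (1 / p)"
proof -
  have "1 \<le> conj_exponent p \<and> real_of_ereal (1 / conj_exponent p) = 1 - real_of_ereal (1 / p)"
  proof (cases p)
    case (real r)
    then have r: "1 \<le> r" using assms by simp
    show ?thesis
    proof (cases "r = 1")
      case True
      then have "conj_exponent p = \<infinity>" using real
        by (simp add: conj_exponent_def one_ereal_def divide_ereal_def)
      then show ?thesis using True real by (simp add: one_ereal_def)
    next
      case False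
      have "conj_exponent p = ereal (1/(1-1/r))"
        using real False r by (auto simp: conj_exponent_def one_ereal_def divide_ereal_def field_simps)
      then show ?thesis using False r real by (simp add: one_ereal_def field_simps)
    qed
  qed (use assms in \<open>auto simp: conj_exponent_def one_ereal_def divide_ereal_def\<close>)
  then show "1 \<le> conj_exponent p" "real_of_ereal (1 / conj_exponent p) = 1 - real_of_ereal (1 / p)" by auto
qed

lemma ereal_divide_recip: "1 \<le> p \<Longrightarrow> ereal a / p = ereal (a * real_of_ereal (1/p))"
  by (cases p) (auto simp: one_ereal_def divide_ereal_def divide_inverse)

lemma recip_bounds: "1 \<le> p \<Longrightarrow> 0 \<le> real_of_ereal (1/p)" "1 \<le> p \<Longrightarrow> real_of_ereal (1/p) \<le> 1" "2 \<le> p \<Longrightarrow>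
  real_of_ereal (1/p) \<le> 1/2"
  "1 \<le> p \<Longrightarrow> p < \<infinity> \<Longrightarrow> 0 < real_of_ereal (1/p)"
  by (cases p; simp add: one_ereal_def)+

lemma L_norm_cong_AE:
  assumes "f \<in> borel_measurable M" "g \<in> borel_measurable M" "AE x in M. f x = g x"
  shows "L_norm M p f = L_norm M p g"
proof -
  have "(\<integral>\<^sup>+x. ennreal_powr (f x) a \<partial>M) = (\<integral>\<^sup>+x. ennreal_powr (g x) a \<partial>M)" for a
    using assms(3) by (intro nn_integral_cong_AE) (auto elim: eventually_mono)
  moreover have "esssup M f = esssup M g" using assms by (rule esssup_AE_cong)
  ultimately show ?thesis using assms by (simp add: L_norm_def)
qed

lemma L_norm_measurable: "L_norm M p f < \<infinity> \<Longrightarrow> f \<in> borel_measurable M"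
  by (cases "f \<in> borel_measurable M") (auto simp: L_norm_def esssup_non_measurable split: if_splits)

text \<open>Brings a time integral into the form of the weighted sum in \<open>mixed\<close>, with
  the level sets of \<open>G\<close> as index set.\<close>

lemma integral_simple_compose:
  fixes \<phi> :: "('x \<Rightarrow> complex) \<Rightarrow> real"
  assumes J: "J \<in> lmeasurable" and G: "simple_function (lebesgue_on J) G"
  shows "(LINT t|lebesgue_on J. \<phi> (G t)) = (\<Sum>g\<in>G ` J. measure lebesgue {t\<in>J. G t = g} * \<phi> g)"
proof -
  have Js: "J \<in> sets lebesgue" using J by auto
  have fin: "finite (G ` J)" using simple_functionD(1)[OF G] by (simp add: space_restrict_space)
  have m: "{t\<in>J. G t = g} \<in> sets (lebesgue_on J)" for g
  proof -
    have "{t\<in>J. G t = g} = G -` {g} \<inter> space (lebesgue_on J)" by (auto simp: space_restrict_space)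
    then show ?thesis using simple_functionD(2)[OF G, of "{g}"] by simp
  qed
  have "(LINT t|lebesgue_on J. \<phi> (G t))
    = (LINT t|lebesgue_on J. (\<Sum>g\<in>G ` J. indicator {t\<in>J. G t = g} t * \<phi> g))"
  proof (rule Bochner_Integration.integral_cong[OF refl])
    fix t assume "t \<in> space (lebesgue_on J)"
    then have t: "t \<in> J" by (simp add: space_restrict_space)
    have "(\<Sum>g\<in>G ` J. indicator {t\<in>J. G t = g} t * \<phi> g) = (\<Sum>g\<in>G ` J. if g = G t then \<phi> (G t) else 0)"
      using t by (intro sum.cong) (auto simp: indicator_def)
    also have "\<dots> = \<phi> (G t)" using fin t by simp
    finally show "\<phi> (G t) = (\<Sum>g\<in>G ` J. indicator {t\<in>J. G t = g} t * \<phi> g)" by simp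
  qed
  also have "\<dots> = (\<Sum>g\<in>G ` J. LINT t|lebesgue_on J. indicator {t\<in>J. G t = g} t * \<phi> g)"
  proof (rule Bochner_Integration.integral_sum)
    interpret finite_measure "lebesgue_on J" by (rule finite_measure_lebesgue_on[OF J])
    show "integrable (lebesgue_on J) (\<lambda>t. indicator {t\<in>J. G t = g} t * \<phi> g)" for g
      using m[of g] by (intro integrable_mult_left integrable_real_indicator) (auto simp: less_top[symmetric])
  qed
  also have "\<dots> = (\<Sum>g\<in>G ` J. measure lebesgue {t\<in>J. G t = g} * \<phi> g)"
  proof (rule sum.cong[OF refl])
    fix g
    have "(LINT t|lebesgue_on J. indicator {t\<in>J. G t = g} t * \<phi> g)
      = measure (lebesgue_on J) ({t\<in>J. G t = g} \<inter> space (lebesgue_on J)) * \<phi> g"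
      by simp
    also have "{t\<in>J. G t = g} \<inter> space (lebesgue_on J) = {t\<in>J. G t = g}" by (auto simp: space_restrict_space)
    also have "measure (lebesgue_on J) {t\<in>J. G t = g} = measure lebesgue {t\<in>J. G t = g}"
      using Js by (intro measure_restrict_space) auto
    finally show "(LINT t|lebesgue_on J. indicator {t\<in>J. G t = g} t * \<phi> g) = measure lebesgue {t\<in>J. G t = g}
      * \<phi> g" .
  qed
  finally show ?thesis .
qed

section \<open>Interpolation with one time frozen\<close>

context dispersive
begin

text \<open>Both regimes share the formula \<open>a = 2/(2 - \<sigma> * (1 - 2*\<beta>))\<close>,
  which is 2 at the endpoint. The dyadic argument there lives in an interval of length 2, whence the
  constraint on \<open>J\<close>.\<close>

lemma strichartz:
  assumes \<beta>: "0 \<le> \<beta>" "\<beta> \<le> 1/2" and cond: "\<sigma> * (1 - 2*\<beta>) < 1 \<or> (1 < \<sigma> \<and> \<sigma> * (1 - 2*\<beta>) = 1)"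
    and a: "a = 1/(1 - \<sigma> * (1/2 - \<beta>))"
  obtains C where "C > 0" "\<And>c J G. J \<in> lmeasurable \<Longrightarrow> J \<subseteq> {c..<c+2} \<Longrightarrow> time_simple M J G \<Longrightarrow>
     norm (Tstar J G) \<le> C * (LINT t|lebesgue_on J. nrm M (1/(1-\<beta>)) (G t) powr a) powr (1/a)"
  using cond
proof
  assume lt: "\<sigma> * (1 - 2*\<beta>) < 1"
  have a': "a = 2/(2 - \<sigma> * (1 - 2*\<beta>))" using lt by (simp add: a field_simps)
  obtain C where C: "C > 0" "\<And>E G. E \<in> lmeasurable \<Longrightarrow> time_simple M E G \<Longrightarrow>
     norm (Tstar E G) \<le> C * (LINT t|lebesgue_on E. nrm M (1/(1-\<beta>)) (G t) powr a) powr (1/a)"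
    by (rule strichartz_nonendpoint[OF \<beta> refl lt a']) blast
  show ?thesis by (rule that[OF C(1)]) (rule C(2))
next
  assume c: "1 < \<sigma> \<and> \<sigma> * (1 - 2*\<beta>) = 1"
  then have "\<beta> = (\<sigma>-1)/(2*\<sigma>)" by (simp add: field_simps)
  then obtain C where C: "C > 0" "\<And>c J G. J \<in> lmeasurable \<Longrightarrow> J \<subseteq> {c..<c+2} \<Longrightarrow> time_simple M J G \<Longrightarrow>
     norm (Tstar J G) \<le> C * sqrt (LINT t|lebesgue_on J. (nrm M (1/(1-\<beta>)) (G t))\<^sup>2)"
    using strichartz_endpoint[of \<beta>] c by blast
  have s12: "\<sigma> * (1/2 - \<beta>) = 1/2" using c by (simp add: algebra_simps)
  have a2: "a = 2" unfolding a s12 by simp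
  show ?thesis
  proof (rule that[OF C(1)])
    fix c J G assume "J \<in> lmeasurable" "J \<subseteq> {c..<c+2}" "time_simple M J G"
    then show "norm (Tstar J G) \<le> C * (LINT t|lebesgue_on J. nrm M (1/(1-\<beta>)) (G t) powr a) powr (1/a)"
      using C(2)[of J c G] by (simp add: a2 powr_half_sqrt integral_nonneg_AE)
  qed
qed

lemma Tstar_cong: "(\<And>t x. t \<in> J \<Longrightarrow> x \<in> space M \<Longrightarrow> \<Phi> t x = \<Psi> t x) \<Longrightarrow> Tstar J \<Phi> = Tstar J \<Psi>"
proof -
  assume a: "\<And>t x. t \<in> J \<Longrightarrow> x \<in> space M \<Longrightarrow> \<Phi> t x = \<Psi> t x"
  have "(LINT t|lebesgue_on J. L2_inner M (\<Phi> t) (U t h))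
    = (LINT t|lebesgue_on J. L2_inner M (\<Psi> t) (U t h))" for h
    unfolding L2_inner_def using a
    by (intro Bochner_Integration.integral_cong refl) (auto simp: space_restrict_space)
  then show ?thesis by (simp add: Tstar_def)
qed

lemma Tstar_add:
  assumes J: "J \<in> lmeasurable" and G: "time_simple M J G" "time_simple M J H"
  shows "Tstar J (\<lambda>t x. G t x + H t x) = Tstar J G + Tstar J H"
proof (rule Tstar_eqI)
  fix h
  have "cinner (Tstar J G + Tstar J H) h
    = (LINT t|lebesgue_on J. L2_inner M (G t) (U t h) + L2_inner M (H t) (U t h))"
    using admissible_integrable[OF time_simple_admissible[OF J G(1)]]
      admissible_integrable[OF time_simple_admissible[OF J G(2)]]
    by (simp add: cinner_add_left cinner_Tstar[OF time_simple_admissible[OF J G(1)]]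
      cinner_Tstar[OF time_simple_admissible[OF J G(2)]])
  also have "\<dots> = (LINT t|lebesgue_on J. L2_inner M (\<lambda>x. G t x + H t x) (U t h))"
  proof (rule Bochner_Integration.integral_cong[OF refl])
    fix t assume "t \<in> space (lebesgue_on J)"
    then have "G t \<in> L2 M" "H t \<in> L2 M"
      using G by (auto simp: time_simple_def space_restrict_space intro: test_L2)
    then show "L2_inner M (G t) (U t h) + L2_inner M (H t) (U t h) = L2_inner M (\<lambda>x. G t x + H t x) (U t h)"
      using L2_inner_add_left[OF _ _ U_L2] by simp
  qed
  finally show "cinner (Tstar J G + Tstar J H) h
    = (LINT t|lebesgue_on J. L2_inner M (\<lambda>x. G t x + H t x) (U t h))" .
qed

lemma off_diagonal_dispersive:
  assumes J: "J \<in> lmeasurable" and sep: "\<And>t. t \<in> J \<Longrightarrow> c1 \<le> \<bar>t - s\<bar>" and c1: "0 < c1" and f: "test M f"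
    and G: "time_simple M J G"
  shows "cmod (cinner (adj s f) (Tstar J G)) \<le> B * c1 powr (-\<sigma>) * nrm M 1 f
    * (LINT t|lebesgue_on J. nrm M 1 (G t))"
proof -
  have i: "integrable (lebesgue_on J) (\<lambda>t. nrm M 1 (G t))"
    using time_simple_nrm_integrable[OF J G, where u=1 and v=1] by simp
  have "cmod (cinner (adj s f) (Tstar J G)) = cmod (LINT t|lebesgue_on J. L2_inner M (G t) (U t (adj s f)))"
    by (subst norm_cinner_commute) (simp add: cinner_Tstar[OF time_simple_admissible[OF J G]])
  also have "\<dots> \<le> (LINT t|lebesgue_on J. B * c1 powr (-\<sigma>) * nrm M 1 f * nrm M 1 (G t))"
  proof (rule order_trans[OF integral_norm_bound integral_mono])
    show "integrable (lebesgue_on J) (\<lambda>t. cmod (L2_inner M (G t) (U t (adj s f))))"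
      by (intro integrable_norm admissible_integrable time_simple_admissible J G)
    show "integrable (lebesgue_on J) (\<lambda>t. B * c1 powr (-\<sigma>) * nrm M 1 f * nrm M 1 (G t))" using i by simp
    fix t assume "t \<in> space (lebesgue_on J)"
    then have t: "t \<in> J" by (simp add: space_restrict_space)
    then have g: "test M (G t)" using G by (simp add: time_simple_def)
    have st: "s \<noteq> t" using sep[OF t] c1 by auto
    have "cmod (L2_inner M (G t) (U t (adj s f))) = cmod (cinner (adj s f) (adj t (G t)))"
      by (subst norm_cinner_commute) (simp add: cinner_adj[OF test_L2[OF g]])
    also have "\<dots> \<le> B * \<bar>t - s\<bar> powr (-\<sigma>) * nrm M 1 f * nrm M 1 (G t)" by (rule pair_dispersive[OF f g st])
    also have "\<dots> \<le> B * c1 powr (-\<sigma>) * nrm M 1 f * nrm M 1 (G t)"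
      using sep[OF t] c1 sigma_pos B1 by (intro mult_right_mono mult_left_mono powr_mono2') auto
    finally show "cmod (L2_inner M (G t) (U t (adj s f))) \<le> B * c1 powr (-\<sigma>) * nrm M 1 f * nrm M 1 (G t)" .
  qed
  also have "\<dots> = B * c1 powr (-\<sigma>) * nrm M 1 f * (LINT t|lebesgue_on J. nrm M 1 (G t))" by simp
  finally show ?thesis .
qed

text \<open>Interpolation with parameter \<open>\<theta> = 2x\<close> between \<open>off_diagonal_dispersive\<close> and the Strichartz estimate
  for \<open>\<beta> = y/(2x)\<close>; the condition on \<open>x\<close> and \<open>y\<close> says that this Strichartz estimate is available.\<close>

lemma off_diagonal:
  assumes c1: "0 < c1" and xy: "0 \<le> y" "y \<le> x" "x \<le> 1/2"
    and cond: "x = 0 \<or> \<sigma> * (x - y) < x \<or> (1 < \<sigma> \<and> \<sigma> * (x - y) = x)" and v: "v = 1/(1 - \<sigma> * (x - y))"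
  obtains C where "C > 0" "\<And>c J s f G. J \<in> lmeasurable \<Longrightarrow> J \<subseteq> {c..<c+2} \<Longrightarrow> (\<And>t. t \<in> J \<Longrightarrow> c1 \<le> \<bar>t - s\<bar>) \<Longrightarrow>
     test M f \<Longrightarrow> time_simple M J G \<Longrightarrow>
     cmod (cinner (adj s f) (Tstar J G)) \<le> C * nrm M (1/(1-x)) f
       * (LINT t|lebesgue_on J. nrm M (1/(1-y)) (G t) powr v) powr (1/v)"
proof (cases "x = 0")
  case True
  \<comment> \<open>Here \<open>\<theta>\<close> is 0 and \<open>\<beta>\<close> would be a quotient
    of zeros; the dispersive inequality by itself is the claim.\<close>
  then have [simp]: "x = 0" "y = 0" "v = 1" using xy v by auto
  show ?thesis
  proof (rule that[of "B * c1 powr (-\<sigma>)"])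
    show "0 < B * c1 powr (-\<sigma>)" using B1 c1 by simp
    fix c s :: real and J and f :: "'x \<Rightarrow> complex"
      and G assume "J \<in> lmeasurable" "\<And>t. t \<in> J \<Longrightarrow> c1 \<le> \<bar>t - s\<bar>" "test M f" "time_simple M J G"
    from off_diagonal_dispersive[OF this(1,2) c1 this(3,4)]
    show "cmod (cinner (adj s f) (Tstar J G)) \<le> B * c1 powr (-\<sigma>) * nrm M (1/(1-x)) f
      * (LINT t|lebesgue_on J. nrm M (1/(1-y)) (G t) powr v) powr (1/v)"
      by (simp add: integral_nonneg_AE)
  qed
next
  case False
  then have x: "x > 0" using xy by simp
  \<comment> \<open>Forced by the spatial exponents:
    \<open>1 - x = (1 - \<theta>) + \<theta>/2\<close> determines \<open>\<theta>\<close>, and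
    \<open>1 - y = (1 - \<theta>) + \<theta> * (1 - \<beta>)\<close> then determines
    \<open>\<beta>\<close>.\<close>
  define \<theta> where "\<theta> = 2*x"
  define \<beta> where "\<beta> = y/\<theta>"
  have \<theta>: "0 < \<theta>" "\<theta> \<le> 1" using x xy by (auto simp: \<theta>_def)
  have \<beta>: "0 \<le> \<beta>" "\<beta> \<le> 1/2" using xy x by (auto simp: \<beta>_def \<theta>_def field_simps)
  have y\<theta>: "y = \<theta> * \<beta>" using \<theta> by (simp add: \<beta>_def)
  have eq\<sigma>: "\<sigma> * (1 - 2*\<beta>) = \<sigma> * (x - y) / x" using x by (simp add: \<beta>_def \<theta>_def field_simps)
  have cond': "\<sigma> * (1 - 2*\<beta>) < 1 \<or> (1 < \<sigma> \<and> \<sigma> * (1 - 2*\<beta>) = 1)"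
    using cond x unfolding eq\<sigma> by (auto simp: divide_less_eq)
  define a where "a = 1/(1 - \<sigma> * (1/2 - \<beta>))"
  obtain C1 where C1: "C1 > 0" and S: "\<And>c J G. J \<in> lmeasurable \<Longrightarrow> J \<subseteq> {c..<c+2} \<Longrightarrow> time_simple M J G \<Longrightarrow>
     norm (Tstar J G) \<le> C1 * (LINT t|lebesgue_on J. nrm M (1/(1-\<beta>)) (G t) powr a) powr (1/a)"
    using strichartz[OF \<beta> cond' a_def] by blast
  have \<sigma>\<beta>: "\<sigma> * (1/2 - \<beta>) \<le> 1/2" using cond' by (auto simp: algebra_simps)
  have a1: "a > 0" "1/a = 1 - \<sigma> * (1/2 - \<beta>)" using \<sigma>\<beta> by (auto simp: a_def)
  have \<sigma>xy: "\<sigma> * (x - y) = \<theta> * (\<sigma> * (1/2 - \<beta>))" by (simp add: y\<theta> \<theta>_def algebra_simps)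
  have v1: "v > 0" "1/v = 1 - \<sigma> * (x - y)"
  proof -
    have "\<theta> * (\<sigma> * (1/2 - \<beta>)) \<le> 1 * (1/2)" using \<theta> \<sigma>\<beta> sigma_pos \<beta> by (intro mult_mono) auto
    then show "v > 0" "1/v = 1 - \<sigma> * (x - y)" unfolding v \<sigma>xy by auto
  qed
  define K0 where "K0 = B * c1 powr (-\<sigma>)"
  define K1 where "K1 = A * C1"
  have K: "0 < K0" "0 < K1" using A1 B1 c1 C1 by (auto simp: K0_def K1_def)
  define C where "C = K0 powr (1-\<theta>) * K1 powr \<theta>"
  show ?thesis
  proof (rule that[of C])
    show "C > 0" using K by (simp add: C_def)
    fix c s :: real and J and f :: "'x \<Rightarrow> complex" and G0 assume J: "J \<in> lmeasurable" and Jc: "J \<subseteq> {c..<c+2}"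
      and sep: "\<And>t. t \<in> J \<Longrightarrow> c1 \<le> \<bar>t - s\<bar>"
      and f: "test M f" and G0: "time_simple M J G0"
    have G0s: "simple_function (lebesgue_on J) G0" using G0 by (simp add: time_simple_def)
    \<comment> \<open>Of \<open>G0\<close> only the level sets are kept; the value on each of them
      is replaced by an arbitrary \<open>\<gamma>\<close>, so that it can be deformed. Choosing for
      \<open>\<gamma>\<close> the conjugate of \<open>g\<close> on the set where
      \<open>G0 t = g\<close> gives \<open>G0\<close> back at the end.\<close>
    define P where "P g \<gamma> t x = (if G0 t = g then cnj (\<gamma> x) else 0)" for g \<gamma> :: "'x \<Rightarrow> complex" and t :: real
      and x :: 'x
    have tP: "time_simple M J (P g \<gamma>)" if "test M \<gamma>" for g \<gamma>
    proof -
      have "P g \<gamma> = (\<lambda>t. (\<lambda>d. if d = g then (\<lambda>x. cnj (\<gamma> x)) else (\<lambda>x. 0)) (G0 t))"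
        by (auto simp: P_def fun_eq_iff)
      moreover have "time_simple M J (\<lambda>t. (\<lambda>d. if d = g then (\<lambda>x. cnj (\<gamma> x)) else (\<lambda>x. 0)) (G0 t))"
        using that by (intro time_simple_compose[OF G0]) (auto intro: test_cnj test_zero)
      ultimately show ?thesis by simp
    qed
    define \<Lambda> where "\<Lambda> g f \<gamma> = cinner (adj s f) (Tstar J (P g \<gamma>))" for g f \<gamma>
    interpret bilinear_family M "G0 ` J" "\<lambda>g. measure lebesgue {t\<in>J. G0 t = g}" \<Lambda>
    proof
      show "finite (G0 ` J)" using simple_functionD(1)[OF G0s] by (simp add: space_restrict_space)
      fix g f f' \<gamma> \<gamma>' :: "'x \<Rightarrow> complex" and c :: complex
      show "\<Lambda> g f \<gamma> = \<Lambda> g f' \<gamma>" if "\<And>x. x \<in> space M \<Longrightarrow> f x = f' x"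
        unfolding \<Lambda>_def using adj_cong[OF that] by simp
      show "\<Lambda> g f \<gamma> = \<Lambda> g f \<gamma>'" if "\<And>x. x \<in> space M \<Longrightarrow> \<gamma> x = \<gamma>' x"
        unfolding \<Lambda>_def using Tstar_cong[of J "P g \<gamma>" "P g \<gamma>'"] that by (simp add: P_def)
      assume f: "test M f" and \<gamma>: "test M \<gamma>"
      show "\<Lambda> g (\<lambda>x. f x + f' x) \<gamma> = \<Lambda> g f \<gamma> + \<Lambda> g f' \<gamma>" if "test M f'"
        unfolding \<Lambda>_def using adj_add[OF test_L2[OF f] test_L2[OF that]] by (simp add: cinner_add_left)
      show "\<Lambda> g f (\<lambda>x. \<gamma> x + \<gamma>' x) = \<Lambda> g f \<gamma> + \<Lambda> g f \<gamma>'" if "test M \<gamma>'"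
      proof -
        have "P g (\<lambda>x. \<gamma> x + \<gamma>' x) = (\<lambda>t x. P g \<gamma> t x + P g \<gamma>' t x)" by (auto simp: P_def fun_eq_iff)
        then show ?thesis unfolding \<Lambda>_def using Tstar_add[OF J tP[OF \<gamma>] tP[OF that]]
          by (simp add: cinner_add_right)
      qed
      show "\<Lambda> g (\<lambda>x. c * f x) \<gamma> = c * \<Lambda> g f \<gamma>"
        unfolding \<Lambda>_def using adj_scale[OF test_L2[OF f]] by (simp add: cinner_scaleC_left)
      show "\<Lambda> g f (\<lambda>x. c * \<gamma> x) = c * \<Lambda> g f \<gamma>"
      proof -
        have "P g (\<lambda>x. c * \<gamma> x) = (\<lambda>t x. cnj c * P g \<gamma> t x)" by (auto simp: P_def fun_eq_iff)
        then show ?thesis unfolding \<Lambda>_def using Tstar_scale[OF J tP[OF \<gamma>]] by (simp add: cinner_scaleC_right)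
      qed
    qed simp
    have t\<gamma>: "time_simple M J (\<lambda>t x. cnj (\<gamma> (G0 t) x))" if "\<forall>g\<in>G0 ` J. test M (\<gamma> g)" for \<gamma>
      using that by (intro time_simple_compose[OF G0, of "\<lambda>g x. cnj (\<gamma> g x)"] test_cnj) auto
    have form: "(\<Sum>g\<in>G0 ` J. \<Lambda> g f (\<gamma> g)) = cinner (adj s f) (Tstar J (\<lambda>t x. cnj (\<gamma> (G0 t) x)))"
      if "\<forall>g\<in>G0 ` J. test M (\<gamma> g)" for f \<gamma>
    proof -
      have "Tstar J (\<lambda>t x. cnj (\<gamma> (G0 t) x)) = (\<Sum>g\<in>G0 ` J. Tstar J (P g (\<gamma> g)))"
      proof (rule Tstar_sum[OF J finite_index t\<gamma>[OF that]])
        show "time_simple M J (P g (\<gamma> g))" if "g \<in> G0 ` J" for g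
          using that \<open>\<forall>g\<in>G0 ` J. test M (\<gamma> g)\<close> by (intro tP) blast
        fix t x assume "t \<in> J"
        then have "(\<Sum>g\<in>G0 ` J. P g (\<gamma> g) t x) = (\<Sum>g\<in>G0 ` J. if g = G0 t then cnj (\<gamma> (G0 t) x) else 0)"
          by (intro sum.cong) (auto simp: P_def)
        then show "cnj (\<gamma> (G0 t) x) = (\<Sum>g\<in>G0 ` J. P g (\<gamma> g) t x)" using \<open>t \<in> J\<close> finite_index by simp
      qed
      then show ?thesis by (simp add: \<Lambda>_def cinner_sum_right)
    qed
    have mx: "mixed u w \<gamma> = (LINT t|lebesgue_on J. nrm M u (\<gamma> (G0 t)) powr w) powr (1/w)" for u w \<gamma>
      unfolding mixed_def using integral_simple_compose[OF J G0s, of "\<lambda>g. nrm M u (\<gamma> g) powr w"] by simp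
    have b0: "bounded_form 1 1 1 K0"
      unfolding bounded_form_def
    proof (intro allI impI)
      fix f :: "'x \<Rightarrow> complex" and \<gamma> :: "('x \<Rightarrow> complex) \<Rightarrow> 'x \<Rightarrow> complex" assume f: "test M f"
        and \<gamma>: "\<forall>g\<in>G0 ` J. test M (\<gamma> g)"
      show "cmod (\<Sum>g\<in>G0 ` J. \<Lambda> g f (\<gamma> g)) \<le> K0 * nrm M 1 f * mixed 1 1 \<gamma>"
        unfolding form[OF \<gamma>] mx using off_diagonal_dispersive[OF J sep c1 f t\<gamma>[OF \<gamma>]]
        by (simp add: K0_def integral_nonneg_AE)
    qed
    have b1: "bounded_form 2 (1/(1-\<beta>)) a K1"
      unfolding bounded_form_def
    proof (intro allI impI)
      fix f :: "'x \<Rightarrow> complex" and \<gamma> :: "('x \<Rightarrow> complex) \<Rightarrow> 'x \<Rightarrow> complex" assume f: "test M f"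
        and \<gamma>: "\<forall>g\<in>G0 ` J. test M (\<gamma> g)"
      have "cmod (\<Sum>g\<in>G0 ` J. \<Lambda> g f (\<gamma> g)) \<le> norm (adj s f) * norm (Tstar J (\<lambda>t x. cnj (\<gamma> (G0 t) x)))"
        unfolding form[OF \<gamma>] by (rule cinner_Cauchy_Schwarz)
      also have "\<dots> \<le> (A * nrm M 2 f) * (C1
        * (LINT t|lebesgue_on J. nrm M (1/(1-\<beta>)) (\<lambda>x. cnj (\<gamma> (G0 t) x)) powr a) powr (1/a))"
        using A1 by (intro mult_mono norm_adj test_L2 f S[OF J Jc t\<gamma>[OF \<gamma>]]) auto
      finally show "cmod (\<Sum>g\<in>G0 ` J. \<Lambda> g f (\<gamma> g)) \<le> K1 * nrm M 2 f * mixed (1/(1-\<beta>)) a \<gamma>"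
        unfolding mx by (simp add: K1_def mult_ac)
    qed
    have "bounded_form (1/(1-x)) (1/(1-y)) v (K0 powr (1-\<theta>) * K1 powr \<theta>)"
    proof (rule riesz_thorin[OF b0 b1 K])
      show "1 / (1 / (1 - x)) = (1 - \<theta>) / 1 + \<theta> / 2" using xy by (simp add: \<theta>_def)
      have "1 / (1/(1-\<beta>)) = 1 - \<beta>" using \<beta> by simp
      then have "(1 - \<theta>) / 1 + \<theta> / (1/(1-\<beta>)) = 1 - \<theta> * \<beta>" by (simp add: algebra_simps)
      then show "1 / (1 / (1 - y)) = (1 - \<theta>) / 1 + \<theta> / (1/(1-\<beta>))" using xy y\<theta> by simp
      have "\<theta> / a = \<theta> * (1 - \<sigma> * (1/2 - \<beta>))" by (simp add: a1(2)[symmetric])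
      then show "1 / v = (1 - \<theta>) / 1 + \<theta> / a" unfolding v1(2) \<sigma>xy by (simp add: algebra_simps)
    qed (use xy \<beta> a1 v1 \<theta> in auto)
    from this[unfolded bounded_form_def, rule_format, of f "\<lambda>g x. cnj (g x)"]
    have "cmod (\<Sum>g\<in>G0 ` J. \<Lambda> g f (\<lambda>x. cnj (g x))) \<le> K0 powr (1-\<theta>) * K1 powr \<theta> * nrm M (1/(1-x)) f
      * mixed (1/(1-y)) v (\<lambda>g x. cnj (g x))"
      using f G0 by (auto simp: time_simple_def intro: test_cnj)
    moreover have "(\<Sum>g\<in>G0 ` J. \<Lambda> g f (\<lambda>x. cnj (g x))) = cinner (adj s f) (Tstar J G0)"
      using form[of "\<lambda>g x. cnj (g x)" f] G0 by (auto simp: time_simple_def intro: test_cnj)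
    ultimately show "cmod (cinner (adj s f) (Tstar J G0)) \<le> C * nrm M (1/(1-x)) f
      * (LINT t|lebesgue_on J. nrm M (1/(1-y)) (G0 t) powr v) powr (1/v)"
      unfolding mx by (simp add: C_def)
  qed
qed

end

lemma dual_norm_cong:
  assumes "\<And>\<phi>. test M \<phi> \<Longrightarrow> L2_inner M v \<phi> = L2_inner M w \<phi>"
  shows "dual_norm M y k v = dual_norm M y k w"
  unfolding dual_norm_def using assms by (intro SUP_cong) auto

section \<open>The operator of the theorem and its estimate by duality\<close>

context dispersive
begin

text \<open>This is where the a priori assumption on \<open>F\<close> enters: integrability in time
  with values in \<open>L2\<close> is what gives \<open>Tstar I F\<close> a meaning.\<close>

lemma admissible_of_mixed_space:
  assumes I: "I \<in> sets lebesgue" and F: "F \<in> mixed_space M I 1 2"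
  shows "admissible I F"
proof -
  let ?L = "lebesgue_on I"
  have sm: "strong_meas M I F" using F
    by (simp add: mixed_space_def strongly_measurable_strong_meas del: numeral_eq_ereal)
  have fin: "L_norm ?L 1 (\<lambda>t. Lp_norm M 2 (F t)) < \<infinity>"
    using F by (simp add: mixed_space_def mixed_norm_def del: numeral_eq_ereal)
  have m1: "(\<lambda>t. Lp_norm M 2 (F t)) \<in> borel_measurable ?L" by (rule L_norm_measurable[OF fin])
  have m2: "(\<lambda>t. ennreal (nrm M 2 (F t))) \<in> borel_measurable ?L" using strong_meas_nrm[OF I sm] by measurable
  have "AE t in ?L. Lp_norm M 2 (F t) = ennreal (nrm M 2 (F t))"
    using strong_meas_AE_L2[OF sm] by eventually_elim (rule Lp_norm_2)
  then have "L_norm ?L 1 (\<lambda>t. ennreal (nrm M 2 (F t))) < \<infinity>" using L_norm_cong_AE[OF m1 m2] fin by simp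
  then obtain K where K: "K \<ge> 0" "L_norm ?L 1 (\<lambda>t. ennreal (nrm M 2 (F t))) = ennreal K"
    by (cases "L_norm ?L 1 (\<lambda>t. ennreal (nrm M 2 (F t)))") auto
  then have "Lp_bound ?L 1 (\<lambda>t. nrm M 2 (F t)) K"
    using L_norm_le_iff[of "\<lambda>t. nrm M 2 (F t)" 1 K ?L] by (simp add: one_ereal_def)
  then have "(\<integral>\<^sup>+t. ennreal (nrm M 2 (F t)) \<partial>?L) < \<infinity>" by (auto simp: Lp_bound_def intro: le_less_trans)
  then have "integrable ?L (\<lambda>t. nrm M 2 (F t))"
    using strong_meas_nrm[OF I sm] by (intro integrableI_nonneg) auto
  then show ?thesis using I sm by (simp add: admissible_def)
qed

text \<open>\<open>U t (Tstar I F)\<close> has the defining property of the weak integral, so the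
  chosen representative exists and has the same pairings. The two agree up to a null set, which is
  all that norms detect.\<close>

lemma TTstar_inner:
  assumes F: "admissible I F" and g: "g \<in> L2 M"
  shows "TTstar M U (zero_extension I F) t \<in> L2 M"
    and "L2_inner M (TTstar M U (zero_extension I F) t) g = L2_inner M (U t (Tstar I F)) g"
proof -
  let ?F = "zero_extension I F"
  let ?\<Phi> = "\<lambda>s. U t (adj s (?F s))"
  have I: "I \<in> sets lebesgue" and sm: "strong_meas M I F" using F by (auto simp: admissible_def)
  have hb: "has_bochner_integral lebesgue (\<lambda>s. L2_inner M (?\<Phi> s) g) (L2_inner M (U t (Tstar I F)) g)"
    if g: "g \<in> L2 M" for g
  proof -
    let ?f = "\<lambda>s. indicator I s *\<^sub>R L2_inner M (F s) (U s (adj t g))"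
    have "L2_inner M (U t (Tstar I F)) g = cinner (Tstar I F) (adj t g)"
      by (subst L2_inner_cnj, subst cinner_commute) (simp add: cinner_adj[OF g])
    also have "\<dots> = (LINT s|lebesgue_on I. L2_inner M (F s) (U s (adj t g)))" by (rule cinner_Tstar[OF F])
    finally have "has_bochner_integral (lebesgue_on I) (\<lambda>s. L2_inner M (F s) (U s (adj t g)))
      (L2_inner M (U t (Tstar I F)) g)"
      using admissible_integrable[OF F] by (simp add: has_bochner_integral_iff)
    then have h: "has_bochner_integral lebesgue ?f (L2_inner M (U t (Tstar I F)) g)"
      using I by (subst (asm) has_bochner_integral_restrict_space) auto
    have "AE s in lebesgue_on I. F s \<in> L2 M" by (rule strong_meas_AE_L2[OF sm])
    then have "AE s in lebesgue. s \<in> I \<longrightarrow> F s \<in> L2 M" using I by (subst (asm) AE_restrict_space_iff) auto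
    then have ae: "AE s in lebesgue. ?f s = L2_inner M (?\<Phi> s) g"
    proof eventually_elim
      case (elim s)
      have "?F s \<in> L2 M" using elim by (auto simp: zero_extension_def intro: test_L2 test_zero)
      then have "L2_inner M (?\<Phi> s) g = L2_inner M (?F s) (U s (adj t g))"
        using adj_pair[OF _ g, of "?F s" s t] cinner_adj[of "?F s" s "adj t g"] by simp
      then show ?case by (simp add: zero_extension_def)
    qed
    have fm: "?f \<in> borel_measurable lebesgue" using h by (auto simp: has_bochner_integral_iff)
    \<comment> \<open>At exceptional times \<open>?F s\<close> need not be square integrable, and
      then its adjoint image is unspecified; completeness makes the integrand measurable all the
      same.\<close>
    have "(\<lambda>s. L2_inner M (?\<Phi> s) g) \<in> borel_measurable lebesgue" 
      by (rule complete_measure.borel_measurable_AE[OF completion.complete_measure_axioms fm ae])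
    then show ?thesis using has_bochner_integral_cong_AE[OF fm _ ae] h by blast
  qed
  have "\<exists>G. G \<in> Lp_space M 2 \<and> (\<forall>g\<in>Lp_space M 2. has_bochner_integral lebesgue (\<lambda>s. L2_inner M (?\<Phi> s) g)
    (L2_inner M G g))"
    using hb U_L2 unfolding L2_def by blast
  from someI_ex[OF this]
  have T: "TTstar M U ?F t \<in> Lp_space M 2"
    "\<forall>g\<in>Lp_space M 2. has_bochner_integral lebesgue (\<lambda>s. L2_inner M (?\<Phi> s) g)
      (L2_inner M (TTstar M U ?F t) g)"
    unfolding TTstar_def L2_integral_def by blast+
  show "TTstar M U ?F t \<in> L2 M" using T(1) by (simp only: L2_def)
  have "has_bochner_integral lebesgue (\<lambda>s. L2_inner M (?\<Phi> s) g) (L2_inner M (TTstar M U ?F t) g)"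
    using T(2) g unfolding L2_def by blast
  then show "L2_inner M (TTstar M U ?F t) g = L2_inner M (U t (Tstar I F)) g"
    using hb[OF g] by (rule has_bochner_integral_eq)
qed

text \<open>\<open>x\<close>, \<open>y\<close>, \<open>z\<close>, \<open>zq\<close> stand for the
  reciprocals of \<open>rt\<close>, \<open>r\<close>, \<open>qt\<close>, \<open>q\<close>. If
  \<open>y \<le> x\<close>, \<open>F\<close> enters through its integral in time and the output has
  the reciprocal time exponent \<open>\<sigma> * (x - y)\<close>. Otherwise the output is bounded in
  time and \<open>F\<close> enters with \<open>1 - \<sigma> * (y - x)\<close>. The remaining
  exponents follow from the nesting of Lebesgue spaces. The constant does not depend on
  \<open>k\<close>, so the truncation can be removed afterwards.\<close>

lemma inhomogeneous_estimate:
  assumes c1: "0 < c1" and xy: "0 \<le> x" "x \<le> 1/2" "0 \<le> y" "y \<le> 1/2"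
    and k1: "(\<sigma> - 1) * y \<le> \<sigma> * x" and k2: "(\<sigma> - 1) * x \<le> \<sigma> * y"
    and z: "\<sigma> * (y - x) \<le> z" "0 \<le> z" "z \<le> 1" and zq: "\<sigma> * (x - y) \<le> zq" "0 \<le> zq" "zq \<le> 1"
    and one: "\<sigma> = 1 \<Longrightarrow> 0 < x \<and> 0 < y"
  obtains C where "C > 0" "\<And>I J ci cj F \<phi> K k. I \<in> lmeasurable \<Longrightarrow> J \<in> lmeasurable \<Longrightarrow> measure lebesgue I \<le> 1 \<Longrightarrow>
    measure lebesgue J \<le> 1 \<Longrightarrow>
    I \<subseteq> {ci..<ci+2} \<Longrightarrow> J \<subseteq> {cj..<cj+2} \<Longrightarrow> (\<And>s t. s \<in> I \<Longrightarrow> t \<in> J \<Longrightarrow> c1 \<le> \<bar>t - s\<bar>) \<Longrightarrow> admissible I F \<Longrightarrow>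
    (AE s in lebesgue_on I. Lp_bound M (1-x) (\<lambda>x. cmod (F s x)) (\<phi> s)) \<Longrightarrow> Lp_bound (lebesgue_on I) (1-z) \<phi> K \<Longrightarrow>
    Lp_bound (lebesgue_on J) zq (\<lambda>t. dual_norm M y (real k) (U t (Tstar I F))) (C * K)"
proof -
  have prob: "emeasure (lebesgue_on I) (space (lebesgue_on I)) \<le> 1"
    if "I \<in> lmeasurable" "measure lebesgue I \<le> 1" for I :: "real set"
  proof -
    have "emeasure (lebesgue_on I) (space (lebesgue_on I)) = ennreal (measure lebesgue I)"
      using that by (simp add: space_restrict_space emeasure_restrict_space emeasure_eq_measure2)
    then show ?thesis using that(2) by (simp add: ennreal_le_1)
  qed
  \<comment> \<open>The index condition says \<open>\<sigma> * (b - a) \<le> b\<close>. It is strict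
    for \<open>\<sigma> < 1\<close> unless \<open>b = 0\<close>, and for \<open>\<sigma> = 1\<close>
    because \<open>a > 0\<close>. Equality survives for \<open>\<sigma> > 1\<close> only, where the
    endpoint estimate is available.\<close>
  have cond: "b = 0 \<or> \<sigma> * (b - a) < b \<or> (1 < \<sigma> \<and> \<sigma> * (b - a) = b)"
    if "0 \<le> a" "a \<le> b" "(\<sigma> - 1) * b \<le> \<sigma> * a" "\<sigma> = 1 \<Longrightarrow> 0 < a" for a b
  proof -
    have le: "\<sigma> * (b - a) \<le> b" using that(3) by (simp add: algebra_simps)
    consider "\<sigma> < 1" | "\<sigma> = 1" | "1 < \<sigma>" by linarith
    then show ?thesis
    proof cases
      case 1
      have "\<sigma> * (b - a) \<le> \<sigma> * b" using that sigma_pos by (intro mult_left_mono) auto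
      moreover have "b = 0 \<or> \<sigma> * b < b" using 1 that by (cases "b = 0") auto
      ultimately show ?thesis by auto
    qed (use that le in auto)
  qed
  show ?thesis
  proof (cases "y \<le> x")
    case True
    define v where "v = 1/(1 - \<sigma> * (x - y))"
    have half: "\<sigma> * (x - y) \<le> 1/2" using k2 xy by (simp add: algebra_simps)
    have s0: "0 \<le> \<sigma> * (x - y)" using True sigma_pos by simp
    have v1: "1 \<le> v" "1 - 1/v = \<sigma> * (x - y)" using half s0 by (auto simp: v_def field_simps)
    obtain C where C: "C > 0" and off: "\<And>c J s f G. J \<in> lmeasurable \<Longrightarrow> J \<subseteq> {c..<c+2} \<Longrightarrow>
      (\<And>t. t \<in> J \<Longrightarrow> c1 \<le> \<bar>t - s\<bar>) \<Longrightarrow>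
     test M f \<Longrightarrow> time_simple M J G \<Longrightarrow>
     cmod (cinner (adj s f) (Tstar J G)) \<le> C * nrm M (1/(1-x)) f
       * (LINT t|lebesgue_on J. nrm M (1/(1-y)) (G t) powr v) powr (1/v)"
      by (rule off_diagonal[OF c1 xy(3) True xy(2) cond[OF xy(3) True k2] v_def]) (use one in auto)
    show ?thesis
    proof (rule that[OF C])
      fix I J :: "real set" and ci cj K F \<phi> and k :: nat
      assume I: "I \<in> lmeasurable" and J: "J \<in> lmeasurable" and mI: "measure lebesgue I \<le> 1"
        and mJ: "measure lebesgue J \<le> 1"
        and Jc: "J \<subseteq> {cj..<cj+2}" and sep: "\<And>s t. s \<in> I \<Longrightarrow> t \<in> J \<Longrightarrow> c1 \<le> \<bar>t - s\<bar>" and F: "admissible I F"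
        and F\<phi>: "AE s in lebesgue_on I. Lp_bound M (1-x) (\<lambda>x. cmod (F s x)) (\<phi> s)"
          and \<phi>: "Lp_bound (lebesgue_on I) (1-z) \<phi> K"
      define h where "h = Tstar I F"
      have K0: "0 \<le> K" using \<phi> by (rule Lp_bound_nonneg)
      have \<phi>1: "Lp_bound (lebesgue_on I) 1 \<phi> K"
        by (rule Lp_bound_mono_exponent[OF prob[OF I mI] \<phi>]) (use z in auto)
      have sI: "AE s in lebesgue_on I. s \<in> I" by (rule AE_I2) (simp add: space_restrict_space)
      have dualG: "cmod (LINT t|lebesgue_on J. L2_inner M (U t h) (G t))
          \<le> (C * K) * (LINT t|lebesgue_on J. nrm M (1/(1-y)) (G t) powr v) powr (1/v)"
            if G: "time_simple M J G" for G
      proof -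
        define w where "w = Tstar J G"
        define N where "N = (LINT t|lebesgue_on J. nrm M (1/(1-y)) (G t) powr v) powr (1/v)"
        have N0: "0 \<le> N" by (simp add: N_def)
        \<comment> \<open>The off-diagonal bound dualised in \<open>f\<close>: uniformly in
          \<open>s\<close>, \<open>U s w\<close> lies in the dual of the space of
          \<open>F s\<close>. Hence only the integral of \<open>\<phi>\<close> matters.\<close>
        have wb: "Lp_bound M x (\<lambda>\<xi>. cmod (U s w \<xi>)) (C * N)" if s: "s \<in> I" for s
        proof (rule L2_converse[OF xy(1) _ U_L2])
          fix f :: "'x \<Rightarrow> complex" assume f: "test M f"
          have "cmod (L2_inner M (U s w) f) = cmod (cinner (adj s f) w)"
            by (subst L2_inner_cnj) (simp add: cinner_adj[OF test_L2[OF f]])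
          also have "\<dots> \<le> C * nrm M (1/(1-x)) f * N"
            unfolding w_def N_def by (rule off[OF J Jc _ f G]) (use sep s in auto)
          finally show "cmod (L2_inner M (U s w) f) \<le> C * N * nrm M (1/(1-x)) f" by (simp add: mult_ac)
        qed (use xy C N0 in auto)
        have "(LINT t|lebesgue_on J. L2_inner M (U t h) (G t))
          = cnj (LINT t|lebesgue_on J. L2_inner M (G t) (U t h))"
          by (simp add: L2_inner_cnj[of M "U _ h"] del: complex_cnj_cancel_iff)
        then have "cmod (LINT t|lebesgue_on J. L2_inner M (U t h) (G t)) = cmod (cinner w h)"
          using cinner_Tstar[OF time_simple_admissible[OF J G]] by (simp add: w_def)
        also have "\<dots> = cmod (LINT s|lebesgue_on I. L2_inner M (F s) (U s w))"
          by (subst norm_cinner_commute) (simp add: h_def cinner_Tstar[OF F])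
        finally have "ennreal (cmod (LINT t|lebesgue_on J. L2_inner M (U t h) (G t)))
          \<le> (\<integral>\<^sup>+s. ennreal (cmod (L2_inner M (F s) (U s w))) \<partial>lebesgue_on I)"
          using integral_norm_bound_ennreal[OF admissible_integrable[OF F]] by simp
        also have "\<dots> \<le> (\<integral>\<^sup>+s. ennreal \<bar>\<phi> s\<bar> * ennreal (C * N) \<partial>lebesgue_on I)"
        proof (rule nn_integral_mono_AE)
          have "AE s in lebesgue_on I. F s \<in> L2 M"
            using F by (auto simp: admissible_def intro: strong_meas_AE_L2)
          then show "AE s in lebesgue_on I. ennreal (cmod (L2_inner M (F s) (U s w))) \<le> ennreal \<bar>\<phi> s\<bar>
            * ennreal (C * N)"
            using F\<phi> sI
          proof eventually_elim
            case (elim s)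
            have "cmod (L2_inner M (F s) (U s w)) \<le> \<phi> s * (C * N)"
              by (rule L2_inner_Holder[OF elim(1,2) U_L2]) (use wb[OF elim(3)] xy in auto)
            also have "\<dots> \<le> \<bar>\<phi> s\<bar> * (C * N)" using C N0 by (intro mult_right_mono) auto
            finally show ?case using C N0 by (simp flip: ennreal_mult add: ennreal_leI)
          qed
        qed
        also have "\<dots> = (\<integral>\<^sup>+s. ennreal \<bar>\<phi> s\<bar> \<partial>lebesgue_on I) * ennreal (C * N)"
          using Lp_bound_measurable[OF \<phi>] by (intro nn_integral_multc) measurable
        also have "\<dots> \<le> ennreal K * ennreal (C * N)"
          using \<phi>1 by (intro mult_right_mono) (auto simp: Lp_bound_def)
        also have "\<dots> = ennreal (C * K * N)" using C K0 N0 by (simp flip: ennreal_mult add: mult_ac)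
        finally show ?thesis using C K0 N0 by (simp add: N_def[symmetric])
      qed
      have "Lp_bound (lebesgue_on J) (1 - 1/v) (\<lambda>t. dual_norm M y (real k) (U t h)) (C * K)"
        by (rule mixed_converse[OF J U_strong_meas_on xy(3) _ v1(1) _ _ _ _ dualG, where B="A * norm h"])
          (use J xy C K0 A1 energy in auto)
      then show "Lp_bound (lebesgue_on J) zq (\<lambda>t. dual_norm M y (real k) (U t (Tstar I F))) (C * K)"
        unfolding h_def by (rule Lp_bound_mono_exponent[OF prob[OF J mJ]]) (use v1 s0 zq in auto)
    qed
  next
    case False
    then have xy': "x \<le> y" by simp
    define v where "v = 1/(1 - \<sigma> * (y - x))"
    have half: "\<sigma> * (y - x) \<le> 1/2" using k1 xy by (simp add: algebra_simps)
    have s0: "0 \<le> \<sigma> * (y - x)" using xy' sigma_pos by simp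
    have v1: "1 \<le> v" "1 - 1/v = \<sigma> * (y - x)" using half s0 by (auto simp: v_def field_simps)
    obtain C where C: "C > 0" and off: "\<And>c J s f G. J \<in> lmeasurable \<Longrightarrow> J \<subseteq> {c..<c+2} \<Longrightarrow>
      (\<And>t. t \<in> J \<Longrightarrow> c1 \<le> \<bar>t - s\<bar>) \<Longrightarrow>
     test M f \<Longrightarrow> time_simple M J G \<Longrightarrow>
     cmod (cinner (adj s f) (Tstar J G)) \<le> C * nrm M (1/(1-y)) f
       * (LINT t|lebesgue_on J. nrm M (1/(1-x)) (G t) powr v) powr (1/v)"
      by (rule off_diagonal[OF c1 xy(1) xy' xy(4) cond[OF xy(1) xy' k1] v_def]) (use one in auto)
    show ?thesis
    proof (rule that[OF C])
      fix I J :: "real set" and ci cj K F \<phi> and k :: nat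
      assume I: "I \<in> lmeasurable" and J: "J \<in> lmeasurable" and mI: "measure lebesgue I \<le> 1"
        and mJ: "measure lebesgue J \<le> 1"
        and Ic: "I \<subseteq> {ci..<ci+2}" and sep: "\<And>s t. s \<in> I \<Longrightarrow> t \<in> J \<Longrightarrow> c1 \<le> \<bar>t - s\<bar>" and F: "admissible I F"
        and F\<phi>: "AE s in lebesgue_on I. Lp_bound M (1-x) (\<lambda>x. cmod (F s x)) (\<phi> s)"
          and \<phi>: "Lp_bound (lebesgue_on I) (1-z) \<phi> K"
      define h where "h = Tstar I F"
      have Is: "I \<in> sets lebesgue" using I by auto
      have K0: "0 \<le> K" using \<phi> by (rule Lp_bound_nonneg)
      have \<phi>1: "Lp_bound (lebesgue_on I) (1 - \<sigma> * (y - x)) \<phi> K"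
        by (rule Lp_bound_mono_exponent[OF prob[OF I mI] \<phi>]) (use z s0 in auto)
      \<comment> \<open>Now \<open>t\<close> is frozen and the bound is pointwise on
        \<open>J\<close>. The off-diagonal estimate is applied on \<open>I\<close> and turned by
        \<open>mixed_converse\<close> into a bound for the function \<open>V\<close> of
        \<open>s\<close> below.\<close>
      have hb: "Lp_bound M y (\<lambda>\<xi>. cmod (U t h \<xi>)) (C * K)" if t: "t \<in> J" for t
      proof (rule L2_converse[OF xy(3) _ U_L2])
        fix g :: "'x \<Rightarrow> complex" assume g: "test M g"
        define N where "N = nrm M (1/(1-y)) g"
        have N0: "0 \<le> N" by (simp add: N_def)
        define V where "V s = U s (adj t g)" for s
        define n where "n k s = dual_norm M x (real k) (V s)" for k :: nat and s
        have n0: "0 \<le> n k s" for k s unfolding n_def V_def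
          by (rule dual_norm_nonneg[OF xy(1) _ U_L2]) (use xy in auto)
        have nb: "Lp_bound (lebesgue_on I) (\<sigma> * (y - x)) (n k) (C * N)" for k
          unfolding n_def V_def v1(2)[symmetric]
        proof (rule mixed_converse[OF I U_strong_meas_on[OF Is] xy(1) _ v1(1), where B="A * norm (adj t g)"])
          fix G assume G: "time_simple M I G"
          have "(LINT s|lebesgue_on I. L2_inner M (U s (adj t g)) (G s))
            = cnj (LINT s|lebesgue_on I. L2_inner M (G s) (U s (adj t g)))"
            by (simp add: L2_inner_cnj[of M "U _ (adj t g)"] del: complex_cnj_cancel_iff)
          then have "cmod (LINT s|lebesgue_on I. L2_inner M (U s (adj t g)) (G s))
            = cmod (cinner (adj t g) (Tstar I G))"
            using cinner_Tstar[OF time_simple_admissible[OF I G]] by (subst norm_cinner_commute) simp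
          also have "\<dots> \<le> C * nrm M (1/(1-y)) g
            * (LINT t|lebesgue_on I. nrm M (1/(1-x)) (G t) powr v) powr (1/v)"
            by (rule off[OF I Ic _ g G]) (use sep t in \<open>auto simp: abs_minus_commute\<close>)
          finally show "cmod (LINT s|lebesgue_on I. L2_inner M (U s (adj t g)) (G s))
            \<le> C * N * (LINT t|lebesgue_on I. nrm M (1/(1-x)) (G t) powr v) powr (1/v)" by (simp add: N_def)
        qed (use xy C N0 A1 energy in auto)
        \<comment> \<open>The truncated norms are finite and measurable in \<open>s\<close>. Their
          supremum is the norm of \<open>V s\<close>, possibly infinite at some times, so the limit
          in \<open>k\<close> is taken only under the integral.\<close>
        have pair: "ennreal (cmod (L2_inner M f (V s))) \<le> (SUP k. ennreal \<bar>\<phi>' * n k s\<bar>)"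
          if f: "f \<in> L2 M" "Lp_bound M (1-x) (\<lambda>\<xi>. cmod (f \<xi>)) \<phi>'" for f s \<phi>'
        proof -
          have \<phi>'0: "0 \<le> \<phi>'" using f(2) by (rule Lp_bound_nonneg)
          show ?thesis
          proof (cases "(SUP k. ennreal \<bar>\<phi>' * n k s\<bar>)")
            case top
            show ?thesis unfolding top by (rule top_greatest)
          next
            case (real R)
            have R: "\<phi>' * n k s \<le> R" for k
            proof -
              have "ennreal \<bar>\<phi>' * n k s\<bar> \<le> ennreal R" unfolding real(2)[symmetric] by (rule SUP_upper) simp
              then show ?thesis using real(1) by simp
            qed
            show ?thesis
            \<comment> \<open>For \<open>\<phi>' = 0\<close> the supremum contains no information on
              \<open>V s\<close>, but then \<open>f\<close> vanishes almost everywhere.\<close>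
            proof (cases "\<phi>' = 0")
              case True
              then have "AE \<xi> in M. f \<xi> = 0" using Lp_bound_zero[of M "1-x" "\<lambda>\<xi>. cmod (f \<xi>)"] f(2) by simp
              then have "L2_inner M f (V s) = L2_inner M (\<lambda>x. 0) (V s)"
                by (intro L2_inner_cong_AE f test_L2[OF test_zero]) (auto simp: V_def U_L2)
              then show ?thesis by simp
            next
              case False
              then have "\<phi>' > 0" using \<phi>'0 by simp
              then have "\<forall>k::nat. dual_norm M x (real k) (V s) \<le> R/\<phi>'"
                using R by (simp add: n_def pos_le_divide_eq mult.commute)
              then have "Lp_bound M x (\<lambda>\<xi>. cmod (V s \<xi>)) (R/\<phi>')"
                using dual_norm_le_iff[OF xy(1) _ _, of "V s" M "R/\<phi>'"] xy real(1) \<phi>'0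
                  by (simp add: V_def U_L2)
              then have "cmod (L2_inner M f (V s)) \<le> \<phi>' * (R/\<phi>')"
                using xy by (intro L2_inner_Holder[OF f]) (auto simp: V_def U_L2)
              then show ?thesis using \<open>\<phi>' > 0\<close> unfolding real(2) by (simp add: ennreal_leI)
            qed
          qed
        qed
        have "cmod (L2_inner M (U t h) g) = cmod (LINT s|lebesgue_on I. L2_inner M (F s) (V s))"
        proof -
          have "cmod (L2_inner M (U t h) g) = cmod (cinner h (adj t g))"
            by (subst L2_inner_cnj, subst norm_cinner_commute) (simp add: cinner_adj[OF test_L2[OF g]])
          then show ?thesis by (simp add: h_def V_def cinner_Tstar[OF F])
        qed
        then have "ennreal (cmod (L2_inner M (U t h) g))
          \<le> (\<integral>\<^sup>+s. ennreal (cmod (L2_inner M (F s) (V s))) \<partial>lebesgue_on I)"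
          using integral_norm_bound_ennreal[OF admissible_integrable[OF F], of "adj t g"] by (simp add: V_def)
        also have "\<dots> \<le> (\<integral>\<^sup>+s. (SUP k. ennreal \<bar>\<phi> s * n k s\<bar>) \<partial>lebesgue_on I)"
        proof (rule nn_integral_mono_AE)
          have "AE s in lebesgue_on I. F s \<in> L2 M"
            using F by (auto simp: admissible_def intro: strong_meas_AE_L2)
          then show "AE s in lebesgue_on I. ennreal (cmod (L2_inner M (F s) (V s)))
            \<le> (SUP k. ennreal \<bar>\<phi> s * n k s\<bar>)"
            using F\<phi> by eventually_elim (rule pair)
        qed
        also have "\<dots> = (SUP k. \<integral>\<^sup>+s. ennreal \<bar>\<phi> s * n k s\<bar> \<partial>lebesgue_on I)"
        proof (rule nn_integral_monotone_convergence_SUP)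
          show "incseq (\<lambda>k s. ennreal \<bar>\<phi> s * n k s\<bar>)"
          proof (intro incseq_SucI le_funI ennreal_leI)
            fix k s
            have "n k s \<le> n (Suc k) s" unfolding n_def V_def
              by (rule dual_norm_mono[OF xy(1) _ U_L2]) (use xy in auto)
            then show "\<bar>\<phi> s * n k s\<bar> \<le> \<bar>\<phi> s * n (Suc k) s\<bar>" using n0 by (simp add: abs_mult mult_left_mono)
          qed
          show "(\<lambda>s. ennreal \<bar>\<phi> s * n k s\<bar>) \<in> borel_measurable (lebesgue_on I)" for k
            using Lp_bound_measurable[OF \<phi>] Lp_bound_measurable[OF nb[of k]] by measurable
        qed
        also have "\<dots> \<le> ennreal (K * (C * N))"
        proof (rule SUP_least)
          fix k
          have "Lp_bound (lebesgue_on I) (1 - (1 - \<sigma> * (y - x))) (n k) (C * N)" using nb[of k] by simp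
          from Lp_bound_Holder[OF \<phi>1 this]
          show "(\<integral>\<^sup>+s. ennreal \<bar>\<phi> s * n k s\<bar> \<partial>lebesgue_on I) \<le> ennreal (K * (C * N))"
            using s0 half by (simp add: abs_mult)
        qed
        finally show "cmod (L2_inner M (U t h) g) \<le> C * K * nrm M (1/(1-y)) g"
          using C K0 N0 by (simp add: N_def[symmetric] mult_ac)
      qed (use xy C K0 in auto)
      have dn: "dual_norm M y (real k) (U t h) \<le> C * K" if "t \<in> J" for t
      proof -
        have "y < 1" "0 \<le> C * K" using xy C K0 by auto
        from dual_norm_le_iff[OF xy(3) this(1) U_L2[of t h] this(2)] show ?thesis using hb[OF that] by blast
      qed
      have "Lp_bound (lebesgue_on J) 0 (\<lambda>t. dual_norm M y (real k) (U t h)) (C * K)"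
      proof -
        have "(\<lambda>t. dual_norm M y (real k) (U t h)) \<in> borel_measurable (lebesgue_on J)"
          using J xy by (intro strong_meas_dual_norm U_strong_meas_on) auto
        moreover have "AE t in lebesgue_on J. \<bar>dual_norm M y (real k) (U t h)\<bar> \<le> C * K"
          using dn dual_norm_nonneg[OF xy(3) _ U_L2] xy by (intro AE_I2) (auto simp: space_restrict_space)
        ultimately show ?thesis using C K0 by (simp add: Lp_bound_def)
      qed
      then show "Lp_bound (lebesgue_on J) zq (\<lambda>t. dual_norm M y (real k) (U t (Tstar I F))) (C * K)"
        unfolding h_def by (rule Lp_bound_mono_exponent[OF prob[OF J mJ]]) (use zq in auto)
    qed
  qed
qed

end

text \<open>\<open>measure\<close> is 0 on non-measurable sets and on sets of infinite measure, so
  the value 1 excludes both. Any two points are at distance at most 1, since the segment between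
  them lies in the interval. The half-open interval of length 2 leaves room for a right end point
  and fits the dyadic intervals.\<close>

lemma unit_length_interval:
  fixes I :: "real set"
  assumes I: "is_interval I" and m: "measure lebesgue I = 1"
  shows "I \<in> lmeasurable" "\<exists>c. I \<subseteq> {c..<c+2}"
proof -
  have s: "I \<in> sets lebesgue"
  proof (rule ccontr)
    assume "I \<notin> sets lebesgue"
    then have "measure lebesgue I = 0" by (simp add: measure_notin_sets)
    then show False using m by simp
  qed
  have "emeasure lebesgue I \<noteq> \<infinity>"
  proof
    assume "emeasure lebesgue I = \<infinity>"
    then have "measure lebesgue I = 0" by (simp add: measure_def)
    then show False using m by simp
  qed
  then have "emeasure lebesgue I < \<infinity>" unfolding infinity_ennreal_def top.not_eq_extremum .
  with s show lm: "I \<in> lmeasurable" by (rule fmeasurableI)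
  have d: "b - a \<le> 1" if "a \<in> I" "b \<in> I" for a b
  proof (cases "a \<le> b")
    case True
    have sub: "{a..b} \<subseteq> I"
    proof
      fix w assume "w \<in> {a..b}"
      then have "a \<le> w" "w \<le> b" by simp_all
      with I that show "w \<in> I" unfolding is_interval_1 by blast
    qed
    have "measure lebesgue {a..b} \<le> measure lebesgue I"
      by (rule measure_mono_fmeasurable[OF sub _ lm]) simp
    then show ?thesis using True m by simp
  qed simp
  have ne: "I \<noteq> {}" using m by auto
  then obtain s0 where s0: "s0 \<in> I" by blast
  have bb: "bdd_below I"
  proof (rule bdd_belowI)
    fix w assume "w \<in> I"
    from d[OF this s0] show "s0 - 1 \<le> w" by linarith
  qed
  have "I \<subseteq> {Inf I..<Inf I + 2}"
  proof
    fix w assume w: "w \<in> I"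
    have "w - 1 \<le> Inf I"
    proof (rule cInf_greatest[OF ne])
      fix v assume "v \<in> I"
      from d[OF this w] show "w - 1 \<le> v" by linarith
    qed
    with cInf_lower[OF w bb] show "w \<in> {Inf I..<Inf I + 2}" by simp
  qed
  then show "\<exists>c. I \<subseteq> {c..<c+2}" by blast
qed

lemma dispersive_intro:
  fixes M :: "'x measure" and U :: "real \<Rightarrow> 'h::chilbert_space \<Rightarrow> 'x \<Rightarrow> complex"
  assumes "\<sigma> > 0" and lin: "\<And>t. linear_into_L2 M (U t)"
    and sm: "\<And>h. strongly_measurable M UNIV 2 (\<lambda>t. U t h)"
    and energy: "\<exists>A::real. \<forall>t h. Lp_norm M 2 (U t h) \<le> ennreal (A * norm h)"
    and disp: "\<exists>B::real. \<forall>t s. t \<noteq> s \<longrightarrow> (\<forall>f \<in> Lp_space M 1 \<inter> Lp_space M 2.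
          Lp_norm M \<infinity> (U t (L2_adjoint M (U s) f))
            \<le> ennreal (B * \<bar>t - s\<bar> powr (- \<sigma>)) * Lp_norm M 1 f)"
  obtains A B where "dispersive M U \<sigma> A B"
proof -
  obtain A0 where A0: "\<And>t h. Lp_norm M 2 (U t h) \<le> ennreal (A0 * norm h)" using energy by blast
  obtain B0 where B0: "\<And>t s f. t \<noteq> s \<Longrightarrow> f \<in> Lp_space M 1 \<Longrightarrow> f \<in> L2 M \<Longrightarrow> Lp_norm M \<infinity> (U t (L2_adjoint M (U s) f))
            \<le> ennreal (B0 * \<bar>t - s\<bar> powr (- \<sigma>)) * Lp_norm M 1 f" using disp unfolding L2_def by blast
  show ?thesis
  \<comment> \<open>The constants of the hypotheses may be small or negative; replacing them by the
    maximum with 1 preserves the inequalities.\<close>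
  proof (rule that[of "max A0 1" "max B0 1"], unfold_locales)
    show "0 < \<sigma>" "linear_into_L2 M (U t)" "1 \<le> max A0 1" "1 \<le> max B0 1" for t using assms by auto
    show "strong_meas M UNIV (\<lambda>t. U t h)" for h by (rule strongly_measurable_strong_meas[OF sm])
    show "nrm M 2 (U t h) \<le> max A0 1 * norm h" for t h
    proof -
      have "U t h \<in> L2 M" using lin unfolding linear_into_L2_def L2_def by blast
      then have "ennreal (nrm M 2 (U t h)) \<le> ennreal (A0 * norm h)" using A0[of t h] by (simp only: Lp_norm_2)
      also have "\<dots> \<le> ennreal (max A0 1 * norm h)" by (intro ennreal_leI mult_right_mono) auto
      finally show ?thesis by (subst (asm) ennreal_le_iff) auto
    qed
    fix t s :: real and f :: "'x \<Rightarrow> complex" assume ts: "t \<noteq> s" and f: "test M f"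
    have f1: "Lp_norm M 1 f \<le> ennreal (nrm M 1 f)"
      using test_Lp_bound[OF f, of 1] Lp_norm_le_iff[of 1 "nrm M 1 f" M f] by (simp add: one_ereal_def)
    then have "f \<in> Lp_space M 1" using test_measurable[OF f] by (auto simp: Lp_space_def intro: le_less_trans)
    from B0[OF ts this test_L2[OF f]]
    have "Lp_norm M \<infinity> (U t (L2_adjoint M (U s) f)) \<le> ennreal (B0 * \<bar>t - s\<bar> powr (- \<sigma>)) * Lp_norm M 1 f" .
    also have "\<dots> \<le> ennreal (max B0 1 * \<bar>t - s\<bar> powr (- \<sigma>)) * ennreal (nrm M 1 f)"
      by (intro mult_mono f1 ennreal_leI mult_right_mono) auto
    also have "\<dots> = ennreal (max B0 1 * \<bar>t - s\<bar> powr (- \<sigma>) * nrm M 1 f)" by (simp add: ennreal_mult)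
    finally show "Lp_bound M 0 (\<lambda>x. cmod (U t (L2_adjoint M (U s) f) x)) (max B0 1 * \<bar>t - s\<bar> powr (-\<sigma>)
      * nrm M 1 f)"
      by (subst (asm) Lp_norm_le_iff) auto
  qed
qed

theorem theorem1p10:
  fixes M :: "'x measure"
    and U :: "real \<Rightarrow> 'h::chilbert_space \<Rightarrow> 'x \<Rightarrow> complex"
    and \<sigma> c\<^sub>1 c\<^sub>2 :: real
    and q r qt rt :: ereal
  assumes "\<sigma> > 0"
    and "\<And>t. linear_into_L2 M (U t)"
    and "\<And>h. strongly_measurable M UNIV 2 (\<lambda>t. U t h)"
    and energy: "\<exists>A::real. \<forall>t h. Lp_norm M 2 (U t h) \<le> ennreal (A * norm h)"
    and dispersive: "\<exists>B::real. \<forall>t s. t \<noteq> s \<longrightarrow> (\<forall>f \<in> Lp_space M 1 \<inter> Lp_space M 2.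
          Lp_norm M \<infinity> (U t (L2_adjoint M (U s) f))
            \<le> ennreal (B * \<bar>t - s\<bar> powr (- \<sigma>)) * Lp_norm M 1 f)"
    and "0 < c\<^sub>1" "c\<^sub>1 \<le> c\<^sub>2"
    and "1 \<le> q" "q \<le> \<infinity>" "1 \<le> qt" "qt \<le> \<infinity>"
    and "2 \<le> r" "r \<le> \<infinity>" "2 \<le> rt" "rt \<le> \<infinity>"
    and "ereal (\<sigma> - 1) / r \<le> ereal \<sigma> / rt"
    and "ereal (\<sigma> - 1) / rt \<le> ereal \<sigma> / r"
    and "1 / q \<ge> ereal \<sigma> * (1 / rt - 1 / r)"
    and "1 / qt \<ge> ereal \<sigma> * (1 / r - 1 / rt)"
    and "\<sigma> = 1 \<Longrightarrow> r < \<infinity> \<and> rt < \<infinity>"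
  shows "\<exists>C::real. \<forall>I J F.
           is_interval I \<and> is_interval J \<and> measure lebesgue I = 1 \<and> measure lebesgue J = 1 \<and>
           c\<^sub>1 \<le> setdist I J \<and> setdist I J \<le> c\<^sub>2 \<and>
           F \<in> mixed_space M I (conj_exponent qt) (conj_exponent rt) \<and> F \<in> mixed_space M I 1 2
           \<longrightarrow> mixed_norm M J q r (TTstar M U (zero_extension I F))
               \<le> ennreal C * mixed_norm M I (conj_exponent qt) (conj_exponent rt) F"
proof -
  obtain A B where D: "dispersive M U \<sigma> A B" by (rule dispersive_intro[OF assms(1,2,3) energy dispersive])
  interpret dispersive M U \<sigma> A B by (rule D)
  define x where "x = real_of_ereal (1/rt)"
  define y where "y = real_of_ereal (1/r)"
  define z where "z = real_of_ereal (1/qt)"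
  define zq where "zq = real_of_ereal (1/q)"
  have one_le: "1 \<le> r" "1 \<le> rt" using \<open>2 \<le> r\<close> \<open>2 \<le> rt\<close> ereal_two_ge_one order_trans by blast+
  have xy: "0 \<le> x" "x \<le> 1/2" "0 \<le> y" "y \<le> 1/2"
    unfolding x_def y_def using recip_bounds one_le \<open>2 \<le> r\<close> \<open>2 \<le> rt\<close> by blast+
  have zz: "0 \<le> z" "z \<le> 1" "0 \<le> zq" "zq \<le> 1"
    unfolding z_def zq_def using recip_bounds \<open>1 \<le> q\<close> \<open>1 \<le> qt\<close> by blast+
  have k: "(\<sigma> - 1) * y \<le> \<sigma> * x" "(\<sigma> - 1) * x \<le> \<sigma> * y"
    using \<open>ereal (\<sigma> - 1) / r \<le> ereal \<sigma> / rt\<close> \<open>ereal (\<sigma> - 1) / rt \<le> ereal \<sigma> / r\<close>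
    by (simp_all add: ereal_divide_recip[OF one_le(1)] ereal_divide_recip[OF one_le(2)] x_def y_def)
  have recip: "1/p = ereal (real_of_ereal (1/p))" if "1 \<le> p" for p :: ereal
    using ereal_divide_recip[OF that, of 1] by (simp add: one_ereal_def)
  have s: "\<sigma> * (x - y) \<le> zq" "\<sigma> * (y - x) \<le> z"
  proof -
    have "ereal \<sigma> * (ereal x - ereal y) \<le> ereal zq" "ereal \<sigma> * (ereal y - ereal x) \<le> ereal z"
      using \<open>1 / q \<ge> ereal \<sigma> * (1 / rt - 1 / r)\<close> \<open>1 / qt \<ge> ereal \<sigma> * (1 / r - 1 / rt)\<close>
      unfolding x_def y_def z_def zq_def recip[OF one_le(1), symmetric] recip[OF one_le(2), symmetric]
        recip[OF \<open>1 \<le> q\<close>, symmetric] recip[OF \<open>1 \<le> qt\<close>, symmetric] .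
    then show "\<sigma> * (x - y) \<le> zq" "\<sigma> * (y - x) \<le> z" by simp_all
  qed
  have one: "0 < x \<and> 0 < y" if "\<sigma> = 1"
    unfolding x_def y_def using recip_bounds(4) one_le \<open>\<sigma> = 1 \<Longrightarrow> r < \<infinity> \<and> rt < \<infinity>\<close>[OF that] by blast
  obtain C where C: "C > 0" and main: "\<And>I J ci cj F \<phi> K k. I \<in> lmeasurable \<Longrightarrow> J \<in> lmeasurable \<Longrightarrow>
    measure lebesgue I \<le> 1 \<Longrightarrow> measure lebesgue J \<le> 1 \<Longrightarrow>
    I \<subseteq> {ci..<ci+2} \<Longrightarrow> J \<subseteq> {cj..<cj+2} \<Longrightarrow> (\<And>s t. s \<in> I \<Longrightarrow> t \<in> J \<Longrightarrow> c\<^sub>1 \<le> \<bar>t - s\<bar>) \<Longrightarrow> admissible I F \<Longrightarrow>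
    (AE s in lebesgue_on I. Lp_bound M (1-x) (\<lambda>x. cmod (F s x)) (\<phi> s)) \<Longrightarrow> Lp_bound (lebesgue_on I) (1-z) \<phi> K \<Longrightarrow>
    Lp_bound (lebesgue_on J) zq (\<lambda>t. dual_norm M y (real k) (U t (Tstar I F))) (C * K)"
    apply (rule inhomogeneous_estimate[OF \<open>0 < c\<^sub>1\<close> xy k s(2) zz(1,2) s(1) zz(3,4) one], assumption)
    subgoal premises p for C
      apply (rule p(1)[OF p(2)])
      subgoal premises q by (rule p(3)[OF q])
      done
    done
  show ?thesis
  proof (intro exI[of _ C] allI impI, elim conjE)
    fix I J F
    assume I: "is_interval I" "measure lebesgue I = 1" and J: "is_interval J" "measure lebesgue J = 1"
      and dist: "c\<^sub>1 \<le> setdist I J"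
      and F1: "F \<in> mixed_space M I (conj_exponent qt) (conj_exponent rt)" and F2: "F \<in> mixed_space M I 1 2"
    have Im: "I \<in> lmeasurable" and Jm: "J \<in> lmeasurable"
      by (rule unit_length_interval(1)[OF I] unit_length_interval(1)[OF J])+
    obtain ci where Ic: "I \<subseteq> {ci..<ci+2}" using unit_length_interval(2)[OF I] by blast
    obtain cj where Jc: "J \<subseteq> {cj..<cj+2}" using unit_length_interval(2)[OF J] by blast
    have sep: "c\<^sub>1 \<le> \<bar>t - s\<bar>" if "s \<in> I" "t \<in> J" for s t
      using dist setdist_le_dist[OF that] by (simp add: dist_real_def abs_minus_commute)
    have F: "admissible I F" using Im F2 by (intro admissible_of_mixed_space) auto
    \<comment> \<open>\<open>enn2real\<close> sends infinity to 0, but \<open>F s\<close> has finite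
      norm for almost every \<open>s\<close>, so \<open>\<phi>\<close> is the norm almost
      everywhere.\<close>
    define \<phi> where "\<phi> s = enn2real (Lp_norm M (conj_exponent rt) (F s))" for s
    have "AE s in lebesgue_on I. F s \<in> Lp_space M (conj_exponent rt)"
      using F1 by (simp add: mixed_space_def strongly_measurable_def)
    then have \<phi>eq: "AE s in lebesgue_on I. Lp_norm M (conj_exponent rt) (F s) = ennreal (\<phi> s)"
      by eventually_elim (simp add: \<phi>_def Lp_space_def)
    have F\<phi>: "AE s in lebesgue_on I. Lp_bound M (1-x) (\<lambda>\<xi>. cmod (F s \<xi>)) (\<phi> s)"
      using \<phi>eq
    proof eventually_elim
      case (elim s)
      have "0 \<le> \<phi> s" by (simp add: \<phi>_def)
      from Lp_norm_le_iff[OF conj_exponent_recip(1)[OF one_le(2)] this, of M "F s"] elim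
      show ?case by (simp add: conj_exponent_recip(2)[OF one_le(2)] x_def)
    qed
    have fin: "L_norm (lebesgue_on I) (conj_exponent qt) (\<lambda>t. Lp_norm M (conj_exponent rt) (F t)) < \<infinity>"
      using F1 by (simp add: mixed_space_def mixed_norm_def)
    have m1: "(\<lambda>t. Lp_norm M (conj_exponent rt) (F t)) \<in> borel_measurable (lebesgue_on I)"
      by (rule L_norm_measurable[OF fin])
    have m2: "(\<lambda>t. ennreal (\<phi> t)) \<in> borel_measurable (lebesgue_on I)"
      unfolding \<phi>_def using m1 by simp
    obtain K where K: "0 \<le> K" "mixed_norm M I (conj_exponent qt) (conj_exponent rt) F = ennreal K"
      using fin unfolding mixed_norm_def by
        (cases "L_norm (lebesgue_on I) (conj_exponent qt) (\<lambda>t. Lp_norm M (conj_exponent rt) (F t))") auto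
    have "L_norm (lebesgue_on I) (conj_exponent qt) (\<lambda>t. ennreal (\<phi> t)) = ennreal K"
      using L_norm_cong_AE[OF m1 m2 \<phi>eq] K(2) by (simp add: mixed_norm_def)
    then have \<phi>K: "Lp_bound (lebesgue_on I) (1-z) \<phi> K"
      using L_norm_le_iff[of \<phi> "conj_exponent qt" K "lebesgue_on I"] conj_exponent_recip[OF \<open>1 \<le> qt\<close>] K(1)
      by (simp add: \<phi>_def z_def)
    define T where "T = TTstar M U (zero_extension I F)"
    have bound: "Lp_bound (lebesgue_on J) zq (\<lambda>t. dual_norm M y (real k) (U t (Tstar I F))) (C * K)" for k
      by (rule main[OF Im Jm _ _ Ic Jc sep F F\<phi> \<phi>K]) (use I J in auto)
    have "mixed_norm M J q r T \<le> ennreal (C * K)"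
      unfolding mixed_norm_def
    \<comment> \<open>The bounds hold with one constant for all \<open>k\<close>, so the supremum
      keeps it; measurability in \<open>t\<close> of the norm of the output comes along.\<close>
    proof (rule L_norm_SUP_le[where n="\<lambda>k t. dual_norm M y (real k) (U t (Tstar I F))"])
      show "1 \<le> q" by fact
      show "0 \<le> C * K" using C K by simp
      show "0 \<le> dual_norm M y (real k) (U t (Tstar I F))" for k t
        using xy by (intro dual_norm_nonneg U_L2) auto
      show "dual_norm M y (real k) (U t (Tstar I F)) \<le> dual_norm M y (real (Suc k)) (U t (Tstar I F))" for k t
        using xy by (intro dual_norm_mono U_L2) auto
      show "Lp_bound (lebesgue_on J) (real_of_ereal (1/q)) (\<lambda>t. dual_norm M y (real k) (U t (Tstar I F))) (C
        * K)" for k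
        using bound[of k] by (simp add: zq_def)
      show "Lp_norm M r (T t) = (SUP k. ennreal (dual_norm M y (real k) (U t (Tstar I F))))" for t
      proof -
        \<comment> \<open>Equal pairings with test functions mean equal truncated norms, whichever
          representative the weak integral has selected at time \<open>t\<close>.\<close>
        have "dual_norm M y (real k) (T t) = dual_norm M y (real k) (U t (Tstar I F))" for k
          unfolding T_def by (intro dual_norm_cong TTstar_inner(2)[OF F] test_L2)
        then show ?thesis
          unfolding T_def by (subst Lp_norm_eq_SUP_dual_norm[OF \<open>2
            \<le> r\<close> y_def TTstar_inner(1)[OF F test_L2[OF test_zero]]]) simp
      qed
    qed
    then show "mixed_norm M J q r (TTstar M U (zero_extension I F))
               \<le> ennreal C * mixed_norm M I (conj_exponent qt) (conj_exponent rt) F"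
      using C K by (simp add: T_def ennreal_mult)
  qed
qed

end
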